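(* Let $\Omega$ be a compact $(n+1)$-dimensional Riemannian manifold with smooth boundary $\Sigma$, and let $\omega$ be a smooth differential $p$-form on $\Omega$ with $p\geq 1$. Then $$\int_{\Omega}\left(\|d\omega\|^2+\|\delta\omega\|^2\right)=\int_{\Omega}\left(\|\nabla\omega\|^2+\langle W^{[p]}_{\Omega}(\omega),\omega\rangle\right)+2\int_{\Sigma}\langle i_N\omega,\delta^{\Sigma}(J^{\star}\omega)\rangle+\int_{\Sigma}\mathcal{B}(\omega,\omega),$$ where the boundary term is $$\mathcal{B}(\omega,\omega)=\langle S^{[p]}(J^{\star}\omega),J^{\star}\omega\rangle+\langle S^{[n+1-p]}(J^{\star}\star\omega),J^{\star}\star\omega\rangle$$ or, equivalently, $$\mathcal{B}(\omega,\omega)=\langle S^{[p]}(J^{\star}\omega),J^{\star}\omega\rangle+nH\|i_N\omega\|^2-\langle S^{[p-1]}(i_N\omega),i_N\omega\rangle.$$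
   Context: $d$ is the exterior derivative on $\Omega$, $\delta$ its formal adjoint, $\Delta=d\delta+\delta d$ the Hodge Laplacian and $\nabla$ the Levi-Civita connection. $W^{[p]}_\Omega$ is the self-adjoint bundle endomorphism of $p$-forms (the curvature term) defined by the Bochner formula $\Delta\omega=\nabla^{\star}\nabla\omega+W^{[p]}_\Omega(\omega)$. Pointwise inner products on $p$-forms are the standard ones for which $\{e_{i_1}^\star\wedge\dots\wedge e_{i_p}^\star: i_1<\dots<i_p\}$ is orthonormal whenever $(e_i)$ is an orthonormal frame, and $\|\nabla\omega\|^2=\sum_i\|\nabla_{e_i}\omega\|^2$. $\star$ (in front of $\omega$) is the Hodge star operator of $\Omega$ (for a local choice of orientation; $\mathcal B$ does not depend on this choice). $J:\Sigma\to\Omega$ is the inclusion, $J^\star$ the restriction (pull-back) of forms to $\Sigma$, $N$ the inner unit normal along $\Sigma$, $i_N$ interior multiplication by $N$, and $\delta^\Sigma$ the codifferential of $\Sigma$ with its induced metric. The shape operator is $S(X)=-\nabla_XN$ for $X\in T\Sigma$, $H=\frac1n\operatorname{tr}S$ is the mean curvature, and $S^{[p]}$ is the extension of $S$ to $p$-forms on $\Sigma$: $S^{[p]}\phi(X_1,\dots,X_p)=\sum_{j=1}^p\phi(X_1,\dots,S(X_j),\dots,X_p)$, with $S^{[0]}=0$ by convention. *)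

theory Defs
  imports "HOL-Analysis.Analysis"
begin

section \<open>Smooth maps on subsets of Euclidean space\<close>

primrec Ck_on :: "nat \<Rightarrow> ('e::real_normed_vector \<Rightarrow> 'f::real_normed_vector) \<Rightarrow> 'e set \<Rightarrow> bool" where
  "Ck_on 0 f S \<longleftrightarrow> continuous_on S f"
| "Ck_on (Suc k) f S \<longleftrightarrow>
     f differentiable_on S \<and> (\<forall>v. Ck_on k (\<lambda>x. frechet_derivative f (at x) v) S)"

text \<open>On a set that is not open (such as a relatively open part of a half-space), smoothness means
  local extendability to a smooth function on an open set.\<close>

definition smooth_on :: "'e::real_normed_vector set \<Rightarrow> ('e \<Rightarrow> 'f::real_normed_vector) \<Rightarrow> bool" where
  "smooth_on A f \<longleftrightarrow>
     (\<forall>x\<in>A. \<exists>U F. open U \<and> x \<in> U \<and> (\<forall>k. Ck_on k F U) \<and> (\<forall>y\<in>A \<inter> U. F y = f y))"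


section \<open>Manifolds with boundary\<close>

text \<open>A smooth structure on \<open>pts\<close> is given by an indexed family of charts; the chart with index \<open>i\<close>
  is the restriction of \<open>chart i\<close> to \<open>cdom i\<close>. The atlas need not be maximal.\<close>

record ('i, 'a, 'e) atlas =
  pts :: "'a set"
  idx :: "'i set"
  cdom :: "'i \<Rightarrow> 'a set"
  chart :: "'i \<Rightarrow> 'a \<Rightarrow> 'e"

definition cimg :: "('i,'a,'e) atlas \<Rightarrow> 'i \<Rightarrow> 'e set" where
  "cimg M i = chart M i ` cdom M i"

definition transition :: "('i,'a,'e) atlas \<Rightarrow> 'i \<Rightarrow> 'i \<Rightarrow> 'e \<Rightarrow> 'e" where
  "transition M i j x = chart M j (inv_into (cdom M i) (chart M i) x)"

definition overlap :: "('i,'a,'e) atlas \<Rightarrow> 'i \<Rightarrow> 'i \<Rightarrow> 'e set" where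
  "overlap M i j = chart M i ` (cdom M i \<inter> cdom M j)"

definition half_space :: "(real \<times> 'b) set" where
  "half_space = {x. 0 \<le> fst x}"

text \<open>The argument \<open>R\<close> is the local model: \<open>half_space\<close> for manifolds with boundary.\<close>

definition smooth_atlas ::
  "'e::euclidean_space set \<Rightarrow> ('i,'a::t2_space,'e) atlas \<Rightarrow> bool" where
  "smooth_atlas R M \<longleftrightarrow>
     pts M = (\<Union>i\<in>idx M. cdom M i) \<and>
     (\<forall>i\<in>idx M. openin (top_of_set (pts M)) (cdom M i) \<and>
                openin (top_of_set R) (cimg M i) \<and>
                (\<exists>\<psi>. homeomorphism (cdom M i) (cimg M i) (chart M i) \<psi>)) \<and>
     (\<forall>i\<in>idx M. \<forall>j\<in>idx M. smooth_on (overlap M i j) (transition M i j))"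

definition interior_pts :: "('i,'a,'e::topological_space) atlas \<Rightarrow> 'a set" where
  "interior_pts M = {q. \<exists>i\<in>idx M. q \<in> cdom M i \<and> chart M i q \<in> interior (cimg M i)}"

text \<open>The boundary as a manifold. It keeps the index set of the atlas, a chart with values in
  \<open>half_space\<close> restricting to a chart with values in \<open>'b = {0} \<times> 'b\<close>.\<close>

definition bdry :: "('i,'a,real \<times> 'b::euclidean_space) atlas \<Rightarrow> ('i,'a,'b) atlas" where
  "bdry M = \<lparr>pts = pts M - interior_pts M, idx = idx M,
             cdom = (\<lambda>i. cdom M i - interior_pts M), chart = (\<lambda>i q. snd (chart M i q))\<rparr>"


section \<open>Tensor fields and differential forms\<close>

text \<open>A covariant tensor field is represented by its local expressions: \<open>T i x vs\<close> is the value of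
  the tensor at the point with coordinates \<open>x\<close> in chart \<open>i\<close> on the tangent vectors whose coordinate
  expressions in chart \<open>i\<close> are the entries of the list \<open>vs\<close>. For a tensor of rank \<open>p\<close> only lists of
  length \<open>p\<close> and points \<open>x \<in> cimg M i\<close> matter.\<close>

type_synonym ('i, 'e) tensor = "'i \<Rightarrow> 'e \<Rightarrow> 'e list \<Rightarrow> real"

definition multilin :: "nat \<Rightarrow> ('e::real_vector list \<Rightarrow> real) \<Rightarrow> bool" where
  "multilin p \<alpha> \<longleftrightarrow> (\<forall>vs. length vs = p \<longrightarrow> (\<forall>j<p. linear (\<lambda>v. \<alpha> (vs[j := v]))))"

definition alternating :: "nat \<Rightarrow> ('e::real_vector list \<Rightarrow> real) \<Rightarrow> bool" where
  "alternating p \<alpha> \<longleftrightarrow> multilin p \<alpha> \<and> (\<forall>vs. length vs = p \<longrightarrow> \<not> distinct vs \<longrightarrow> \<alpha> vs = 0)"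

definition tensor_field ::
  "('i,'a,'e::euclidean_space) atlas \<Rightarrow> nat \<Rightarrow> ('i,'e) tensor \<Rightarrow> bool" where
  "tensor_field M p T \<longleftrightarrow>
     (\<forall>i\<in>idx M. \<forall>x\<in>cimg M i. multilin p (T i x)) \<and>
     (\<forall>i\<in>idx M. \<forall>vs. length vs = p \<longrightarrow> smooth_on (cimg M i) (\<lambda>x. T i x vs)) \<and>
     (\<forall>i\<in>idx M. \<forall>j\<in>idx M. \<forall>x\<in>overlap M i j. \<forall>vs. length vs = p \<longrightarrow>
        T i x vs = T j (transition M i j x)
          (map (frechet_derivative (transition M i j) (at x within overlap M i j)) vs))"

definition diff_form ::
  "('i,'a,'e::euclidean_space) atlas \<Rightarrow> nat \<Rightarrow> ('i,'e) tensor \<Rightarrow> bool" where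
  "diff_form M p \<omega> \<longleftrightarrow>
     tensor_field M p \<omega> \<and> (\<forall>i\<in>idx M. \<forall>x\<in>cimg M i. alternating p (\<omega> i x))"

text \<open>Forms with compact support in the interior.\<close>

definition test_form ::
  "('i,'a::t2_space,'e::euclidean_space) atlas \<Rightarrow> nat \<Rightarrow> ('i,'e) tensor \<Rightarrow> bool" where
  "test_form M p \<phi> \<longleftrightarrow>
     diff_form M p \<phi> \<and>
     (\<exists>K. compact K \<and> K \<subseteq> interior_pts M \<and>
        (\<forall>i\<in>idx M. \<forall>q\<in>cdom M i - K. \<forall>vs. length vs = p \<longrightarrow> \<phi> i (chart M i q) vs = 0))"

definition dirderiv ::
  "('i,'a,'e::euclidean_space) atlas \<Rightarrow> 'i \<Rightarrow> ('e \<Rightarrow> 'f::real_normed_vector) \<Rightarrow> 'e \<Rightarrow> 'e \<Rightarrow> 'f" where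
  "dirderiv M i f x v = frechet_derivative f (at x within cimg M i) v"

text \<open>The formula for \<open>d\<omega>(v\<^sub>0, \<dots>, v\<^sub>p)\<close>, evaluated on the coordinate-constant vector
  fields \<open>v\<^sub>j\<close>, whose brackets vanish.\<close>

definition ext_d ::
  "('i,'a,'e::euclidean_space) atlas \<Rightarrow> ('i,'e) tensor \<Rightarrow> ('i,'e) tensor" where
  "ext_d M \<omega> i x vs =
     (\<Sum>j<length vs. (-1)^j * dirderiv M i (\<lambda>y. \<omega> i y (take j vs @ drop (Suc j) vs)) x (vs ! j))"

definition pullback :: "('i, real \<times> 'b) tensor \<Rightarrow> ('i,'b) tensor" where
  "pullback \<omega> i y vs = \<omega> i (0, y) (map (Pair 0) vs)"


section \<open>Riemannian metrics\<close>

definition riemannian_metric ::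
  "('i,'a,'e::euclidean_space) atlas \<Rightarrow> ('i,'e) tensor \<Rightarrow> bool" where
  "riemannian_metric M g \<longleftrightarrow>
     tensor_field M 2 g \<and>
     (\<forall>i\<in>idx M. \<forall>x\<in>cimg M i.
        (\<forall>u v. g i x [u, v] = g i x [v, u]) \<and> (\<forall>u. u \<noteq> 0 \<longrightarrow> g i x [u, u] > 0))"

definition orthonormal_frame :: "('e::euclidean_space list \<Rightarrow> real) \<Rightarrow> 'e list \<Rightarrow> bool" where
  "orthonormal_frame h es \<longleftrightarrow>
     length es = DIM('e) \<and>
     (\<forall>i<DIM('e). \<forall>j<DIM('e). h [es ! i, es ! j] = (if i = j then 1 else 0))"

definition frame :: "('e::euclidean_space list \<Rightarrow> real) \<Rightarrow> 'e list" where
  "frame h = (SOME es. orthonormal_frame h es)"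

text \<open>The inner product of \<open>p\<close>-forms for which the \<open>e\<^sub>I\<^sup>*\<close>, \<open>I\<close> increasing, are orthonormal: the
  coefficient of \<open>\<alpha>\<close> with respect to \<open>e\<^sub>I\<^sup>*\<close> is \<open>\<alpha> (nths es I)\<close>. It does not depend on the
  frame.\<close>

definition form_inner ::
  "('e::euclidean_space list \<Rightarrow> real) \<Rightarrow> nat \<Rightarrow> ('e list \<Rightarrow> real) \<Rightarrow> ('e list \<Rightarrow> real) \<Rightarrow> real" where
  "form_inner h p \<alpha> \<beta> =
     (\<Sum>I | I \<subseteq> {..<DIM('e)} \<and> card I = p. \<alpha> (nths (frame h) I) * \<beta> (nths (frame h) I))"

text \<open>The inner product of \<open>p\<close>-form valued 1-forms, the first slot being that of the 1-form.\<close>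

definition form1_inner ::
  "('e::euclidean_space list \<Rightarrow> real) \<Rightarrow> nat \<Rightarrow> ('e list \<Rightarrow> real) \<Rightarrow> ('e list \<Rightarrow> real) \<Rightarrow> real" where
  "form1_inner h p \<alpha> \<beta> =
     (\<Sum>e\<leftarrow>frame h. form_inner h p (\<lambda>vs. \<alpha> (e # vs)) (\<lambda>vs. \<beta> (e # vs)))"

text \<open>The determinant of the matrix of \<open>h\<close> in the standard basis.\<close>

definition gram_det :: "('e::euclidean_space list \<Rightarrow> real) \<Rightarrow> real" where
  "gram_det h = (\<Sum>\<pi> | \<pi> permutes (Basis :: 'e set). of_int (sign \<pi>) * (\<Prod>b\<in>Basis. h [b, \<pi> b]))"

text \<open>The Riemannian measure is the unique Borel measure with density \<open>sqrt (det g)\<close> in every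
  chart; no orientation is involved.\<close>

definition riem_measure ::
  "('i,'a::t2_space,'e::euclidean_space) atlas \<Rightarrow> ('i,'e) tensor \<Rightarrow> 'a measure" where
  "riem_measure M g =
     (THE \<mu>. sets \<mu> = sets (restrict_space borel (pts M)) \<and>
        (\<forall>i\<in>idx M. \<forall>B\<in>sets borel. B \<subseteq> cdom M i \<longrightarrow>
           emeasure \<mu> B =
             (\<integral>\<^sup>+x. indicator (chart M i ` B) x * ennreal (sqrt (gram_det (g i x))) \<partial>lborel)))"

text \<open>Integral of a scalar function given by its local expressions \<open>f i x\<close>, which agree on
  overlaps; hence the choice of chart at each point is immaterial.\<close>

definition riem_integral ::
  "('i,'a::t2_space,'e::euclidean_space) atlas \<Rightarrow> ('i,'e) tensor \<Rightarrow> ('i \<Rightarrow> 'e \<Rightarrow> real) \<Rightarrow> real" where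
  "riem_integral M g f =
     (LINT q|riem_measure M g. (let i = (SOME i. i \<in> idx M \<and> q \<in> cdom M i) in f i (chart M i q)))"

text \<open>The Levi-Civita connection: \<open>christoffel M g i x u v\<close> is \<open>\<nabla>\<^sub>u v\<close> for coordinate-constant
  \<open>v\<close>. The two clauses are vanishing torsion and compatibility with the metric.\<close>

definition christoffel ::
  "('i,'a,'e::euclidean_space) atlas \<Rightarrow> ('i,'e) tensor \<Rightarrow> 'i \<Rightarrow> 'e \<Rightarrow> 'e \<Rightarrow> 'e \<Rightarrow> 'e" where
  "christoffel M g i x =
     (THE \<Gamma>. (\<forall>u v. \<Gamma> u v = \<Gamma> v u) \<and>
        (\<forall>u v w. dirderiv M i (\<lambda>y. g i y [v, w]) x u = g i x [\<Gamma> u v, w] + g i x [v, \<Gamma> u w]))"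

text \<open>Covariant derivative of a tensor field; the head of the list is the direction of
  differentiation.\<close>

definition nabla ::
  "('i,'a,'e::euclidean_space) atlas \<Rightarrow> ('i,'e) tensor \<Rightarrow> ('i,'e) tensor \<Rightarrow> ('i,'e) tensor" where
  "nabla M g T i x ws =
     (let u = hd ws; vs = tl ws in
      dirderiv M i (\<lambda>y. T i y vs) x u
      - (\<Sum>j<length vs. T i x (vs[j := christoffel M g i x u (vs ! j)])))"


section \<open>Formal adjoints, Hodge Laplacian and the curvature term\<close>

text \<open>The formal adjoint of the exterior derivative, applied to a \<open>p\<close>-form, \<open>p \<ge> 1\<close>.\<close>

definition codiff ::
  "('i,'a::t2_space,'e::euclidean_space) atlas \<Rightarrow> ('i,'e) tensor \<Rightarrow> nat \<Rightarrow>
   ('i,'e) tensor \<Rightarrow> ('i,'e) tensor" where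
  "codiff M g p \<omega> =
     (SOME \<eta>. diff_form M (p - 1) \<eta> \<and>
        (\<forall>\<phi>. test_form M (p - 1) \<phi> \<longrightarrow>
           riem_integral M g (\<lambda>i x. form_inner (g i x) p (ext_d M \<phi> i x) (\<omega> i x)) =
           riem_integral M g (\<lambda>i x. form_inner (g i x) (p - 1) (\<phi> i x) (\<eta> i x))))"

text \<open>The formal adjoint of \<open>\<nabla>\<close> on \<open>p\<close>-forms, applied to a \<open>p\<close>-form valued 1-form.\<close>

definition nabla_adj ::
  "('i,'a::t2_space,'e::euclidean_space) atlas \<Rightarrow> ('i,'e) tensor \<Rightarrow> nat \<Rightarrow>
   ('i,'e) tensor \<Rightarrow> ('i,'e) tensor" where
  "nabla_adj M g p T =
     (SOME \<eta>. diff_form M p \<eta> \<and>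
        (\<forall>\<phi>. test_form M p \<phi> \<longrightarrow>
           riem_integral M g (\<lambda>i x. form1_inner (g i x) p (nabla M g \<phi> i x) (T i x)) =
           riem_integral M g (\<lambda>i x. form_inner (g i x) p (\<phi> i x) (\<eta> i x))))"

text \<open>The Hodge Laplacian on \<open>p\<close>-forms, \<open>p \<ge> 1\<close>.\<close>

definition hodge_laplacian ::
  "('i,'a::t2_space,'e::euclidean_space) atlas \<Rightarrow> ('i,'e) tensor \<Rightarrow> nat \<Rightarrow>
   ('i,'e) tensor \<Rightarrow> ('i,'e) tensor" where
  "hodge_laplacian M g p \<omega> i x vs =
     ext_d M (codiff M g p \<omega>) i x vs + codiff M g (Suc p) (ext_d M \<omega>) i x vs"

text \<open>\<open>W\<close> is the self-adjoint bundle endomorphism of \<open>p\<close>-forms (\<open>W i x\<close> being its local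
  expression at a point) given by the Bochner formula, which determines it.\<close>

definition curvature_term ::
  "('i,'a::t2_space,'e::euclidean_space) atlas \<Rightarrow> ('i,'e) tensor \<Rightarrow> nat \<Rightarrow>
   ('i \<Rightarrow> 'e \<Rightarrow> ('e list \<Rightarrow> real) \<Rightarrow> ('e list \<Rightarrow> real)) \<Rightarrow> bool" where
  "curvature_term M g p W \<longleftrightarrow>
     (\<forall>i\<in>idx M. \<forall>x\<in>cimg M i. \<forall>\<alpha> \<beta>. alternating p \<alpha> \<longrightarrow> alternating p \<beta> \<longrightarrow>
        alternating p (W i x \<alpha>) \<and>
        (\<forall>a b vs. length vs = p \<longrightarrow>
           W i x (\<lambda>us. a * \<alpha> us + b * \<beta> us) vs = a * W i x \<alpha> vs + b * W i x \<beta> vs) \<and>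
        form_inner (g i x) p (W i x \<alpha>) \<beta> = form_inner (g i x) p \<alpha> (W i x \<beta>)) \<and>
     (\<forall>\<eta>. diff_form M p \<eta> \<longrightarrow>
        diff_form M p (\<lambda>i x. W i x (\<eta> i x)) \<and>
        (\<forall>i\<in>idx M. \<forall>x\<in>cimg M i. \<forall>vs. length vs = p \<longrightarrow>
           hodge_laplacian M g p \<eta> i x vs =
             nabla_adj M g p (nabla M g \<eta>) i x vs + W i x (\<eta> i x) vs))"


section \<open>Hodge star\<close>

text \<open>A choice of orientation on each chart domain, encoded by the associated Riemannian volume
  form. No compatibility between different charts is required.\<close>

definition local_volume_form ::
  "('i,'a,'e::euclidean_space) atlas \<Rightarrow> ('i,'e) tensor \<Rightarrow> ('i,'e) tensor \<Rightarrow> bool" where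
  "local_volume_form M g \<nu> \<longleftrightarrow>
     (\<forall>i\<in>idx M.
        (\<forall>x\<in>cimg M i. alternating DIM('e) (\<nu> i x) \<and>
           (\<forall>es. orthonormal_frame (g i x) es \<longrightarrow> \<bar>\<nu> i x es\<bar> = 1)) \<and>
        (\<forall>vs. length vs = DIM('e) \<longrightarrow> smooth_on (cimg M i) (\<lambda>x. \<nu> i x vs)))"

text \<open>\<open>\<star>(e\<^sub>I\<^sup>*) = \<nu>(e\<^sub>I, \<cdot>)\<close>, so that \<open>\<beta> \<and> \<star>\<alpha> = \<langle>\<beta>, \<alpha>\<rangle> \<nu>\<close>.\<close>

definition hodge_star ::
  "('i,'e::euclidean_space) tensor \<Rightarrow> ('i,'e) tensor \<Rightarrow> nat \<Rightarrow> ('i,'e) tensor \<Rightarrow> ('i,'e) tensor" where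
  "hodge_star g \<nu> p \<omega> i x vs =
     (\<Sum>I | I \<subseteq> {..<DIM('e)} \<and> card I = p.
        \<omega> i x (nths (frame (g i x)) I) * \<nu> i x (nths (frame (g i x)) I @ vs))"


section \<open>Geometry of the boundary\<close>

definition inner_normal ::
  "('i, real \<times> 'b::euclidean_space) tensor \<Rightarrow> 'i \<Rightarrow> 'b \<Rightarrow> real \<times> 'b" where
  "inner_normal g i y =
     (THE N. g i (0, y) [N, N] = 1 \<and> (\<forall>u. g i (0, y) [N, (0, u)] = 0) \<and> fst N > 0)"

text \<open>\<open>i\<^sub>N \<omega>\<close> as a form on the boundary.\<close>

definition int_normal ::
  "('i, real \<times> 'b::euclidean_space) tensor \<Rightarrow> ('i, real \<times> 'b) tensor \<Rightarrow> ('i,'b) tensor" where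
  "int_normal g \<omega> i y vs = \<omega> i (0, y) (inner_normal g i y # map (Pair 0) vs)"

text \<open>\<open>S(X) = -\<nabla>\<^sub>X N\<close>. The bracket is \<open>\<nabla>\<^sub>X N\<close>, which is tangent to the boundary, that is, of
  the form \<open>(0, u)\<close>; \<open>snd\<close> identifies it with a tangent vector of the boundary.\<close>

definition shape_op ::
  "('i,'a,real \<times> 'b::euclidean_space) atlas \<Rightarrow> ('i, real \<times> 'b) tensor \<Rightarrow> 'i \<Rightarrow> 'b \<Rightarrow> 'b \<Rightarrow> 'b" where
  "shape_op M g i y X =
     - snd (dirderiv (bdry M) i (inner_normal g i) y X
            + christoffel M g i (0, y) (0, X) (inner_normal g i y))"

definition mean_curvature ::
  "('i,'a,real \<times> 'b::euclidean_space) atlas \<Rightarrow> ('i, real \<times> 'b) tensor \<Rightarrow> 'i \<Rightarrow> 'b \<Rightarrow> real" where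
  "mean_curvature M g i y = (1 / real DIM('b)) * (\<Sum>b\<in>Basis. shape_op M g i y b \<bullet> b)"

text \<open>The extension \<open>S\<^bsup>[p]\<^esup>\<close>; the degree \<open>p\<close> is the length of the argument list. It vanishes in
  degree 0.\<close>

definition form_ext :: "('e \<Rightarrow> 'e) \<Rightarrow> ('e list \<Rightarrow> real) \<Rightarrow> 'e list \<Rightarrow> real" where
  "form_ext S \<phi> vs = (\<Sum>j<length vs. \<phi> (vs[j := S (vs ! j)]))"

definition bdry_term ::
  "('i,'a,real \<times> 'b::euclidean_space) atlas \<Rightarrow> ('i, real \<times> 'b) tensor \<Rightarrow> ('i, real \<times> 'b) tensor \<Rightarrow>
   nat \<Rightarrow> ('i, real \<times> 'b) tensor \<Rightarrow> 'i \<Rightarrow> 'b \<Rightarrow> real" where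
  "bdry_term M g \<nu> p \<omega> i y =
     (let h = pullback g i y; S = shape_op M g i y; q = DIM('b) + 1 - p;
          \<alpha> = pullback \<omega> i y; \<beta> = pullback (hodge_star g \<nu> p \<omega>) i y in
      form_inner h p (form_ext S \<alpha>) \<alpha> + form_inner h q (form_ext S \<beta>) \<beta>)"

definition bdry_term' ::
  "('i,'a,real \<times> 'b::euclidean_space) atlas \<Rightarrow> ('i, real \<times> 'b) tensor \<Rightarrow>
   nat \<Rightarrow> ('i, real \<times> 'b) tensor \<Rightarrow> 'i \<Rightarrow> 'b \<Rightarrow> real" where
  "bdry_term' M g p \<omega> i y =
     (let h = pullback g i y; S = shape_op M g i y;
          \<alpha> = pullback \<omega> i y; \<gamma> = int_normal g \<omega> i y in
      form_inner h p (form_ext S \<alpha>) \<alpha>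
      + real DIM('b) * mean_curvature M g i y * form_inner h (p - 1) \<gamma> \<gamma>
      - form_inner h (p - 1) (form_ext S \<gamma>) \<gamma>)"

end

theory Submission
  imports Defs "HOL-Combinatorics.Multiset_Permutations"
begin

text \<open>In a chart, \<open>d\<close>, \<open>\<delta>\<close> and \<open>\<nabla>\<^sup>*\<close> are the alternation and the negative contractions of the
Levi-Civita derivative. By definition \<open>\<delta>\<close> and \<open>\<nabla>\<^sup>*\<nabla>\<close> are choices characterised by
pairing with compactly supported test forms, so they agree with these contractions because a
continuous form orthogonal to all test forms vanishes.

Green's formula holds chartwise up to the divergence of a one-form, and the divergence theorem is
reduced by a partition of unity to compactly supported fields on a half space, where it is Fubini
and the fundamental theorem of calculus. Integrating
\<open>\<langle>\<Delta>\<omega>, \<omega>\<rangle> = \<langle>\<nabla>\<^sup>*\<nabla>\<omega>, \<omega>\<rangle> + \<langle>W \<omega>, \<omega>\<rangle>\<close> by parts leaves the boundary integrand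
\<open>\<langle>\<nabla>\<^sub>N \<omega>, \<omega>\<rangle> - \<langle>i\<^sub>N d\<omega>, \<omega>\<rangle> + \<langle>\<delta>\<omega>, i\<^sub>N \<omega>\<rangle>\<close>. Expanded in a frame adapted to \<open>N\<close>, its normal
derivatives cancel; by Gauss and Weingarten the tangential part consists of the two shape operator
terms and of \<open>\<langle>i\<^sub>N \<omega>, \<delta> J\<^sup>* \<omega>\<rangle>\<close> and \<open>\<langle>d i\<^sub>N \<omega>, J\<^sup>* \<omega>\<rangle>\<close> on \<open>\<Sigma>\<close>, whose integrals agree as
\<open>\<Sigma>\<close> is closed. The two forms of \<open>\<B>\<close> agree because \<open>\<star>\<close> is an isometry exchanging the
derivation extension of \<open>S\<close> with \<open>tr S\<close> minus it.\<close>

text \<open>Inner products and adjoints are defined through choices (\<open>SOME\<close>,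
  \<open>THE\<close>) that carry no smoothness. A Gram-Schmidt frame replaces the chosen one: it
  varies smoothly with the metric, and the terms from differentiating it drop out of derivatives of
  contractions because its covariant derivative is skew. Contractions run over all ordered tuples,
  not only increasing ones, so that they obey a recursion on the first slot. The price is a factor
  p!, and the alternation of \<nabla>\<omega> contributes the factor p + 1 that turns 1/(p+1)! into
  1/p!.

  Test forms live in the interior, so a formal adjoint is determined there first and at the boundary
  only by continuity, the interior being dense. Manifolds are developed over an abstract closed
  model set, used with the half space for \<Omega> and with the whole space for \<Sigma>, so that
  measures, adjoints and Green's formula are available on both from one development.\<close>

abbreviation der :: "'e::real_normed_vector set => ('e => 'f::real_normed_vector) => 'e => 'e => 'f" where
  "der A f x \<equiv> frechet_derivative f (at x within A)"

section \<open>Functions of class C^k on open sets\<close>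

lemma Ck_on_cong:
  assumes "open U" "\<And>x. x \<in> U ==> f x = g x"
  shows "Ck_on k f U \<longleftrightarrow> Ck_on k g U"
  using assms(2)
proof (induction k arbitrary: f g)
  case 0
  then show ?case by (simp cong: continuous_on_cong)
next
  case (Suc k)
  have hd: "(f has_derivative D) (at x) \<longleftrightarrow> (g has_derivative D) (at x)" if "x \<in> U" for x D
    using has_derivative_transform_within_open[OF _ \<open>open U\<close> that, of f D UNIV g]
      has_derivative_transform_within_open[OF _ \<open>open U\<close> that, of g D UNIV f] Suc.prems by auto
  have "f differentiable_on U \<longleftrightarrow> g differentiable_on U"
    unfolding differentiable_on_eq_differentiable_at[OF \<open>open U\<close>] differentiable_def using hd by blast
  moreover have "der UNIV f x = der UNIV g x" if "x \<in> U" for x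
    unfolding frechet_derivative_def hd[OF that] ..
  then have "Ck_on k (\<lambda>x. der UNIV f x v) U
      \<longleftrightarrow> Ck_on k (\<lambda>x. der UNIV g x v) U" for v
    by (intro Suc.IH) simp
  ultimately show ?case by simp
qed

text \<open>Replaces the chosen \<open>frechet_derivative\<close> by any explicitly given
  derivative; the closure properties below rest on this rule.\<close>

lemma Ck_on_SucI:
  assumes "open U" "\<And>x. x \<in> U ==> (f has_derivative f' x) (at x)"
    and "\<And>v. Ck_on k (\<lambda>x. f' x v) U"
  shows "Ck_on (Suc k) f U"
proof -
  have "f differentiable_on U"
    unfolding differentiable_on_eq_differentiable_at[OF assms(1)] differentiable_def
    using assms(2) by blast
  moreover have "Ck_on k (\<lambda>x. der UNIV f x v) U" for v
    using assms(3)[of v] Ck_on_cong[OF assms(1), of "\<lambda>x. f' x v" "\<lambda>x. der UNIV f x v"]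
      frechet_derivative_at[OF assms(2)] by metis
  ultimately show ?thesis by simp
qed

lemma Ck_on_SucD:
  assumes "open U" "Ck_on (Suc k) f U" "x \<in> U"
  shows "(f has_derivative der UNIV f x) (at x)"
  using assms differentiable_on_eq_differentiable_at[OF assms(1), of f]
  by (auto simp: frechet_derivative_works[symmetric])

lemma Ck_on_lower: "Ck_on (Suc k) f S ==> Ck_on k f S"
  by (induction k arbitrary: f) (auto simp: differentiable_imp_continuous_on)

lemma Ck_on_subset: "Ck_on k f U ==> V \<subseteq> U ==> Ck_on k f V"
  by (induction k arbitrary: f) (auto intro: continuous_on_subset differentiable_on_subset)

lemma Ck_on_deriv: "Ck_on (Suc k) f U ==> Ck_on k (\<lambda>x. der UNIV f x v) U"
  by simp

declare Ck_on.simps(2) [simp del]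

lemma Ck_on_const: "open U ==> Ck_on k (\<lambda>x. c) U"
proof (induction k arbitrary: c)
  case (Suc k)
  then show ?case by (intro Ck_on_SucI[where f'="\<lambda>_ _. 0"]) auto
qed auto

lemma Ck_on_linear:
  assumes "bounded_linear f" "open U" shows "Ck_on k f U"
proof (cases k)
  case 0
  then show ?thesis using assms by (simp add: linear_continuous_on)
next
  case (Suc k')
  show ?thesis unfolding Suc
    by (rule Ck_on_SucI[where f'="\<lambda>_. f"])
      (use assms in \<open>auto intro: bounded_linear_imp_has_derivative Ck_on_const\<close>)
qed

lemma Ck_on_add:
  assumes "open U" "Ck_on k f U" "Ck_on k g U"
  shows "Ck_on k (\<lambda>x. f x + g x) U"
  using assms(2,3)
proof (induction k arbitrary: f g)
  case (Suc k)
  show ?case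
  proof (rule Ck_on_SucI[OF assms(1)])
    show "((\<lambda>x. f x + g x) has_derivative
      (\<lambda>v. der UNIV f x v + der UNIV g x v)) (at x)" if "x \<in> U" for x
      by (intro has_derivative_add Ck_on_SucD[OF assms(1) Suc.prems(1) that]
          Ck_on_SucD[OF assms(1) Suc.prems(2) that])
    show "Ck_on k (\<lambda>x. der UNIV f x v + der UNIV g x v) U" for v
      by (intro Suc.IH Ck_on_deriv Suc.prems)
  qed
qed (auto intro: continuous_on_add)

lemma (in bounded_bilinear) Ck_on_prod:
  fixes f :: "'z::real_normed_vector => 'a" and g :: "'z => 'b"
  assumes "open U" "Ck_on k f U" "Ck_on k g U"
  shows "Ck_on k (\<lambda>x. prod (f x) (g x)) U"
  using assms(2,3)
proof (induction k arbitrary: f g)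
  case 0
  then show ?case by (auto intro: continuous_on)
next
  case (Suc k)
  show ?case
  proof (rule Ck_on_SucI[OF assms(1)])
    show "((\<lambda>x. prod (f x) (g x)) has_derivative
      (\<lambda>v. prod (f x) (der UNIV g x v) + prod (der UNIV f x v) (g x))) (at x)"
      if "x \<in> U" for x
      by (intro FDERIV Ck_on_SucD[OF assms(1) Suc.prems(1) that] Ck_on_SucD[OF assms(1) Suc.prems(2) that])
    show "Ck_on k (\<lambda>x. prod (f x) (der UNIV g x v) + prod (der UNIV f x v) (g x)) U" for v
      by (intro Ck_on_add Suc.IH assms(1) Ck_on_lower[OF Suc.prems(1)] Ck_on_lower[OF Suc.prems(2)]
          Ck_on_deriv Suc.prems)
  qed
qed

lemma Ck_on_sum:
  assumes "open U" "\<And>i. i \<in> I ==> Ck_on k (f i) U"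
  shows "Ck_on k (\<lambda>x. \<Sum>i\<in>I. f i x) U"
  using assms(2)
  by (induction I rule: infinite_finite_induct) (auto intro: Ck_on_const Ck_on_add assms(1))

text \<open>The derivative given by the chain rule is expanded in the basis of the middle space: it
  becomes a sum of products of coordinates of the derivative of \<open>g\<close> with partial
  derivatives of \<open>f\<close> composed with \<open>g\<close>, to which the induction hypothesis
  applies. Hence \<open>f\<close> is generalised and the middle space Euclidean.\<close>

lemma Ck_on_compose:
  fixes g :: "'e::real_normed_vector => 'f::euclidean_space"
  assumes "open U" "open V" "g ` U \<subseteq> V" "Ck_on k g U" "Ck_on k f V"
  shows "Ck_on k (\<lambda>x. f (g x)) U"
  using assms(4,5)
proof (induction k arbitrary: f)
  case 0
  then show ?case using assms(3) by (auto intro: continuous_on_compose2)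
next
  case (Suc k)
  show ?case
  proof (rule Ck_on_SucI[OF assms(1)])
    fix x assume x: "x \<in> U"
    have Df: "(f has_derivative der UNIV f (g x)) (at (g x))"
      using Ck_on_SucD[OF assms(2) Suc.prems(2)] x assms(3) by blast
    have "((\<lambda>x. f (g x)) has_derivative
      (\<lambda>v. der UNIV f (g x) (der UNIV g x v))) (at x)"
      using has_derivative_compose[OF Ck_on_SucD[OF assms(1) Suc.prems(1) x] Df] .
    also have "(\<lambda>v. der UNIV f (g x) (der UNIV g x v)) =
      (\<lambda>v. \<Sum>b\<in>Basis. (der UNIV g x v \<bullet> b) *\<^sub>R der UNIV f (g x) b)"
    proof
      fix v
      have lin: "linear (der UNIV f (g x))" using Df has_derivative_linear by blast
      show "der UNIV f (g x) (der UNIV g x v) =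
        (\<Sum>b\<in>Basis. (der UNIV g x v \<bullet> b) *\<^sub>R der UNIV f (g x) b)"
        by (subst euclidean_representation[symmetric, of "der UNIV g x v"])
          (simp add: linear_sum[OF lin] linear_cmul[OF lin])
    qed
    finally show "((\<lambda>x. f (g x)) has_derivative (\<lambda>v. \<Sum>b\<in>Basis.
       (der UNIV g x v \<bullet> b) *\<^sub>R der UNIV f (g x) b)) (at x)" .
  next
    fix v
    have 1: "Ck_on k (\<lambda>x. der UNIV g x v \<bullet> b) U" for b
      by (intro bounded_bilinear.Ck_on_prod[OF bounded_bilinear_inner] Ck_on_deriv Ck_on_const
          Suc.prems assms(1))
    have 2: "Ck_on k (\<lambda>x. der UNIV f (g x) b) U" for b
      by (intro Suc.IH Ck_on_deriv Ck_on_lower[OF Suc.prems(1)] Suc.prems)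
    show "Ck_on k (\<lambda>x. \<Sum>b\<in>Basis.
       (der UNIV g x v \<bullet> b) *\<^sub>R der UNIV f (g x) b) U"
      by (intro Ck_on_sum assms(1) bounded_bilinear.Ck_on_prod[OF bounded_bilinear_scaleR] 1 2)
  qed
qed

lemma Ck_on_mult:
  fixes f g :: "'e::real_normed_vector => real"
  assumes "open U" "Ck_on k f U" "Ck_on k g U"
  shows "Ck_on k (\<lambda>x. f x * g x) U"
  using bounded_bilinear.Ck_on_prod[OF bounded_bilinear_mult assms] .

section \<open>Real powers and a smooth function vanishing on a half-line\<close>

lemma Ck_on_powr: "Ck_on k (\<lambda>t::real. t powr a) {0<..}"
proof (induction k arbitrary: a)
  case 0
  then show ?case by (auto intro!: continuous_intros)
next
  case (Suc k)
  show ?case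
  proof (rule Ck_on_SucI[where f'="\<lambda>t v. a * v * t powr (a - 1)"])
    show "((\<lambda>t. t powr a) has_derivative (\<lambda>v. a * v * x powr (a - 1))) (at x)" if "x \<in> {0<..}" for x :: real
      using has_real_derivative_powr[of x a] that
      by (auto simp: has_field_derivative_def mult_ac elim!: has_derivative_eq_rhs)
    show "Ck_on k (\<lambda>t. a * v * t powr (a - 1)) {0<..}" for v
      by (intro Ck_on_mult Ck_on_const Suc) auto
  qed simp
qed

text \<open>The family is closed under differentiation up to linear combinations:
  the derivative of the function with parameter \<open>n\<close> is the one with parameter \<open>n + 2\<close>
  minus \<open>n\<close> times the one with parameter \<open>n + 1\<close>.\<close>

definition flat_fun :: "nat => real => real" where
  "flat_fun n t = (if t > 0 then (1/t)^n * exp (-1/t) else 0)"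

text \<open>The exponential series at \<open>1/t\<close> exceeds its single term of index
  \<open>n + 2\<close>. The two spare powers of \<open>t\<close> give a quadratic bound, which is
  what the derivative at the origin needs.\<close>

lemma flat_fun_bound: "\<bar>flat_fun n t\<bar> \<le> fact (Suc (Suc n)) * t\<^sup>2"
proof (cases "t > 0")
  case True
  define m where "m = Suc (Suc n)"
  have "(\<Sum>k\<in>{m}. inverse (fact k) *\<^sub>R (1/t)^k) \<le> exp (1/t)"
    unfolding exp_def using True by (intro sum_le_suminf summable_exp_generic) auto
  then have *: "inverse (fact m) *\<^sub>R (1/t)^m \<le> exp (1/t)" by simp
  have "(1/t)^m = fact m * (inverse (fact m) *\<^sub>R (1/t)^m)" by simp
  also have "\<dots> \<le> fact m * exp (1/t)" by (rule mult_left_mono[OF *]) simp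
  finally have "(1/t)^m \<le> fact m * exp (1/t)" .
  then have "(1/t)^m * exp (-1/t) \<le> fact m * exp (1/t) * exp (-1/t)"
    by (intro mult_right_mono) simp_all
  also have "\<dots> = fact m" by (simp add: mult.assoc flip: exp_add)
  finally have "(1/t)^m * exp (-1/t) \<le> fact m" .
  then have "t\<^sup>2 * ((1/t)^m * exp (-1/t)) \<le> t\<^sup>2 * fact m"
    by (intro mult_left_mono) auto
  moreover have "t\<^sup>2 * ((1/t)^m * exp (-1/t)) = flat_fun n t"
    using True by (simp add: flat_fun_def m_def power2_eq_square)
  moreover have "flat_fun n t \<ge> 0" by (simp add: flat_fun_def)
  ultimately show ?thesis by (simp add: m_def mult.commute)
qed (auto simp: flat_fun_def)


lemma flat_fun_deriv:
  "(flat_fun n has_real_derivative flat_fun (n + 2) t - real n * flat_fun (n + 1) t) (at t)"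
proof -
  consider "t > 0" | "t < 0" | "t = 0" by linarith
  then show ?thesis
  proof cases
    case 1
    have "((\<lambda>t. (1/t)^n * exp (-1/t)) has_real_derivative
        real n * (1/t)^(n - 1) * (- 1 / t\<^sup>2) * exp (-1/t) + (1/t)^n * (exp (-1/t) * (1 / t\<^sup>2))) (at t)"
      using 1 by (auto intro!: derivative_eq_intros simp: power2_eq_square)
    also have "real n * (1/t)^(n - 1) * (- 1 / t\<^sup>2) * exp (-1/t) + (1/t)^n * (exp (-1/t) * (1 / t\<^sup>2))
        = flat_fun (n + 2) t - real n * flat_fun (n + 1) t"
      using 1 by (cases n) (auto simp: flat_fun_def power2_eq_square algebra_simps add_divide_distrib)
    finally show ?thesis
      by (rule has_field_derivative_transform_within_open[of _ _ _ "{0<..}"])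
        (use 1 in \<open>auto simp: flat_fun_def\<close>)
  next
    case 2
    have "((\<lambda>t. 0) has_real_derivative 0) (at t)" by simp
    then have "(flat_fun n has_real_derivative 0) (at t)"
      by (rule has_field_derivative_transform_within_open[of _ _ _ "{..<0}"])
        (use 2 in \<open>auto simp: flat_fun_def\<close>)
    then show ?thesis using 2 by (simp add: flat_fun_def)
  next
    \<comment> \<open>At the origin the quadratic bound makes the difference quotient at most a
      constant times \<open>\<bar>h\<bar>\<close>.\<close>
    case 3
    have "((\<lambda>h. (flat_fun n (0 + h) - flat_fun n 0) / h) \<longlongrightarrow> 0) (at 0)"
    proof (rule Lim_null_comparison)
      have "norm ((flat_fun n (0 + h) - flat_fun n 0) / h) \<le> fact (Suc (Suc n)) * \<bar>h\<bar>" if "h \<noteq> 0" for h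
      proof -
        have "\<bar>flat_fun n h\<bar> / \<bar>h\<bar> \<le> fact (Suc (Suc n)) * h\<^sup>2 / \<bar>h\<bar>"
          by (intro divide_right_mono flat_fun_bound) simp
        also have "\<dots> = fact (Suc (Suc n)) * \<bar>h\<bar>"
          using that by (simp add: power2_eq_square divide_simps abs_if)
        finally show ?thesis by (simp add: flat_fun_def)
      qed
      then show "\<forall>\<^sub>F h in at 0. norm ((flat_fun n (0 + h) - flat_fun n 0) / h)
          \<le> fact (Suc (Suc n)) * \<bar>h\<bar>"
        by (auto simp: eventually_at_filter)
      show "((\<lambda>h. fact (Suc (Suc n)) * \<bar>h\<bar>) \<longlongrightarrow> (0::real)) (at 0)"
        by (auto intro!: tendsto_eq_intros)
    qed
    then show ?thesis using 3 by (simp add: DERIV_def flat_fun_def)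
  qed
qed

lemma Ck_on_flat_fun: "Ck_on k (flat_fun n) UNIV"
proof (induction k arbitrary: n)
  case 0
  show ?case
    using DERIV_isCont[OF flat_fun_deriv] by (simp add: continuous_on_eq_continuous_at)
next
  case (Suc k)
  show ?case
  proof (rule Ck_on_SucI[where f'="\<lambda>t v. (flat_fun (n + 2) t + (- real n) * flat_fun (n + 1) t) * v"])
    show "(flat_fun n has_derivative (\<lambda>v. (flat_fun (n + 2) x + (- real n) * flat_fun (n + 1) x) * v)) (at x)" for x
      using flat_fun_deriv[of n x] by (simp add: has_field_derivative_def)
    show "Ck_on k (\<lambda>t. (flat_fun (n + 2) t + (- real n) * flat_fun (n + 1) t) * v) UNIV" for v
      by (intro Ck_on_mult Ck_on_add Ck_on_const Suc open_UNIV)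
  qed simp
qed

text \<open>The second difference over a parallelogram is a difference in the direction
  \<open>u\<close> of a difference in the direction \<open>v\<close>; the one-variable mean value
  theorem is applied twice.\<close>

lemma second_derivative_mean_value:
  fixes f :: "'e::real_normed_vector => real"
  assumes U: "open U" and C: "Ck_on (Suc (Suc 0)) f U" and h: "h > 0"
    and box: "\<And>s t. 0 \<le> s ==> s \<le> h ==> 0 \<le> t ==> t \<le> h ==> x + s *\<^sub>R u + t *\<^sub>R v \<in> U"
  shows "\<exists>s t. 0 < s \<and> s < h \<and> 0 < t \<and> t < h \<and>
    f (x + h *\<^sub>R u + h *\<^sub>R v) - f (x + h *\<^sub>R u) - f (x + h *\<^sub>R v) + f x
    = h * h * der UNIV (\<lambda>y. der UNIV f y u) (x + s *\<^sub>R u + t *\<^sub>R v) v"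
proof -
  have D1: "(f has_derivative der UNIV f y) (at y)" if "y \<in> U" for y
    using Ck_on_SucD[OF U C that] .
  have D2: "((\<lambda>y. der UNIV f y u) has_derivative
      der UNIV (\<lambda>y. der UNIV f y u) y) (at y)" if "y \<in> U" for y
    using Ck_on_SucD[OF U Ck_on_deriv[OF C] that] .
  have line: "((\<lambda>r. F (a + r *\<^sub>R w)) has_real_derivative F' w) (at r)"
    if "(F has_derivative F') (at (a + r *\<^sub>R w))" for F :: "'e => real" and F' a w r
  proof -
    have "((\<lambda>r. F (a + r *\<^sub>R w)) has_derivative (\<lambda>d. F' (d *\<^sub>R w))) (at r)"
      by (rule has_derivative_compose[of "\<lambda>r. a + r *\<^sub>R w" "\<lambda>d. d *\<^sub>R w" r UNIV F F', OF _ that])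
        (auto intro!: derivative_eq_intros)
    then show ?thesis
      using linear_cmul[OF has_derivative_linear[OF that]]
      by (auto simp: has_field_derivative_def mult.commute elim!: has_derivative_eq_rhs)
  qed
  define g where "g s = f (x + h *\<^sub>R v + s *\<^sub>R u) - f (x + s *\<^sub>R u)" for s
  have "\<exists>s. 0 < s \<and> s < h \<and> g h - g 0 = (h - 0) *
    (der UNIV f (x + h *\<^sub>R v + s *\<^sub>R u) u - der UNIV f (x + s *\<^sub>R u) u)"
  proof (rule MVT2[OF h])
    fix s assume s: "0 \<le> s" "s \<le> h"
    show "(g has_real_derivative der UNIV f (x + h *\<^sub>R v + s *\<^sub>R u) u
      - der UNIV f (x + s *\<^sub>R u) u) (at s)"
      unfolding g_def
      using box[OF s, of h] box[OF s, of 0] h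
      by (intro DERIV_diff line D1) (auto simp: algebra_simps)
  qed
  then obtain s where s: "0 < s" "s < h" and gs: "g h - g 0 = h *
    (der UNIV f (x + h *\<^sub>R v + s *\<^sub>R u) u - der UNIV f (x + s *\<^sub>R u) u)"
    by auto
  define k where "k t = der UNIV f (x + s *\<^sub>R u + t *\<^sub>R v) u" for t
  have "\<exists>t. 0 < t \<and> t < h \<and> k h - k 0 = (h - 0) *
    der UNIV (\<lambda>y. der UNIV f y u) (x + s *\<^sub>R u + t *\<^sub>R v) v"
  proof (rule MVT2[OF h])
    fix t assume t: "0 \<le> t" "t \<le> h"
    show "(k has_real_derivative
      der UNIV (\<lambda>y. der UNIV f y u) (x + s *\<^sub>R u + t *\<^sub>R v) v) (at t)"
      unfolding k_def using box[of s t] s t by (intro line[OF D2]) auto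
  qed
  then obtain t where t: "0 < t" "t < h" and kt: "k h - k 0 = h *
    der UNIV (\<lambda>y. der UNIV f y u) (x + s *\<^sub>R u + t *\<^sub>R v) v"
    by auto
  have "f (x + h *\<^sub>R u + h *\<^sub>R v) - f (x + h *\<^sub>R u) - f (x + h *\<^sub>R v) + f x = g h - g 0"
    by (simp add: g_def algebra_simps)
  also have "\<dots> = h * (k h - k 0)" unfolding gs k_def by (simp add: algebra_simps)
  finally show ?thesis using s t kt by (metis mult.assoc)
qed

text \<open>The second difference is symmetric in \<open>u\<close> and \<open>v\<close>, so the two
  mixed derivatives take a common value at points arbitrarily close to \<open>x\<close>; continuity
  gives equality at \<open>x\<close> itself.\<close>

lemma second_derivative_symmetric_real:
  fixes f :: "'e::real_normed_vector => real"
  assumes U: "open U" and C: "Ck_on (Suc (Suc 0)) f U" and x: "x \<in> U"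
  shows "der UNIV (\<lambda>y. der UNIV f y u) x v = der UNIV (\<lambda>y. der UNIV f y v) x u"
proof (rule ccontr)
  let ?D = "\<lambda>u v y. der UNIV (\<lambda>y. der UNIV f y u) y v"
  assume ne: "?D u v x \<noteq> ?D v u x"
  define e where "e = dist (?D u v x) (?D v u x) / 2"
  have e: "e > 0" using ne by (simp add: e_def)
  have "isCont (?D a b) x" for a b
    using Ck_on_deriv[OF Ck_on_deriv[OF C, of a], of b] continuous_on_eq_continuous_at[OF U, of "?D a b"] x by simp
  then have "\<forall>\<^sub>F y in nhds x. dist (?D a b y) (?D a b x) < e" for a b
    using e unfolding isCont_def tendsto_iff eventually_at_filter by (fastforce elim: eventually_mono)
  then have "\<forall>\<^sub>F y in nhds x. y \<in> U \<and> dist (?D u v y) (?D u v x) < e \<and> dist (?D v u y) (?D v u x) < e"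
    by (intro eventually_conj eventually_nhds_in_open U x)
  then obtain d where d: "d > 0"
    and near: "\<And>y. dist y x < d ==> y \<in> U \<and> dist (?D u v y) (?D u v x) < e \<and> dist (?D v u y) (?D v u x) < e"
    unfolding eventually_nhds_metric by blast
  \<comment> \<open>Small enough that the parallelogram spanned by \<open>h *\<^sub>R u\<close> and
    \<open>h *\<^sub>R v\<close> stays in the ball of radius \<open>d\<close>; the summand 1 keeps
    the denominator positive.\<close>
  define h where "h = d / (norm u + norm v + 1)"
  have pos: "norm u + norm v + 1 > 0" by (smt (verit) norm_ge_zero)
  have h: "h > 0" using d pos by (simp add: h_def)
  have box: "dist (x + s *\<^sub>R u + t *\<^sub>R v) x < d" if "0 \<le> s" "s \<le> h" "0 \<le> t" "t \<le> h" for s t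
  proof -
    have "norm (s *\<^sub>R u + t *\<^sub>R v) \<le> s * norm u + t * norm v"
      using norm_triangle_ineq[of "s *\<^sub>R u" "t *\<^sub>R v"] that by simp
    also have "\<dots> \<le> h * norm u + h * norm v" using that by (intro add_mono mult_right_mono) auto
    also have "\<dots> < h * (norm u + norm v + 1)" using h by (simp add: algebra_simps)
    also have "\<dots> = d" using pos by (simp add: h_def)
    finally show ?thesis by (simp add: dist_norm add.assoc)
  qed
  obtain s t where st: "0 < s" "s < h" "0 < t" "t < h"
    "f (x + h *\<^sub>R u + h *\<^sub>R v) - f (x + h *\<^sub>R u) - f (x + h *\<^sub>R v) + f x = h * h * ?D u v (x + s *\<^sub>R u + t *\<^sub>R v)"
    using second_derivative_mean_value[OF U C h, of x u v] near box by blast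
  have box': "dist (x + s *\<^sub>R v + t *\<^sub>R u) x < d" if "0 \<le> s" "s \<le> h" "0 \<le> t" "t \<le> h" for s t
    using box[OF that(3,4,1,2)] by (simp add: add_ac)
  obtain s' t' where st': "0 < s'" "s' < h" "0 < t'" "t' < h"
    "f (x + h *\<^sub>R v + h *\<^sub>R u) - f (x + h *\<^sub>R v) - f (x + h *\<^sub>R u) + f x = h * h * ?D v u (x + s' *\<^sub>R v + t' *\<^sub>R u)"
    using second_derivative_mean_value[OF U C h, of x v u] near box' by blast
  have "f (x + h *\<^sub>R u + h *\<^sub>R v) = f (x + h *\<^sub>R v + h *\<^sub>R u)" by (simp add: add_ac)
  then have "h * h * ?D u v (x + s *\<^sub>R u + t *\<^sub>R v) = h * h * ?D v u (x + s' *\<^sub>R v + t' *\<^sub>R u)"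
    using st(5) st'(5) by linarith
  then have "?D u v (x + s *\<^sub>R u + t *\<^sub>R v) = ?D v u (x + s' *\<^sub>R v + t' *\<^sub>R u)" using h by simp
  moreover have "dist (?D u v (x + s *\<^sub>R u + t *\<^sub>R v)) (?D u v x) < e" using near box[of s t] st by simp
  moreover have "dist (?D v u (x + s' *\<^sub>R v + t' *\<^sub>R u)) (?D v u x) < e" using near box'[of s' t'] st' by simp
  ultimately show False unfolding e_def by (smt (verit) dist_commute dist_triangle field_sum_of_halves)
qed

section \<open>Smooth functions on relatively open subsets of a convex body\<close>

text \<open>The condition under which a derivative within \<open>A\<close> is unique.\<close>

definition regular_set :: "'e::euclidean_space set => bool" where
  "regular_set A \<longleftrightarrow> (\<forall>x\<in>A. \<forall>i\<in>Basis. \<forall>e>0. \<exists>d. 0 < \<bar>d\<bar> \<and> \<bar>d\<bar> < e \<and> x + d *\<^sub>R i \<in> A)"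

lemma smooth_onI:
  assumes "\<And>x. x \<in> A ==> \<exists>U F. open U \<and> x \<in> U \<and> (\<forall>k. Ck_on k F U) \<and> (\<forall>y\<in>A \<inter> U. F y = f y)"
  shows "smooth_on A f"
  using assms by (simp add: smooth_on_def)

lemma smooth_onE:
  assumes "smooth_on A f" "x \<in> A"
  obtains U F where "open U" "x \<in> U" "\<And>k. Ck_on k F U" "\<And>y. y \<in> A ==> y \<in> U ==> F y = f y"
  using assms unfolding smooth_on_def by (metis IntI)

lemma smooth_on_open:
  assumes "open U" "\<And>k. Ck_on k f U" "A \<subseteq> U" shows "smooth_on A f"
  using assms by (intro smooth_onI) blast

lemma smooth_on_subset: "smooth_on A f ==> B \<subseteq> A ==> smooth_on B f"
proof (rule smooth_onI)
  fix x assume f: "smooth_on A f" "B \<subseteq> A" "x \<in> B"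
  obtain U F where "open U" "x \<in> U" "\<And>k. Ck_on k F U" "\<And>y. y \<in> A ==> y \<in> U ==> F y = f y"
    using smooth_onE[OF f(1)] f by blast
  then show "\<exists>U F. open U \<and> x \<in> U \<and> (\<forall>k. Ck_on k F U) \<and> (\<forall>y\<in>B \<inter> U. F y = f y)"
    using f(2) by (intro exI[of _ U] exI[of _ F]) auto
qed

lemma smooth_on_cong:
  assumes "smooth_on A f" "\<And>x. x \<in> A ==> g x = f x" shows "smooth_on A g"
proof (rule smooth_onI)
  fix x assume "x \<in> A"
  from smooth_onE[OF assms(1) this] obtain U F where "open U" "x \<in> U" "\<And>k. Ck_on k F U"
    "\<And>y. y \<in> A ==> y \<in> U ==> F y = f y" by blast
  then show "\<exists>U F. open U \<and> x \<in> U \<and> (\<forall>k. Ck_on k F U) \<and> (\<forall>y\<in>A \<inter> U. F y = g y)"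
    using assms(2) by (intro exI[of _ U] exI[of _ F]) auto
qed

lemma smooth_on_local:
  assumes "\<And>x. x \<in> A ==> \<exists>U. open U \<and> x \<in> U \<and> smooth_on (A \<inter> U) f"
  shows "smooth_on A f"
proof (rule smooth_onI)
  fix x assume x: "x \<in> A"
  obtain U where U: "open U" "x \<in> U" "smooth_on (A \<inter> U) f" using assms[OF x] by blast
  obtain V F where "open V" "x \<in> V" "\<And>k. Ck_on k F V" "\<And>y. y \<in> A \<inter> U ==> y \<in> V ==> F y = f y"
    using smooth_onE[OF U(3)] x U(2) by blast
  then show "\<exists>U F. open U \<and> x \<in> U \<and> (\<forall>k. Ck_on k F U) \<and> (\<forall>y\<in>A \<inter> U. F y = f y)"
    using U by (intro exI[of _ "U \<inter> V"] exI[of _ F]) (auto intro: Ck_on_subset)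
qed

lemma smooth_on_const: "smooth_on A (\<lambda>x. c)"
  by (rule smooth_on_open[OF open_UNIV]) (auto intro: Ck_on_const)

lemma smooth_on_linear: "bounded_linear f ==> smooth_on A f"
  by (rule smooth_on_open[OF open_UNIV]) (auto intro: Ck_on_linear)

text \<open>Pointwise binary operations need only be treated on open sets: intersect the domains of
  the two local extensions.\<close>

lemma smooth_on_combine:
  fixes f :: "'e::real_normed_vector => 'f::real_normed_vector" and g :: "'e => 'g::real_normed_vector"
  assumes f: "smooth_on A f" and g: "smooth_on A g"
    and C: "\<And>U (F :: 'e => 'f) (G :: 'e => 'g) k. open U ==> (\<And>k. Ck_on k F U) ==> (\<And>k. Ck_on k G U) ==> Ck_on k (\<lambda>x. h (F x) (G x)) U"
  shows "smooth_on A (\<lambda>x. h (f x) (g x))"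
proof (rule smooth_onI)
  fix x assume x: "x \<in> A"
  obtain U F where U: "open U" "x \<in> U" "\<And>k. Ck_on k F U" "\<And>y. y \<in> A ==> y \<in> U ==> F y = f y"
    using smooth_onE[OF f x] by blast
  obtain V G where V: "open V" "x \<in> V" "\<And>k. Ck_on k G V" "\<And>y. y \<in> A ==> y \<in> V ==> G y = g y"
    using smooth_onE[OF g x] by blast
  have "Ck_on k (\<lambda>x. h (F x) (G x)) (U \<inter> V)" for k
    using U V by (intro C) (auto intro: Ck_on_subset)
  then show "\<exists>U H. open U \<and> x \<in> U \<and> (\<forall>k. Ck_on k H U) \<and> (\<forall>y\<in>A \<inter> U. H y = h (f y) (g y))"
    using U V by (intro exI[of _ "U \<inter> V"] exI[of _ "\<lambda>x. h (F x) (G x)"]) auto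
qed

lemma smooth_on_add: "smooth_on A f ==> smooth_on A g ==> smooth_on A (\<lambda>x. f x + g x)"
  by (rule smooth_on_combine) (auto intro: Ck_on_add)

lemma smooth_on_bilinear:
  "bounded_bilinear h ==> smooth_on A f ==> smooth_on A g ==> smooth_on A (\<lambda>x. h (f x) (g x))"
  by (rule smooth_on_combine) (auto intro: bounded_bilinear.Ck_on_prod)

lemmas smooth_on_mult = smooth_on_bilinear[OF bounded_bilinear_mult]
lemmas smooth_on_scaleR = smooth_on_bilinear[OF bounded_bilinear_scaleR]
lemmas smooth_on_inner = smooth_on_bilinear[OF bounded_bilinear_inner]

lemma smooth_on_sum:
  "(\<And>i. i \<in> I ==> smooth_on A (f i)) ==> smooth_on A (\<lambda>x. \<Sum>i\<in>I. f i x)"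
  by (induction I rule: infinite_finite_induct) (auto intro: smooth_on_const smooth_on_add)

lemma smooth_on_minus: "smooth_on A f ==> smooth_on A (\<lambda>x. - f x)"
  using smooth_on_scaleR[OF smooth_on_const[of A "-1"]] by simp

lemma smooth_on_diff: "smooth_on A f ==> smooth_on A g ==> smooth_on A (\<lambda>x. f x - g x)"
  unfolding diff_conv_add_uminus by (intro smooth_on_add smooth_on_minus)

lemma smooth_on_compose:
  fixes g :: "'e::real_normed_vector => 'f::euclidean_space"
  assumes g: "smooth_on A g" and f: "smooth_on B f" and AB: "g ` A \<subseteq> B"
  shows "smooth_on A (\<lambda>x. f (g x))"
proof (rule smooth_onI)
  fix x assume x: "x \<in> A"
  obtain U G where U: "open U" "x \<in> U" "\<And>k. Ck_on k G U" "\<And>y. y \<in> A ==> y \<in> U ==> G y = g y"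
    using smooth_onE[OF g x] by blast
  obtain V F where V: "open V" "g x \<in> V" "\<And>k. Ck_on k F V" "\<And>y. y \<in> B ==> y \<in> V ==> F y = f y"
    using smooth_onE[OF f, of "g x"] AB x by blast
  have "continuous_on U G" using U(3)[of 0] by simp
  then have o: "open (G -` V \<inter> U)" using V(1) continuous_on_open_vimage[OF U(1), of G] by simp
  have "Ck_on k (\<lambda>x. F (G x)) (G -` V \<inter> U)" for k
    by (rule Ck_on_compose[OF o V(1) _ Ck_on_subset[OF U(3)] V(3)]) auto
  then show "\<exists>U H. open U \<and> x \<in> U \<and> (\<forall>k. Ck_on k H U) \<and> (\<forall>y\<in>A \<inter> U. H y = f (g y))"
    using o U V x AB by (intro exI[of _ "G -` V \<inter> U"] exI[of _ "\<lambda>x. F (G x)"]) auto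
qed

lemma smooth_on_powr:
  fixes f :: "'e::real_normed_vector => real"
  shows "smooth_on A f ==> (\<And>x. x \<in> A ==> f x > 0) ==> smooth_on A (\<lambda>x. f x powr a)"
  by (rule smooth_on_compose[of A f "{0<..}" "\<lambda>t. t powr a"])
    (auto intro: smooth_on_open[of "{0<..}"] Ck_on_powr)

lemma smooth_on_continuous_on: "smooth_on A f ==> continuous_on A f"
proof -
  assume f: "smooth_on A f"
  have "continuous (at x within A) f" if x: "x \<in> A" for x
  proof -
    obtain U F where U: "open U" "x \<in> U" "\<And>k. Ck_on k F U" "\<And>y. y \<in> A ==> y \<in> U ==> F y = f y"
      using smooth_onE[OF f x] by blast
    have "continuous_on U F" using U(3)[of 0] by simp
    then have "continuous_on (A \<inter> U) F" by (rule continuous_on_subset) simp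
    then have "continuous_on (A \<inter> U) f" by (rule continuous_on_eq) (use U in auto)
    then have "continuous (at x within A \<inter> U) f"
      using x U by (simp add: continuous_on_eq_continuous_within)
    moreover have "at x within A \<inter> U = at x within A"
      using U by (intro at_within_nhd[of x U]) auto
    ultimately show ?thesis by (simp add: continuous_within)
  qed
  then show ?thesis using continuous_on_eq_continuous_within by blast
qed

lemma regular_set_derivative_unique:
  assumes "regular_set A" "x \<in> A" "(f has_derivative D1) (at x within A)" "(f has_derivative D2) (at x within A)"
  shows "D1 = D2"
  by (rule frechet_derivative_unique_within[OF assms(3,4)]) (use assms(1,2) in \<open>simp add: regular_set_def\<close>)

lemma regular_set_openin:
  fixes A :: "'e::euclidean_space set"
  assumes A: "regular_set A" and B: "openin (top_of_set A) B" shows "regular_set B"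
  unfolding regular_set_def
proof (intro ballI allI impI)
  fix x i :: 'e and e :: real assume x: "x \<in> B" and i: "i \<in> Basis" and e: "e > 0"
  obtain T where T: "open T" "B = A \<inter> T" using B by (auto simp: openin_open)
  obtain r where r: "r > 0" "ball x r \<subseteq> T" using T x open_contains_ball by blast
  obtain d where d: "0 < \<bar>d\<bar>" "\<bar>d\<bar> < min e r" "x + d *\<^sub>R i \<in> A"
    using A[unfolded regular_set_def, rule_format, of x i "min e r"] x T i e r by auto
  then have "x + d *\<^sub>R i \<in> ball x r" using i by (simp add: dist_norm)
  then show "\<exists>d. 0 < \<bar>d\<bar> \<and> \<bar>d\<bar> < e \<and> x + d *\<^sub>R i \<in> B" using d r T by auto
qed

lemma regular_set_open: "open U ==> regular_set U"
proof -
  assume U: "open U"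
  have "\<exists>d. 0 < \<bar>d\<bar> \<and> \<bar>d\<bar> < e" if "e > 0" for e :: real using that by (intro exI[of _ "e / 2"]) auto
  then have "regular_set (UNIV :: 'a set)" by (simp add: regular_set_def)
  then show ?thesis by (rule regular_set_openin) (simp add: U)
qed

lemma at_within_openin:
  assumes "openin (top_of_set A) B" "x \<in> B" shows "at x within B = at x within A"
proof -
  obtain T where T: "open T" "B = A \<inter> T" using assms by (auto simp: openin_open)
  then show ?thesis using at_within_nhd[of x T B A] assms by auto
qed

lemma frechet_derivative_eq:
  assumes "regular_set A" "x \<in> A" "(f has_derivative D) (at x within A)"
  shows "der A f x = D"
proof -
  have "f differentiable (at x within A)" using assms(3) by (rule differentiableI)
  then have "(f has_derivative der A f x) (at x within A)"
    by (simp add: frechet_derivative_works)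
  from regular_set_derivative_unique[OF assms(1,2) this assms(3)] show ?thesis .
qed

lemma frechet_derivative_cong:
  assumes "x \<in> A" "\<And>y. y \<in> A ==> f y = g y"
  shows "der A f x = der A g x"
proof -
  have "(f has_derivative D) (at x within A) \<longleftrightarrow> (g has_derivative D) (at x within A)" for D
    using has_derivative_transform[OF assms(1), of g f D] has_derivative_transform[OF assms(1), of f g D] assms(2)
    by auto
  then show ?thesis by (simp add: frechet_derivative_def)
qed

text \<open>On a regular set the derivative within \<open>A\<close> is unique, hence equals that of
  every local extension. Statements about \<open>der A\<close>, also at boundary points, thus reduce
  to open sets.\<close>

lemma smooth_on_local_extension:
  assumes "regular_set A" "smooth_on A f" "x \<in> A"
  obtains U F where "open U" "x \<in> U" "\<And>k. Ck_on k F U" "\<And>y. y \<in> A ==> y \<in> U ==> F y = f y"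
    "\<And>y. y \<in> A ==> y \<in> U ==> (f has_derivative der UNIV F y) (at y within A)"
    "\<And>y. y \<in> A ==> y \<in> U ==> der A f y = der UNIV F y"
proof -
  obtain U F where U: "open U" "x \<in> U" "\<And>k. Ck_on k F U" "\<And>y. y \<in> A ==> y \<in> U ==> F y = f y"
    using smooth_onE[OF assms(2,3)] by blast
  have hd: "(f has_derivative der UNIV F y) (at y within A)" if y: "y \<in> A" "y \<in> U" for y
  proof -
    have "(F has_derivative der UNIV F y) (at y within A \<inter> U)"
      using Ck_on_SucD[OF U(1) U(3) y(2)] has_derivative_at_withinI by blast
    then have "(f has_derivative der UNIV F y) (at y within A \<inter> U)"
      by (rule has_derivative_transform[rotated 2]) (use U y in auto)
    then show ?thesis using at_within_openin[of A "A \<inter> U" y] U y by (simp add: openin_open_Int)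
  qed
  show ?thesis
    by (rule that[OF U hd frechet_derivative_eq[OF assms(1) _ hd]])
qed

lemma smooth_on_has_derivative:
  assumes "regular_set A" "smooth_on A f" "x \<in> A"
  shows "(f has_derivative der A f x) (at x within A)"
  using smooth_on_local_extension[OF assms] assms(3) by metis

lemma smooth_on_frechet_derivative:
  assumes "regular_set A" "smooth_on A f"
  shows "smooth_on A (\<lambda>x. der A f x v)"
proof (rule smooth_onI)
  fix x assume x: "x \<in> A"
  obtain U F where U: "open U" "x \<in> U" "\<And>k. Ck_on k F U" "\<And>y. y \<in> A ==> y \<in> U ==> F y = f y"
    "\<And>y. y \<in> A ==> y \<in> U ==> der A f y = der UNIV F y"
    using smooth_on_local_extension[OF assms x] by metis
  then show "\<exists>U F. open U \<and> x \<in> U \<and> (\<forall>k. Ck_on k F U) \<and>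
      (\<forall>y\<in>A \<inter> U. F y = der A f y v)"
    by (intro exI[of _ U] exI[of _ "\<lambda>y. der UNIV F y v"]) (auto intro: Ck_on_deriv)
qed

lemma frechet_derivative_bounded_linear:
  assumes "regular_set A" "smooth_on A f" "x \<in> A" "bounded_linear h"
  shows "der A (\<lambda>y. h (f y)) x v = h (der A f x v)"
  using frechet_derivative_eq[OF assms(1,3)
      bounded_linear.has_derivative[OF assms(4) smooth_on_has_derivative[OF assms(1,2,3)]]] by metis

lemma frechet_derivative_openin:
  assumes "openin (top_of_set A) B" "x \<in> B"
  shows "der B f x = der A f x"
  using at_within_openin[OF assms] by simp

text \<open>Taking components makes the function real-valued, and a local extension moves the
  question to an open set.\<close>

lemma second_derivative_symmetric:
  fixes f :: "'e::euclidean_space => 'f::euclidean_space"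
  assumes A: "regular_set A" and f: "smooth_on A f" and x: "x \<in> A"
  shows "der A (\<lambda>y. der A f y u) x v =
    der A (\<lambda>y. der A f y v) x u"
proof (rule euclidean_eqI)
  fix b :: 'f assume b: "b \<in> Basis"
  define h where "h y = f y \<bullet> b" for y
  have bl: "bounded_linear (\<lambda>y::'f. y \<bullet> b)" by (rule bounded_linear_inner_left)
  have h: "smooth_on A h" unfolding h_def by (intro smooth_on_inner f smooth_on_const)
  have 1: "der A h y w = der A f y w \<bullet> b"
    if "y \<in> A" for y w
    unfolding h_def using frechet_derivative_bounded_linear[OF A f that bl] .
  have 2: "der A (\<lambda>y. der A f y w) x w' \<bullet> b =
    der A (\<lambda>y. der A h y w) x w'" for w w'
    using frechet_derivative_bounded_linear[OF A smooth_on_frechet_derivative[OF A f] x bl, of w w']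
      frechet_derivative_cong[OF x, of "\<lambda>y. der A h y w"
        "\<lambda>y. der A f y w \<bullet> b"] 1 by simp
  obtain U F where U: "open U" "x \<in> U" "\<And>k. Ck_on k F U" "\<And>y. y \<in> A ==> y \<in> U ==> F y = h y"
    "\<And>y. y \<in> A ==> y \<in> U ==> der A h y = der UNIV F y"
    using smooth_on_local_extension[OF A h x] by metis
  have AU: "openin (top_of_set A) (A \<inter> U)" "x \<in> A \<inter> U" using U x by (auto simp: openin_open_Int)
  have "der A (\<lambda>y. der A h y w) x =
    der UNIV (\<lambda>y. der UNIV F y w) x" for w
  proof -
    have "der A (\<lambda>y. der A h y w) x =
      der (A \<inter> U) (\<lambda>y. der UNIV F y w) x"
      unfolding frechet_derivative_openin[OF AU, symmetric]
      by (rule frechet_derivative_cong[OF AU(2)]) (use U in auto)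
    also have "\<dots> = der UNIV (\<lambda>y. der UNIV F y w) x"
      by (rule frechet_derivative_eq[OF regular_set_openin[OF A AU(1)] AU(2)])
        (rule has_derivative_at_withinI, rule Ck_on_SucD[OF U(1) _ U(2)], rule Ck_on_deriv, rule U(3))
    finally show ?thesis .
  qed
  then show "der A (\<lambda>y. der A f y u) x v \<bullet> b =
    der A (\<lambda>y. der A f y v) x u \<bullet> b"
    unfolding 2 using second_derivative_symmetric_real[OF U(1) U(3) U(2)] by simp
qed

section \<open>Multilinear and alternating forms on lists of vectors\<close>

lemma multilin_Cons: "multilin (Suc p) \<alpha> ==> multilin p (\<lambda>vs. \<alpha> (v # vs))"
  unfolding multilin_def
proof (intro allI impI)
  fix vs :: "'a list" and j
  assume m: "\<forall>vs. length vs = Suc p \<longrightarrow> (\<forall>j<Suc p. linear (\<lambda>v. \<alpha> (vs[j := v])))"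
    and vs: "length vs = p" "j < p"
  then have "linear (\<lambda>w. \<alpha> ((v # vs)[Suc j := w]))" by (metis Suc_less_eq length_Cons)
  then show "linear (\<lambda>w. \<alpha> (v # vs[j := w]))" by simp
qed

lemma multilin_head:
  assumes "multilin (Suc p) \<alpha>" "length vs = p" shows "linear (\<lambda>v. \<alpha> (v # vs))"
proof -
  have "linear (\<lambda>v. \<alpha> ((0 # vs)[0 := v]))"
    using assms unfolding multilin_def by (metis length_Cons zero_less_Suc)
  then show ?thesis by simp
qed

lemma multilin_SucI:
  assumes "\<And>v. multilin p (\<lambda>vs. \<alpha> (v # vs))"
    and "\<And>vs. length vs = p ==> linear (\<lambda>v. \<alpha> (v # vs))"
  shows "multilin (Suc p) \<alpha>"
  unfolding multilin_def
proof (intro allI impI)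
  fix vs :: "'a list" and j assume vs: "length vs = Suc p" "j < Suc p"
  then obtain w ws where w: "vs = w # ws" "length ws = p" by (cases vs) auto
  show "linear (\<lambda>v. \<alpha> (vs[j := v]))"
  proof (cases j)
    case 0
    then show ?thesis using assms(2)[OF w(2)] w by simp
  next
    case (Suc i)
    then have "linear (\<lambda>v. \<alpha> (w # ws[i := v]))"
      using assms(1)[of w] w vs unfolding multilin_def by auto
    then show ?thesis using w Suc by simp
  qed
qed

lemma multilin_0: "multilin 0 \<alpha>" by (simp add: multilin_def)

lemma multilin_mid:
  assumes "multilin p \<alpha>" "length a + Suc (length b) = p"
  shows "linear (\<lambda>v. \<alpha> (a @ v # b))"
proof -
  have "linear (\<lambda>v. \<alpha> ((a @ 0 # b)[length a := v]))"
    using assms unfolding multilin_def by (metis add_Suc_right length_Cons length_append less_add_Suc1)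
  then show ?thesis by simp
qed

lemma multilin_append2: "multilin (p + q) \<alpha> ==> length ws = q ==> multilin p (\<lambda>vs. \<alpha> (vs @ ws))"
proof (induction p arbitrary: \<alpha>)
  case (Suc p)
  show ?case
  proof (rule multilin_SucI)
    show "multilin p (\<lambda>vs. \<alpha> ((v # vs) @ ws))" for v
      using Suc.IH[of "\<lambda>vs. \<alpha> (v # vs)"] multilin_Cons[of "p + q" \<alpha> v] Suc.prems by simp
    show "linear (\<lambda>v. \<alpha> ((v # vs) @ ws))" if "length vs = p" for vs
      using multilin_head[of "p + q" \<alpha> "vs @ ws"] Suc.prems that by simp
  qed
qed (rule multilin_0)

lemma linear_cmul_fun: "linear f ==> linear (\<lambda>x. c * f x :: real)"
  by (auto simp: linear_iff algebra_simps)

lemma multilin_add: "multilin p \<alpha> ==> multilin p \<beta> ==> multilin p (\<lambda>vs. \<alpha> vs + \<beta> vs)"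
  unfolding multilin_def by (auto intro: linear_compose_add)

lemma multilin_cmul: "multilin p \<alpha> ==> multilin p (\<lambda>vs. c * \<alpha> vs)"
  unfolding multilin_def by (auto intro: linear_cmul_fun)

lemma multilin_sum: "(\<And>i. i \<in> I ==> multilin p (\<alpha> i)) ==> multilin p (\<lambda>vs. \<Sum>i\<in>I. \<alpha> i vs)"
  unfolding multilin_def by (auto intro!: linear_compose_sum)

lemma multilin_minus: "multilin p \<alpha> ==> multilin p (\<lambda>vs. - \<alpha> vs)"
  using multilin_cmul[of p \<alpha> "-1"] by simp

lemma multilin_diff: "multilin p \<alpha> ==> multilin p \<beta> ==> multilin p (\<lambda>vs. \<alpha> vs - \<beta> vs)"
  using multilin_add[OF _ multilin_minus, of p \<alpha> \<beta>] by simp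

lemma multilin_cong:
  assumes "multilin p \<alpha>" "\<And>vs. length vs = p ==> \<beta> vs = \<alpha> vs" shows "multilin p \<beta>"
  using assms by (auto simp: multilin_def)

lemma multilin_map:
  assumes "multilin p \<alpha>" "linear L" shows "multilin p (\<lambda>vs. \<alpha> (map L vs))"
  unfolding multilin_def
proof (intro allI impI)
  fix vs :: "'b list" and j assume "length vs = p" "j < p"
  then have "linear (\<lambda>v. \<alpha> ((map L vs)[j := v]))" using assms(1) by (simp add: multilin_def)
  from linear_compose[OF assms(2) this] show "linear (\<lambda>v. \<alpha> (map L (vs[j := v])))"
    by (simp add: o_def map_update)
qed

lemma alternating_multilin: "alternating p \<alpha> ==> multilin p \<alpha>"
  by (simp add: alternating_def)

lemma alternating_not_distinct: "alternating p \<alpha> ==> length vs = p ==> \<not> distinct vs ==> \<alpha> vs = 0"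
  by (simp add: alternating_def)

lemma alternating_Cons: "alternating (Suc p) \<alpha> ==> alternating p (\<lambda>vs. \<alpha> (v # vs))"
  by (auto simp: alternating_def multilin_Cons)

lemma alternating_append2: "alternating (p + q) \<alpha> ==> length ws = q ==> alternating p (\<lambda>vs. \<alpha> (vs @ ws))"
  by (auto simp: alternating_def multilin_append2)

lemma alternating_cmul: "alternating p \<alpha> ==> alternating p (\<lambda>vs. c * \<alpha> vs)"
  by (auto simp: alternating_def multilin_cmul)

lemma alternating_add: "alternating p \<alpha> ==> alternating p \<beta> ==> alternating p (\<lambda>vs. \<alpha> vs + \<beta> vs)"
  by (auto simp: alternating_def multilin_add)

lemma alternating_sum: "(\<And>i. i \<in> I ==> alternating p (\<alpha> i)) ==> alternating p (\<lambda>vs. \<Sum>i\<in>I. \<alpha> i vs)"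
  by (auto simp: alternating_def multilin_sum)

lemma alternating_cong:
  assumes "alternating p \<alpha>" "\<And>vs. length vs = p ==> \<beta> vs = \<alpha> vs" shows "alternating p \<beta>"
  using assms multilin_cong[of p \<alpha> \<beta>] by (auto simp: alternating_def)

lemma alternating_map:
  assumes "alternating p \<alpha>" "linear L" shows "alternating p (\<lambda>vs. \<alpha> (map L vs))"
  using assms multilin_map[of p \<alpha> L] by (auto simp: alternating_def distinct_map)

text \<open>Polarisation: expand \<alpha> with \<open>x + y\<close> in both adjacent slots.\<close>

lemma swap_of_adjacent:
  assumes m: "multilin p \<alpha>" and z: "\<And>a x b. length a + Suc (Suc (length b)) = p ==> \<alpha> (a @ x # x # b) = 0"
    and l: "length a + Suc (Suc (length b)) = p"
  shows "\<alpha> (a @ y # x # b) = - \<alpha> (a @ x # y # b)"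
proof -
  have 1: "linear (\<lambda>v. \<alpha> (a @ v # w # b))" for w
    using multilin_mid[OF m, of a "w # b"] l by simp
  have 2: "linear (\<lambda>v. \<alpha> (a @ w # v # b))" for w
    using multilin_mid[OF m, of "a @ [w]" b] l by simp
  have "0 = \<alpha> (a @ (x + y) # (x + y) # b)" by (simp add: z[OF l])
  also have "\<dots> = \<alpha> (a @ x # x # b) + \<alpha> (a @ y # x # b) + (\<alpha> (a @ x # y # b) + \<alpha> (a @ y # y # b))"
    by (simp add: linear_add[OF 1] linear_add[OF 2])
  finally show ?thesis using z[OF l, of x] z[OF l, of y] by linarith
qed

text \<open>One sign for each adjacent transposition on the way to the front.\<close>

lemma move_of_adjacent:
  assumes m: "multilin p \<alpha>" and z: "\<And>a x b. length a + Suc (Suc (length b)) = p ==> \<alpha> (a @ x # x # b) = 0"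
  shows "length a + Suc (length b) = p ==> \<alpha> (a @ x # b) = (-1) ^ length a * \<alpha> (x # a @ b)"
proof (induction a arbitrary: b rule: rev_induct)
  case (snoc y a)
  have "\<alpha> (a @ y # x # b) = - \<alpha> (a @ x # y # b)"
    by (rule swap_of_adjacent[OF m z]) (use snoc.prems in simp_all)
  then show ?case using snoc.IH[of "y # b"] snoc.prems by simp
qed simp

text \<open>Two equal entries can be brought next to each other at the cost of a sign, so only
  adjacent repetitions have to be tested. This is the criterion applied to \<open>form_ext\<close>
  and \<open>alt\<close>.\<close>

lemma alternatingI_adjacent:
  assumes m: "multilin p \<alpha>" and z: "\<And>a x b. length a + Suc (Suc (length b)) = p ==> \<alpha> (a @ x # x # b) = 0"
  shows "alternating p \<alpha>"
  unfolding alternating_def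
proof (intro conjI m allI impI)
  fix vs :: "'a list" assume vs: "length vs = p" "\<not> distinct vs"
  then obtain a b c x where v: "vs = a @ [x] @ b @ [x] @ c" using not_distinct_decomp by blast
  have "\<alpha> ((a @ x # b) @ x # c) = (-1) ^ length (a @ x # b) * \<alpha> (x # (a @ x # b) @ c)"
    by (rule move_of_adjacent[OF m z]) (use vs(1) v in simp_all)
  moreover have "\<alpha> ((x # a) @ x # b @ c) = (-1) ^ length (x # a) * \<alpha> (x # (x # a) @ b @ c)"
    by (rule move_of_adjacent[OF m z]) (use vs(1) v in simp_all)
  moreover have "\<alpha> ([] @ x # x # a @ b @ c) = 0" by (rule z) (use vs(1) v in simp)
  ultimately show "\<alpha> vs = 0" using v by simp
qed

lemma alternating_move:
  assumes "alternating p \<alpha>" "length a + Suc (length b) = p"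
  shows "\<alpha> (a @ x # b) = (-1) ^ length a * \<alpha> (x # a @ b)"
proof (rule move_of_adjacent[OF alternating_multilin[OF assms(1)] _ assms(2)])
  show "\<alpha> (a @ x # x # b) = 0" if "length a + Suc (Suc (length b)) = p" for a x b
    using that by (intro alternating_not_distinct[OF assms(1)]) auto
qed

text \<open>A reordering multiplies both forms by the same sign, which squares to one; signs of
  permutations never have to be tracked.\<close>

lemma alternating_product_permute:
  assumes "alternating p \<alpha>" "alternating p \<beta>" "mset xs = mset ys" "length xs = p"
  shows "\<alpha> xs * \<beta> xs = \<alpha> ys * (\<beta> ys :: real)"
  using assms
proof (induction xs arbitrary: p \<alpha> \<beta> ys)
  case (Cons x xs)
  obtain q where p: "p = Suc q" "length xs = q" using Cons.prems by auto
  have "x \<in> set ys" using mset_eq_setD[OF Cons.prems(3)] by auto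
  then obtain a b where ys: "ys = a @ x # b" using split_list[of x ys] by blast
  have ms: "mset xs = mset (a @ b)" using Cons.prems(3) ys by simp
  then have l: "length a + Suc (length b) = p" using mset_eq_length[OF ms] p by simp
  have sq: "(-1) ^ length a * (-1) ^ length a = (1::real)"
    by (simp flip: power_mult_distrib)
  have "\<alpha> ys * \<beta> ys = ((-1) ^ length a * (-1) ^ length a) * (\<alpha> (x # a @ b) * \<beta> (x # a @ b))"
    unfolding ys alternating_move[OF Cons.prems(1) l] alternating_move[OF Cons.prems(2) l] by simp
  also have "\<dots> = \<alpha> (x # a @ b) * \<beta> (x # a @ b)" unfolding sq by simp
  also have "\<dots> = \<alpha> (x # xs) * \<beta> (x # xs)"
    by (rule Cons.IH[OF alternating_Cons[OF Cons.prems(1)[unfolded p(1)]]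
        alternating_Cons[OF Cons.prems(2)[unfolded p(1)]] ms p(2), symmetric])
  finally show ?case by (rule sym)
qed simp

section \<open>Inner products and orthonormal families\<close>

definition metric_at :: "('e::euclidean_space list => real) => bool" where
  "metric_at h \<longleftrightarrow> multilin 2 h \<and> (\<forall>u v. h [u, v] = h [v, u]) \<and> (\<forall>u. u \<noteq> 0 \<longrightarrow> h [u, u] > 0)"

definition onb :: "('e::euclidean_space list => real) => (nat => 'e) => bool" where
  "onb h E \<longleftrightarrow> (\<forall>i<DIM('e). \<forall>j<DIM('e). h [E i, E j] = (if i = j then 1 else 0))"

lemma metric_at_sym: "metric_at h ==> h [u, v] = h [v, u]"
  by (simp add: metric_at_def)

lemma metric_at_linear1: "metric_at h ==> linear (\<lambda>u. h [u, v])"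
  using multilin_head[of 1 h "[v]"] by (simp add: metric_at_def numeral_2_eq_2)

lemma metric_at_linear2: "metric_at h ==> linear (\<lambda>v. h [u, v])"
  using metric_at_linear1[of h u] by (simp add: metric_at_sym)

lemma metric_at_eqI:
  assumes "metric_at h" "\<And>w. h [u, w] = h [v, w]" shows "u = v"
proof -
  have "h [u - v, u - v] = 0" using assms linear_diff[OF metric_at_linear1[OF assms(1)]] by simp
  then show ?thesis using assms(1) unfolding metric_at_def by (metis less_irrefl right_minus_eq)
qed

lemma onb_frame: "orthonormal_frame h es ==> onb h ((!) es)"
  by (simp add: onb_def orthonormal_frame_def)

lemma frame_onb: "onb h E ==> orthonormal_frame (h :: 'e::euclidean_space list => real) (map E [0..<DIM('e)])"
  by (simp add: onb_def orthonormal_frame_def)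

lemma onb_inj:
  assumes "onb (h :: 'e::euclidean_space list => real) E" shows "inj_on E {..<DIM('e)}"
proof (rule inj_onI)
  fix i j assume ij: "i \<in> {..<DIM('e)}" "j \<in> {..<DIM('e)}" "E i = E j"
  have "h [E i, E j] = (if i = j then 1 else 0)" "h [E i, E i] = 1"
    using assms ij(1,2) by (simp_all add: onb_def)
  then show "i = j" using ij(3) by (metis zero_neq_one)
qed

text \<open>\<open>DIM('e)\<close> orthonormal vectors are independent, hence span; pairing with
  \<open>E j\<close> then identifies the coefficients.\<close>

lemma onb_expand:
  fixes h :: "'e::euclidean_space list => real"
  assumes h: "metric_at h" and E: "onb h E"
  shows "v = (\<Sum>k<DIM('e). h [v, E k] *\<^sub>R E k)"
proof -
  let ?B = "E ` {..<DIM('e)}"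
  have hs: "h [\<Sum>k<DIM('e). c k *\<^sub>R E k, E j] = c j" if "j < DIM('e)" for c j
  proof -
    have "h [\<Sum>k<DIM('e). c k *\<^sub>R E k, E j] = (\<Sum>k<DIM('e). c k * h [E k, E j])"
      by (simp add: linear_sum[OF metric_at_linear1[OF h]] linear_cmul[OF metric_at_linear1[OF h]])
    also have "\<dots> = (\<Sum>k<DIM('e). if k = j then c k else 0)"
      using E that by (intro sum.cong) (auto simp: onb_def)
    finally show ?thesis using that by simp
  qed
  have card: "card ?B = DIM('e)" using card_image[OF onb_inj[OF E]] by simp
  have "independent ?B"
  proof (rule independent_if_scalars_zero)
    fix f x assume f: "(\<Sum>x\<in>?B. f x *\<^sub>R x) = 0" and x: "x \<in> ?B"
    then obtain j where j: "j < DIM('e)" "x = E j" by auto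
    have "(\<Sum>k<DIM('e). f (E k) *\<^sub>R E k) = 0"
      using f sum.reindex[OF onb_inj[OF E], of "\<lambda>x. f x *\<^sub>R x"] by simp
    then have "h [0, E j] = f (E j)" using hs[OF j(1), of "\<lambda>k. f (E k)"] by simp
    then show "f x = 0" using linear_0[OF metric_at_linear1[OF h]] j by simp
  qed auto
  then have "span ?B = UNIV"
    using card_eq_dim[of ?B UNIV] card by (auto simp: dim_UNIV)
  then have "v \<in> span ?B" by simp
  then obtain c where c: "v = (\<Sum>x\<in>?B. c x *\<^sub>R x)" unfolding span_finite[of ?B, simplified] by auto
  have v: "v = (\<Sum>k<DIM('e). c (E k) *\<^sub>R E k)"
    using c sum.reindex[OF onb_inj[OF E], of "\<lambda>x. c x *\<^sub>R x"] by simp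
  have "h [v, E k] = c (E k)" if "k < DIM('e)" for k using hs[OF that, of "\<lambda>k. c (E k)"] v by simp
  then show ?thesis using v by simp
qed

lemma onb_expand_linear:
  fixes h :: "'e::euclidean_space list => real"
  assumes "metric_at h" "onb h E" "linear f"
  shows "f v = (\<Sum>k<DIM('e). h [v, E k] *\<^sub>R f (E k))"
  using arg_cong[OF onb_expand[OF assms(1,2), of v], of f]
  by (simp add: linear_sum[OF assms(3)] linear_cmul[OF assms(3)])

lemma onb_expand_real:
  fixes h :: "'e::euclidean_space list => real" and f :: "'e => real"
  assumes "metric_at h" "onb h E" "linear f"
  shows "f v = (\<Sum>k<DIM('e). h [v, E k] * f (E k))"
  using onb_expand_linear[OF assms, of v] by simp

text \<open>Expanding \<open>S (E k)\<close> in the frame \<open>F\<close> and recombining over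
  \<open>E\<close> moves \<open>S\<close> to the other slot and changes the frame at once. With
  \<open>S\<close> the identity it says that a trace does not depend on the frame.\<close>

lemma onb_adjoint_sum:
  fixes h :: "'e::euclidean_space list => real" and B :: "'e => 'e => real"
  assumes h: "metric_at h" and E: "onb h E" and F: "onb h F"
    and B: "\<And>v. linear (\<lambda>u. B u v)" "\<And>u. linear (B u)" and S: "\<And>u v. h [S u, v] = h [u, S v]"
  shows "(\<Sum>k<DIM('e). B (S (E k)) (E k)) = (\<Sum>k<DIM('e). B (F k) (S (F k)))"
proof -
  have "(\<Sum>k<DIM('e). B (S (E k)) (E k)) = (\<Sum>k<DIM('e). \<Sum>l<DIM('e). h [S (E k), F l] * B (F l) (E k))"
    by (intro sum.cong refl onb_expand_real[OF h F B(1)])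
  also have "\<dots> = (\<Sum>l<DIM('e). \<Sum>k<DIM('e). h [S (F l), E k] * B (F l) (E k))"
    by (subst sum.swap) (simp add: S metric_at_sym[OF h, of "E _" "S _"])
  also have "\<dots> = (\<Sum>l<DIM('e). B (F l) (S (F l)))"
    by (intro sum.cong refl onb_expand_real[OF h E B(2), symmetric])
  finally show ?thesis .
qed

lemma onb_trace:
  fixes h :: "'e::euclidean_space list => real" and B :: "'e => 'e => real"
  assumes "metric_at h" "onb h E" "onb h F" "\<And>v. linear (\<lambda>u. B u v)" "\<And>u. linear (B u)"
  shows "(\<Sum>k<DIM('e). B (E k) (E k)) = (\<Sum>k<DIM('e). B (F k) (F k))"
  using onb_adjoint_sum[OF assms, of "\<lambda>x. x"] by simp

text \<open>In the application \<open>X\<close> is the covariant derivative of a frame. Its matrix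
  is skew, so the two sums are negatives of each other.\<close>

lemma onb_antisym_sum:
  fixes h :: "'e::euclidean_space list => real" and B :: "'e => 'e => real"
  assumes h: "metric_at h" and E: "onb h E"
    and B: "\<And>v. linear (\<lambda>u. B u v)" "\<And>u. linear (B u)"
    and X: "\<And>k l. k < DIM('e) ==> l < DIM('e) ==> h [X k, E l] + h [E k, X l] = 0"
  shows "(\<Sum>k<DIM('e). B (X k) (E k) + B (E k) (X k)) = 0"
proof -
  have "(\<Sum>k<DIM('e). B (X k) (E k)) = (\<Sum>k<DIM('e). \<Sum>l<DIM('e). h [X k, E l] * B (E l) (E k))"
    by (intro sum.cong refl onb_expand_real[OF h E B(1)])
  also have "\<dots> = (\<Sum>l<DIM('e). \<Sum>k<DIM('e). - h [X l, E k] * B (E l) (E k))"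
  proof (subst sum.swap, intro sum.cong refl)
    fix k l assume "k \<in> {..<DIM('e)}" "l \<in> {..<DIM('e)}"
    then show "h [X l, E k] * B (E k) (E l) = - h [X k, E l] * B (E k) (E l)"
      using X[of l k] metric_at_sym[OF h, of "X k" "E l"] by (simp add: add_eq_0_iff)
  qed
  also have "\<dots> = (\<Sum>l<DIM('e). - (\<Sum>k<DIM('e). h [X l, E k] * B (E l) (E k)))"
    by (simp add: sum_negf)
  also have "\<dots> = (\<Sum>l<DIM('e). - B (E l) (X l))"
    by (intro sum.cong refl arg_cong[where f=uminus] onb_expand_real[OF h E B(2), symmetric])
  also have "\<dots> = - (\<Sum>l<DIM('e). B (E l) (X l))"
    by (simp add: sum_negf)
  finally show ?thesis by (simp add: sum.distrib)
qed

subsection \<open>Gram--Schmidt\<close>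

text \<open>A single Gram-Schmidt step, kept separate since it also yields the unit normal from a
  tangential frame. The norm is inverted by \<open>powr\<close> because real powers of positive
  smooth functions are known to be smooth.\<close>

definition normalize_perp :: "('e::euclidean_space list => real) => 'e => (nat => 'e) => nat => 'e" where
  "normalize_perp h b E k =
     (let w = b - (\<Sum>l<k. h [b, E l] *\<^sub>R E l) in (h [w, w] powr (- 1 / 2)) *\<^sub>R w)"

function gram_schmidt :: "('e::euclidean_space list => real) => (nat => 'e) => nat => 'e" where
  "gram_schmidt h b k = (let w = b k - (\<Sum>l<k. h [b k, gram_schmidt h b l] *\<^sub>R gram_schmidt h b l)
     in (h [w, w] powr (- 1 / 2)) *\<^sub>R w)"
  by auto
termination by (relation "Wellfounded.measure (\<lambda>(h, b, k). k)") auto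

declare gram_schmidt.simps [simp del]

lemma gram_schmidt_perp: "gram_schmidt h b k = normalize_perp h (b k) (gram_schmidt h b) k"
  by (subst gram_schmidt.simps) (simp add: normalize_perp_def)

lemma normalize_perp:
  assumes h: "metric_at h" and E: "\<And>i j. i < k ==> j < k ==> h [E i, E j] = (if i = j then 1 else 0)"
    and b: "b \<notin> span (E ` {..<k})"
  shows "h [normalize_perp h b E k, normalize_perp h b E k] = 1"
    and "j < k ==> h [normalize_perp h b E k, E j] = 0"
    and "\<exists>c>0. \<exists>u\<in>span (E ` {..<k}). normalize_perp h b E k = c *\<^sub>R (b - u)"
proof -
  define u where "u = (\<Sum>l<k. h [b, E l] *\<^sub>R E l)"
  define w where "w = b - u"
  define c where "c = h [w, w] powr (- 1 / 2)"
  have u: "u \<in> span (E ` {..<k})" unfolding u_def by (intro span_sum span_scale span_base) auto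
  have "w \<noteq> 0" using b u by (auto simp: w_def)
  then have pos: "h [w, w] > 0" using h by (simp add: metric_at_def)
  have np: "normalize_perp h b E k = c *\<^sub>R w" by (simp add: normalize_perp_def c_def w_def u_def Let_def)
  have l1: "h [c *\<^sub>R x, y] = c * h [x, y]" "h [x, c *\<^sub>R y] = c * h [x, y]" for x y c
    using linear_cmul[OF metric_at_linear1[OF h]] linear_cmul[OF metric_at_linear2[OF h]] by auto
  have "c * c * h [w, w] = h [w, w] powr (- 1 / 2 + - 1 / 2) * h [w, w]"
    unfolding c_def powr_add ..
  also have "\<dots> = 1" using pos by (simp add: powr_minus)
  finally show "h [normalize_perp h b E k, normalize_perp h b E k] = 1"
    unfolding np l1 by simp
  show "h [normalize_perp h b E k, E j] = 0" if j: "j < k"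
  proof -
    have "h [u, E j] = (\<Sum>l<k. h [b, E l] * h [E l, E j])"
      by (simp add: u_def linear_sum[OF metric_at_linear1[OF h]] linear_cmul[OF metric_at_linear1[OF h]])
    also have "\<dots> = (\<Sum>l<k. if l = j then h [b, E l] else 0)" using E j by (intro sum.cong) auto
    finally have "h [w, E j] = 0" using j linear_diff[OF metric_at_linear1[OF h]] by (simp add: w_def)
    then show ?thesis unfolding np l1 by simp
  qed
  show "\<exists>c>0. \<exists>u\<in>span (E ` {..<k}). normalize_perp h b E k = c *\<^sub>R (b - u)"
    using np u pos unfolding w_def by (intro exI[of _ c] conjI bexI[of _ u]) (auto simp: c_def w_def)
qed

definition basis_enum :: "nat => 'e::euclidean_space" where
  "basis_enum = (SOME f. bij_betw f {..<DIM('e)} Basis)"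

lemma basis_enum: "bij_betw (basis_enum :: nat => 'e::euclidean_space) {..<DIM('e)} Basis"
proof -
  have "\<exists>f. bij_betw f {..<DIM('e)} (Basis :: 'e set)"
    using ex_bij_betw_nat_finite[OF finite_Basis] by (simp add: lessThan_atLeast0)
  then show ?thesis unfolding basis_enum_def by (rule someI_ex)
qed

text \<open>Unlike \<open>frame\<close>, which is an arbitrary choice for each inner product, this
  frame is an explicit expression in \<open>h\<close> and hence varies smoothly with the
  point.\<close>

definition gs_frame :: "('e::euclidean_space list => real) => nat => 'e" where
  "gs_frame h = gram_schmidt h basis_enum"

text \<open>Equality of spans is carried through the induction because it keeps the next basis
  vector outside the span of the frame vectors already built, so that it can be normalised.\<close>

lemma gs_frame_span_aux:
  assumes h: "metric_at (h :: 'e::euclidean_space list => real)"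
  shows "k \<le> DIM('e) ==> span (gs_frame h ` {..<k}) = span (basis_enum ` {..<k}) \<and>
    (\<forall>i<k. \<forall>j<k. h [gs_frame h i, gs_frame h j] = (if i = j then 1 else 0))"
proof (induction k)
  case (Suc k)
  have IH: "span (gs_frame h ` {..<k}) = span (basis_enum ` {..<k})"
    "\<And>i j. i < k ==> j < k ==> h [gs_frame h i, gs_frame h j] = (if i = j then 1 else 0)"
    using Suc by auto
  let ?b = "basis_enum :: nat => 'e"
  have inj: "inj_on ?b {..<DIM('e)}" and img: "?b ` {..<DIM('e)} = Basis"
    using basis_enum by (auto simp: bij_betw_def)
  have kD: "k < DIM('e)" using Suc.prems by simp
  have "?b k \<notin> ?b ` {..<k}" using inj_onD[OF inj, of k] kD by force
  moreover have "?b ` {..<k} \<subseteq> ?b ` {..<DIM('e)}" using kD by (intro image_mono) auto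
  ultimately have "?b ` {..<k} \<subseteq> Basis - {?b k}" using img by blast
  then have "span (?b ` {..<k}) \<subseteq> span (Basis - {?b k})" by (rule span_mono)
  moreover have "?b k \<notin> span (Basis - {?b k})"
    using independent_Basis img kD unfolding dependent_def by blast
  ultimately have nb: "?b k \<notin> span (gs_frame h ` {..<k})" using IH by auto
  have eq: "gs_frame h k = normalize_perp h (?b k) (gs_frame h) k"
    unfolding gs_frame_def by (rule gram_schmidt_perp)
  note np = normalize_perp[OF h IH(2) nb, simplified eq[symmetric]]
  obtain c u where cu: "c > 0" "u \<in> span (gs_frame h ` {..<k})" "gs_frame h k = c *\<^sub>R (?b k - u)"
    using np(3) by blast
  let ?G = "gs_frame h ` {..<k}" and ?B = "?b ` {..<k}"
  have ins: "gs_frame h ` {..<Suc k} = insert (gs_frame h k) ?G" "?b ` {..<Suc k} = insert (?b k) ?B"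
    by (auto simp: lessThan_Suc)
  have uB: "u \<in> span (insert (?b k) ?B)" using cu(2) IH(1) span_mono[of ?B "insert (?b k) ?B"] by blast
  have 1: "gs_frame h k \<in> span (insert (?b k) ?B)"
    unfolding cu(3) by (intro span_scale span_diff uB span_base) auto
  have "?b k = inverse c *\<^sub>R gs_frame h k + u" unfolding cu(3) using cu(1) by simp
  moreover have "u \<in> span (insert (gs_frame h k) ?G)" using cu(2) span_mono[of ?G "insert (gs_frame h k) ?G"] by blast
  then have "inverse c *\<^sub>R gs_frame h k + u \<in> span (insert (gs_frame h k) ?G)"
    by (rule span_add[OF span_scale[OF span_base], rotated]) simp
  ultimately have 2: "?b k \<in> span (insert (gs_frame h k) ?G)" by simp
  have "?G \<subseteq> span (insert (?b k) ?B)" "?B \<subseteq> span (insert (gs_frame h k) ?G)"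
    using IH(1) span_superset[of ?G] span_superset[of ?B] span_mono[of ?B "insert (?b k) ?B"]
      span_mono[of ?G "insert (gs_frame h k) ?G"] by blast+
  then have "span (insert (gs_frame h k) ?G) = span (insert (?b k) ?B)"
    using 1 2 by (intro subset_antisym span_minimal subspace_span) auto
  moreover have "h [gs_frame h i, gs_frame h j] = (if i = j then 1 else 0)" if "i < Suc k" "j < Suc k" for i j
  proof -
    consider "i < k" "j < k" | "i = k" "j < k" | "i < k" "j = k" | "i = k" "j = k" using \<open>i < Suc k\<close> \<open>j < Suc k\<close> by linarith
    then show ?thesis
      using IH(2) np(1) np(2) metric_at_sym[OF h] by cases auto
  qed
  ultimately show ?case unfolding ins by blast
qed simp

lemma onb_gs_frame: "metric_at h ==> onb h (gs_frame h)"
  using gs_frame_span_aux[of h "DIM('a)"] by (simp add: onb_def)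

lemma frame_orthonormal: "metric_at h ==> orthonormal_frame h (frame h)"
  unfolding frame_def using frame_onb[OF onb_gs_frame] by (rule someI)

section \<open>Contractions over frames\<close>

text \<open>All ordered index tuples are summed over, so that the recursion peels off the first slot
  and multilinear algebra goes by induction on the rank. The relation to increasing tuples is the
  factor \<open>fact p\<close> in \<open>form_inner_contract\<close>.\<close>

primrec tsum :: "(nat => 'e::euclidean_space) => nat => ('e list => real) => real" where
  "tsum E 0 f = f []"
| "tsum E (Suc p) f = (\<Sum>k<DIM('e). tsum E p (\<lambda>vs. f (E k # vs)))"

abbreviation contract :: "(nat => 'e::euclidean_space) => nat => ('e list => real) => ('e list => real) => real" where
  "contract E p \<alpha> \<beta> \<equiv> tsum E p (\<lambda>vs. \<alpha> vs * \<beta> vs)"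

lemma tsum_add: "tsum E p (\<lambda>vs. f vs + g vs) = tsum E p f + tsum E p g"
  by (induction p arbitrary: f g) (simp_all add: sum.distrib)

lemma tsum_cmul: "tsum E p (\<lambda>vs. c * f vs) = c * tsum E p f"
  by (induction p arbitrary: f) (simp_all add: sum_distrib_left)

lemma tsum_0: "tsum E p (\<lambda>vs. 0) = 0"
  using tsum_cmul[of E p 0 "\<lambda>_. 0"] by simp

lemma tsum_sum: "tsum E p (\<lambda>vs. \<Sum>i\<in>I. f i vs) = (\<Sum>i\<in>I. tsum E p (f i))"
  by (induction I rule: infinite_finite_induct) (simp_all add: tsum_0 tsum_add)

lemma tsum_cong: "(\<And>vs. length vs = p ==> f vs = g vs) ==> tsum E p f = tsum E p g"
proof (induction p arbitrary: f g)
  case (Suc p)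
  show ?case unfolding tsum.simps
    by (intro sum.cong refl Suc.IH Suc.prems) simp
qed simp

lemma linear_tsum:
  assumes "\<And>vs. length vs = p ==> linear (\<lambda>x. f x vs)"
  shows "linear (\<lambda>x. tsum E p (f x))"
  using assms
proof (induction p arbitrary: f)
  case (Suc p)
  have "linear (\<lambda>x. tsum E p (\<lambda>vs. f x (E k # vs)))" for k
    by (rule Suc.IH) (simp add: Suc.prems)
  then show ?case unfolding tsum.simps by (intro linear_compose_sum) auto
qed simp

lemma contract_linear1:
  "multilin (Suc p) \<alpha> ==> linear (\<lambda>u. contract E p (\<lambda>vs. \<alpha> (u # vs)) \<beta>)"
  using linear_cmul_fun[OF multilin_head, of p \<alpha>] by (intro linear_tsum) (simp add: mult.commute)

lemma contract_linear2:
  "multilin (Suc p) \<beta> ==> linear (\<lambda>u. contract E p \<alpha> (\<lambda>vs. \<beta> (u # vs)))"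
  using linear_cmul_fun[OF multilin_head, of p \<beta>] by (intro linear_tsum) simp

text \<open>The frame is exchanged slot by slot: in the later slots by the induction hypothesis, in
  the first one by \<open>onb_trace\<close>.\<close>

lemma contract_frame:
  fixes h :: "'e::euclidean_space list => real"
  assumes h: "metric_at h" "onb h E" "onb h F"
  shows "multilin p \<alpha> ==> multilin p \<beta> ==> contract E p \<alpha> \<beta> = contract F p \<alpha> \<beta>"
proof (induction p arbitrary: \<alpha> \<beta>)
  case (Suc p)
  have "contract E (Suc p) \<alpha> \<beta> = (\<Sum>k<DIM('e). contract F p (\<lambda>vs. \<alpha> (E k # vs)) (\<lambda>vs. \<beta> (E k # vs)))"
    unfolding tsum.simps by (intro sum.cong refl Suc.IH multilin_Cons Suc.prems)
  also have "\<dots> = (\<Sum>k<DIM('e). contract F p (\<lambda>vs. \<alpha> (F k # vs)) (\<lambda>vs. \<beta> (F k # vs)))"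
    by (intro onb_trace[OF h] contract_linear1 contract_linear2 Suc.prems)
  finally show ?case by simp
qed simp

lemma multilin_eq_on_frame:
  fixes h :: "'e::euclidean_space list => real"
  assumes h: "metric_at h" "onb h E"
  shows "multilin p \<alpha> ==> multilin p \<beta> ==>
    (\<And>vs. length vs = p ==> set vs \<subseteq> E ` {..<DIM('e)} ==> \<alpha> vs = \<beta> vs) ==> length vs = p ==> \<alpha> vs = \<beta> vs"
proof (induction p arbitrary: \<alpha> \<beta> vs)
  case (Suc p)
  obtain w ws where vs: "vs = w # ws" "length ws = p" using Suc.prems(4) by (cases vs) auto
  have eq: "\<alpha> (E k # ws) = \<beta> (E k # ws)" if k: "k < DIM('e)" for k
    by (rule Suc.IH[OF multilin_Cons[OF Suc.prems(1)] multilin_Cons[OF Suc.prems(2)] Suc.prems(3) vs(2)])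
      (use k in auto)
  have "\<alpha> (w # ws) = (\<Sum>k<DIM('e). h [w, E k] * \<alpha> (E k # ws))"
    by (rule onb_expand_real[OF h multilin_head[OF Suc.prems(1) vs(2)]])
  also have "\<dots> = (\<Sum>k<DIM('e). h [w, E k] * \<beta> (E k # ws))" using eq by simp
  also have "\<dots> = \<beta> (w # ws)"
    by (rule onb_expand_real[OF h multilin_head[OF Suc.prems(2) vs(2)], symmetric])
  finally show ?case using vs by simp
qed simp

lemma tsum_lists:
  fixes E :: "nat => 'e::euclidean_space"
  assumes inj: "inj_on E {..<DIM('e)}"
  shows "tsum E p f = sum f {vs. set vs \<subseteq> E ` {..<DIM('e)} \<and> length vs = p}"
proof (induction p arbitrary: f)
  case 0
  have "{vs. set vs \<subseteq> E ` {..<DIM('e)} \<and> length vs = 0} = {[]}" by auto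
  then show ?case by simp
next
  case (Suc p)
  let ?A = "E ` {..<DIM('e)}" and ?L = "\<lambda>p. {vs. set vs \<subseteq> E ` {..<DIM('e)} \<and> length vs = p}"
  have "tsum E (Suc p) f = (\<Sum>k<DIM('e). \<Sum>vs\<in>?L p. f (E k # vs))"
    by (simp add: Suc.IH)
  also have "\<dots> = (\<Sum>e\<in>?A. \<Sum>vs\<in>?L p. f (e # vs))"
    using sum.reindex[OF inj, of "\<lambda>e. \<Sum>vs\<in>?L p. f (e # vs)"] by simp
  also have "\<dots> = (\<Sum>(e, vs)\<in>?A \<times> ?L p. f (e # vs))"
    by (rule sum.cartesian_product)
  also have "\<dots> = sum f ((\<lambda>(e, vs). e # vs) ` (?A \<times> ?L p))"
    by (subst sum.reindex) (auto simp: inj_on_def split_def)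
  also have "(\<lambda>(e, vs). e # vs) ` (?A \<times> ?L p) = ?L (Suc p)"
  proof (intro equalityI subsetI)
    fix vs assume "vs \<in> ?L (Suc p)"
    then obtain w ws where "vs = w # ws" "w \<in> ?A" "ws \<in> ?L p" by (cases vs) auto
    then show "vs \<in> (\<lambda>(e, vs). e # vs) ` (?A \<times> ?L p)" by force
  qed auto
  finally show ?case .
qed

lemma nths_frame:
  assumes "distinct es" "I \<subseteq> {..<length es}"
  shows "distinct (nths es I)" "set (nths es I) = (!) es ` I" "length (nths es I) = card I"
proof -
  show 1: "distinct (nths es I)" by (rule distinct_nthsI[OF assms(1)])
  show 2: "set (nths es I) = (!) es ` I" using assms(2) by (auto simp: set_nths)
  have "inj_on ((!) es) I"
    using assms(2) by (intro inj_on_nth[OF assms(1)]) auto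
  then show "length (nths es I) = card I"
    using distinct_card[OF 1] unfolding 2 by (simp add: card_image)
qed

lemma orthonormal_frame_distinct:
  assumes "orthonormal_frame (h :: 'e::euclidean_space list => real) es"
  shows "distinct es" "length es = DIM('e)"
proof -
  show l: "length es = DIM('e)" using assms by (simp add: orthonormal_frame_def)
  have "inj_on ((!) es) {..<length es}" using onb_inj[OF onb_frame[OF assms]] l by simp
  then show "distinct es" by (auto simp: distinct_conv_nth inj_on_def)
qed

text \<open>Lists with a repetition contribute nothing. The others are grouped by their set of
  entries: each set has \<open>fact p\<close> orderings, on all of which the product of the two
  forms is the same.\<close>

lemma contract_subsets:
  fixes h :: "'e::euclidean_space list => real"
  assumes es: "orthonormal_frame h es" and ab: "alternating p \<alpha>" "alternating p \<beta>"
  shows "contract ((!) es) p \<alpha> \<beta> =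
    fact p * (\<Sum>I | I \<subseteq> {..<DIM('e)} \<and> card I = p. \<alpha> (nths es I) * \<beta> (nths es I))"
proof -
  note dl = orthonormal_frame_distinct[OF es]
  let ?A = "(!) es ` {..<DIM('e)}"
  let ?K = "{K. K \<subseteq> ?A \<and> card K = p}"
  let ?I = "{I. I \<subseteq> {..<DIM('e)} \<and> card I = p}"
  let ?L = "{vs. set vs \<subseteq> ?A \<and> length vs = p}"
  define f where "f vs = \<alpha> vs * \<beta> vs" for vs
  have inj: "inj_on ((!) es) {..<DIM('e)}" by (rule onb_inj[OF onb_frame[OF es]])
  have finA: "finite ?A" by simp
  have finL: "finite ?L" by (rule finite_lists_length_eq) simp
  have "contract ((!) es) p \<alpha> \<beta> = sum f ?L"
    unfolding f_def by (rule tsum_lists[OF inj])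
  also have "\<dots> = sum f {vs \<in> ?L. distinct vs}"
    using finL by (intro sum.mono_neutral_right)
      (auto simp: f_def alternating_not_distinct[OF ab(1)])
  also have "{vs \<in> ?L. distinct vs} = (\<Union>K\<in>?K. permutations_of_set K)"
    by (auto simp: permutations_of_set_def distinct_card)
  also have "sum f \<dots> = (\<Sum>K\<in>?K. sum f (permutations_of_set K))"
  proof (rule sum.UNION_disjoint)
    show "finite ?K" using finite_Pow_iff[of ?A] finA by (rule_tac finite_subset[of _ "Pow ?A"]) auto
    show "\<forall>K\<in>?K. finite (permutations_of_set K)" by simp
    show "\<forall>K\<in>?K. \<forall>K'\<in>?K. K \<noteq> K' \<longrightarrow> permutations_of_set K \<inter> permutations_of_set K' = {}"
      by (auto simp: permutations_of_set_def)
  qed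
  also have "?K = (\<lambda>I. (!) es ` I) ` ?I"
  proof (intro equalityI subsetI)
    fix K assume K: "K \<in> ?K"
    then obtain I where I: "I \<subseteq> {..<DIM('e)}" "K = (!) es ` I" by (auto simp: subset_image_iff)
    then have "card I = p" using K card_image[OF inj_on_subset[OF inj I(1)]] by simp
    then show "K \<in> (\<lambda>I. (!) es ` I) ` ?I" using I by blast
  next
    fix K assume "K \<in> (\<lambda>I. (!) es ` I) ` ?I"
    then obtain I where I: "I \<subseteq> {..<DIM('e)}" "K = (!) es ` I" "card I = p" by auto
    then show "K \<in> ?K" using card_image[OF inj_on_subset[OF inj I(1)]] by auto
  qed
  also have "(\<Sum>K\<in>(\<lambda>I. (!) es ` I) ` ?I. sum f (permutations_of_set K)) =
     (\<Sum>I\<in>?I. sum f (permutations_of_set ((!) es ` I)))"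
  proof (subst sum.reindex)
    show "inj_on ((`) ((!) es)) ?I"
      using inj_on_image_Pow[OF inj] by (rule inj_on_subset) auto
  qed simp
  also have "\<dots> = (\<Sum>I\<in>?I. fact p * f (nths es I))"
  proof (rule sum.cong[OF refl])
    fix I assume I: "I \<in> ?I"
    have sub: "I \<subseteq> {..<length es}" using I dl by simp
    note nf = nths_frame[OF dl(1) sub]
    have c: "card ((!) es ` I) = p" using nf distinct_card[OF nf(1)] I by simp
    have fin: "finite ((!) es ` I)" using nf(2) by (metis List.finite_set)
    have "f vs = f (nths es I)" if "vs \<in> permutations_of_set ((!) es ` I)" for vs
    proof -
      have vs: "set vs = (!) es ` I" "distinct vs" using that by (auto simp: permutations_of_set_def)
      then have "mset vs = mset (nths es I)" using nf by (simp add: set_eq_iff_mset_eq_distinct[symmetric])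
      moreover have "length vs = p" using vs c distinct_card by metis
      ultimately show ?thesis unfolding f_def using alternating_product_permute[OF ab] by blast
    qed
    then have "sum f (permutations_of_set ((!) es ` I)) = (\<Sum>vs\<in>permutations_of_set ((!) es ` I). f (nths es I))"
      by (intro sum.cong) auto
    also have "\<dots> = fact p * f (nths es I)" using card_permutations_of_set[OF fin] c by simp
    finally show "sum f (permutations_of_set ((!) es ` I)) = fact p * f (nths es I)" .
  qed
  finally show ?thesis by (simp add: f_def sum_distrib_left)
qed

text \<open>Replaces the arbitrary choice \<open>frame h\<close> by any orthonormal frame, in
  particular by a smooth one or one adapted to the boundary.\<close>

lemma form_inner_contract:
  assumes h: "metric_at h" "onb h E" and ab: "alternating p \<alpha>" "alternating p \<beta>"
  shows "form_inner h p \<alpha> \<beta> = contract E p \<alpha> \<beta> / fact p"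
proof -
  note fo = frame_orthonormal[OF h(1)]
  have "contract E p \<alpha> \<beta> = contract ((!) (frame h)) p \<alpha> \<beta>"
    by (intro contract_frame[OF h onb_frame[OF fo]] alternating_multilin ab)
  then show ?thesis unfolding form_inner_def contract_subsets[OF fo ab] by simp
qed

lemma form1_inner_contract:
  fixes h :: "'e::euclidean_space list => real"
  assumes h: "metric_at h" "onb h E" and m: "multilin (Suc p) \<alpha>" "multilin (Suc p) \<beta>"
    and ab: "\<And>v. alternating p (\<lambda>vs. \<alpha> (v # vs))" "\<And>v. alternating p (\<lambda>vs. \<beta> (v # vs))"
  shows "form1_inner h p \<alpha> \<beta> = contract E (Suc p) \<alpha> \<beta> / fact p"
proof -
  note fo = frame_orthonormal[OF h(1)]
  have "form1_inner h p \<alpha> \<beta> =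
    (\<Sum>k<DIM('e). form_inner h p (\<lambda>vs. \<alpha> (frame h ! k # vs)) (\<lambda>vs. \<beta> (frame h ! k # vs)))"
    using orthonormal_frame_distinct(2)[OF fo]
    by (simp add: form1_inner_def sum_list_sum_nth lessThan_atLeast0)
  also have "\<dots> = contract ((!) (frame h)) (Suc p) \<alpha> \<beta> / fact p"
    by (simp add: form_inner_contract[OF h(1) onb_frame[OF fo] ab] sum_divide_distrib)
  also have "\<dots> = contract E (Suc p) \<alpha> \<beta> / fact p"
    using contract_frame[OF h(1) onb_frame[OF fo] h(2) m] by simp
  finally show ?thesis .
qed

lemma form_inner_cong:
  assumes "metric_at h" "\<And>vs. length vs = p ==> \<alpha> vs = \<alpha>' vs" "\<And>vs. length vs = p ==> \<beta> vs = \<beta>' vs"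
  shows "form_inner h p \<alpha> \<beta> = form_inner h p \<alpha>' \<beta>'"
  unfolding form_inner_def
proof (rule sum.cong[OF refl])
  fix I assume I: "I \<in> {I. I \<subseteq> {..<DIM('a)} \<and> card I = p}"
  note dl = orthonormal_frame_distinct[OF frame_orthonormal[OF assms(1)]]
  have "length (nths (frame h) I) = p" using nths_frame(3)[of "frame h" I] dl I by simp
  then show "\<alpha> (nths (frame h) I) * \<beta> (nths (frame h) I) = \<alpha>' (nths (frame h) I) * \<beta>' (nths (frame h) I)"
    using assms by simp
qed

lemma form_inner_sym: "form_inner h p \<alpha> \<beta> = form_inner h p \<beta> \<alpha>"
  by (simp add: form_inner_def mult.commute)

lemma form_inner_add: "form_inner h p (\<lambda>vs. \<alpha> vs + \<beta> vs) \<gamma> = form_inner h p \<alpha> \<gamma> + form_inner h p \<beta> \<gamma>"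
  by (simp add: form_inner_def distrib_right sum.distrib)

lemma form_inner_diff: "form_inner h p (\<lambda>vs. \<alpha> vs - \<beta> vs) \<gamma> = form_inner h p \<alpha> \<gamma> - form_inner h p \<beta> \<gamma>"
  by (simp add: form_inner_def left_diff_distrib sum_subtractf)

lemma form_inner_cmul: "form_inner h p (\<lambda>vs. c * \<alpha> vs) \<gamma> = c * form_inner h p \<alpha> \<gamma>"
  by (simp add: form_inner_def sum_distrib_left mult.assoc)

lemma form_inner_self_nonneg: "form_inner h p \<alpha> \<alpha> \<ge> 0"
  by (auto simp: form_inner_def intro: sum_nonneg)

lemma contract_self_zero:
  fixes h :: "'e::euclidean_space list => real"
  assumes h: "metric_at h" "onb h E"
  shows "multilin p \<alpha> ==> contract E p \<alpha> \<alpha> = 0 ==> length vs = p ==> \<alpha> vs = 0"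
proof (rule multilin_eq_on_frame[OF h, where p = p and \<beta> = "\<lambda>_. 0"])
  fix ws assume c: "contract E p \<alpha> \<alpha> = 0" and ws: "length ws = p" "set ws \<subseteq> E ` {..<DIM('e)}"
  have "(\<Sum>vs\<in>{vs. set vs \<subseteq> E ` {..<DIM('e)} \<and> length vs = p}. \<alpha> vs * \<alpha> vs) = 0"
    using c tsum_lists[OF onb_inj[OF h(2)], of p "\<lambda>vs. \<alpha> vs * \<alpha> vs"] by simp
  moreover have "finite {vs. set vs \<subseteq> E ` {..<DIM('e)} \<and> length vs = p}"
    by (rule finite_lists_length_eq) simp
  ultimately have "\<forall>vs\<in>{vs. set vs \<subseteq> E ` {..<DIM('e)} \<and> length vs = p}. \<alpha> vs * \<alpha> vs = 0"
    by (subst (asm) sum_nonneg_eq_0_iff) auto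
  then show "\<alpha> ws = 0" using ws by auto
qed (auto simp: multilin_def linear_zero)

lemma form_inner_self_zero:
  assumes "metric_at h" "alternating p \<alpha>" "form_inner h p \<alpha> \<alpha> = 0" "length vs = p"
  shows "\<alpha> vs = 0"
  using contract_self_zero[OF assms(1) onb_gs_frame[OF assms(1)] alternating_multilin[OF assms(2)] _ assms(4)]
    form_inner_contract[OF assms(1) onb_gs_frame[OF assms(1)] assms(2,2)] assms(3) by simp

text \<open>For any inner product on the space, the squared norm of the form is a sum over an empty
  family of index sets; definiteness gives zero.\<close>

lemma alternating_above_dim:
  assumes "alternating p (\<alpha> :: 'e::euclidean_space list => real)" "p > DIM('e)" "length vs = p"
  shows "\<alpha> vs = 0"
proof -
  define h :: "'e list => real" where "h vs = vs ! 0 \<bullet> vs ! 1" for vs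
  have "multilin 2 h"
    unfolding numeral_2_eq_2
  proof (intro multilin_SucI multilin_0)
    fix v :: 'e and vs :: "'e list"
    show "linear (\<lambda>va. h (v # va # vs))" by (simp add: h_def bounded_linear.linear[OF bounded_linear_inner_right])
    assume "length vs = Suc 0"
    then show "linear (\<lambda>v. h (v # vs))" by (simp add: h_def bounded_linear.linear[OF bounded_linear_inner_left])
  qed
  moreover have "h [u, v] = h [v, u]" for u v by (simp add: h_def inner_commute[of u])
  moreover have "h [u, u] > 0" if "u \<noteq> 0" for u using that by (simp add: h_def)
  ultimately have h: "metric_at h" unfolding metric_at_def by blast
  note fo = frame_orthonormal[OF h]
  have "card I \<noteq> p" if "I \<subseteq> {..<DIM('e)}" for I
    using assms(2) card_mono[OF _ that] by simp
  then have "{I. I \<subseteq> {..<DIM('e)} \<and> card I = p} = {}" by blast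
  then have "form_inner h p \<alpha> \<alpha> = 0" unfolding form_inner_def by (simp only: sum.empty)
  then show ?thesis using form_inner_self_zero[OF h assms(1) _ assms(3)] by simp
qed

section \<open>Derivation extension of an endomorphism and the Hodge star\<close>

lemma form_ext_Nil: "form_ext S \<phi> [] = 0"
  by (simp add: form_ext_def)

lemma form_ext_Cons: "form_ext S \<phi> (v # vs) = \<phi> (S v # vs) + form_ext S (\<lambda>ws. \<phi> (v # ws)) vs"
proof -
  have "form_ext S \<phi> (v # vs) = (\<Sum>j<Suc (length vs). \<phi> ((v # vs)[j := S ((v # vs) ! j)]))"
    by (simp only: form_ext_def length_Cons)
  also have "\<dots> = \<phi> (S v # vs) + (\<Sum>j<length vs. \<phi> (v # vs[j := S (vs ! j)]))"
    unfolding sum.lessThan_Suc_shift by simp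
  finally show ?thesis by (simp only: form_ext_def)
qed

lemma form_ext_append:
  "form_ext S \<phi> (us @ vs) = form_ext S (\<lambda>ws. \<phi> (ws @ vs)) us + form_ext S (\<lambda>ws. \<phi> (us @ ws)) vs"
  by (induction us arbitrary: \<phi>) (simp_all add: form_ext_Nil form_ext_Cons)

lemma form_ext_cong: "(\<And>ws. length ws = length vs ==> \<phi> ws = \<psi> ws) ==> form_ext S \<phi> vs = form_ext S \<psi> vs"
  by (simp add: form_ext_def)

lemma form_ext_sum: "form_ext S (\<lambda>ws. \<Sum>i\<in>I. c i * \<phi> i ws) vs = (\<Sum>i\<in>I. c i * form_ext S (\<phi> i) vs)"
  unfolding form_ext_def sum_distrib_left by (rule sum.swap)

lemma multilin_form_ext: "linear S ==> multilin p \<phi> ==> multilin p (form_ext S \<phi>)"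
proof (induction p arbitrary: \<phi>)
  case (Suc p)
  have l: "linear (\<lambda>v. \<phi> (v # vs))" if "length vs = p" for vs by (rule multilin_head[OF Suc.prems(2) that])
  show ?case
  proof (rule multilin_SucI)
    fix v
    have "multilin p (\<lambda>vs. \<phi> (S v # vs) + form_ext S (\<lambda>ws. \<phi> (v # ws)) vs)"
      by (intro multilin_add multilin_Cons[OF Suc.prems(2)] Suc.IH[OF Suc.prems(1)])
    then show "multilin p (\<lambda>vs. form_ext S \<phi> (v # vs))" by (simp add: form_ext_Cons)
  next
    fix vs :: "'a list" assume vs: "length vs = p"
    have "linear (\<lambda>v. \<phi> (S v # vs) + (\<Sum>j<length vs. \<phi> (v # vs[j := S (vs ! j)])))"
      using vs linear_compose[OF Suc.prems(1) l[OF vs]]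
      by (intro linear_compose_add linear_compose_sum) (auto simp: o_def intro: l)
    then show "linear (\<lambda>v. form_ext S \<phi> (v # vs))" unfolding form_ext_Cons unfolding form_ext_def .
  qed
qed (rule multilin_0)

lemma form_ext_zero:
  assumes "\<And>ws. length ws = length vs ==> \<phi> ws = 0" shows "form_ext S \<phi> vs = 0"
  using assms by (simp add: form_ext_def)

text \<open>On a list with two equal neighbours the terms changing another slot keep the pair, and
  the two terms changing the pair cancel by antisymmetry.\<close>

lemma alternating_form_ext:
  assumes S: "linear S" and \<phi>: "alternating p \<phi>" shows "alternating p (form_ext S \<phi>)"
proof (rule alternatingI_adjacent[OF multilin_form_ext[OF S alternating_multilin[OF \<phi>]]])
  fix a b :: "'a list" and x assume l: "length a + Suc (Suc (length b)) = p"
  have z: "\<phi> (c @ y # y # d) = 0" if "length c = length a" "length d = length b" for c d y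
    using l that by (intro alternating_not_distinct[OF \<phi>]) auto
  have "form_ext S (\<lambda>ws. \<phi> (ws @ x # x # b)) a = 0" "form_ext S (\<lambda>ws. \<phi> (a @ x # x # ws)) b = 0"
    by (intro form_ext_zero z; simp)+
  moreover have "\<phi> (a @ S x # x # b) + \<phi> (a @ x # S x # b) = 0"
  proof -
    have "\<phi> (a @ S x # x # b) = - \<phi> (a @ x # S x # b)"
    proof (rule swap_of_adjacent[OF alternating_multilin[OF \<phi>] _ l])
      show "\<phi> (c @ y # y # d) = 0" if "length c + Suc (Suc (length d)) = p" for c y d
        using that by (intro alternating_not_distinct[OF \<phi>]) auto
    qed
    then show ?thesis by simp
  qed
  ultimately show "form_ext S \<phi> (a @ x # x # b) = 0"
    by (simp add: form_ext_append form_ext_Cons)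
qed

lemma contract_form_ext_adjoint:
  fixes h :: "'e::euclidean_space list => real"
  assumes h: "metric_at h" "onb h E" and S: "linear S" "\<And>u v. h [S u, v] = h [u, S v]"
  shows "multilin p \<alpha> ==> multilin p \<beta> ==> contract E p (form_ext S \<alpha>) \<beta> = contract E p \<alpha> (form_ext S \<beta>)"
proof (induction p arbitrary: \<alpha> \<beta>)
  case (Suc p)
  let ?B = "\<lambda>u v. contract E p (\<lambda>vs. \<alpha> (u # vs)) (\<lambda>vs. \<beta> (v # vs))"
  have "contract E (Suc p) (form_ext S \<alpha>) \<beta> = (\<Sum>k<DIM('e). ?B (S (E k)) (E k)) +
     (\<Sum>k<DIM('e). contract E p (form_ext S (\<lambda>vs. \<alpha> (E k # vs))) (\<lambda>vs. \<beta> (E k # vs)))"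
    by (simp add: form_ext_Cons distrib_right tsum_add sum.distrib)
  also have "(\<Sum>k<DIM('e). ?B (S (E k)) (E k)) = (\<Sum>k<DIM('e). ?B (E k) (S (E k)))"
    by (intro onb_adjoint_sum[OF h h(2) _ _ S(2)] contract_linear1 contract_linear2 Suc.prems)
  also have "(\<Sum>k<DIM('e). contract E p (form_ext S (\<lambda>vs. \<alpha> (E k # vs))) (\<lambda>vs. \<beta> (E k # vs))) =
     (\<Sum>k<DIM('e). contract E p (\<lambda>vs. \<alpha> (E k # vs)) (form_ext S (\<lambda>vs. \<beta> (E k # vs))))"
    by (intro sum.cong refl Suc.IH multilin_Cons Suc.prems)
  finally show ?case by (simp add: form_ext_Cons distrib_left tsum_add sum.distrib)
qed (simp add: form_ext_Nil)

lemma form_inner_form_ext_adjoint: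
  assumes h: "metric_at h" and S: "linear S" "\<And>u v. h [S u, v] = h [u, S v]"
    and ab: "alternating p \<alpha>" "alternating p \<beta>"
  shows "form_inner h p (form_ext S \<alpha>) \<beta> = form_inner h p \<alpha> (form_ext S \<beta>)"
  using contract_form_ext_adjoint[OF h onb_gs_frame[OF h] S ab[THEN alternating_multilin]]
  by (simp add: form_inner_contract[OF h onb_gs_frame[OF h]] ab alternating_form_ext[OF S(1)])

definition trace_wrt :: "('e::euclidean_space list => real) => ('e => 'e) => real" where
  "trace_wrt h S = (\<Sum>k<DIM('e). h [S (gs_frame h k), gs_frame h k])"

lemma trace_wrt_onb:
  fixes h :: "'e::euclidean_space list => real"
  assumes "metric_at h" "onb h E" "linear S"
  shows "trace_wrt h S = (\<Sum>k<DIM('e). h [S (E k), E k])"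
  unfolding trace_wrt_def
  using linear_compose[OF assms(3) metric_at_linear1[OF assms(1)]]
  by (intro onb_trace[OF assms(1) onb_gs_frame[OF assms(1)] assms(2)] metric_at_linear2[OF assms(1)])
    (simp add: o_def)

text \<open>The mean curvature is defined with the coordinate basis, in general not orthonormal for
  \<open>h\<close>; expanding that basis in an \<open>h\<close>-orthonormal frame relates the two
  traces.\<close>

lemma trace_wrt_Basis:
  fixes h :: "'e::euclidean_space list => real"
  assumes h: "metric_at h" and S: "linear S"
  shows "trace_wrt h S = (\<Sum>b\<in>Basis. S b \<bullet> b)"
proof -
  let ?E = "gs_frame h"
  note l = metric_at_linear1[OF h]
  have "(\<Sum>b\<in>Basis. S b \<bullet> b) = (\<Sum>b\<in>Basis. \<Sum>k<DIM('e). h [b, ?E k] * (S (?E k) \<bullet> b))"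
  proof (rule sum.cong[OF refl])
    fix b :: 'e
    have "linear (\<lambda>x. S x \<bullet> b)"
      using linear_compose[OF S bounded_linear.linear[OF bounded_linear_inner_left[of b]]] by (simp add: o_def)
    then show "S b \<bullet> b = (\<Sum>k<DIM('e). h [b, ?E k] * (S (?E k) \<bullet> b))"
      by (rule onb_expand_real[OF h onb_gs_frame[OF h]])
  qed
  also have "\<dots> = (\<Sum>k<DIM('e). \<Sum>b\<in>Basis. h [b, ?E k] * (S (?E k) \<bullet> b))"
    by (rule sum.swap)
  also have "\<dots> = (\<Sum>k<DIM('e). h [S (?E k), ?E k])"
  proof (rule sum.cong[OF refl])
    fix k
    have "h [S (?E k), ?E k] = h [\<Sum>b\<in>Basis. (S (?E k) \<bullet> b) *\<^sub>R b, ?E k]"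
      by (simp add: euclidean_representation)
    also have "\<dots> = (\<Sum>b\<in>Basis. h [b, ?E k] * (S (?E k) \<bullet> b))"
      by (simp add: linear_sum[OF l] linear_cmul[OF l] mult.commute)
    finally show "(\<Sum>b\<in>Basis. h [b, ?E k] * (S (?E k) \<bullet> b)) = h [S (?E k), ?E k]" by simp
  qed
  finally show ?thesis by (simp add: trace_wrt_def)
qed

lemma distinct_sublist_frame:
  fixes h :: "'e::euclidean_space list => real"
  assumes "onb h E" "distinct vs" "length vs = DIM('e)" "set vs \<subseteq> E ` {..<DIM('e)}"
  shows "orthonormal_frame h vs"
  unfolding orthonormal_frame_def
proof (intro conjI assms(3) allI impI)
  fix i j assume ij: "i < DIM('e)" "j < DIM('e)"
  then have "vs ! i \<in> E ` {..<DIM('e)}" "vs ! j \<in> E ` {..<DIM('e)}"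
    using assms(3,4) nth_mem[of i vs] nth_mem[of j vs] by auto
  then obtain k l where kl: "k < DIM('e)" "l < DIM('e)" "vs ! i = E k" "vs ! j = E l" by blast
  have "i = j \<longleftrightarrow> k = l"
    using nth_eq_iff_index_eq[OF assms(2), of i j] ij assms(3) kl inj_onD[OF onb_inj[OF assms(1)], of k l] by auto
  then show "h [vs ! i, vs ! j] = (if i = j then 1 else 0)"
    using assms(1) kl by (simp add: onb_def)
qed

text \<open>On a list of all frame vectors only the component of \<open>S (vs ! j)\<close> along
  \<open>vs ! j\<close> survives, any other repeating an entry; multilinearity extends the identity
  to all lists.\<close>

lemma form_ext_top:
  fixes h :: "'e::euclidean_space list => real"
  assumes h: "metric_at h" and S: "linear S" and \<nu>: "alternating DIM('e) \<nu>" and vs: "length vs = DIM('e)"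
  shows "form_ext S \<nu> vs = trace_wrt h S * \<nu> vs"
proof (rule multilin_eq_on_frame[OF h onb_gs_frame[OF h] _ _ _ vs])
  show "multilin DIM('e) (form_ext S \<nu>)" by (intro multilin_form_ext S alternating_multilin[OF \<nu>])
  show "multilin DIM('e) (\<lambda>vs. trace_wrt h S * \<nu> vs)" by (intro multilin_cmul alternating_multilin[OF \<nu>])
  fix vs :: "'e list" assume vs: "length vs = DIM('e)" "set vs \<subseteq> gs_frame h ` {..<DIM('e)}"
  show "form_ext S \<nu> vs = trace_wrt h S * \<nu> vs"
  proof (cases "distinct vs")
    case False
    then show ?thesis
      using alternating_not_distinct[OF \<nu> vs(1)] alternating_not_distinct[OF alternating_form_ext[OF S \<nu>] vs(1)] by simp
  next
    case True
    have E: "onb h ((!) vs)"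
      by (intro onb_frame distinct_sublist_frame[OF onb_gs_frame[OF h] True vs])
    have "\<nu> (vs[j := S (vs ! j)]) = h [S (vs ! j), vs ! j] * \<nu> vs" if j: "j < DIM('e)" for j
    proof -
      have "linear (\<lambda>v. \<nu> (vs[j := v]))"
        using alternating_multilin[OF \<nu>] vs j by (simp add: multilin_def)
      then have "\<nu> (vs[j := S (vs ! j)]) = (\<Sum>k<DIM('e). h [S (vs ! j), vs ! k] * \<nu> (vs[j := vs ! k]))"
        by (rule onb_expand_real[OF h E])
      also have "\<dots> = (\<Sum>k<DIM('e). if k = j then h [S (vs ! j), vs ! k] * \<nu> vs else 0)"
      proof (intro sum.cong refl)
        fix k assume k: "k \<in> {..<DIM('e)}"
        have "\<nu> (vs[j := vs ! k]) = 0" if "k \<noteq> j"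
        proof -
          have "vs[j := vs ! k] ! k = vs[j := vs ! k] ! j" using that k j vs by simp
          then have "\<not> distinct (vs[j := vs ! k])"
            using nth_eq_iff_index_eq[of "vs[j := vs ! k]" k j] that k j vs by auto
          then show ?thesis using vs by (intro alternating_not_distinct[OF \<nu>]) auto
        qed
        then show "h [S (vs ! j), vs ! k] * \<nu> (vs[j := vs ! k])
          = (if k = j then h [S (vs ! j), vs ! k] * \<nu> vs else 0)" by auto
      qed
      finally show ?thesis using j by simp
    qed
    then show ?thesis
      using vs by (simp add: form_ext_def trace_wrt_onb[OF h E S] sum_distrib_right)
  qed
qed

text \<open>The star at a point with respect to a volume form, written with
  \<open>form_inner\<close> so that self-adjointness of \<open>form_ext\<close> applies to it
  directly.\<close>

definition star_wrt :: "('e::euclidean_space list => real) => ('e list => real) => nat => ('e list => real) => 'e list => real" where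
  "star_wrt h \<nu> p \<gamma> vs = form_inner h p \<gamma> (\<lambda>us. \<nu> (us @ vs))"

text \<open>On the frame vectors indexed by \<open>I\<close> only the coefficient of the complement
  of \<open>I\<close> survives, with a sign. Taking complements is a bijection of index
  sets.\<close>

lemma star_wrt_isometry:
  fixes h :: "'e::euclidean_space list => real"
  assumes h: "metric_at h" and \<nu>: "alternating DIM('e) \<nu>" "\<And>es. orthonormal_frame h es ==> \<bar>\<nu> es\<bar> = 1"
    and pq: "p + q = DIM('e)" and ab: "alternating p \<alpha>" "alternating p \<beta>"
  shows "form_inner h q (star_wrt h \<nu> p \<alpha>) (star_wrt h \<nu> p \<beta>) = form_inner h p \<alpha> \<beta>"
proof -
  let ?f = "frame h"
  let ?P = "\<lambda>p. {I. I \<subseteq> {..<DIM('e)} \<and> card I = p}"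
  note fo = frame_orthonormal[OF h]
  note dl = orthonormal_frame_distinct[OF fo]
  have nf: "distinct (nths ?f I)" "set (nths ?f I) = (!) ?f ` I" "length (nths ?f I) = p" if "I \<in> ?P p" for I p
    using nths_frame[OF dl(1), of I] dl(2) that by auto
  have inj: "inj_on ((!) ?f) {..<DIM('e)}" by (rule onb_inj[OF onb_frame[OF fo]])
  have fin: "finite (?P p)" for p by (rule finite_subset[of _ "Pow {..<DIM('e)}"]) auto
  \<comment> \<open>The sign of the volume form on the frame reordered with the complement of
    \<open>I\<close> first; only its square enters.\<close>
  define \<sigma> where "\<sigma> I = \<nu> (nths ?f ({..<DIM('e)} - I) @ nths ?f I)" for I
  have comp: "{..<DIM('e)} - I \<in> ?P p" if "I \<in> ?P q" for I
    using that pq by (auto simp: card_Diff_subset finite_subset)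
  have sigma: "\<sigma> I * \<sigma> I = 1" if I: "I \<in> ?P q" for I
  proof -
    note a = nf[OF I] and b = nf[OF comp[OF I]]
    have "set (nths ?f ({..<DIM('e)} - I)) \<inter> set (nths ?f I) = {}"
      unfolding a b using inj I by (auto simp: inj_on_def)
    then have "orthonormal_frame h (nths ?f ({..<DIM('e)} - I) @ nths ?f I)"
      using a b pq I by (intro distinct_sublist_frame[OF onb_frame[OF fo]]) auto
    then have "\<bar>\<sigma> I\<bar> = 1" unfolding \<sigma>_def by (rule \<nu>(2))
    then show ?thesis by (metis abs_mult_self_eq mult_1)
  qed
  have star: "star_wrt h \<nu> p \<gamma> (nths ?f I) = \<gamma> (nths ?f ({..<DIM('e)} - I)) * \<sigma> I" if I: "I \<in> ?P q" for I \<gamma>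
  proof -
    have "star_wrt h \<nu> p \<gamma> (nths ?f I) =
      (\<Sum>K\<in>?P p. if K = {..<DIM('e)} - I then \<gamma> (nths ?f K) * \<nu> (nths ?f K @ nths ?f I) else 0)"
      unfolding star_wrt_def form_inner_def
    proof (intro sum.cong refl)
      fix K assume K: "K \<in> ?P p"
      have "\<nu> (nths ?f K @ nths ?f I) = 0" if ne: "K \<noteq> {..<DIM('e)} - I"
      proof -
        have "K \<inter> I \<noteq> {}"
        proof
          assume "K \<inter> I = {}"
          then have sub: "K \<subseteq> {..<DIM('e)} - I" using K by auto
          have "card ({..<DIM('e)} - I) = card K" using comp[OF I] K by auto
          then show False using card_subset_eq[OF _ sub] ne by auto
        qed
        then have "\<not> distinct (nths ?f K @ nths ?f I)" using nf[OF K] nf[OF I] by auto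
        then show ?thesis using nf[OF K] nf[OF I] pq by (intro alternating_not_distinct[OF \<nu>(1)]) auto
      qed
      then show "\<gamma> (nths ?f K) * \<nu> (nths ?f K @ nths ?f I) =
        (if K = {..<DIM('e)} - I then \<gamma> (nths ?f K) * \<nu> (nths ?f K @ nths ?f I) else 0)" by auto
    qed
    also have "\<dots> = \<gamma> (nths ?f ({..<DIM('e)} - I)) * \<sigma> I"
      using comp[OF I] fin by (simp add: \<sigma>_def)
    finally show ?thesis .
  qed
  have "form_inner h q (star_wrt h \<nu> p \<alpha>) (star_wrt h \<nu> p \<beta>) =
    (\<Sum>I\<in>?P q. \<alpha> (nths ?f ({..<DIM('e)} - I)) * \<beta> (nths ?f ({..<DIM('e)} - I)) * (\<sigma> I * \<sigma> I))"
    unfolding form_inner_def by (intro sum.cong refl) (simp add: star)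
  also have "\<dots> = (\<Sum>I\<in>?P q. \<alpha> (nths ?f ({..<DIM('e)} - I)) * \<beta> (nths ?f ({..<DIM('e)} - I)))"
    by (intro sum.cong refl) (simp add: sigma)
  also have "\<dots> = (\<Sum>K\<in>?P p. \<alpha> (nths ?f K) * \<beta> (nths ?f K))"
  proof (rule sum.reindex_bij_witness[of _ "\<lambda>K. {..<DIM('e)} - K" "\<lambda>K. {..<DIM('e)} - K"])
    show "{..<DIM('e)} - K \<in> ?P q" if "K \<in> ?P p" for K
      using that pq by (auto simp: card_Diff_subset finite_subset)
  qed (use comp in auto)
  finally show ?thesis by (simp add: form_inner_def)
qed

text \<open>On a concatenated list \<open>form_ext S \<nu>\<close> is the trace times \<nu>, and it
  also splits into the parts acting on \<open>us\<close> and on \<open>vs\<close>. Self-adjointness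
  moves the part acting on \<open>us\<close> over to \<gamma>.\<close>

lemma star_wrt_form_ext:
  fixes h :: "'e::euclidean_space list => real"
  assumes h: "metric_at h" and S: "linear S" "\<And>u v. h [S u, v] = h [u, S v]"
    and \<nu>: "alternating DIM('e) \<nu>" and pq: "p + q = DIM('e)" and \<gamma>: "alternating p \<gamma>" and vs: "length vs = q"
  shows "form_ext S (star_wrt h \<nu> p \<gamma>) vs = trace_wrt h S * star_wrt h \<nu> p \<gamma> vs - star_wrt h \<nu> p (form_ext S \<gamma>) vs"
proof -
  have \<nu>vs: "alternating p (\<lambda>us. \<nu> (us @ vs))"
    using \<nu> pq vs by (intro alternating_append2[of p q]) auto
  have "form_ext S (star_wrt h \<nu> p \<gamma>) vs = form_inner h p \<gamma> (\<lambda>us. form_ext S (\<lambda>ws. \<nu> (us @ ws)) vs)"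
    unfolding star_wrt_def form_inner_def by (rule form_ext_sum)
  also have "\<dots> = form_inner h p \<gamma> (\<lambda>us. trace_wrt h S * \<nu> (us @ vs) - form_ext S (\<lambda>ws. \<nu> (ws @ vs)) us)"
  proof (rule form_inner_cong[OF h])
    fix us :: "'e list" assume us: "length us = p"
    have "form_ext S \<nu> (us @ vs) = trace_wrt h S * \<nu> (us @ vs)"
      by (rule form_ext_top[OF h S(1) \<nu>]) (use us vs pq in simp)
    then show "form_ext S (\<lambda>ws. \<nu> (us @ ws)) vs = trace_wrt h S * \<nu> (us @ vs) - form_ext S (\<lambda>ws. \<nu> (ws @ vs)) us"
      by (simp add: form_ext_append)
  qed simp
  also have "\<dots> = trace_wrt h S * star_wrt h \<nu> p \<gamma> vs - form_inner h p \<gamma> (form_ext S (\<lambda>us. \<nu> (us @ vs)))"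
    unfolding form_inner_sym[of h p \<gamma>] form_inner_diff form_inner_cmul star_wrt_def by simp
  also have "form_inner h p \<gamma> (form_ext S (\<lambda>us. \<nu> (us @ vs))) = star_wrt h \<nu> p (form_ext S \<gamma>) vs"
    unfolding star_wrt_def by (rule form_inner_form_ext_adjoint[OF h S \<gamma> \<nu>vs, symmetric])
  finally show ?thesis .
qed

lemma form_ext_star_inner:
  fixes h :: "'e::euclidean_space list => real"
  assumes h: "metric_at h" and S: "linear S" "\<And>u v. h [S u, v] = h [u, S v]"
    and \<nu>: "alternating DIM('e) \<nu>" "\<And>es. orthonormal_frame h es ==> \<bar>\<nu> es\<bar> = 1"
    and pq: "p + q = DIM('e)" and \<gamma>: "alternating p \<gamma>"
  shows "form_inner h q (form_ext S (star_wrt h \<nu> p \<gamma>)) (star_wrt h \<nu> p \<gamma>) =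
    trace_wrt h S * form_inner h p \<gamma> \<gamma> - form_inner h p (form_ext S \<gamma>) \<gamma>"
proof -
  have "form_inner h q (form_ext S (star_wrt h \<nu> p \<gamma>)) (star_wrt h \<nu> p \<gamma>) =
    form_inner h q (\<lambda>vs. trace_wrt h S * star_wrt h \<nu> p \<gamma> vs - star_wrt h \<nu> p (form_ext S \<gamma>) vs) (star_wrt h \<nu> p \<gamma>)"
    by (rule form_inner_cong[OF h star_wrt_form_ext[OF h S \<nu>(1) pq \<gamma>]]) auto
  also have "\<dots> = trace_wrt h S * form_inner h p \<gamma> \<gamma> - form_inner h p (form_ext S \<gamma>) \<gamma>"
    unfolding form_inner_diff form_inner_cmul
    using star_wrt_isometry[OF h \<nu> pq] \<gamma> alternating_form_ext[OF S(1) \<gamma>] by simp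
  finally show ?thesis .
qed

section \<open>Determinants\<close>

text \<open>An index type with \<open>DIM('e)\<close> elements, which makes the results of the library on square
  matrices available for an arbitrary Euclidean space.\<close>

typedef (overloaded) ('e::euclidean_space) bidx = "{..<DIM('e)}"
  by (rule exI[of _ 0]) simp

instance bidx :: (euclidean_space) finite
proof
  have "(UNIV :: 'a bidx set) = Abs_bidx ` {..<DIM('a)}" by (rule type_definition.Abs_image[OF type_definition_bidx, symmetric])
  then show "finite (UNIV :: 'a bidx set)" by (metis finite_imageI finite_lessThan)
qed

instantiation bidx :: (euclidean_space) wellorder
begin

definition less_eq_bidx :: "'a bidx => 'a bidx => bool" where
  "less_eq_bidx i j \<longleftrightarrow> Rep_bidx i \<le> Rep_bidx j"

definition less_bidx :: "'a bidx => 'a bidx => bool" where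
  "less_bidx i j \<longleftrightarrow> Rep_bidx i < Rep_bidx j"

instance
proof
  fix P :: "'a bidx => bool" and a
  assume *: "\<And>x. (\<And>y. y < x ==> P y) ==> P x"
  show "P a"
    by (induction "Rep_bidx a" arbitrary: a rule: less_induct) (rule *, simp add: less_bidx_def)
qed (auto simp: less_eq_bidx_def less_bidx_def Rep_bidx_inject)

end

lemma Rep_bidx_bij: "bij_betw Rep_bidx (UNIV :: 'e::euclidean_space bidx set) {..<DIM('e)}"
  unfolding bij_betw_def
  using type_definition.Rep_range[OF type_definition_bidx] Rep_bidx_inject by (auto simp: inj_on_def)

definition bvec :: "'e::euclidean_space bidx => 'e" where
  "bvec i = basis_enum (Rep_bidx i)"

lemma bvec_bij: "bij_betw bvec UNIV (Basis :: 'e::euclidean_space set)"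
  using bij_betw_trans[OF Rep_bidx_bij basis_enum] by (simp add: bvec_def[abs_def] o_def)

lemma sum_bvec: "(\<Sum>i\<in>UNIV. f (bvec i)) = (\<Sum>b\<in>(Basis :: 'e::euclidean_space set). f b)"
  by (rule sum.reindex_bij_betw[OF bvec_bij])

lemma bvec_inner: "bvec i \<bullet> (bvec j :: 'e::euclidean_space) = (if i = j then 1 else 0)"
proof -
  have "bvec i \<in> (Basis :: 'e set)" "bvec j \<in> (Basis :: 'e set)" "inj (bvec :: 'e bidx => 'e)"
    using bvec_bij[where 'e='e] by (auto simp: bij_betw_def)
  then show ?thesis by (simp add: inner_Basis inj_eq)
qed

lemma bvec_expand: "v = (\<Sum>i\<in>UNIV. (v \<bullet> bvec i) *\<^sub>R (bvec i :: 'e::euclidean_space))"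
  unfolding sum_bvec[of "\<lambda>b. (v \<bullet> b) *\<^sub>R b"] by (simp add: euclidean_representation)

definition gram_matrix :: "('e::euclidean_space list => real) => real ^ 'e bidx ^ 'e bidx" where
  "gram_matrix h = (\<chi> i j. h [bvec i, bvec j])"

text \<open>Permutations of \<open>Basis\<close> and of the index type correspond by conjugation
  with \<open>bvec\<close>, which preserves signs.\<close>

lemma gram_det_matrix: "gram_det (h :: 'e::euclidean_space list => real) = det (gram_matrix h)"
proof -
  let ?f = "bvec :: 'e bidx => 'e"
  let ?m = "map_permutation UNIV ?f"
  have inj: "inj_on ?f UNIV" using bvec_bij by (auto simp: bij_betw_def)
  have inv: "inv_into UNIV ?f (?f x) = x" for x using inj by simp
  have bij2: "bij_betw (inv_into UNIV ?f) Basis UNIV" by (rule bij_betw_inv_into[OF bvec_bij])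
  have finv: "?f (inv_into UNIV ?f b) = b" if "b \<in> Basis" for b
    using bij_betw_inv_into_right[OF bvec_bij that] .
  have "det (gram_matrix h) = (\<Sum>p | p permutes UNIV. of_int (sign p) * (\<Prod>i\<in>UNIV. h [?f i, ?f (p i)]))"
    by (simp add: det_def gram_matrix_def)
  also have "\<dots> = (\<Sum>\<pi> | \<pi> permutes (Basis :: 'e set). of_int (sign \<pi>) * (\<Prod>b\<in>Basis. h [b, \<pi> b]))"
  proof (rule sum.reindex_bij_witness[of _ "map_permutation Basis (inv_into UNIV ?f)" ?m])
    fix p :: "'e bidx => 'e bidx" assume p: "p \<in> {p. p permutes UNIV}"
    then show "map_permutation Basis (inv_into UNIV ?f) (?m p) = p"
      by (intro map_permutation_compose_inv[OF bvec_bij]) (auto simp: inv)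
    show "?m p \<in> {\<pi>. \<pi> permutes Basis}"
      using p map_permutation_permutes[OF bvec_bij] by simp
    have "sign (?m p) = sign p"
      using p by (intro sign_map_permutation) (auto simp: inj)
    moreover have "(\<Prod>b\<in>Basis. h [b, ?m p b]) = (\<Prod>i\<in>UNIV. h [?f i, ?m p (?f i)])"
      by (rule prod.reindex_bij_betw[OF bvec_bij, symmetric])
    moreover have "?m p (?f i) = ?f (p i)" for i by (rule map_permutation_apply[OF inj]) simp
    ultimately show "of_int (sign (?m p)) * (\<Prod>b\<in>Basis. h [b, ?m p b]) =
      of_int (sign p) * (\<Prod>i\<in>UNIV. h [?f i, ?f (p i)])" by simp
  next
    fix \<pi> :: "'e => 'e" assume p: "\<pi> \<in> {\<pi>. \<pi> permutes Basis}"
    then show "?m (map_permutation Basis (inv_into UNIV ?f) \<pi>) = \<pi>"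
      by (intro map_permutation_compose_inv[OF bij2]) (auto simp: finv)
    show "map_permutation Basis (inv_into UNIV ?f) \<pi> \<in> {p. p permutes UNIV}"
      using p map_permutation_permutes[OF bij2] by simp
  qed
  finally show ?thesis unfolding gram_det_def by (rule sym)
qed

text \<open>The coordinate volume form. Being of top degree it is accessible to
  \<open>form_ext_top\<close>, which takes the place of Jacobi's formula when the density is
  differentiated.\<close>

definition vol_std :: "'e::euclidean_space list => real" where
  "vol_std vs = det (\<chi> i j. vs ! Rep_bidx i \<bullet> bvec j :: real ^ 'e bidx ^ 'e bidx)"

lemma alternating_vol_std: "alternating DIM('e) (vol_std :: 'e::euclidean_space list => real)"
  unfolding alternating_def
proof (intro conjI allI impI)
  show "multilin DIM('e) (vol_std :: 'e list => real)"
    unfolding multilin_def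
  proof (intro allI impI)
    fix vs :: "'e list" and k assume vs: "length vs = DIM('e)" and k: "k < DIM('e)"
    define i0 :: "'e bidx" where "i0 = Abs_bidx k"
    have i0: "Rep_bidx i0 = k" unfolding i0_def using k by (simp add: Abs_bidx_inverse)
    have *: "vol_std (vs[k := v]) = det (\<chi> i. if i = i0 then \<chi> j. v \<bullet> bvec j else \<chi> j. vs ! Rep_bidx i \<bullet> bvec j)" for v
    proof -
      have "(\<chi> i j. vs[k := v] ! Rep_bidx i \<bullet> bvec j) =
        (\<chi> i. if i = i0 then \<chi> j. v \<bullet> bvec j else \<chi> j. vs ! Rep_bidx i \<bullet> (bvec j :: 'e))"
      proof (rule vec_eq_iff[THEN iffD2], intro allI)
        fix i :: "'e bidx"
        show "(\<chi> i j. vs[k := v] ! Rep_bidx i \<bullet> bvec j) $ i =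
          (\<chi> i. if i = i0 then \<chi> j. v \<bullet> bvec j else \<chi> j. vs ! Rep_bidx i \<bullet> (bvec j :: 'e)) $ i"
          using i0 vs k Rep_bidx_inject[of i i0] by (cases "i = i0") simp_all
      qed
      then show ?thesis by (simp only: vol_std_def)
    qed
    show "linear (\<lambda>v. vol_std (vs[k := v]))"
    proof (rule linearI)
      fix u v :: 'e and c :: real
      have "(\<chi> j. (u + v) \<bullet> bvec j) = (\<chi> j. u \<bullet> bvec j) + (\<chi> j. v \<bullet> (bvec j :: 'e))"
        by (simp add: vec_eq_iff inner_add_left)
      then show "vol_std (vs[k := u + v]) = vol_std (vs[k := u]) + vol_std (vs[k := v])"
        unfolding * by (simp only: det_row_add)
      have "(\<chi> j. (c *\<^sub>R u) \<bullet> bvec j) = c *s (\<chi> j. u \<bullet> (bvec j :: 'e))"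
        by (simp add: vec_eq_iff)
      then show "vol_std (vs[k := c *\<^sub>R u]) = c *\<^sub>R vol_std (vs[k := u])"
        unfolding * by (simp only: det_row_mul real_scaleR_def)
    qed
  qed
  fix vs :: "'e list" assume vs: "length vs = DIM('e)" "\<not> distinct vs"
  then obtain k l where kl: "k < DIM('e)" "l < DIM('e)" "k \<noteq> l" "vs ! k = vs ! l"
    by (auto simp: distinct_conv_nth)
  have "Abs_bidx k \<noteq> (Abs_bidx l :: 'e bidx)" using kl by (simp add: Abs_bidx_inject)
  moreover have "row (Abs_bidx k) (\<chi> i j. vs ! Rep_bidx i \<bullet> bvec j :: real ^ 'e bidx ^ 'e bidx) =
    row (Abs_bidx l) (\<chi> i j. vs ! Rep_bidx i \<bullet> bvec j :: real ^ 'e bidx ^ 'e bidx)"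
    using kl by (simp add: row_def vec_eq_iff Abs_bidx_inverse)
  ultimately show "vol_std vs = 0" unfolding vol_std_def by (rule det_identical_rows)
qed

lemma metric_at_expand:
  assumes h: "metric_at h"
  shows "h [u, v] = (\<Sum>l\<in>UNIV. \<Sum>k\<in>UNIV. (u \<bullet> bvec k) * (h [bvec k, bvec l] * (v \<bullet> bvec l)))"
proof -
  have "h [u, v] = h [\<Sum>k\<in>UNIV. (u \<bullet> bvec k) *\<^sub>R bvec k, \<Sum>l\<in>UNIV. (v \<bullet> bvec l) *\<^sub>R bvec l]"
    by (simp only: bvec_expand[symmetric])
  also have "\<dots> = (\<Sum>l\<in>UNIV. (v \<bullet> bvec l) * (\<Sum>k\<in>UNIV. (u \<bullet> bvec k) * h [bvec k, bvec l]))"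
    by (simp add: linear_sum[OF metric_at_linear1[OF h]] linear_cmul[OF metric_at_linear1[OF h]]
        linear_sum[OF metric_at_linear2[OF h]] linear_cmul[OF metric_at_linear2[OF h]])
  finally show ?thesis by (simp add: sum_distrib_left mult_ac)
qed

text \<open>With \<open>B\<close> the coordinate matrix of the frame, orthonormality reads
  \<open>B ** gram_matrix h ** transpose B = mat 1\<close>; take determinants.\<close>

lemma gram_det_vol_std:
  fixes h :: "'e::euclidean_space list => real"
  assumes h: "metric_at h" and es: "orthonormal_frame h es"
  shows "gram_det h * (vol_std es)\<^sup>2 = 1"
proof -
  let ?B = "\<chi> i j. es ! Rep_bidx i \<bullet> bvec j :: real ^ 'e bidx ^ 'e bidx"
  have E: "onb h ((!) es)" by (rule onb_frame[OF es])
  have "?B ** gram_matrix h ** transpose ?B = mat 1"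
  proof (rule vec_eq_iff[THEN iffD2], intro allI, rule vec_eq_iff[THEN iffD2], intro allI)
    fix i j :: "'e bidx"
    let ?u = "es ! Rep_bidx i" and ?v = "es ! Rep_bidx j"
    have "h [?u, ?v] = (\<Sum>l\<in>UNIV. \<Sum>k\<in>UNIV. (?u \<bullet> bvec k) * (h [bvec k, bvec l] * (?v \<bullet> bvec l)))"
      by (rule metric_at_expand[OF h])
    also have "\<dots> = (?B ** gram_matrix h ** transpose ?B) $ i $ j"
      by (simp add: matrix_matrix_mult_def transpose_def gram_matrix_def sum_distrib_right mult.assoc)
    finally have "(?B ** gram_matrix h ** transpose ?B) $ i $ j = h [?u, ?v]" by simp
    also have "\<dots> = (mat 1 :: real ^ 'e bidx ^ 'e bidx) $ i $ j"
      using E Rep_bidx[of i] Rep_bidx[of j] by (simp add: onb_def mat_def Rep_bidx_inject)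
    finally show "(?B ** gram_matrix h ** transpose ?B) $ i $ j = (mat 1 :: real ^ 'e bidx ^ 'e bidx) $ i $ j" .
  qed
  then have "det (?B ** gram_matrix h ** transpose ?B) = 1" by simp
  then show ?thesis
    by (simp add: det_mul det_transpose gram_det_matrix vol_std_def power2_eq_square mult_ac)
qed

lemma gram_det_pos: "metric_at h ==> gram_det h > 0"
  using gram_det_vol_std[OF _ frame_orthonormal, of h]
  by (metis less_eq_real_def mult_eq_0_iff not_le zero_le_mult_iff zero_le_power2 zero_neq_one linorder_neqE_linordered_idom less_numeral_extra(1))

definition lin_det :: "('e::euclidean_space => 'e) => real" where
  "lin_det L = det (\<chi> i j. L (bvec j) \<bullet> bvec i :: real ^ 'e bidx ^ 'e bidx)"

lemma gram_det_pullback: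
  fixes h :: "'e::euclidean_space list => real"
  assumes h: "metric_at h"
  shows "gram_det (\<lambda>vs. h (map L vs)) = (lin_det L)\<^sup>2 * gram_det h"
proof -
  let ?B = "\<chi> i j. L (bvec j) \<bullet> bvec i :: real ^ 'e bidx ^ 'e bidx"
  have "gram_matrix (\<lambda>vs. h (map L vs)) = transpose ?B ** gram_matrix h ** ?B"
  proof (rule vec_eq_iff[THEN iffD2], intro allI, rule vec_eq_iff[THEN iffD2], intro allI)
    fix i j :: "'e bidx"
    show "gram_matrix (\<lambda>vs. h (map L vs)) $ i $ j = (transpose ?B ** gram_matrix h ** ?B) $ i $ j"
      using metric_at_expand[OF h, of "L (bvec i)" "L (bvec j)"]
      by (simp add: matrix_matrix_mult_def transpose_def gram_matrix_def sum_distrib_right mult.assoc)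
  qed
  then show ?thesis
    by (simp add: det_mul det_transpose gram_det_matrix lin_det_def power2_eq_square mult_ac)
qed

section \<open>Tensor fields in a chart\<close>

definition tfield :: "'e::euclidean_space set => nat => ('e => 'e list => real) => bool" where
  "tfield A p T \<longleftrightarrow> (\<forall>x\<in>A. multilin p (T x)) \<and> (\<forall>vs. length vs = p \<longrightarrow> smooth_on A (\<lambda>x. T x vs))"

lemma der_linear: "regular_set A ==> smooth_on A f ==> x \<in> A ==> linear (der A f x)"
  using smooth_on_has_derivative has_derivative_linear by blast

lemma der_eq: "regular_set A ==> x \<in> A ==> (f has_derivative D) (at x within A) ==> der A f x u = D u"
  using frechet_derivative_eq by metis

lemma der_const: "regular_set A ==> x \<in> A ==> der A (\<lambda>y. c) x u = 0"
  by (rule der_eq[where D="\<lambda>_. 0"]) auto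

lemma der_add:
  assumes "regular_set A" "smooth_on A f" "smooth_on A g" "x \<in> A"
  shows "der A (\<lambda>y. f y + g y) x u = der A f x u + der A g x u"
  by (rule der_eq[OF assms(1,4)]) (intro has_derivative_add smooth_on_has_derivative assms)

lemma der_sum:
  assumes "regular_set A" "\<And>i. i \<in> I ==> smooth_on A (f i)" "x \<in> A"
  shows "der A (\<lambda>y. \<Sum>i\<in>I. f i y) x u = (\<Sum>i\<in>I. der A (f i) x u)"
  by (rule der_eq[OF assms(1,3)]) (intro has_derivative_sum smooth_on_has_derivative assms)

lemma der_bilinear:
  assumes "bounded_bilinear b" "regular_set A" "smooth_on A f" "smooth_on A g" "x \<in> A"
  shows "der A (\<lambda>y. b (f y) (g y)) x u = b (f x) (der A g x u) + b (der A f x u) (g x)"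
  by (rule der_eq[OF assms(2,5)]) (intro bounded_bilinear.FDERIV[OF assms(1)] smooth_on_has_derivative assms)

lemmas der_mult = der_bilinear[OF bounded_bilinear_mult]
lemmas der_inner = der_bilinear[OF bounded_bilinear_inner]

lemma der_cong: "x \<in> A ==> (\<And>y. y \<in> A ==> f y = g y) ==> der A f x u = der A g x u"
  using frechet_derivative_cong[of x A f g] by simp

lemma der_inner_const:
  fixes f :: "'e::euclidean_space => 'f::real_inner"
  assumes "regular_set A" "smooth_on A f" "x \<in> A"
  shows "der A (\<lambda>y. f y \<bullet> c) x u = der A f x u \<bullet> c"
  by (simp add: der_inner[OF assms(1,2) smooth_on_const assms(3)] der_const[OF assms(1,3)])

lemma tfield_Cons: "tfield A (Suc p) T ==> tfield A p (\<lambda>x vs. T x (v # vs))"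
  unfolding tfield_def by (auto intro: multilin_Cons)

lemma tfield_multilin: "tfield A p T ==> x \<in> A ==> multilin p (T x)"
  by (simp add: tfield_def)

lemma tfield_smooth: "tfield A p T ==> length vs = p ==> smooth_on A (\<lambda>x. T x vs)"
  by (simp add: tfield_def)

lemma tfield_head_expand:
  assumes "tfield A (Suc p) T" "x \<in> A" "length vs = p"
  shows "T x (v # vs) = (\<Sum>b\<in>Basis. (v \<bullet> b) * T x (b # vs))"
proof -
  note l = multilin_head[OF tfield_multilin[OF assms(1,2)] assms(3)]
  have "T x (v # vs) = T x ((\<Sum>b\<in>Basis. (v \<bullet> b) *\<^sub>R b) # vs)" by (simp add: euclidean_representation)
  also have "\<dots> = (\<Sum>b\<in>Basis. (v \<bullet> b) * T x (b # vs))" by (simp add: linear_sum[OF l] linear_cmul[OF l])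
  finally show ?thesis .
qed

text \<open>The field in the first slot is expanded in the coordinate basis, which reduces
  smoothness to that of sums of products.\<close>

lemma tfield_Cons_field:
  fixes V :: "'e::euclidean_space => 'e"
  assumes T: "tfield A (Suc p) T" and V: "smooth_on A V"
  shows "tfield A p (\<lambda>x vs. T x (V x # vs))"
  unfolding tfield_def
proof (intro conjI ballI allI impI)
  show "multilin p (\<lambda>vs. T x (V x # vs))" if "x \<in> A" for x
    by (rule multilin_Cons[OF tfield_multilin[OF T that]])
  fix vs :: "'e list" assume vs: "length vs = p"
  have "smooth_on A (\<lambda>x. \<Sum>b\<in>Basis. (V x \<bullet> b) * T x (b # vs))"
    by (intro smooth_on_sum smooth_on_mult smooth_on_inner V smooth_on_const tfield_smooth[OF T]) (simp add: vs)
  then show "smooth_on A (\<lambda>x. T x (V x # vs))"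
    by (rule smooth_on_cong) (rule tfield_head_expand[OF T _ vs])
qed

lemma der_Cons_field:
  fixes V :: "'e::euclidean_space => 'e"
  assumes A: "regular_set A" and T: "tfield A (Suc p) T" and V: "smooth_on A V" and x: "x \<in> A" and vs: "length vs = p"
  shows "der A (\<lambda>y. T y (V y # vs)) x u = der A (\<lambda>y. T y (V x # vs)) x u + T x (der A V x u # vs)"
proof -
  have s1: "smooth_on A (\<lambda>y. V y \<bullet> b)" for b by (intro smooth_on_inner V smooth_on_const)
  have s2: "smooth_on A (\<lambda>y. T y (b # vs))" for b by (rule tfield_smooth[OF T]) (simp add: vs)
  have "der A (\<lambda>y. T y (V y # vs)) x u = der A (\<lambda>y. \<Sum>b\<in>Basis. (V y \<bullet> b) * T y (b # vs)) x u"
    by (rule der_cong[OF x tfield_head_expand[OF T _ vs]])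
  also have "\<dots> = (\<Sum>b\<in>Basis. (V x \<bullet> b) * der A (\<lambda>y. T y (b # vs)) x u + (der A V x u \<bullet> b) * T x (b # vs))"
    by (simp add: der_sum[OF A smooth_on_mult[OF s1 s2] x] der_mult[OF A s1 s2 x] der_inner_const[OF A V x])
  also have "\<dots> = (\<Sum>b\<in>Basis. (V x \<bullet> b) * der A (\<lambda>y. T y (b # vs)) x u) + T x (der A V x u # vs)"
    by (simp add: sum.distrib tfield_head_expand[OF T x vs, symmetric])
  also have "(\<Sum>b\<in>Basis. (V x \<bullet> b) * der A (\<lambda>y. T y (b # vs)) x u) =
     der A (\<lambda>y. \<Sum>b\<in>Basis. (V x \<bullet> b) * T y (b # vs)) x u"
    by (simp add: der_sum[OF A smooth_on_mult[OF smooth_on_const s2] x] der_mult[OF A smooth_on_const s2 x] der_const[OF A x])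
  also have "\<dots> = der A (\<lambda>y. T y (V x # vs)) x u"
    by (rule der_cong[OF x tfield_head_expand[OF T _ vs, symmetric]])
  finally show ?thesis .
qed

lemma tfield_map_smooth:
  fixes Vs :: "('e::euclidean_space => 'e) list"
  shows "tfield A p T ==> length Vs = p ==> (\<And>V. V \<in> set Vs ==> smooth_on A V) ==>
    smooth_on A (\<lambda>x. T x (map (\<lambda>V. V x) Vs))"
proof (induction Vs arbitrary: p T)
  case (Cons V Vs)
  then obtain q where q: "p = Suc q" "length Vs = q" by auto
  show ?case
    using Cons.IH[OF tfield_Cons_field[OF Cons.prems(1)[unfolded q(1)] Cons.prems(3)[of V]] q(2)] Cons.prems(3) by simp
qed (auto simp: tfield_def)

text \<open>Leibniz rule: the coefficients vary with the arguments frozen at \<open>x\<close>, then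
  each argument varies in turn.\<close>

lemma der_map_fields:
  fixes Vs :: "('e::euclidean_space => 'e) list"
  assumes A: "regular_set A" and x: "x \<in> A"
  shows "tfield A p T ==> length Vs = p ==> (\<And>V. V \<in> set Vs ==> smooth_on A V) ==>
    der A (\<lambda>y. T y (map (\<lambda>V. V y) Vs)) x u = der A (\<lambda>y. T y (map (\<lambda>V. V x) Vs)) x u +
      (\<Sum>j<p. T x ((map (\<lambda>V. V x) Vs)[j := der A (Vs ! j) x u]))"
proof (induction Vs arbitrary: p T)
  case (Cons V Vs)
  then obtain q where q: "p = Suc q" "length Vs = q" by auto
  have T: "tfield A (Suc q) T" and V: "smooth_on A V" using Cons.prems q by auto
  have IH: "der A (\<lambda>y. T y (V y # map (\<lambda>V. V y) Vs)) x u = der A (\<lambda>y. T y (V y # map (\<lambda>V. V x) Vs)) x u +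
      (\<Sum>j<q. T x (V x # (map (\<lambda>V. V x) Vs)[j := der A (Vs ! j) x u]))"
    using Cons.IH[OF tfield_Cons_field[OF T V] q(2)] Cons.prems(3) by simp
  have hd: "der A (\<lambda>y. T y (V y # map (\<lambda>V. V x) Vs)) x u =
    der A (\<lambda>y. T y (V x # map (\<lambda>V. V x) Vs)) x u + T x (der A V x u # map (\<lambda>V. V x) Vs)"
    by (rule der_Cons_field[OF A T V x]) (simp add: q)
  show ?case unfolding q(1) sum.lessThan_Suc_shift using IH hd by simp
qed simp

section \<open>The Levi-Civita connection in a chart\<close>

definition pder :: "'e::euclidean_space set => ('e => 'e list => real) => 'e => 'e list => real" where
  "pder A T x ws = der A (\<lambda>y. T y (tl ws)) x (hd ws)"

text \<open>\<open>christoffel\<close> with the coordinate domain as a parameter, so that it is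
  available on overlaps, on slabs near the boundary and on boundary slices.\<close>

definition chr :: "'e::euclidean_space set => ('e => 'e list => real) => 'e => 'e => 'e => 'e" where
  "chr A G x = (THE \<Gamma>. (\<forall>u v. \<Gamma> u v = \<Gamma> v u) \<and>
     (\<forall>u v w. der A (\<lambda>y. G y [v, w]) x u = G x [\<Gamma> u v, w] + G x [v, \<Gamma> u w]))"

definition nab :: "'e::euclidean_space set => ('e => 'e list => real) => ('e => 'e list => real) => 'e => 'e list => real" where
  "nab A G T x ws = pder A T x ws - form_ext (chr A G x (hd ws)) (T x) (tl ws)"

lemma christoffel_chr: "christoffel M g i = chr (cimg M i) (g i)"
  by (simp add: fun_eq_iff christoffel_def chr_def dirderiv_def)

lemma nabla_nab: "nabla M g T i = nab (cimg M i) (g i) (T i)"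
  by (simp add: fun_eq_iff nabla_def nab_def pder_def form_ext_def dirderiv_def christoffel_chr Let_def)

lemma multilin_pder:
  assumes A: "regular_set A" and T: "tfield A p T" and x: "x \<in> A"
  shows "multilin p (\<lambda>vs. der A (\<lambda>y. T y vs) x u)"
  unfolding multilin_def
proof (intro allI impI)
  fix vs :: "'a list" and j assume vs: "length vs = p" "j < p"
  have l: "linear (\<lambda>v. T y (vs[j := v]))" if "y \<in> A" for y
    using tfield_multilin[OF T that] vs by (simp add: multilin_def)
  have s: "smooth_on A (\<lambda>y. T y (vs[j := v]))" for v
    by (rule tfield_smooth[OF T]) (simp add: vs)
  show "linear (\<lambda>v. der A (\<lambda>y. T y (vs[j := v])) x u)"
  proof (rule linearI)
    fix v w :: 'a and c :: real
    have "der A (\<lambda>y. T y (vs[j := v + w])) x u = der A (\<lambda>y. T y (vs[j := v]) + T y (vs[j := w])) x u"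
      by (rule der_cong[OF x]) (simp add: linear_add[OF l])
    then show "der A (\<lambda>y. T y (vs[j := v + w])) x u = der A (\<lambda>y. T y (vs[j := v])) x u + der A (\<lambda>y. T y (vs[j := w])) x u"
      by (simp add: der_add[OF A s s x])
    have "der A (\<lambda>y. T y (vs[j := c *\<^sub>R v])) x u = der A (\<lambda>y. c * T y (vs[j := v])) x u"
      by (rule der_cong[OF x]) (simp add: linear_cmul[OF l])
    then show "der A (\<lambda>y. T y (vs[j := c *\<^sub>R v])) x u = c *\<^sub>R der A (\<lambda>y. T y (vs[j := v])) x u"
      by (simp add: der_mult[OF A smooth_on_const s x] der_const[OF A x])
  qed
qed

lemma tfield_pder:
  assumes A: "regular_set A" and T: "tfield A p T"
  shows "tfield A (Suc p) (pder A T)"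
  unfolding tfield_def
proof (intro conjI ballI allI impI)
  fix x assume x: "x \<in> A"
  show "multilin (Suc p) (pder A T x)"
  proof (rule multilin_SucI)
    show "multilin p (\<lambda>vs. pder A T x (v # vs))" for v
      using multilin_pder[OF A T x] by (simp add: pder_def)
    show "linear (\<lambda>v. pder A T x (v # vs))" if "length vs = p" for vs
      using der_linear[OF A tfield_smooth[OF T that] x] by (simp add: pder_def)
  qed
next
  fix ws :: "'a list" assume "length ws = Suc p"
  then show "smooth_on A (\<lambda>x. pder A T x ws)"
    unfolding pder_def by (intro smooth_on_frechet_derivative A tfield_smooth[OF T]) simp
qed

locale chart_metric =
  fixes A :: "'e::euclidean_space set" and G :: "'e => 'e list => real"
  assumes reg: "regular_set A" and tG: "tfield A 2 G" and met: "\<And>x. x \<in> A ==> metric_at (G x)"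
begin

abbreviation E :: "'e => nat => 'e" where "E x \<equiv> gs_frame (G x)"
abbreviation \<Gamma> :: "'e => 'e => 'e => 'e" where "\<Gamma> \<equiv> chr A G"

lemma onbE: "x \<in> A ==> onb (G x) (E x)"
  by (rule onb_gs_frame[OF met])

lemma smooth_G: "smooth_on A U ==> smooth_on A V ==> smooth_on A (\<lambda>x. G x [U x, V x])"
  using tfield_map_smooth[OF tG, of "[U, V]"] by auto

lemma smooth_frame: "k < DIM('e) ==> smooth_on A (\<lambda>x. E x k)"
proof (induction k rule: less_induct)
  case (less k)
  define w where "w x = basis_enum k - (\<Sum>l<k. G x [basis_enum k, E x l] *\<^sub>R E x l)" for x
  have Ek: "E x k = (G x [w x, w x] powr (- 1 / 2)) *\<^sub>R w x" for x
    unfolding gs_frame_def by (subst gram_schmidt.simps) (simp add: w_def gs_frame_def Let_def)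
  have sw: "smooth_on A w"
    unfolding w_def using less
    by (intro smooth_on_diff smooth_on_const smooth_on_sum smooth_on_scaleR smooth_G) auto
  \<comment> \<open>If \<open>w x\<close> vanished, so would \<open>E x k\<close>, which has norm
    one.\<close>
  have pos: "G x [w x, w x] > 0" if x: "x \<in> A" for x
  proof -
    have "G x [E x k, E x k] = 1" using onbE[OF x] less.prems by (simp add: onb_def)
    moreover have "G x [0, 0] = 0" by (rule linear_0[OF metric_at_linear1[OF met[OF x]]])
    ultimately have "w x \<noteq> 0" using Ek[of x] by auto
    then show ?thesis using met[OF x] by (simp add: metric_at_def)
  qed
  show ?case unfolding Ek by (intro smooth_on_scaleR smooth_on_powr smooth_G sw pos)
qed

text \<open>The Koszul formula for coordinate-constant fields, whose brackets vanish: it prescribes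
  the inner product of the Christoffel vector with \<open>w\<close>.\<close>

definition koszul :: "'e => 'e => 'e => 'e => real" where
  "koszul x u v w = (pder A G x [u, v, w] + pder A G x [v, u, w] - pder A G x [w, u, v]) / 2"

lemma pder_sym: "x \<in> A ==> pder A G x [u, v, w] = pder A G x [u, w, v]"
  unfolding pder_def list.sel by (rule der_cong) (auto simp: metric_at_sym[OF met])

lemma pder_linear:
  assumes x: "x \<in> A"
  shows "linear (\<lambda>u. pder A G x [u, v, w])" "linear (\<lambda>v. pder A G x [u, v, w])" "linear (\<lambda>w. pder A G x [u, v, w])"
proof -
  note m = tfield_multilin[OF tfield_pder[OF reg tG] x]
  show "linear (\<lambda>u. pder A G x [u, v, w])" "linear (\<lambda>v. pder A G x [u, v, w])" "linear (\<lambda>w. pder A G x [u, v, w])"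
    using multilin_mid[OF m, of "[]" "[v, w]"] multilin_mid[OF m, of "[u]" "[w]"] multilin_mid[OF m, of "[u, v]" "[]"]
    by simp_all
qed

lemma koszul_linear:
  assumes x: "x \<in> A"
  shows "linear (\<lambda>u. koszul x u v w)" "linear (\<lambda>v. koszul x u v w)" "linear (\<lambda>w. koszul x u v w)"
  unfolding koszul_def
  using linear_add[OF pder_linear(1)[OF x]] linear_add[OF pder_linear(2)[OF x]] linear_add[OF pder_linear(3)[OF x]]
    linear_cmul[OF pder_linear(1)[OF x]] linear_cmul[OF pder_linear(2)[OF x]] linear_cmul[OF pder_linear(3)[OF x]]
  by (auto intro!: linearI simp: algebra_simps add_divide_distrib diff_divide_distrib)

definition \<Gamma>K :: "'e => 'e => 'e => 'e" where
  "\<Gamma>K x u v = (\<Sum>k<DIM('e). koszul x u v (E x k) *\<^sub>R E x k)"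

lemma \<Gamma>K_koszul:
  assumes x: "x \<in> A" shows "G x [\<Gamma>K x u v, w] = koszul x u v w"
proof -
  note l = metric_at_linear1[OF met[OF x]]
  have "koszul x u v w = (\<Sum>k<DIM('e). G x [w, E x k] * koszul x u v (E x k))"
    by (rule onb_expand_real[OF met[OF x] onbE[OF x] koszul_linear(3)[OF x]])
  then show ?thesis
    by (simp add: \<Gamma>K_def linear_sum[OF l] linear_cmul[OF l] mult.commute metric_at_sym[OF met[OF x], of w])
qed

text \<open>The vector given by the Koszul formula satisfies both clauses; conversely symmetry and
  compatibility, combined over the three choices of the direction of differentiation, force that
  formula. So the \<open>THE\<close> in \<open>chr\<close> is well defined.\<close>

lemma \<Gamma>_eq:
  assumes x: "x \<in> A" shows "\<Gamma> x = \<Gamma>K x"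
  unfolding chr_def
proof (rule the_equality)
  have pd: "der A (\<lambda>y. G y [v, w]) x u = pder A G x [u, v, w]" for u v w by (simp add: pder_def)
  note s = metric_at_sym[OF met[OF x]]
  show "(\<forall>u v. \<Gamma>K x u v = \<Gamma>K x v u) \<and>
    (\<forall>u v w. der A (\<lambda>y. G y [v, w]) x u = G x [\<Gamma>K x u v, w] + G x [v, \<Gamma>K x u w])"
  proof (intro conjI allI)
    fix u v w
    show "\<Gamma>K x u v = \<Gamma>K x v u"
      using pder_sym[OF x] by (simp add: \<Gamma>K_def koszul_def add.commute)
    have "G x [v, \<Gamma>K x u w] = koszul x u w v" by (subst s) (rule \<Gamma>K_koszul[OF x])
    then show "der A (\<lambda>y. G y [v, w]) x u = G x [\<Gamma>K x u v, w] + G x [v, \<Gamma>K x u w]"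
      unfolding pd \<Gamma>K_koszul[OF x]
      using pder_sym[OF x, of u v w] pder_sym[OF x, of w u v] pder_sym[OF x, of v u w]
      by (simp add: koszul_def field_simps)
  qed
  fix \<Delta> assume \<Delta>: "(\<forall>u v. \<Delta> u v = \<Delta> v u) \<and>
    (\<forall>u v w. der A (\<lambda>y. G y [v, w]) x u = G x [\<Delta> u v, w] + G x [v, \<Delta> u w])"
  show "\<Delta> = \<Gamma>K x"
  proof (intro ext metric_at_eqI[OF met[OF x]])
    fix u v w
    have 1: "pder A G x [u, v, w] = G x [\<Delta> u v, w] + G x [v, \<Delta> u w]" for u v w
      using \<Delta> pd by simp
    have "koszul x u v w = (G x [\<Delta> u v, w] + G x [v, \<Delta> u w] + (G x [\<Delta> v u, w] + G x [u, \<Delta> v w])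
      - (G x [\<Delta> w u, v] + G x [u, \<Delta> w v])) / 2"
      unfolding koszul_def 1 by simp
    also have "\<Delta> v u = \<Delta> u v" using \<Delta> by blast
    also have "\<Delta> w u = \<Delta> u w" using \<Delta> by blast
    also have "\<Delta> w v = \<Delta> v w" using \<Delta> by blast
    also have "G x [\<Delta> u w, v] = G x [v, \<Delta> u w]" by (rule s)
    finally show "G x [\<Delta> u v, w] = G x [\<Gamma>K x u v, w]" unfolding \<Gamma>K_koszul[OF x] by simp
  qed
qed

lemma \<Gamma>_sym: "x \<in> A ==> \<Gamma> x u v = \<Gamma> x v u"
  using pder_sym by (simp add: \<Gamma>_eq \<Gamma>K_def koszul_def add.commute)

lemma \<Gamma>_metric:
  assumes x: "x \<in> A"
  shows "der A (\<lambda>y. G y [v, w]) x u = G x [\<Gamma> x u v, w] + G x [v, \<Gamma> x u w]"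
proof -
  have "G x [v, \<Gamma>K x u w] = koszul x u w v"
    by (subst metric_at_sym[OF met[OF x]]) (rule \<Gamma>K_koszul[OF x])
  moreover have "der A (\<lambda>y. G y [v, w]) x u = pder A G x [u, v, w]" by (simp add: pder_def)
  ultimately show ?thesis
    unfolding \<Gamma>_eq[OF x] \<Gamma>K_koszul[OF x]
    using pder_sym[OF x, of u v w] pder_sym[OF x, of w u v] pder_sym[OF x, of v u w]
    by (simp add: koszul_def field_simps)
qed

text \<open>The means of recognising connections: both the transformation law between charts and the
  tangential part at the boundary are identified by checking these two clauses.\<close>

lemma \<Gamma>_unique:
  assumes x: "x \<in> A" and "\<And>u v. \<Delta> u v = \<Delta> v u"
    and "\<And>u v w. der A (\<lambda>y. G y [v, w]) x u = G x [\<Delta> u v, w] + G x [v, \<Delta> u w]"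
  shows "\<Delta> = \<Gamma> x"
proof (intro ext metric_at_eqI[OF met[OF x]])
  fix u v w
  note s = metric_at_sym[OF met[OF x]]
  have eq: "G x [\<Delta> u v, w] = (der A (\<lambda>y. G y [v, w]) x u + der A (\<lambda>y. G y [u, w]) x v - der A (\<lambda>y. G y [u, v]) x w) / 2"
    if "\<And>u v. \<Delta> u v = \<Delta> v u" "\<And>u v w. der A (\<lambda>y. G y [v, w]) x u = G x [\<Delta> u v, w] + G x [v, \<Delta> u w]" for \<Delta>
    unfolding that(2) using that(1)[of w u] that(1)[of w v] that(1)[of v u] s[of "\<Delta> u w" v] by simp
  show "G x [\<Delta> u v, w] = G x [\<Gamma> x u v, w]"
    using eq[of \<Delta>, OF assms(2,3)] eq[of "\<Gamma> x", OF \<Gamma>_sym[OF x] \<Gamma>_metric[OF x]] by simp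
qed

lemma \<Gamma>_linear:
  assumes x: "x \<in> A" shows "linear (\<Gamma> x u)" "linear (\<lambda>u. \<Gamma> x u v)"
proof -
  note e = metric_at_eqI[OF met[OF x]] and l = metric_at_linear1[OF met[OF x]]
  show "linear (\<Gamma> x u)" unfolding \<Gamma>_eq[OF x]
    by (intro linearI; rule e)
      (simp_all add: linear_add[OF l] linear_cmul[OF l] \<Gamma>K_koszul[OF x]
        linear_add[OF koszul_linear(2)[OF x]] linear_cmul[OF koszul_linear(2)[OF x]])
  show "linear (\<lambda>u. \<Gamma> x u v)" unfolding \<Gamma>_eq[OF x]
    by (intro linearI; rule e)
      (simp_all add: linear_add[OF l] linear_cmul[OF l] \<Gamma>K_koszul[OF x]
        linear_add[OF koszul_linear(1)[OF x]] linear_cmul[OF koszul_linear(1)[OF x]])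
qed

lemma \<Gamma>_smooth: "smooth_on A (\<lambda>x. \<Gamma> x u v)"
proof -
  have "smooth_on A (\<lambda>x. \<Gamma>K x u v)"
    unfolding \<Gamma>K_def
  proof (intro smooth_on_sum smooth_on_scaleR smooth_frame)
    fix k assume k: "k \<in> {..<DIM('e)}"
    have s: "smooth_on A (\<lambda>x. pder A G x (map (\<lambda>V. V x) [U, V, W]))"
      if "smooth_on A U" "smooth_on A V" "smooth_on A W" for U V W
      by (rule tfield_map_smooth[OF tfield_pder[OF reg tG]]) (use that in auto)
    have F: "smooth_on A (\<lambda>x. E x k)" using k by (intro smooth_frame) auto
    have "smooth_on A (\<lambda>x. (1/2) * (pder A G x [u, v, E x k] + pder A G x [v, u, E x k] - pder A G x [E x k, u, v]))"
      using s[of "\<lambda>_. u" "\<lambda>_. v" "\<lambda>x. E x k"] s[of "\<lambda>_. v" "\<lambda>_. u" "\<lambda>x. E x k"] s[of "\<lambda>x. E x k" "\<lambda>_. u" "\<lambda>_. v"]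
      by (intro smooth_on_mult smooth_on_diff smooth_on_add smooth_on_const) (simp_all add: F smooth_on_const)
    then show "smooth_on A (\<lambda>x. koszul x u v (E x k))" by (rule smooth_on_cong) (simp add: koszul_def)
  qed auto
  then show ?thesis by (rule smooth_on_cong) (simp add: \<Gamma>_eq)
qed

lemma tfield_form_ext:
  assumes T: "tfield A p T" and vs: "length vs = p"
  shows "smooth_on A (\<lambda>x. form_ext (\<Gamma> x u) (T x) vs)"
  unfolding form_ext_def
proof (intro smooth_on_sum)
  fix j assume j: "j \<in> {..<length vs}"
  define Vs where "Vs = (map (\<lambda>v (_::'e). v) vs)[j := \<lambda>x. \<Gamma> x u (vs ! j)]"
  have "smooth_on A (\<lambda>x. T x (map (\<lambda>V. V x) Vs))"
  proof (rule tfield_map_smooth[OF T])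
    show "length Vs = p" by (simp add: Vs_def vs)
    fix V assume "V \<in> set Vs"
    then have "V \<in> insert (\<lambda>x. \<Gamma> x u (vs ! j)) (set (map (\<lambda>v _. v) vs))"
      unfolding Vs_def using set_update_subset_insert by fast
    then show "smooth_on A V" by (auto intro: smooth_on_const \<Gamma>_smooth)
  qed
  moreover have "map (\<lambda>V. V x) Vs = vs[j := \<Gamma> x u (vs ! j)]" for x
    by (simp add: Vs_def map_update o_def)
  ultimately show "smooth_on A (\<lambda>x. T x (vs[j := \<Gamma> x u (vs ! j)]))" by simp
qed

lemma tfield_nab:
  assumes T: "tfield A p T" shows "tfield A (Suc p) (nab A G T)"
  unfolding tfield_def
proof (intro conjI ballI allI impI)
  fix x assume x: "x \<in> A"
  show "multilin (Suc p) (nab A G T x)"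
  proof (rule multilin_SucI)
    show "multilin p (\<lambda>vs. nab A G T x (v # vs))" for v
      unfolding nab_def pder_def list.sel
      by (intro multilin_diff multilin_pder[OF reg T x] multilin_form_ext \<Gamma>_linear[OF x] tfield_multilin[OF T x])
    fix vs :: "'e list" assume vs: "length vs = p"
    have "linear (\<lambda>v. T x (vs[j := \<Gamma> x v (vs ! j)]))" if "j < p" for j
    proof -
      have "linear (\<lambda>v. T x (vs[j := v]))" using tfield_multilin[OF T x] vs that by (simp add: multilin_def)
      from linear_compose[OF \<Gamma>_linear(2)[OF x] this] show ?thesis by (simp add: o_def)
    qed
    then show "linear (\<lambda>v. nab A G T x (v # vs))"
      unfolding nab_def pder_def list.sel form_ext_def
      by (intro linear_compose_sub linear_compose_sum ballI der_linear[OF reg tfield_smooth[OF T vs] x]) (simp add: vs)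
  qed
next
  fix ws :: "'e list" assume ws: "length ws = Suc p"
  then show "smooth_on A (\<lambda>x. nab A G T x ws)"
    unfolding nab_def
    by (intro smooth_on_diff tfield_smooth[OF tfield_pder[OF reg T]] tfield_form_ext[OF T]) auto
qed

lemma alternating_nab:
  assumes T: "tfield A p T" and alt: "\<And>y. y \<in> A ==> alternating p (T y)" and x: "x \<in> A"
  shows "alternating p (\<lambda>vs. nab A G T x (u # vs))"
  unfolding alternating_def
proof (intro conjI allI impI)
  show "multilin p (\<lambda>vs. nab A G T x (u # vs))" by (rule multilin_Cons[OF tfield_multilin[OF tfield_nab[OF T] x]])
  fix vs :: "'e list" assume vs: "length vs = p" "\<not> distinct vs"
  have "der A (\<lambda>y. T y vs) x u = der A (\<lambda>y. 0) x u"
    by (rule der_cong[OF x alternating_not_distinct[OF alt vs]])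
  then show "nab A G T x (u # vs) = 0"
    using alternating_not_distinct[OF alternating_form_ext[OF \<Gamma>_linear(1)[OF x] alt[OF x]] vs]
    by (simp add: nab_def pder_def der_const[OF reg x])
qed

definition nabE :: "'e => 'e => nat => 'e" where
  "nabE x u k = der A (\<lambda>y. E y k) x u + \<Gamma> x u (E x k)"

text \<open>Covariant product rule. The Christoffel term of the slot filled by \<open>V\<close> is
  what completes the coordinate derivative of \<open>V\<close> to a covariant one.\<close>

lemma nab_Cons_field:
  assumes T: "tfield A (Suc p) T" and V: "smooth_on A V" and x: "x \<in> A" and vs: "length vs = p"
  shows "nab A G (\<lambda>y vs. T y (V y # vs)) x (u # vs) =
    nab A G T x (u # V x # vs) + T x ((der A V x u + \<Gamma> x u (V x)) # vs)"
  unfolding nab_def pder_def list.sel form_ext_Cons der_Cons_field[OF reg T V x vs]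
  by (simp add: linear_add[OF multilin_head[OF tfield_multilin[OF T x] vs]])

lemma der_metric:
  assumes U: "smooth_on A U" and V: "smooth_on A V" and x: "x \<in> A"
  shows "der A (\<lambda>y. G y [U y, V y]) x u =
    G x [der A U x u + \<Gamma> x u (U x), V x] + G x [U x, der A V x u + \<Gamma> x u (V x)]"
proof -
  have "der A (\<lambda>y. G y [U y, V y]) x u = der A (\<lambda>y. G y [U x, V x]) x u +
      (\<Sum>j<2. G x ([U x, V x][j := der A ([U, V] ! j) x u]))"
    using der_map_fields[OF reg x tG, of "[U, V]" u] U V by auto
  then show ?thesis
    by (simp add: numeral_2_eq_2 \<Gamma>_metric[OF x] linear_add[OF metric_at_linear1[OF met[OF x]]]
        linear_add[OF metric_at_linear2[OF met[OF x]]])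
qed

text \<open>Differentiate the constants \<open>G x [E x k, E x l]\<close>.\<close>

lemma nabE_antisym:
  assumes x: "x \<in> A" and kl: "k < DIM('e)" "l < DIM('e)"
  shows "G x [nabE x u k, E x l] + G x [E x k, nabE x u l] = 0"
proof -
  have "der A (\<lambda>y. G y [E y k, E y l]) x u = der A (\<lambda>y. if k = l then 1 else 0) x u"
    using onbE kl by (intro der_cong[OF x]) (auto simp: onb_def)
  then show ?thesis
    using der_metric[OF smooth_frame[OF kl(1)] smooth_frame[OF kl(2)] x, of u]
    by (simp add: nabE_def der_const[OF reg x])
qed

text \<open>Induction on the rank. Filling the first slot with a frame field adds terms containing
  \<open>nabE\<close>; they cancel in the sum over the frame because \<open>nabE\<close> is skew
  (\<open>onb_antisym_sum\<close>).\<close>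

lemma der_contract:
  assumes x: "x \<in> A"
  shows "tfield A p \<alpha> ==> tfield A p \<beta> ==>
    smooth_on A (\<lambda>y. contract (E y) p (\<alpha> y) (\<beta> y)) \<and>
    der A (\<lambda>y. contract (E y) p (\<alpha> y) (\<beta> y)) x u =
      contract (E x) p (\<lambda>vs. nab A G \<alpha> x (u # vs)) (\<beta> x) + contract (E x) p (\<alpha> x) (\<lambda>vs. nab A G \<beta> x (u # vs))"
proof (induction p arbitrary: \<alpha> \<beta>)
  case 0
  have s: "smooth_on A (\<lambda>y. \<alpha> y [])" "smooth_on A (\<lambda>y. \<beta> y [])" using 0 by (auto simp: tfield_def)
  show ?case
    using smooth_on_mult[OF s] der_mult[OF reg s x] by (simp add: nab_def pder_def form_ext_Nil)
next
  case (Suc p)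
  define \<alpha>' where "\<alpha>' k y vs = \<alpha> y (E y k # vs)" for k y vs
  define \<beta>' where "\<beta>' k y vs = \<beta> y (E y k # vs)" for k y vs
  have t: "tfield A p (\<alpha>' k)" "tfield A p (\<beta>' k)" if "k < DIM('e)" for k
    unfolding \<alpha>'_def[abs_def] \<beta>'_def[abs_def]
    using tfield_Cons_field[OF Suc.prems(1) smooth_frame[OF that]] tfield_Cons_field[OF Suc.prems(2) smooth_frame[OF that]] by auto
  have IH: "smooth_on A (\<lambda>y. contract (E y) p (\<alpha>' k y) (\<beta>' k y))"
    "der A (\<lambda>y. contract (E y) p (\<alpha>' k y) (\<beta>' k y)) x u =
      contract (E x) p (\<lambda>vs. nab A G (\<alpha>' k) x (u # vs)) (\<beta>' k x) + contract (E x) p (\<alpha>' k x) (\<lambda>vs. nab A G (\<beta>' k) x (u # vs))"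
    if "k < DIM('e)" for k
    using Suc.IH[OF t[OF that]] by auto
  have eq: "contract (E y) (Suc p) (\<alpha> y) (\<beta> y) = (\<Sum>k<DIM('e). contract (E y) p (\<alpha>' k y) (\<beta>' k y))" for y
    by (simp add: \<alpha>'_def \<beta>'_def)
  have sm: "smooth_on A (\<lambda>y. contract (E y) (Suc p) (\<alpha> y) (\<beta> y))"
    unfolding eq by (intro smooth_on_sum IH) auto
  have n\<alpha>: "nab A G (\<alpha>' k) x (u # vs) = nab A G \<alpha> x (u # E x k # vs) + \<alpha> x (nabE x u k # vs)"
    if "k < DIM('e)" "length vs = p" for k vs
    unfolding \<alpha>'_def[abs_def] nabE_def by (rule nab_Cons_field[OF Suc.prems(1) smooth_frame[OF that(1)] x that(2)])
  have n\<beta>: "nab A G (\<beta>' k) x (u # vs) = nab A G \<beta> x (u # E x k # vs) + \<beta> x (nabE x u k # vs)"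
    if "k < DIM('e)" "length vs = p" for k vs
    unfolding \<beta>'_def[abs_def] nabE_def by (rule nab_Cons_field[OF Suc.prems(2) smooth_frame[OF that(1)] x that(2)])
  let ?B = "\<lambda>a b. contract (E x) p (\<lambda>vs. \<alpha> x (a # vs)) (\<lambda>vs. \<beta> x (b # vs))"
  have "der A (\<lambda>y. contract (E y) (Suc p) (\<alpha> y) (\<beta> y)) x u = (\<Sum>k<DIM('e). der A (\<lambda>y. contract (E y) p (\<alpha>' k y) (\<beta>' k y)) x u)"
    unfolding eq by (rule der_sum[OF reg _ x]) (use IH in auto)
  also have "\<dots> = (\<Sum>k<DIM('e). (contract (E x) p (\<lambda>vs. nab A G \<alpha> x (u # E x k # vs)) (\<beta>' k x) +
      contract (E x) p (\<alpha>' k x) (\<lambda>vs. nab A G \<beta> x (u # E x k # vs))) +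
      (?B (nabE x u k) (E x k) + ?B (E x k) (nabE x u k)))"
  proof (rule sum.cong[OF refl])
    fix k assume "k \<in> {..<DIM('e)}"
    then have k: "k < DIM('e)" by simp
    have "contract (E x) p (\<lambda>vs. nab A G (\<alpha>' k) x (u # vs)) (\<beta>' k x) =
      tsum (E x) p (\<lambda>vs. nab A G \<alpha> x (u # E x k # vs) * \<beta>' k x vs + \<alpha> x (nabE x u k # vs) * \<beta> x (E x k # vs))"
      by (rule tsum_cong) (simp add: n\<alpha>[OF k] \<beta>'_def distrib_right)
    moreover have "contract (E x) p (\<alpha>' k x) (\<lambda>vs. nab A G (\<beta>' k) x (u # vs)) =
      tsum (E x) p (\<lambda>vs. \<alpha>' k x vs * nab A G \<beta> x (u # E x k # vs) + \<alpha> x (E x k # vs) * \<beta> x (nabE x u k # vs))"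
      by (rule tsum_cong) (simp add: n\<beta>[OF k] \<alpha>'_def distrib_left)
    ultimately show "der A (\<lambda>y. contract (E y) p (\<alpha>' k y) (\<beta>' k y)) x u =
      (contract (E x) p (\<lambda>vs. nab A G \<alpha> x (u # E x k # vs)) (\<beta>' k x) +
      contract (E x) p (\<alpha>' k x) (\<lambda>vs. nab A G \<beta> x (u # E x k # vs))) +
      (?B (nabE x u k) (E x k) + ?B (E x k) (nabE x u k))"
      unfolding IH(2)[OF k] by (simp add: tsum_add)
  qed
  also have "\<dots> = (\<Sum>k<DIM('e). contract (E x) p (\<lambda>vs. nab A G \<alpha> x (u # E x k # vs)) (\<beta>' k x) +
      contract (E x) p (\<alpha>' k x) (\<lambda>vs. nab A G \<beta> x (u # E x k # vs)))"
    unfolding sum.distrib[of _ "\<lambda>k. ?B (nabE x u k) (E x k) + ?B (E x k) (nabE x u k)"]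
      sum.distrib[of "\<lambda>k. contract (E x) p (\<lambda>vs. nab A G \<alpha> x (u # E x k # vs)) (\<beta>' k x) + contract (E x) p (\<alpha>' k x) (\<lambda>vs. nab A G \<beta> x (u # E x k # vs))"]
    using onb_antisym_sum[OF met[OF x] onbE[OF x] contract_linear1 contract_linear2 nabE_antisym[OF x],
        OF tfield_multilin[OF Suc.prems(1) x] tfield_multilin[OF Suc.prems(2) x]] by simp
  finally show ?case using sm by (simp add: \<alpha>'_def \<beta>'_def sum.distrib)
qed

section \<open>Volume density and divergence in a chart\<close>

definition dens :: "'e => real" where "dens x = sqrt (gram_det (G x))"

text \<open>Up to sign the reciprocal of \<open>dens\<close>. Its derivative is that of a fixed top
  degree form evaluated on moving vectors.\<close>

definition evol :: "'e => real" where "evol x = vol_std (map (E x) [0..<DIM('e)])"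

text \<open>The frame moves by an endomorphism whose trace is the logarithmic derivative of its
  volume. Since \<open>nabE\<close> has no diagonal part, that trace is minus the trace of the
  connection.\<close>

lemma evol_smooth: "smooth_on A evol"
  and der_evol: "x \<in> A ==> der A evol x u = - trace_wrt (G x) (\<Gamma> x u) * evol x"
proof -
  let ?Vs = "map (\<lambda>k y. E y k) [0..<DIM('e)]"
  have tv: "tfield A DIM('e) (\<lambda>y. vol_std)"
    by (auto simp: tfield_def intro: alternating_multilin[OF alternating_vol_std] smooth_on_const)
  have sV: "smooth_on A V" if "V \<in> set ?Vs" for V using that smooth_frame by auto
  have mp: "map (\<lambda>V. V y) ?Vs = map (E y) [0..<DIM('e)]" for y by (simp add: o_def)
  have ev: "evol = (\<lambda>y. vol_std (map (\<lambda>V. V y) ?Vs))" unfolding mp by (simp add: evol_def fun_eq_iff)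
  show "smooth_on A evol" unfolding ev by (rule tfield_map_smooth[OF tv _ sV]) auto
  assume x: "x \<in> A"
  let ?es = "map (E x) [0..<DIM('e)]"
  have len: "length ?es = DIM('e)" and lenV: "length ?Vs = DIM('e)" by simp_all
  \<comment> \<open>The endomorphism taking each frame vector to its coordinate derivative along
    \<open>u\<close>.\<close>
  define S where "S v = (\<Sum>k<DIM('e). G x [v, E x k] *\<^sub>R der A (\<lambda>y. E y k) x u)" for v
  note l1 = metric_at_linear1[OF met[OF x]]
  have S: "linear S" unfolding S_def
    by (auto intro!: linearI simp: linear_add[OF l1] linear_cmul[OF l1] scaleR_add_left sum.distrib scaleR_sum_right)
  have SE: "S (E x j) = der A (\<lambda>y. E y j) x u" if "j < DIM('e)" for j
  proof -
    have "S (E x j) = (\<Sum>k<DIM('e). if k = j then der A (\<lambda>y. E y k) x u else 0)"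
      unfolding S_def using onbE[OF x] that by (intro sum.cong refl) (auto simp: onb_def)
    then show ?thesis using that by simp
  qed
  have "der A evol x u = (\<Sum>j<DIM('e). vol_std (?es[j := der A (?Vs ! j) x u]))"
    unfolding ev using der_map_fields[OF reg x tv lenV sV, where u=u] unfolding mp
    by (simp add: der_const[OF reg x])
  also have "\<dots> = form_ext S vol_std ?es"
    unfolding form_ext_def len by (intro sum.cong refl) (simp add: SE)
  also have "\<dots> = trace_wrt (G x) S * evol x"
    unfolding evol_def by (rule form_ext_top[OF met[OF x] S alternating_vol_std len])
  also have "trace_wrt (G x) S = (\<Sum>k<DIM('e). - G x [\<Gamma> x u (E x k), E x k])"
    unfolding trace_wrt_def
  proof (rule sum.cong[OF refl])
    fix k assume "k \<in> {..<DIM('e)}"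
    then have k: "k < DIM('e)" by simp
    have "2 * G x [nabE x u k, E x k] = 0"
      using nabE_antisym[OF x k k, of u] metric_at_sym[OF met[OF x], of "E x k" "nabE x u k"] by simp
    then show "G x [S (E x k), E x k] = - G x [\<Gamma> x u (E x k), E x k]"
      unfolding SE[OF k] nabE_def by (simp add: linear_add[OF l1])
  qed
  also have "\<dots> = - trace_wrt (G x) (\<Gamma> x u)" by (simp add: trace_wrt_def sum_negf)
  finally show "der A evol x u = - trace_wrt (G x) (\<Gamma> x u) * evol x" by simp
qed

lemma evol_nonzero: "x \<in> A ==> evol x \<noteq> 0"
  and dens_evol: "x \<in> A ==> dens x = (evol x * evol x) powr (- 1 / 2)"
proof -
  assume x: "x \<in> A"
  have 1: "gram_det (G x) * (evol x)\<^sup>2 = 1"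
    unfolding evol_def by (rule gram_det_vol_std[OF met[OF x] frame_onb[OF onbE[OF x]]])
  then show nz: "evol x \<noteq> 0" by auto
  then have "evol x * evol x > 0" by (simp add: zero_less_mult_iff) linarith
  then have pos: "evol x * evol x > 0" .
  have "gram_det (G x) = inverse (evol x * evol x)"
    by (rule inverse_unique[symmetric]) (use 1 in \<open>simp add: power2_eq_square mult.commute\<close>)
  then have "dens x = inverse (sqrt (evol x * evol x))"
    by (simp only: dens_def real_sqrt_inverse)
  also have "sqrt (evol x * evol x) = (evol x * evol x) powr (1 / 2)"
    using pos by (intro powr_half_sqrt[symmetric]) simp
  also have "inverse \<dots> = (evol x * evol x) powr (- 1 / 2)"
    by (simp only: powr_minus[symmetric] minus_divide_left)
  finally show "dens x = (evol x * evol x) powr (- 1 / 2)" .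
qed

lemma dens_smooth: "smooth_on A dens"
proof -
  have "smooth_on A (\<lambda>x. (evol x * evol x) powr (- 1 / 2))"
  proof (intro smooth_on_powr smooth_on_mult evol_smooth)
    show "evol x * evol x > 0" if "x \<in> A" for x
      using evol_nonzero[OF that] by (simp add: zero_less_mult_iff) linarith
  qed
  then show ?thesis by (rule smooth_on_cong) (rule dens_evol)
qed

lemma dens_pos: "x \<in> A ==> dens x > 0"
  unfolding dens_def using gram_det_pos[OF met] by simp

text \<open>Differentiate the identity \<open>dens\<^sup>2 * evol\<^sup>2 = 1\<close>.\<close>

lemma der_dens:
  assumes x: "x \<in> A" shows "der A dens x u = dens x * trace_wrt (G x) (\<Gamma> x u)"
proof -
  let ?t = "trace_wrt (G x) (\<Gamma> x u)"
  have sd: "smooth_on A (\<lambda>y. (dens y * dens y) * (evol y * evol y))"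
    by (intro smooth_on_mult dens_smooth evol_smooth)
  have one: "(dens y * dens y) * (evol y * evol y) = 1" if "y \<in> A" for y
  proof -
    have "dens y * dens y = gram_det (G y)" unfolding dens_def using gram_det_pos[OF met[OF that]] by simp
    then show ?thesis
      using gram_det_vol_std[OF met[OF that] frame_onb[OF onbE[OF that]]] by (simp add: evol_def power2_eq_square)
  qed
  have "der A (\<lambda>y. (dens y * dens y) * (evol y * evol y)) x u = 0"
    using der_cong[OF x one] der_const[OF reg x, of 1 u] by simp
  then have "(dens x * dens x) * (evol x * der A evol x u + der A evol x u * evol x) +
     (dens x * der A dens x u + der A dens x u * dens x) * (evol x * evol x) = 0"
    by (simp add: der_mult[OF reg _ _ x] dens_smooth evol_smooth smooth_on_mult)
  then have "2 * (dens x * evol x * evol x) * (der A dens x u - dens x * ?t) = 0"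
    unfolding der_evol[OF x] by (simp add: algebra_simps)
  then show ?thesis using dens_pos[OF x] evol_nonzero[OF x] by simp
qed

text \<open>The classical expression of the divergence by the density. With \<open>X\<close> dual to
  \<theta>, the derivative of the density contributes the trace of \<open>\<Gamma> x (X x)\<close>,
  which vanishing torsion identifies with the connection part of the covariant derivative of
  \<open>X\<close>.\<close>

lemma divergence_local:
  assumes \<theta>: "tfield A 1 \<theta>" and x: "x \<in> A"
  defines "X \<equiv> \<lambda>y. \<Sum>k<DIM('e). \<theta> y [E y k] *\<^sub>R E y k"
  shows "smooth_on A X"
    and "(\<Sum>b\<in>Basis. der A (\<lambda>y. dens y * (X y \<bullet> b)) x b) = dens x * (\<Sum>k<DIM('e). nab A G \<theta> x [E x k, E x k])"
proof -
  have GX: "G y [X y, v] = \<theta> y [v]" if y: "y \<in> A" for y v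
  proof -
    have lin: "linear (\<lambda>v. \<theta> y [v])" using multilin_head[of 0 "\<theta> y" "[]"] tfield_multilin[OF \<theta> y] by simp
    have "\<theta> y [v] = (\<Sum>k<DIM('e). G y [v, E y k] * \<theta> y [E y k])"
      by (rule onb_expand_real[OF met[OF y] onbE[OF y] lin])
    then show ?thesis
      by (simp add: X_def linear_sum[OF metric_at_linear1[OF met[OF y]]] linear_cmul[OF metric_at_linear1[OF met[OF y]]]
          metric_at_sym[OF met[OF y], of v] mult.commute)
  qed
  show sX: "smooth_on A X"
    unfolding X_def
  proof (intro smooth_on_sum smooth_on_scaleR smooth_frame)
    fix k assume "k \<in> {..<DIM('e)}"
    then show "smooth_on A (\<lambda>y. \<theta> y [E y k])"
      using tfield_map_smooth[OF \<theta>, of "[\<lambda>y. E y k]"] smooth_frame[of k] by auto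
  qed auto
  let ?D = "der A X x"
  note l1 = metric_at_linear1[OF met[OF x]]
  have Dlin: "linear ?D" by (rule der_linear[OF reg sX x])
  \<comment> \<open>The covariant derivative commutes with passing to the dual vector; symmetry of
    the connection puts \<open>X x\<close> first, as it occurs in the derivative of the
    density.\<close>
  have key: "G x [?D u + \<Gamma> x (X x) u, v] = nab A G \<theta> x [u, v]" for u v
  proof -
    have "der A (\<lambda>y. \<theta> y [v]) x u = der A (\<lambda>y. G y [X y, v]) x u"
      by (rule der_cong[OF x]) (simp add: GX)
    also have "\<dots> = G x [?D u + \<Gamma> x u (X x), v] + G x [X x, \<Gamma> x u v]"
      using der_metric[OF sX smooth_on_const x, of v u] by (simp add: der_const[OF reg x])
    also have "G x [X x, \<Gamma> x u v] = \<theta> x [\<Gamma> x u v]" by (rule GX[OF x])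
    finally show ?thesis
      by (simp add: nab_def pder_def form_ext_def \<Gamma>_sym[OF x, of u])
  qed
  have sb: "smooth_on A (\<lambda>y. X y \<bullet> b)" for b by (intro smooth_on_inner sX smooth_on_const)
  have "(\<Sum>b\<in>Basis. der A (\<lambda>y. dens y * (X y \<bullet> b)) x b) =
    dens x * (\<Sum>b\<in>Basis. ?D b \<bullet> b) + (\<Sum>b\<in>Basis. (X x \<bullet> b) * der A dens x b)"
    by (simp add: der_mult[OF reg dens_smooth sb x] der_inner_const[OF reg sX x] sum.distrib sum_distrib_left mult.commute)
  also have "(\<Sum>b\<in>Basis. (X x \<bullet> b) * der A dens x b) = der A dens x (X x)"
  proof -
    note ld = der_linear[OF reg dens_smooth x]
    have "der A dens x (X x) = der A dens x (\<Sum>b\<in>Basis. (X x \<bullet> b) *\<^sub>R b)" by (simp add: euclidean_representation)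
    then show ?thesis by (simp add: linear_sum[OF ld] linear_cmul[OF ld])
  qed
  also have "\<dots> = dens x * trace_wrt (G x) (\<Gamma> x (X x))" by (rule der_dens[OF x])
  also have "(\<Sum>b\<in>Basis. ?D b \<bullet> b) = trace_wrt (G x) ?D"
    by (rule trace_wrt_Basis[OF met[OF x] Dlin, symmetric])
  also have "dens x * trace_wrt (G x) ?D + dens x * trace_wrt (G x) (\<Gamma> x (X x)) =
    dens x * (\<Sum>k<DIM('e). G x [?D (E x k) + \<Gamma> x (X x) (E x k), E x k])"
    by (simp add: trace_wrt_def linear_add[OF l1] sum.distrib distrib_left)
  finally show "(\<Sum>b\<in>Basis. der A (\<lambda>y. dens y * (X y \<bullet> b)) x b) = dens x * (\<Sum>k<DIM('e). nab A G \<theta> x [E x k, E x k])"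
    by (simp add: key)
qed

text \<open>The one-form dual to the contraction of \<open>\<phi>\<close> with \<open>T\<close>, whose divergence gives Green's formula.\<close>

lemma green_local:
  assumes \<phi>: "tfield A p \<phi>" and T: "tfield A (Suc p) T"
  defines "\<theta> \<equiv> \<lambda>y ws. contract (E y) p (\<phi> y) (\<lambda>vs. T y (hd ws # vs))"
  shows "tfield A 1 \<theta>"
    and "x \<in> A ==> nab A G \<theta> x [u, v] = contract (E x) p (\<lambda>vs. nab A G \<phi> x (u # vs)) (\<lambda>vs. T x (v # vs)) +
      contract (E x) p (\<phi> x) (\<lambda>vs. nab A G T x (u # v # vs))"
proof -
  have dc: "smooth_on A (\<lambda>y. contract (E y) p (\<phi> y) (\<lambda>vs. T y (v # vs)))"
    "der A (\<lambda>y. contract (E y) p (\<phi> y) (\<lambda>vs. T y (v # vs))) x u =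
      contract (E x) p (\<lambda>vs. nab A G \<phi> x (u # vs)) (\<lambda>vs. T x (v # vs)) +
      contract (E x) p (\<phi> x) (\<lambda>vs. nab A G (\<lambda>y vs. T y (v # vs)) x (u # vs))" if "x \<in> A" for x u v
    using der_contract[OF that \<phi> tfield_Cons[OF T, of v]] by auto
  show "tfield A 1 \<theta>"
    unfolding tfield_def
  proof (intro conjI ballI allI impI)
    fix y assume y: "y \<in> A"
    show "multilin 1 (\<theta> y)"
      unfolding One_nat_def
      by (intro multilin_SucI multilin_0) (use contract_linear2[OF tfield_multilin[OF T y]] in \<open>simp add: \<theta>_def\<close>)
  next
    fix vs :: "'e list" assume "length vs = 1"
    show "smooth_on A (\<lambda>y. \<theta> y vs)"
    proof (cases "A = {}")
      case False
      then show ?thesis unfolding \<theta>_def using dc(1) by blast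
    qed (simp add: smooth_on_def)
  qed
  assume x: "x \<in> A"
  have "nab A G (\<lambda>y vs. T y (v # vs)) x (u # vs) = nab A G T x (u # v # vs) + T x (\<Gamma> x u v # vs)"
    if "length vs = p" for vs
    using nab_Cons_field[OF T smooth_on_const x that, of v u] by (simp add: der_const[OF reg x])
  then have "contract (E x) p (\<phi> x) (\<lambda>vs. nab A G (\<lambda>y vs. T y (v # vs)) x (u # vs)) =
     tsum (E x) p (\<lambda>vs. \<phi> x vs * nab A G T x (u # v # vs) + \<phi> x vs * T x (\<Gamma> x u v # vs))"
    by (intro tsum_cong) (simp add: distrib_left)
  moreover have "nab A G \<theta> x [u, v] = der A (\<lambda>y. contract (E y) p (\<phi> y) (\<lambda>vs. T y (v # vs))) x u - \<theta> x [\<Gamma> x u v]"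
    by (simp add: nab_def pder_def form_ext_def \<theta>_def)
  ultimately show "nab A G \<theta> x [u, v] = contract (E x) p (\<lambda>vs. nab A G \<phi> x (u # vs)) (\<lambda>vs. T x (v # vs)) +
      contract (E x) p (\<phi> x) (\<lambda>vs. nab A G T x (u # v # vs))"
    by (simp add: dc(2)[OF x] tsum_add \<theta>_def)
qed

end

section \<open>The exterior derivative\<close>

text \<open>Unnormalised alternation over the choice of the first slot only, suited to tensors that
  already alternate in the others; applied to coordinate derivatives it is
  \<open>ext_d\<close>.\<close>

definition alt :: "('e list => real) => 'e list => real" where
  "alt T vs = (\<Sum>j<length vs. (-1)^j * T (vs ! j # take j vs @ drop (Suc j) vs))"

lemma ext_d_alt: "ext_d M \<omega> i x = alt (pder (cimg M i) (\<omega> i) x)"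
  by (simp add: fun_eq_iff ext_d_def alt_def pder_def dirderiv_def)

lemma alt_Nil: "alt T [] = 0"
  by (simp add: alt_def)

lemma alt_Cons: "alt T (v # vs) = T (v # vs) - alt (\<lambda>ws. T (hd ws # v # tl ws)) vs"
proof -
  have "alt T (v # vs) = (\<Sum>j<Suc (length vs). (-1)^j * T ((v # vs) ! j # take j (v # vs) @ drop (Suc j) (v # vs)))"
    by (simp only: alt_def length_Cons)
  also have "\<dots> = T (v # vs) + (\<Sum>j<length vs. - ((-1)^j * T (vs ! j # v # take j vs @ drop (Suc j) vs)))"
    unfolding sum.lessThan_Suc_shift by simp
  finally show ?thesis by (simp add: alt_def sum_negf)
qed

lemma alt_cong: "(\<And>w ws. Suc (length ws) = length vs ==> T (w # ws) = T' (w # ws)) ==> alt T vs = alt T' vs"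
  unfolding alt_def by (intro sum.cong refl) simp

lemma alt_diff: "alt (\<lambda>ws. T ws - T' ws) vs = alt T vs - alt T' vs"
  by (simp add: alt_def right_diff_distrib sum_subtractf)

lemma alt_zero: "(\<And>w ws. Suc (length ws) = length vs ==> T (w # ws) = 0) ==> alt T vs = 0"
  unfolding alt_def by (intro sum.neutral ballI) simp

lemma linear_alt:
  assumes "\<And>w ws. Suc (length ws) = length vs ==> linear (\<lambda>v. T v (w # ws))"
  shows "linear (\<lambda>v. alt (T v) vs)"
  unfolding alt_def using assms
  by (intro linear_compose_sum ballI linear_cmul_fun) simp

lemma alt_map:
  "alt T (map L vs) = alt (\<lambda>ws. T (map L ws)) vs"
  unfolding alt_def by (intro sum.cong) (auto simp: take_map drop_map)

lemma multilin_alt: "multilin p T ==> multilin p (alt T)"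
proof (induction p arbitrary: T)
  case (Suc p)
  have m2: "multilin p (\<lambda>ws. T (hd ws # v # tl ws))" for v
  proof (cases p)
    case (Suc q)
    show ?thesis unfolding Suc
    proof (rule multilin_SucI)
      show "multilin q (\<lambda>vs. T (hd (w # vs) # v # tl (w # vs)))" for w
        using multilin_Cons[OF multilin_Cons[OF Suc.prems[unfolded Suc]]] by simp
      show "linear (\<lambda>w. T (hd (w # vs) # v # tl (w # vs)))" if "length vs = q" for vs
        using multilin_head[OF Suc.prems[unfolded Suc], of "v # vs"] that by simp
    qed
  qed (simp add: multilin_0)
  show ?case
  proof (rule multilin_SucI)
    show "multilin p (\<lambda>vs. alt T (v # vs))" for v
      unfolding alt_Cons by (intro multilin_diff multilin_Cons[OF Suc.prems] Suc.IH m2)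
    show "linear (\<lambda>v. alt T (v # vs))" if vs: "length vs = p" for vs
      unfolding alt_Cons
    proof (intro linear_compose_sub multilin_head[OF Suc.prems vs] linear_alt)
      fix w and ws :: "'a list" assume "Suc (length ws) = length vs"
      then show "linear (\<lambda>v. T (hd (w # ws) # v # tl (w # ws)))"
        using multilin_mid[OF Suc.prems, of "[w]" ws] vs by simp
    qed
  qed
qed (rule multilin_0)

text \<open>The two terms that pull one copy of \<open>x\<close> to the front cancel; every other
  term still contains the adjacent pair.\<close>

lemma alt_adjacent:
  "(\<And>v. alternating p (\<lambda>vs. T (v # vs))) ==> length a + Suc (Suc (length b)) = Suc p ==> alt T (a @ x # x # b) = 0"
proof (induction a arbitrary: p T)
  case Nil
  have "alt (\<lambda>ws. T (hd ws # x # x # tl ws)) b = 0"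
  proof (rule alt_zero)
    fix w and ws :: "'a list" assume "Suc (length ws) = length b"
    then show "T (hd (w # ws) # x # x # tl (w # ws)) = 0"
      using alternating_not_distinct[OF Nil.prems(1), of "x # x # ws"] Nil.prems(2) by simp
  qed
  then show ?case by (simp add: alt_Cons)
next
  case (Cons v a)
  then obtain q where q: "p = Suc q" by (cases p) auto
  have "alternating q (\<lambda>vs. T (w # v # vs))" for w
    using alternating_Cons[OF Cons.prems(1)[of w, unfolded q]] .
  then have "alt (\<lambda>ws. T (hd ws # v # tl ws)) (a @ x # x # b) = 0"
    using Cons.prems(2) q by (intro Cons.IH[of q]) auto
  moreover have "T (v # a @ x # x # b) = 0"
    using Cons.prems(2) by (intro alternating_not_distinct[OF Cons.prems(1)]) auto
  ultimately show ?case by (simp add: alt_Cons)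
qed

lemma alternating_alt:
  assumes "multilin (Suc p) T" "\<And>v. alternating p (\<lambda>vs. T (v # vs))"
  shows "alternating (Suc p) (alt T)"
  by (rule alternatingI_adjacent[OF multilin_alt[OF assms(1)]]) (rule alt_adjacent[OF assms(2)])

text \<open>The cancellation in pairs that also underlies the vanishing of d squared; here it
  disposes of the Christoffel terms.\<close>

lemma alt_symmetric2:
  "(\<And>u v ws. B u v ws = B v u ws) ==> alt (\<lambda>ws. alt (\<lambda>rs. B (hd ws) (hd rs) (tl rs)) (tl ws)) vs = 0"
proof (induction vs arbitrary: B)
  case (Cons v vs)
  have "alt (\<lambda>ws. alt (\<lambda>rs. B (hd ws) (hd rs) (tl rs)) (tl ws)) (v # vs) =
    alt (\<lambda>rs. B v (hd rs) (tl rs)) vs - (alt (\<lambda>ws. B (hd ws) v (tl ws)) vs -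
      alt (\<lambda>ws. alt (\<lambda>rs. B (hd ws) (hd rs) (v # tl rs)) (tl ws)) vs)"
    unfolding alt_Cons list.sel alt_diff ..
  also have "alt (\<lambda>ws. B (hd ws) v (tl ws)) vs = alt (\<lambda>rs. B v (hd rs) (tl rs)) vs"
    by (rule alt_cong) (rule Cons.prems)
  also have "alt (\<lambda>ws. alt (\<lambda>rs. B (hd ws) (hd rs) (v # tl rs)) (tl ws)) vs = 0"
    by (rule Cons.IH) (rule Cons.prems)
  finally show ?case by simp
qed (simp add: alt_Nil)

lemma form_ext_alt:
  assumes "alternating p \<omega>" "length ws = p"
  shows "form_ext S \<omega> ws = alt (\<lambda>rs. \<omega> (S (hd rs) # tl rs)) ws"
  unfolding form_ext_def alt_def
proof (rule sum.cong[OF refl])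
  fix j assume "j \<in> {..<length ws}"
  then have j: "j < length ws" by simp
  have "\<omega> (take j ws @ S (ws ! j) # drop (Suc j) ws) = (-1) ^ length (take j ws) * \<omega> (S (ws ! j) # take j ws @ drop (Suc j) ws)"
    using assms j by (intro alternating_move[OF assms(1)]) simp
  then show "\<omega> (ws[j := S (ws ! j)]) = (-1) ^ j * \<omega> (S (hd (ws ! j # take j ws @ drop (Suc j) ws)) # tl (ws ! j # take j ws @ drop (Suc j) ws))"
    using j by (simp add: upd_conv_take_nth_drop)
qed

lemma alt_form_ext_symmetric:
  assumes "alternating p \<omega>" "\<And>u v. \<Gamma> u v = \<Gamma> v u" "length vs = Suc p"
  shows "alt (\<lambda>ws. form_ext (\<Gamma> (hd ws)) \<omega> (tl ws)) vs = 0"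
proof -
  have "alt (\<lambda>ws. form_ext (\<Gamma> (hd ws)) \<omega> (tl ws)) vs =
    alt (\<lambda>ws. alt (\<lambda>rs. \<omega> (\<Gamma> (hd ws) (hd rs) # tl rs)) (tl ws)) vs"
    by (rule alt_cong) (use assms form_ext_alt[OF assms(1)] in simp)
  also have "\<dots> = 0" by (rule alt_symmetric2) (simp add: assms(2))
  finally show ?thesis .
qed

text \<open>Each of the \<open>p + 1\<close> terms of the alternation has the same contraction with
  \<omega>, whose own sign absorbs the sign of the term. This is where d and \<nabla> differ in
  normalisation.\<close>

lemma contract_alt:
  fixes E :: "nat => 'e::euclidean_space"
  shows "alternating (Suc p) \<omega> ==> contract E (Suc p) (alt T) \<omega> = real (Suc p) * contract E (Suc p) T \<omega>"
proof (induction p arbitrary: T \<omega>)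
  case 0
  then show ?case by (simp add: alt_Cons alt_Nil)
next
  case (Suc p)
  let ?T = "\<lambda>k ws. T (hd ws # E k # tl ws)"
  have IH: "contract E (Suc p) (alt (?T k)) (\<lambda>vs. \<omega> (E k # vs)) =
    - real (Suc p) * (\<Sum>l<DIM('e). tsum E p (\<lambda>vs. T (E l # E k # vs) * \<omega> (E l # E k # vs)))" for k
  proof -
    have sw: "\<omega> (E k # E l # vs) = - \<omega> (E l # E k # vs)" if "length vs = p" for l vs
      using alternating_move[OF Suc.prems, of "[E k]" vs "E l"] that by simp
    have "contract E (Suc p) (alt (?T k)) (\<lambda>vs. \<omega> (E k # vs)) =
      real (Suc p) * contract E (Suc p) (?T k) (\<lambda>vs. \<omega> (E k # vs))"
      by (rule Suc.IH[OF alternating_Cons[OF Suc.prems]])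
    also have "contract E (Suc p) (?T k) (\<lambda>vs. \<omega> (E k # vs)) =
      (\<Sum>l<DIM('e). tsum E p (\<lambda>vs. (-1) * (T (E l # E k # vs) * \<omega> (E l # E k # vs))))"
      unfolding tsum.simps list.sel by (intro sum.cong refl tsum_cong) (simp add: sw)
    finally show ?thesis
      unfolding tsum_cmul sum_distrib_left[symmetric]
      by (simp only: mult_minus1 mult_minus_left mult_minus_right)
  qed
  have "contract E (Suc (Suc p)) (alt T) \<omega> =
    (\<Sum>k<DIM('e). tsum E (Suc p) (\<lambda>vs. T (E k # vs) * \<omega> (E k # vs) + (-1) * (alt (?T k) vs * \<omega> (E k # vs))))"
    unfolding tsum.simps(2)[of E "Suc p"] alt_Cons by (intro sum.cong refl tsum_cong) (simp add: algebra_simps)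
  also have "\<dots> = contract E (Suc (Suc p)) T \<omega> - (\<Sum>k<DIM('e). contract E (Suc p) (alt (?T k)) (\<lambda>vs. \<omega> (E k # vs)))"
    unfolding tsum_add tsum_cmul sum.distrib tsum.simps(2)[of E "Suc p"] by (simp add: sum_negf)
  also have "(\<Sum>k<DIM('e). contract E (Suc p) (alt (?T k)) (\<lambda>vs. \<omega> (E k # vs))) =
    - real (Suc p) * (\<Sum>l<DIM('e). \<Sum>k<DIM('e). tsum E p (\<lambda>vs. T (E l # E k # vs) * \<omega> (E l # E k # vs)))"
    unfolding IH sum_distrib_left[symmetric] by (subst sum.swap) simp
  finally show ?case by (simp add: algebra_simps)
qed

text \<open>Symmetry of the connection removes the Christoffel terms, so d is the alternation of the
  covariant derivative.\<close>

lemma (in chart_metric) alt_pder_nab: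
  assumes "tfield A p T" "alternating p (T x)" "x \<in> A" "length vs = Suc p"
  shows "alt (pder A T x) vs = alt (nab A G T x) vs"
proof -
  have "alt (nab A G T x) vs = alt (pder A T x) vs - alt (\<lambda>ws. form_ext (\<Gamma> x (hd ws)) (T x) (tl ws)) vs"
    unfolding nab_def alt_diff ..
  then show ?thesis using alt_form_ext_symmetric[OF assms(2) \<Gamma>_sym[OF assms(3)] assms(4)] by simp
qed

section \<open>Compact manifolds modelled on a convex body\<close>

text \<open>The model \<open>R\<close> is the half space for \<Omega> and the whole space for
  \<Sigma>. Closedness makes chart images Borel, regularity makes derivatives within them unique,
  and density of the interior allows boundary values to be found by continuity.\<close>

locale mfd =
  fixes R :: "'e::euclidean_space set" and M :: "('i, 'a::t2_space, 'e) atlas"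
  assumes atl: "smooth_atlas R M" and compact_pts: "compact (pts M)"
    and R: "closed R" "regular_set R" "R \<subseteq> closure (interior R)"
begin

abbreviation inv_chart :: "'i => 'e => 'a" where "inv_chart i \<equiv> inv_into (cdom M i) (chart M i)"
abbreviation tr :: "'i => 'i => 'e => 'e" where "tr \<equiv> transition M"
abbreviation ov :: "'i => 'i => 'e set" where "ov \<equiv> overlap M"
abbreviation dtr :: "'i => 'i => 'e => 'e => 'e" where
  "dtr i j x \<equiv> der (overlap M i j) (transition M i j) x"

lemma pts_cover: "pts M = (\<Union>i\<in>idx M. cdom M i)"
  using atl by (simp add: smooth_atlas_def)

lemma dom_open: "i \<in> idx M ==> openin (top_of_set (pts M)) (cdom M i)"
  and cimg_open: "i \<in> idx M ==> openin (top_of_set R) (cimg M i)"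
  using atl unfolding smooth_atlas_def by blast+

lemma dom_sub: "i \<in> idx M ==> cdom M i \<subseteq> pts M"
  using pts_cover by blast

lemma chart_homeo:
  assumes "i \<in> idx M" shows "homeomorphism (cdom M i) (cimg M i) (chart M i) (inv_chart i)"
proof -
  obtain \<psi> where \<psi>: "homeomorphism (cdom M i) (cimg M i) (chart M i) \<psi>"
    using atl assms unfolding smooth_atlas_def by blast
  have inj: "inj_on (chart M i) (cdom M i)"
    by (rule inj_on_inverseI[of _ \<psi>]) (rule homeomorphism_apply1[OF \<psi>])
  have "inv_chart i y = \<psi> y" if yc: "y \<in> cimg M i" for y
  proof -
    obtain q where q: "q \<in> cdom M i" "y = chart M i q" using yc unfolding cimg_def by blast
    show ?thesis unfolding q(2) inv_into_f_f[OF inj q(1)] homeomorphism_apply1[OF \<psi> q(1)] ..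
  qed
  then show ?thesis by (intro homeomorphism_cong[OF \<psi>]) auto
qed

lemma chart_inj: "i \<in> idx M ==> inj_on (chart M i) (cdom M i)"
  by (rule inj_on_inverseI) (rule homeomorphism_apply1[OF chart_homeo])

lemma inv_chart_chart: "i \<in> idx M ==> q \<in> cdom M i ==> inv_chart i (chart M i q) = q"
  by (rule inv_into_f_f[OF chart_inj])

lemma chart_inv_chart: "x \<in> cimg M i ==> chart M i (inv_chart i x) = x"
  unfolding cimg_def by (rule f_inv_into_f)

lemma inv_chart_dom: "x \<in> cimg M i ==> inv_chart i x \<in> cdom M i"
  unfolding cimg_def by (rule inv_into_into)

lemma chart_cimg: "q \<in> cdom M i ==> chart M i q \<in> cimg M i"
  by (simp add: cimg_def)

lemma ov_iff: "i \<in> idx M ==> x \<in> ov i j \<longleftrightarrow> x \<in> cimg M i \<and> inv_chart i x \<in> cdom M j"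
proof
  assume i: "i \<in> idx M" and "x \<in> ov i j"
  then obtain q where "q \<in> cdom M i" "q \<in> cdom M j" "x = chart M i q" by (auto simp: overlap_def)
  then show "x \<in> cimg M i \<and> inv_chart i x \<in> cdom M j" using inv_chart_chart[OF i] chart_cimg by auto
next
  assume i: "i \<in> idx M" and x: "x \<in> cimg M i \<and> inv_chart i x \<in> cdom M j"
  then have "x = chart M i (inv_chart i x)" "inv_chart i x \<in> cdom M i \<inter> cdom M j"
    using chart_inv_chart inv_chart_dom by auto
  then show "x \<in> ov i j" unfolding overlap_def by blast
qed

lemma ov_sub: "ov i j \<subseteq> cimg M i"
  by (auto simp: overlap_def cimg_def)

lemma ov_open:
  assumes i: "i \<in> idx M" and j: "j \<in> idx M" shows "openin (top_of_set (cimg M i)) (ov i j)"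
proof -
  have "openin (top_of_set (cdom M i)) (cdom M i \<inter> cdom M j)"
    using openin_subtopology_Int_subset[OF _ dom_sub[OF i]] dom_open[OF j] dom_sub[OF i]
      openin_subset_trans[of "pts M" "cdom M i \<inter> cdom M j" "cdom M i"] openin_Int[OF dom_open[OF i] dom_open[OF j]] by auto
  then show ?thesis unfolding overlap_def using homeomorphism_imp_open_map[OF chart_homeo[OF i]] by blast
qed

lemma cimg_regular: "i \<in> idx M ==> regular_set (cimg M i)"
  by (rule regular_set_openin[OF R(2) cimg_open])

lemma ov_regular: "i \<in> idx M ==> j \<in> idx M ==> regular_set (ov i j)"
  using regular_set_openin[OF cimg_regular ov_open] .

lemma tr_chart: "i \<in> idx M ==> q \<in> cdom M i ==> tr i j (chart M i q) = chart M j q"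
  by (simp add: transition_def inv_chart_chart)

lemma tr_ov: "i \<in> idx M ==> j \<in> idx M ==> x \<in> ov i j ==> tr i j x \<in> ov j i"
  by (auto simp: overlap_def tr_chart)

lemma tr_image: "i \<in> idx M ==> j \<in> idx M ==> tr i j ` ov i j = ov j i"
  unfolding overlap_def by (force simp: tr_chart image_iff)

lemma tr_tr: "i \<in> idx M ==> j \<in> idx M ==> x \<in> ov i j ==> tr j i (tr i j x) = x"
  by (auto simp: overlap_def tr_chart)

lemma inv_chart_tr: "i \<in> idx M ==> j \<in> idx M ==> x \<in> ov i j ==> inv_chart j (tr i j x) = inv_chart i x"
  by (auto simp: overlap_def tr_chart inv_chart_chart)

lemma tr_cimg: "i \<in> idx M ==> j \<in> idx M ==> x \<in> ov i j ==> tr i j x \<in> cimg M j"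
  using tr_ov ov_sub by blast

lemma tr_smooth: "i \<in> idx M ==> j \<in> idx M ==> smooth_on (ov i j) (tr i j)"
  using atl by (simp add: smooth_atlas_def)

lemma tr_deriv: "i \<in> idx M ==> j \<in> idx M ==> x \<in> ov i j ==> (tr i j has_derivative dtr i j x) (at x within ov i j)"
  by (rule smooth_on_has_derivative[OF ov_regular tr_smooth])

lemma dtr_inverse:
  assumes ij: "i \<in> idx M" "j \<in> idx M" and x: "x \<in> ov i j"
  shows "dtr j i (tr i j x) (dtr i j x v) = v"
proof -
  have d: "(tr j i has_derivative dtr j i (tr i j x)) (at (tr i j x) within tr i j ` ov i j)"
    unfolding tr_image[OF ij] by (rule tr_deriv[OF ij(2,1) tr_ov[OF ij x]])
  have "((\<lambda>y. y) has_derivative (\<lambda>v. dtr j i (tr i j x) (dtr i j x v))) (at x within ov i j)"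
    by (rule has_derivative_transform[OF x _ diff_chain_within[OF tr_deriv[OF ij x] d, unfolded o_def]])
      (simp add: tr_tr[OF ij])
  from regular_set_derivative_unique[OF ov_regular[OF ij] x this has_derivative_ident]
  show ?thesis by metis
qed

lemma der_ov: "i \<in> idx M ==> j \<in> idx M ==> x \<in> ov i j ==> der (ov i j) f x = der (cimg M i) f x"
  by (rule frechet_derivative_openin[OF ov_open])

lemma der_tr:
  assumes ij: "i \<in> idx M" "j \<in> idx M" and x: "x \<in> ov i j" and f: "smooth_on (cimg M j) f"
  shows "der (ov i j) (\<lambda>y. f (tr i j y)) x u = der (cimg M j) f (tr i j x) (dtr i j x u)"
proof -
  have y: "tr i j x \<in> ov j i" by (rule tr_ov[OF ij x])
  have "(f has_derivative der (cimg M j) f (tr i j x)) (at (tr i j x) within tr i j ` ov i j)"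
    unfolding tr_image[OF ij]
    using smooth_on_has_derivative[OF cimg_regular[OF ij(2)] f] y ov_sub at_within_openin[OF ov_open[OF ij(2,1)] y] by auto
  from diff_chain_within[OF tr_deriv[OF ij x] this]
  show ?thesis by (intro der_eq[OF ov_regular[OF ij] x]) (simp add: o_def)
qed

lemma tensor_tfield: "tensor_field M p T ==> i \<in> idx M ==> tfield (cimg M i) p (T i)"
  by (simp add: tensor_field_def tfield_def)

lemma tensor_tr: "tensor_field M p T ==> i \<in> idx M ==> j \<in> idx M ==> x \<in> ov i j ==> length vs = p ==>
  T i x vs = T j (tr i j x) (map (dtr i j x) vs)"
  by (simp add: tensor_field_def)

lemma tensor_fieldI:
  assumes "\<And>i. i \<in> idx M ==> tfield (cimg M i) p (T i)"
    and "\<And>i j x vs. i \<in> idx M ==> j \<in> idx M ==> x \<in> ov i j ==> length vs = p ==>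
      T i x vs = T j (tr i j x) (map (dtr i j x) vs)"
  shows "tensor_field M p T"
  using assms by (simp add: tensor_field_def tfield_def)

lemma tfield_tr:
  assumes ij: "i \<in> idx M" "j \<in> idx M" and T: "tfield (cimg M j) p T"
  shows "tfield (ov i j) p (\<lambda>y. T (tr i j y))"
  unfolding tfield_def
proof (intro conjI ballI allI impI)
  show "multilin p (T (tr i j x))" if "x \<in> ov i j" for x
    by (rule tfield_multilin[OF T tr_cimg[OF ij that]])
  show "smooth_on (ov i j) (\<lambda>x. T (tr i j x) vs)" if "length vs = p" for vs
    by (rule smooth_on_compose[OF tr_smooth[OF ij] tfield_smooth[OF T that]]) (use tr_cimg[OF ij] in auto)
qed

definition d2tr :: "'i => 'i => 'e => 'e => 'e => 'e" where
  "d2tr i j x u v = der (ov i j) (\<lambda>y. dtr i j y v) x u"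

lemma d2tr_sym: "i \<in> idx M ==> j \<in> idx M ==> x \<in> ov i j ==> d2tr i j x u v = d2tr i j x v u"
  unfolding d2tr_def by (rule second_derivative_symmetric[OF ov_regular tr_smooth])

lemma dtr_smooth: "i \<in> idx M ==> j \<in> idx M ==> smooth_on (ov i j) (\<lambda>y. dtr i j y v)"
  by (rule smooth_on_frechet_derivative[OF ov_regular tr_smooth])

text \<open>The second derivatives \<open>d2tr\<close> keep coordinate derivatives from being
  tensorial; in \<open>nabla_tensor\<close> they cancel against those in the transformation law
  \<open>chr_tr\<close>.\<close>

lemma der_tensor_tr:
  assumes ij: "i \<in> idx M" "j \<in> idx M" and x: "x \<in> ov i j" and T: "tensor_field M p T" and vs: "length vs = p"
  shows "der (cimg M i) (\<lambda>y. T i y vs) x u =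
    der (cimg M j) (\<lambda>y. T j y (map (dtr i j x) vs)) (tr i j x) (dtr i j x u) +
    (\<Sum>l<p. T j (tr i j x) ((map (dtr i j x) vs)[l := d2tr i j x u (vs ! l)]))"
proof -
  let ?Vs = "map (\<lambda>v y. dtr i j y v) vs"
  have Tj: "tfield (cimg M j) p (T j)" by (rule tensor_tfield[OF T ij(2)])
  have mp: "map (\<lambda>V. V y) ?Vs = map (dtr i j y) vs" for y by simp
  have "der (cimg M i) (\<lambda>y. T i y vs) x u = der (ov i j) (\<lambda>y. T i y vs) x u"
    by (simp add: der_ov[OF ij x])
  also have "\<dots> = der (ov i j) (\<lambda>y. T j (tr i j y) (map (\<lambda>V. V y) ?Vs)) x u"
    unfolding mp by (rule der_cong[OF x tensor_tr[OF T ij _ vs]])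
  also have "\<dots> = der (ov i j) (\<lambda>y. T j (tr i j y) (map (\<lambda>V. V x) ?Vs)) x u +
     (\<Sum>l<p. T j (tr i j x) ((map (\<lambda>V. V x) ?Vs)[l := der (ov i j) (?Vs ! l) x u]))"
    by (rule der_map_fields[OF ov_regular[OF ij] x tfield_tr[OF ij Tj]])
      (use vs dtr_smooth[OF ij] in auto)
  also have "der (ov i j) (\<lambda>y. T j (tr i j y) (map (\<lambda>V. V x) ?Vs)) x u =
     der (cimg M j) (\<lambda>y. T j y (map (dtr i j x) vs)) (tr i j x) (dtr i j x u)"
    unfolding mp by (rule der_tr[OF ij x tfield_smooth[OF Tj]]) (simp add: vs)
  finally show ?thesis unfolding mp using vs by (simp add: d2tr_def)
qed

end

section \<open>Tensoriality of the covariant and the exterior derivative\<close>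

locale rmfd = mfd R M
  for R :: "'e::euclidean_space set" and M :: "('i, 'a::t2_space, 'e) atlas" +
  fixes g :: "('i, 'e) tensor"
  assumes rg: "riemannian_metric M g"
begin

lemma g_tensor: "tensor_field M 2 g"
  using rg by (simp add: riemannian_metric_def)

lemma g_metric: "i \<in> idx M ==> x \<in> cimg M i ==> metric_at (g i x)"
  using rg tfield_multilin[OF tensor_tfield[OF g_tensor]] unfolding riemannian_metric_def metric_at_def by blast

lemma chart_metric: "i \<in> idx M ==> chart_metric (cimg M i) (g i)"
  by unfold_locales (auto intro: cimg_regular tensor_tfield[OF g_tensor] g_metric)

lemma tfield_subset: "tfield A p T ==> B \<subseteq> A ==> tfield B p T"
  unfolding tfield_def by (auto intro: smooth_on_subset)

lemma chart_metric_ov: "i \<in> idx M ==> j \<in> idx M ==> chart_metric (ov i j) (g i)"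
  by unfold_locales
    (auto intro: ov_regular tfield_subset[OF tensor_tfield[OF g_tensor] ov_sub] g_metric subsetD[OF ov_sub])

lemma chr_ov: "i \<in> idx M ==> j \<in> idx M ==> x \<in> ov i j ==> chr (ov i j) (g i) x = chr (cimg M i) (g i) x"
  unfolding chr_def by (simp add: der_ov)

text \<open>The bilinear map defined by the expected law is torsion-free, since \<open>d2tr\<close>
  is symmetric, and compatible with the metric by \<open>der_tensor_tr\<close>; uniqueness
  identifies it with the connection of chart \<open>i\<close>.\<close>

lemma chr_tr:
  assumes ij: "i \<in> idx M" "j \<in> idx M" and x: "x \<in> ov i j"
  shows "dtr i j x (chr (cimg M i) (g i) x u v) =
    chr (cimg M j) (g j) (tr i j x) (dtr i j x u) (dtr i j x v) + d2tr i j x u v"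
proof -
  interpret O: chart_metric "ov i j" "g i" by (rule chart_metric_ov[OF ij])
  interpret J: chart_metric "cimg M j" "g j" by (rule chart_metric[OF ij(2)])
  let ?D = "dtr i j x" and ?D' = "dtr j i (tr i j x)"
  have y: "tr i j x \<in> ov j i" "tr i j x \<in> cimg M j" using tr_ov[OF ij x] tr_cimg[OF ij x] by auto
  define C where "C u v = J.\<Gamma> (tr i j x) (?D u) (?D v) + d2tr i j x u v" for u v
  define \<Delta> where "\<Delta> u v = ?D' (C u v)" for u v
  have DD: "?D (?D' w) = w" for w
    using dtr_inverse[OF ij(2,1) y(1)] tr_tr[OF ij x] by simp
  have Csym: "C u v = C v u" for u v
    by (simp add: C_def d2tr_sym[OF ij x, of u] J.\<Gamma>_sym[OF y(2), of "?D u"])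
  have gi: "g i x [a, b] = g j (tr i j x) [?D a, ?D b]" for a b
    using tensor_tr[OF g_tensor ij x, of "[a, b]"] by simp
  note l1 = metric_at_linear1[OF g_metric[OF ij(2) y(2)]] and l2 = metric_at_linear2[OF g_metric[OF ij(2) y(2)]]
  have "\<Delta> = chr (ov i j) (g i) x"
  proof (rule O.\<Gamma>_unique[OF x])
    show "\<Delta> u v = \<Delta> v u" for u v by (simp add: \<Delta>_def Csym[of u])
    fix u v w
    have "der (ov i j) (\<lambda>y. g i y [v, w]) x u = der (cimg M j) (\<lambda>y. g j y [?D v, ?D w]) (tr i j x) (?D u) +
      (g j (tr i j x) [d2tr i j x u v, ?D w] + g j (tr i j x) [?D v, d2tr i j x u w])"
      unfolding der_ov[OF ij x, of "\<lambda>y. g i y [v, w]"]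
      using der_tensor_tr[OF ij x g_tensor, of "[v, w]" u] by (simp add: numeral_2_eq_2)
    then show "der (ov i j) (\<lambda>y. g i y [v, w]) x u = g i x [\<Delta> u v, w] + g i x [v, \<Delta> u w]"
      unfolding gi J.\<Gamma>_metric[OF y(2)] by (simp add: \<Delta>_def DD C_def linear_add[OF l1] linear_add[OF l2])
  qed
  then have "chr (cimg M i) (g i) x u v = \<Delta> u v" using chr_ov[OF ij x] by simp
  then show ?thesis by (simp add: \<Delta>_def DD C_def)
qed

lemma nabla_tensor:
  assumes T: "tensor_field M p T" shows "tensor_field M (Suc p) (nabla M g T)"
proof (rule tensor_fieldI)
  show "tfield (cimg M i) (Suc p) (nabla M g T i)" if i: "i \<in> idx M" for i
    unfolding nabla_nab by (rule chart_metric.tfield_nab[OF chart_metric[OF i] tensor_tfield[OF T i]])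
  fix i j x and ws :: "'e list" assume ij: "i \<in> idx M" "j \<in> idx M" and x: "x \<in> ov i j" and ws: "length ws = Suc p"
  then obtain u vs where w: "ws = u # vs" "length vs = p" by (cases ws) auto
  let ?D = "dtr i j x" and ?y = "tr i j x"
  have y: "?y \<in> cimg M j" by (rule tr_cimg[OF ij x])
  note m = tfield_multilin[OF tensor_tfield[OF T ij(2)] y]
  have step: "T i x (vs[l := chr (cimg M i) (g i) x u (vs ! l)]) =
    T j ?y ((map ?D vs)[l := chr (cimg M j) (g j) ?y (?D u) (map ?D vs ! l)]) +
    T j ?y ((map ?D vs)[l := d2tr i j x u (vs ! l)])" if l: "l < p" for l
  proof -
    have lin: "linear (\<lambda>v. T j ?y ((map ?D vs)[l := v]))" using m w l by (simp add: multilin_def)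
    have "T i x (vs[l := chr (cimg M i) (g i) x u (vs ! l)]) =
      T j ?y ((map ?D vs)[l := ?D (chr (cimg M i) (g i) x u (vs ! l))])"
      using tensor_tr[OF T ij x, of "vs[l := chr (cimg M i) (g i) x u (vs ! l)]"] w by (simp add: map_update)
    then show ?thesis unfolding chr_tr[OF ij x] linear_add[OF lin] using w l by simp
  qed
  have "nabla M g T i x (u # vs) = der (cimg M i) (\<lambda>y. T i y vs) x u - (\<Sum>l<p. T i x (vs[l := chr (cimg M i) (g i) x u (vs ! l)]))"
    using w by (simp add: nabla_nab nab_def pder_def form_ext_def)
  also have "\<dots> = der (cimg M j) (\<lambda>y. T j y (map ?D vs)) ?y (?D u) -
     (\<Sum>l<p. T j ?y ((map ?D vs)[l := chr (cimg M j) (g j) ?y (?D u) (map ?D vs ! l)]))"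
    unfolding der_tensor_tr[OF ij x T w(2)] using step by (simp add: sum.distrib)
  also have "\<dots> = nabla M g T j ?y (map ?D (u # vs))"
    using w by (simp add: nabla_nab nab_def pder_def form_ext_def)
  finally show "nabla M g T i x ws = nabla M g T j (tr i j x) (map (dtr i j x) ws)" using w by simp
qed

lemma diff_form_tensor: "diff_form M p \<omega> ==> tensor_field M p \<omega>"
  by (simp add: diff_form_def)

lemma diff_form_alt: "diff_form M p \<omega> ==> i \<in> idx M ==> x \<in> cimg M i ==> alternating p (\<omega> i x)"
  by (simp add: diff_form_def)

lemma alternating_nabla:
  assumes \<omega>: "diff_form M p \<omega>" and i: "i \<in> idx M" "x \<in> cimg M i"
  shows "alternating p (\<lambda>vs. nabla M g \<omega> i x (u # vs))"
  unfolding nabla_nab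
  by (rule chart_metric.alternating_nab[OF chart_metric[OF i(1)] tensor_tfield[OF diff_form_tensor[OF \<omega>] i(1)]])
    (auto intro: diff_form_alt[OF \<omega>] i)

lemma ext_d_nabla:
  assumes \<omega>: "diff_form M p \<omega>" and i: "i \<in> idx M" "x \<in> cimg M i" and vs: "length vs = Suc p"
  shows "ext_d M \<omega> i x vs = alt (nabla M g \<omega> i x) vs"
  unfolding ext_d_alt nabla_nab
  by (rule chart_metric.alt_pder_nab[OF chart_metric[OF i(1)] tensor_tfield[OF diff_form_tensor[OF \<omega>] i(1)] diff_form_alt[OF \<omega> i] i(2) vs])

text \<open>Transformation law and smoothness are inherited from \<nabla>\<omega>, of which
  d\<omega> is the alternation.\<close>

lemma ext_d_form:
  assumes \<omega>: "diff_form M p \<omega>" shows "diff_form M (Suc p) (ext_d M \<omega>)"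
  unfolding diff_form_def
proof (intro conjI ballI)
  note nt = nabla_tensor[OF diff_form_tensor[OF \<omega>]]
  have alt: "alternating (Suc p) (alt (nabla M g \<omega> i x))" if i: "i \<in> idx M" "x \<in> cimg M i" for i x
    by (rule alternating_alt[OF tfield_multilin[OF tensor_tfield[OF nt i(1)] i(2)] alternating_nabla[OF \<omega> i]])
  show alt': "alternating (Suc p) (ext_d M \<omega> i x)" if i: "i \<in> idx M" "x \<in> cimg M i" for i x
    by (rule alternating_cong[OF alt[OF i] ext_d_nabla[OF \<omega> i]])
  show "tensor_field M (Suc p) (ext_d M \<omega>)"
  proof (rule tensor_fieldI)
    fix i assume i: "i \<in> idx M"
    show "tfield (cimg M i) (Suc p) (ext_d M \<omega> i)"
      unfolding tfield_def
    proof (intro conjI ballI allI impI)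
      show "multilin (Suc p) (ext_d M \<omega> i x)" if "x \<in> cimg M i" for x
        by (rule alternating_multilin[OF alt'[OF i that]])
      fix vs :: "'e list" assume vs: "length vs = Suc p"
      have "smooth_on (cimg M i) (\<lambda>x. alt (nabla M g \<omega> i x) vs)"
        unfolding alt_def
        by (intro smooth_on_sum smooth_on_mult smooth_on_const tfield_smooth[OF tensor_tfield[OF nt i]]) (use vs in auto)
      then show "smooth_on (cimg M i) (\<lambda>x. ext_d M \<omega> i x vs)"
        by (rule smooth_on_cong) (rule ext_d_nabla[OF \<omega> i _ vs])
    qed
  next
    fix i j x and vs :: "'e list" assume ij: "i \<in> idx M" "j \<in> idx M" and x: "x \<in> ov i j" and vs: "length vs = Suc p"
    have "ext_d M \<omega> i x vs = alt (nabla M g \<omega> i x) vs" using x ov_sub by (intro ext_d_nabla[OF \<omega> ij(1) _ vs]) auto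
    also have "\<dots> = alt (nabla M g \<omega> j (tr i j x)) (map (dtr i j x) vs)"
      unfolding alt_map by (rule alt_cong) (use tensor_tr[OF nt ij x] vs in simp)
    also have "\<dots> = ext_d M \<omega> j (tr i j x) (map (dtr i j x) vs)"
      by (rule ext_d_nabla[OF \<omega> ij(2) tr_cimg[OF ij x], symmetric]) (simp add: vs)
    finally show "ext_d M \<omega> i x vs = ext_d M \<omega> j (tr i j x) (map (dtr i j x) vs)" .
  qed
qed

end

section \<open>Change of variables\<close>

text \<open>Transport to \<open>real ^ 'e bidx\<close>, the setting of the change of variables
  theorem \<open>has_measure_differentiable_image\<close>.\<close>

definition to_vec :: "'e::euclidean_space => real ^ 'e bidx" where
  "to_vec x = (\<chi> i. x \<bullet> bvec i)"

definition of_vec :: "real ^ 'e bidx => 'e::euclidean_space" where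
  "of_vec y = (\<Sum>i\<in>UNIV. (y $ i) *\<^sub>R bvec i)"

lemma of_to_vec: "of_vec (to_vec x) = (x :: 'e::euclidean_space)"
  unfolding of_vec_def to_vec_def using bvec_expand[of x] by simp

lemma of_vec_inner: "of_vec y \<bullet> bvec j = y $ j"
proof -
  have "of_vec y \<bullet> bvec j = (\<Sum>i\<in>UNIV. if i = j then y $ i else 0)"
    unfolding of_vec_def inner_sum_left by (intro sum.cong refl) (simp add: bvec_inner)
  then show ?thesis by simp
qed

lemma to_of_vec: "to_vec (of_vec y) = y"
  by (simp add: to_vec_def of_vec_inner vec_eq_iff)

lemma linear_to_vec: "linear to_vec"
  by (rule linearI) (simp_all add: to_vec_def vec_eq_iff inner_add_left)

lemma linear_of_vec: "linear of_vec"
  by (rule linearI) (simp_all add: of_vec_def scaleR_add_left sum.distrib scaleR_sum_right)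

lemma to_vec_measurable [measurable]: "to_vec \<in> borel_measurable borel"
  by (rule borel_measurable_continuous_onI[OF linear_continuous_on[OF linear_conv_bounded_linear[THEN iffD1, OF linear_to_vec]]])

lemma of_vec_measurable [measurable]: "of_vec \<in> borel_measurable borel"
  by (rule borel_measurable_continuous_onI[OF linear_continuous_on[OF linear_conv_bounded_linear[THEN iffD1, OF linear_of_vec]]])

text \<open>Both measures give a box the product of its side lengths, as \<open>bvec\<close>
  enumerates the basis.\<close>

lemma lborel_to_vec: "(lborel :: (real ^ 'e::euclidean_space bidx) measure) = distr (lborel :: 'e measure) borel to_vec"
proof (rule lborel_eqI)
  fix l u :: "real ^ 'e bidx" assume "\<And>b. b \<in> Basis ==> l \<bullet> b \<le> u \<bullet> b"
  then have le: "l $ i \<le> u $ i" for i by (simp add: cart_eq_inner_axis axis_in_Basis_iff)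
  have bas: "\<exists>i. b = bvec i" if "b \<in> Basis" for b :: 'e
    using that bvec_bij[where 'e='e] by (auto simp: bij_betw_def)
  have "to_vec -` box l u = (box (of_vec l) (of_vec u) :: 'e set)"
  proof (intro equalityI subsetI)
    fix x :: 'e assume "x \<in> to_vec -` box l u"
    then have "l $ i < x \<bullet> bvec i \<and> x \<bullet> bvec i < u $ i" for i by (simp add: mem_box_cart to_vec_def)
    then show "x \<in> box (of_vec l) (of_vec u)" unfolding mem_box using bas of_vec_inner by metis
  next
    fix x :: 'e assume x: "x \<in> box (of_vec l) (of_vec u)"
    have "bvec i \<in> (Basis :: 'e set)" for i using bvec_bij[where 'e='e] by (auto simp: bij_betw_def)
    then have "l $ i < x \<bullet> bvec i \<and> x \<bullet> bvec i < u $ i" for i using x of_vec_inner unfolding mem_box by metis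
    then show "x \<in> to_vec -` box l u" by (simp add: mem_box_cart to_vec_def)
  qed
  then have "emeasure (distr (lborel :: 'e measure) borel to_vec) (box l u) = emeasure lborel (box (of_vec l) (of_vec u) :: 'e set)"
    by (subst emeasure_distr) simp_all
  also have "\<dots> = ennreal (\<Prod>b\<in>Basis. (of_vec u - of_vec l :: 'e) \<bullet> b)"
    using le bas by (intro emeasure_lborel_box) (metis of_vec_inner)
  also have "(\<Prod>b\<in>Basis. (of_vec u - of_vec l :: 'e) \<bullet> b) = (\<Prod>i\<in>UNIV. u $ i - l $ i)"
    unfolding prod.reindex_bij_betw[OF bvec_bij, symmetric] by (simp add: inner_diff_left of_vec_inner)
  also have "\<dots> = (\<Prod>b\<in>Basis. (u - l) \<bullet> b)"
  proof -
    have "bij_betw (\<lambda>i. axis i 1) UNIV (Basis :: (real ^ 'e bidx) set)"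
      by (auto simp: bij_betw_def inj_on_def axis_eq_axis Basis_vec_def)
    from prod.reindex_bij_betw[OF this, of "\<lambda>b. (u - l) \<bullet> b"]
    show ?thesis by (simp add: inner_axis inner_diff_left)
  qed
  finally show "emeasure (distr (lborel :: 'e measure) borel to_vec) (box l u) = ennreal (\<Prod>b\<in>Basis. (u - l) \<bullet> b)" .
qed simp

lemma to_vec_image_borel: "S \<in> sets borel ==> to_vec ` S \<in> sets borel"
proof -
  assume S: "S \<in> sets borel"
  have "to_vec ` S = of_vec -` S \<inter> space borel"
    by (auto simp: of_to_vec intro!: image_eqI[of _ to_vec "of_vec _"] simp: to_of_vec)
  then show ?thesis using measurable_sets[OF of_vec_measurable S] by simp
qed

lemma emeasure_to_vec:
  fixes S :: "'e::euclidean_space set"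
  assumes S: "S \<in> sets borel" shows "emeasure lborel (to_vec ` S) = emeasure lborel S"
proof -
  have "emeasure lborel (to_vec ` S) = emeasure lborel (to_vec -` (to_vec ` S) \<inter> space lborel)"
    unfolding lborel_to_vec using to_vec_image_borel[OF S] by (subst emeasure_distr) auto
  also have "to_vec -` (to_vec ` S) \<inter> space lborel = S"
    by (auto dest: arg_cong[of _ _ of_vec] simp: of_to_vec)
  finally show ?thesis .
qed

text \<open>The theorem used is an equivalence between finite measure of the image and integrability
  of the Jacobian. The infinite case follows by contraposition: a finite integral of the Jacobian
  would make the measure of the image finite.\<close>

lemma emeasure_differentiable_image:
  fixes F :: "'e::euclidean_space => 'e"
  assumes S: "S \<in> sets borel" and FS: "F ` S \<in> sets borel"
    and D: "\<And>x. x \<in> S ==> (F has_derivative D x) (at x within S)"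
    and inj: "inj_on F S" and cont: "continuous_on S (\<lambda>x. lin_det (D x))"
  shows "emeasure lborel (F ` S) = (\<integral>\<^sup>+x. ennreal \<bar>lin_det (D x)\<bar> * indicator S x \<partial>lborel)"
proof -
  let ?S = "to_vec ` S"
  define f where "f y = to_vec (F (of_vec y))" for y
  define f' where "f' y v = to_vec (D (of_vec y) (of_vec v))" for y v
  define \<phi> where "\<phi> y = \<bar>lin_det (D (of_vec y))\<bar>" for y
  have bl: "bounded_linear (to_vec :: 'e => _)" "bounded_linear (of_vec :: _ => 'e)"
    using linear_to_vec linear_of_vec by (auto simp: linear_conv_bounded_linear)
  have fS: "f ` ?S = to_vec ` F ` S" by (auto simp: f_def of_to_vec image_image)
  have S': "?S \<in> sets lebesgue" using to_vec_image_borel[OF S] by simp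
  have of_S: "of_vec ` ?S = S" by (simp add: image_image of_to_vec)
  have der: "(f has_derivative f' y) (at y within ?S)" if "y \<in> ?S" for y
  proof -
    have y: "of_vec y \<in> S" using that by (auto simp: of_to_vec)
    have "(F has_derivative D (of_vec y)) (at (of_vec y) within of_vec ` ?S)" unfolding of_S by (rule D[OF y])
    from diff_chain_within[OF bounded_linear_imp_has_derivative[OF bl(2)] this]
    have "((\<lambda>y. F (of_vec y)) has_derivative (\<lambda>v. D (of_vec y) (of_vec v))) (at y within ?S)" by (simp add: o_def)
    from bounded_linear.has_derivative[OF bl(1) this] show ?thesis unfolding f_def f'_def .
  qed
  have inj': "inj_on f ?S"
    using inj by (auto simp: inj_on_def f_def of_to_vec dest!: arg_cong[of "to_vec _" _ of_vec])
  have mdet: "\<bar>det (matrix (f' y))\<bar> = \<phi> y" for y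
  proof -
    have "of_vec (axis j 1) = (bvec j :: 'e)" for j
    proof -
      have "of_vec (axis j 1) = (\<Sum>i\<in>UNIV. if i = j then bvec i else (0::'e))"
        unfolding of_vec_def by (intro sum.cong refl) (simp add: axis_def)
      then show ?thesis by simp
    qed
    then have "matrix (f' y) = (\<chi> i j. D (of_vec y) (bvec j) \<bullet> bvec i)"
      by (simp add: matrix_def f'_def to_vec_def vec_eq_iff)
    then show ?thesis by (simp add: \<phi>_def lin_det_def)
  qed
  have key: "f ` ?S \<in> lmeasurable \<and> measure lebesgue (f ` ?S) = m \<longleftrightarrow> (\<phi> has_integral m) ?S" for m
    using has_measure_differentiable_image[OF S' der inj', of m] unfolding mdet .
  have meas: "(\<lambda>x. ennreal (\<phi> x) * indicator ?S x) \<in> borel_measurable borel"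
  proof -
    have "continuous_on ?S (\<lambda>y. lin_det (D (of_vec y)))"
      by (rule continuous_on_compose2[OF cont]) (auto simp: of_to_vec intro: linear_continuous_on bl)
    then have "continuous_on ?S \<phi>" unfolding \<phi>_def by (rule continuous_on_rabs)
    then have "(\<lambda>x. indicator ?S x *\<^sub>R \<phi> x) \<in> borel_measurable borel"
      by (rule borel_measurable_continuous_on_indicator[OF to_vec_image_borel[OF S]])
    then have "(\<lambda>x. ennreal (indicator ?S x *\<^sub>R \<phi> x)) \<in> borel_measurable borel" by measurable
    then show ?thesis by (rule measurable_cong[THEN iffD1, rotated]) (auto simp: indicator_def)
  qed
  have eq: "emeasure lborel (f ` ?S) = (\<integral>\<^sup>+y. ennreal (\<phi> y) * indicator ?S y \<partial>lborel)"
  proof (cases "f ` ?S \<in> lmeasurable")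
    case True
    then have "(\<phi> has_integral measure lebesgue (f ` ?S)) ?S" using key by blast
    then have "(\<integral>\<^sup>+y. ennreal (\<phi> y) * indicator ?S y \<partial>lborel) = ennreal (measure lebesgue (f ` ?S))"
      by (intro nn_integral_has_integral_lebesgue') (simp add: \<phi>_def)
    also have "\<dots> = emeasure lebesgue (f ` ?S)" using emeasure_eq_measure2[OF True] by simp
    also have "\<dots> = emeasure lborel (f ` ?S)" unfolding fS using to_vec_image_borel[OF FS] by simp
    finally show ?thesis by simp
  next
    case False
    have sb: "f ` ?S \<in> sets borel" unfolding fS by (rule to_vec_image_borel[OF FS])
    have top: "emeasure lborel (f ` ?S) = \<infinity>"
    proof (rule ccontr)
      assume "emeasure lborel (f ` ?S) \<noteq> \<infinity>"
      then have "emeasure lebesgue (f ` ?S) < \<infinity>" using sb by (simp add: less_top)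
      then have "f ` ?S \<in> lmeasurable" using sb by (intro fmeasurableI) simp_all
      then show False using False by blast
    qed
    have "(\<integral>\<^sup>+y. ennreal (\<phi> y) * indicator ?S y \<partial>lborel) = \<infinity>"
    proof (rule ccontr)
      assume fin: "(\<integral>\<^sup>+y. ennreal (\<phi> y) * indicator ?S y \<partial>lborel) \<noteq> \<infinity>"
      let ?h = "\<lambda>y. if y \<in> ?S then \<phi> y else 0"
      have h: "ennreal (\<phi> y) * indicator ?S y = ennreal (?h y)" for y by (simp add: indicator_def)
      have hm: "?h \<in> borel_measurable borel"
      proof -
        have "(\<lambda>y. enn2real (ennreal (?h y))) \<in> borel_measurable borel"
          by (rule borel_measurable_enn2real[OF meas[unfolded h]])
        moreover have "enn2real (ennreal (?h y)) = ?h y" for y by (simp add: \<phi>_def)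
        ultimately show ?thesis by simp
      qed
      define r where "r = enn2real (\<integral>\<^sup>+y. ennreal (?h y) \<partial>lborel)"
      have "(\<integral>\<^sup>+y. ennreal (?h y) \<partial>lborel) < top" using fin unfolding h by (simp only: less_top infinity_ennreal_def)
      then have r: "(\<integral>\<^sup>+y. ennreal (?h y) \<partial>lborel) = ennreal r" "0 \<le> r"
        unfolding r_def by (simp_all only: ennreal_enn2real enn2real_nonneg)
      have "(?h has_integral r) UNIV"
        using r hm by (subst has_integral_iff_nn_integral_lebesgue) (auto simp: \<phi>_def nn_integral_completion measurable_completion)
      then have "(\<phi> has_integral r) ?S" by (simp only: has_integral_restrict_UNIV)
      then show False using key False by blast
    qed
    then show ?thesis using top by simp
  qed
  have "(\<integral>\<^sup>+y. ennreal (\<phi> y) * indicator ?S y \<partial>lborel) = (\<integral>\<^sup>+x. ennreal (\<phi> (to_vec x)) * indicator ?S (to_vec x) \<partial>lborel)"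
    unfolding lborel_to_vec using meas by (intro nn_integral_distr) auto
  also have "\<dots> = (\<integral>\<^sup>+x. ennreal \<bar>lin_det (D x)\<bar> * indicator S x \<partial>lborel)"
  proof (rule nn_integral_cong)
    fix x :: 'e
    have "to_vec x \<in> ?S \<longleftrightarrow> x \<in> S" by (auto dest: arg_cong[of "to_vec _" _ of_vec] simp: of_to_vec)
    then show "ennreal (\<phi> (to_vec x)) * indicator ?S (to_vec x) = ennreal \<bar>lin_det (D x)\<bar> * indicator S x"
      by (simp add: \<phi>_def of_to_vec indicator_def)
  qed
  finally show ?thesis using eq emeasure_to_vec[OF FS] unfolding fS by simp
qed

text \<open>The Jacobian density pushed forward along \<open>F\<close> is Lebesgue measure on
  \<open>A'\<close>, by the previous lemma applied to Borel subsets; integrals follow.\<close>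

lemma nn_integral_differentiable_image:
  fixes F :: "'e::euclidean_space => 'e" and h :: "'e => ennreal"
  assumes A: "A \<in> sets borel" "A' \<in> sets borel" and F: "homeomorphism A A' F H"
    and D: "\<And>x. x \<in> A ==> (F has_derivative D x) (at x within A)"
    and cont: "continuous_on A (\<lambda>x. lin_det (D x))"
    and h: "h \<in> borel_measurable (restrict_space borel A')"
  shows "(\<integral>\<^sup>+y. h y * indicator A' y \<partial>lborel) = (\<integral>\<^sup>+x. (ennreal \<bar>lin_det (D x)\<bar> * h (F x)) * indicator A x \<partial>lborel)"
proof -
  let ?d = "\<lambda>x. ennreal \<bar>lin_det (D x)\<bar>"
  let ?L = "restrict_space lborel A" and ?L' = "restrict_space lborel A'"
  have cF: "continuous_on A F" and cH: "continuous_on A' H" and FA: "F ` A = A'" and HF: "\<And>x. x \<in> A ==> H (F x) = x"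
    and FH: "\<And>y. y \<in> A' ==> F (H y) = y" and HA: "H ` A' = A"
    using F by (auto simp: homeomorphism_def)
  have dm: "?d \<in> borel_measurable ?L"
  proof -
    have "(\<lambda>x. lin_det (D x)) \<in> borel_measurable (restrict_space borel A)"
      by (rule borel_measurable_continuous_on_restrict[OF cont])
    then have "?d \<in> borel_measurable (restrict_space borel A)" by measurable
    then show ?thesis by (simp cong: measurable_cong_sets add: sets_restrict_space_cong[OF sets_lborel])
  qed
  have Fm: "F \<in> measurable ?L (restrict_space borel A')"
  proof (rule measurable_restrict_space2)
    show "F \<in> space ?L \<rightarrow> A'" using FA by (auto simp: space_restrict_space)
    show "F \<in> measurable ?L borel"
      using borel_measurable_continuous_on_restrict[OF cF]
      by (simp cong: measurable_cong_sets add: sets_restrict_space_cong[OF sets_lborel])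
  qed
  have m: "distr (density ?L ?d) (restrict_space borel A') F = ?L'"
  proof (rule measure_eqI)
    show "sets (distr (density ?L ?d) (restrict_space borel A') F) = sets ?L'"
      by (simp add: sets_restrict_space_cong[OF sets_lborel])
    fix B assume "B \<in> sets (distr (density ?L ?d) (restrict_space borel A') F)"
    then have Br: "B \<in> sets (restrict_space borel A')" by simp
    then have B: "B \<subseteq> A'" "B \<in> sets borel" using A by (auto simp: sets_restrict_space_iff)
    let ?S = "F -` B \<inter> A"
    have "?S \<in> sets (restrict_space borel A)"
      using measurable_sets[OF Fm Br] by (simp add: space_restrict_space sets_restrict_space_cong[OF sets_lborel])
    then have S: "?S \<in> sets borel" using A by (simp add: sets_restrict_space_iff)
    have FS: "F ` ?S = B" using FA B by auto
    have "emeasure (distr (density ?L ?d) (restrict_space borel A') F) B = emeasure (density ?L ?d) ?S"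
      using Fm Br by (subst emeasure_distr) (auto simp: space_restrict_space)
    also have "\<dots> = (\<integral>\<^sup>+x. ?d x * indicator ?S x \<partial>?L)"
      using dm S A by (intro emeasure_density) (auto simp: sets_restrict_space_iff)
    also have "\<dots> = (\<integral>\<^sup>+x. ?d x * indicator ?S x * indicator A x \<partial>lborel)"
      using A by (intro nn_integral_restrict_space) simp
    also have "\<dots> = (\<integral>\<^sup>+x. ?d x * indicator ?S x \<partial>lborel)"
      by (intro nn_integral_cong) (auto simp: indicator_def)
    also have "\<dots> = emeasure lborel (F ` ?S)"
    proof (rule emeasure_differentiable_image[symmetric, OF S])
      show "F ` ?S \<in> sets borel" unfolding FS by (rule B)
      show "(F has_derivative D x) (at x within ?S)" if "x \<in> ?S" for x
        using D[of x] that by (auto intro: has_derivative_subset)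
      show "inj_on F ?S" by (rule inj_on_inverseI[of _ H]) (auto simp: HF)
      show "continuous_on ?S (\<lambda>x. lin_det (D x))" by (rule continuous_on_subset[OF cont]) auto
    qed
    also have "\<dots> = emeasure ?L' B" unfolding FS using A B by (simp add: emeasure_restrict_space)
    finally show "emeasure (distr (density ?L ?d) (restrict_space borel A') F) B = emeasure ?L' B" .
  qed
  have Fm': "F \<in> measurable (density ?L ?d) (restrict_space borel A')" using Fm by (simp cong: measurable_cong_sets)
  have hFm: "(\<lambda>x. h (F x)) \<in> borel_measurable ?L" by (rule measurable_compose[OF Fm h])
  have "(\<integral>\<^sup>+y. h y * indicator A' y \<partial>lborel) = (\<integral>\<^sup>+y. h y \<partial>?L')"
    using A by (intro nn_integral_restrict_space[symmetric]) simp
  also have "\<dots> = (\<integral>\<^sup>+x. h (F x) \<partial>density ?L ?d)"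
    unfolding m[symmetric] using Fm' h by (intro nn_integral_distr) auto
  also have "\<dots> = (\<integral>\<^sup>+x. ?d x * h (F x) \<partial>?L)"
    by (rule nn_integral_density[OF dm hFm])
  also have "\<dots> = (\<integral>\<^sup>+x. (?d x * h (F x)) * indicator A x \<partial>lborel)"
    using A by (intro nn_integral_restrict_space) simp
  finally show ?thesis .
qed

section \<open>The Riemannian measure\<close>

lemma gram_det_cong: "(\<And>u v. h [u, v] = h' [u, v]) ==> gram_det h = gram_det h'"
  by (simp add: gram_det_def)

lemma borel_openin_closed:
  fixes B :: "'a::topological_space set"
  assumes "closed S" "openin (top_of_set S) B" shows "B \<in> sets borel"
  using assms by (auto simp: openin_open)

context mfd
begin

abbreviation bor :: "'a measure" where "bor \<equiv> restrict_space borel (pts M)"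

lemma pts_closed: "closed (pts M)"
  by (rule compact_imp_closed[OF compact_pts])

lemma cimg_borel: "i \<in> idx M ==> cimg M i \<in> sets borel"
  by (rule borel_openin_closed[OF R(1) cimg_open])

lemma ov_borel: "i \<in> idx M ==> j \<in> idx M ==> ov i j \<in> sets borel"
  using ov_open[of i j] cimg_borel[of i] by (auto simp: openin_open)

lemma cdom_borel: "i \<in> idx M ==> cdom M i \<in> sets borel"
  by (rule borel_openin_closed[OF pts_closed dom_open])

lemma tr_homeo: "i \<in> idx M ==> j \<in> idx M ==> homeomorphism (ov i j) (ov j i) (tr i j) (tr j i)"
  using tr_tr[of i j] tr_tr[of j i] tr_image[of i j] tr_image[of j i]
  by (auto simp: homeomorphism_def intro: smooth_on_continuous_on tr_smooth)

lemma inv_chart_cont: "i \<in> idx M ==> continuous_on (cimg M i) (inv_chart i)"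
  using chart_homeo by (simp add: homeomorphism_def)

lemma chart_cont: "i \<in> idx M ==> continuous_on (cdom M i) (chart M i)"
  using chart_homeo by (simp add: homeomorphism_def)

lemma inv_chart_measurable:
  assumes i: "i \<in> idx M"
  shows "inv_chart i \<in> measurable (restrict_space borel (cimg M i)) bor"
proof (rule measurable_restrict_space2)
  show "inv_chart i \<in> space (restrict_space borel (cimg M i)) \<rightarrow> pts M"
    using inv_chart_dom dom_sub[OF i] by (auto simp: space_restrict_space)
  show "inv_chart i \<in> borel_measurable (restrict_space borel (cimg M i))"
    by (rule borel_measurable_continuous_on_restrict[OF inv_chart_cont[OF i]])
qed

lemma inv_chart_vimage:
  assumes i: "i \<in> idx M" and B: "B \<subseteq> cdom M i"
  shows "inv_chart i -` B \<inter> cimg M i = chart M i ` B"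
proof (intro equalityI subsetI)
  fix x assume "x \<in> inv_chart i -` B \<inter> cimg M i"
  then show "x \<in> chart M i ` B" by (auto intro!: image_eqI[of _ _ "inv_chart i x"] simp: chart_inv_chart)
next
  fix x assume "x \<in> chart M i ` B"
  then show "x \<in> inv_chart i -` B \<inter> cimg M i" using B chart_cimg by (auto simp: inv_chart_chart[OF i] subset_iff)
qed

lemma inv_chart_vimage_borel:
  assumes i: "i \<in> idx M" and B: "B \<in> sets borel"
  shows "inv_chart i -` B \<inter> cimg M i \<in> sets borel"
proof -
  have "B \<inter> pts M \<in> sets bor"
    using B pts_closed by (simp add: sets_restrict_space_iff)
  from measurable_sets[OF inv_chart_measurable[OF i] this]
  have "inv_chart i -` (B \<inter> pts M) \<inter> cimg M i \<in> sets borel"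
    using cimg_borel[OF i] by (simp add: space_restrict_space sets_restrict_space_iff)
  moreover have "inv_chart i -` (B \<inter> pts M) \<inter> cimg M i = inv_chart i -` B \<inter> cimg M i"
    using inv_chart_dom dom_sub[OF i] by auto
  ultimately show ?thesis by simp
qed

lemma finite_chart_cover: "\<exists>J. finite J \<and> J \<subseteq> idx M \<and> pts M = (\<Union>i\<in>J. cdom M i)"
proof -
  have "\<exists>D\<subseteq>cdom M ` idx M. finite D \<and> pts M \<subseteq> \<Union>D"
    using compact_pts[unfolded compact_eq_openin_cover, rule_format, of "cdom M ` idx M"] dom_open pts_cover by auto
  then obtain D where D: "D \<subseteq> cdom M ` idx M" "finite D" "pts M \<subseteq> \<Union>D" by blast
  then obtain J where J: "J \<subseteq> idx M" "finite J" "D = cdom M ` J" using finite_subset_image by metis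
  then have "(\<Union>i\<in>J. cdom M i) \<subseteq> pts M" using dom_sub by blast
  then show ?thesis using D J by (intro exI[of _ J]) auto
qed

text \<open>Finitely many disjoint Borel pieces inside single charts: along them chart measures can
  be glued and two measures compared.\<close>

lemma disjoint_chart_cover:
  obtains n :: nat and c A where "\<forall>k<n. c k \<in> idx M" "\<forall>k<n. A k \<in> sets borel" "\<forall>k<n. A k \<subseteq> cdom M (c k)"
    "disjoint_family_on A {..<n}" "pts M = (\<Union>k<n. A k)"
proof -
  obtain J where J: "finite J" "J \<subseteq> idx M" "pts M = (\<Union>i\<in>J. cdom M i)" using finite_chart_cover by blast
  obtain js where js: "set js = J" using finite_list[OF J(1)] by blast
  define A where "A = disjointed (\<lambda>k. cdom M (js ! k))"
  have mem: "js ! k \<in> idx M" if "k < length js" for k using that js J(2) nth_mem by blast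
  have "A k \<in> sets borel" if "k < length js" for k
    unfolding A_def disjointed_def using that by (intro sets.Diff sets.finite_UN cdom_borel mem) auto
  moreover have "pts M = (\<Union>k<length js. cdom M (js ! k))"
    unfolding J(3) js[symmetric] by (force simp: in_set_conv_nth)
  then have "pts M = (\<Union>k<length js. A k)"
    unfolding A_def using finite_UN_disjointed_eq[of "\<lambda>k. cdom M (js ! k)" "length js"] by (simp add: atLeast0LessThan)
  ultimately show ?thesis
    using mem disjointed_subset[of "\<lambda>k. cdom M (js ! k)"] disjoint_family_on_mono[OF subset_UNIV disjoint_family_disjointed]
    by (intro that[of "length js" "\<lambda>k. js ! k" A]) (auto simp: A_def)
qed

end

context rmfd
begin

abbreviation wt :: "'i => 'e => real" where "wt i x \<equiv> sqrt (gram_det (g i x))"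

lemma wt_dens: "i \<in> idx M ==> wt i = chart_metric.dens (g i)"
  using chart_metric.dens_def[OF chart_metric] by (simp add: fun_eq_iff)

lemma wt_smooth: "i \<in> idx M ==> smooth_on (cimg M i) (wt i)"
  using chart_metric.dens_smooth[OF chart_metric] by (simp add: wt_dens)

lemma wt_pos: "i \<in> idx M ==> x \<in> cimg M i ==> wt i x > 0"
  using gram_det_pos[OF g_metric] by simp

lemma wt_tr:
  assumes ij: "i \<in> idx M" "j \<in> idx M" and x: "x \<in> ov i j"
  shows "wt i x = \<bar>lin_det (dtr i j x)\<bar> * wt j (tr i j x)"
proof -
  have "gram_det (g i x) = gram_det (\<lambda>vs. g j (tr i j x) (map (dtr i j x) vs))"
    by (rule gram_det_cong) (rule tensor_tr[OF g_tensor ij x], simp)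
  also have "\<dots> = (lin_det (dtr i j x))\<^sup>2 * gram_det (g j (tr i j x))"
    by (rule gram_det_pullback[OF g_metric[OF ij(2) tr_cimg[OF ij x]]])
  finally show ?thesis by (simp add: real_sqrt_mult)
qed

lemma wt_measurable: "i \<in> idx M ==> (\<lambda>x. ennreal (wt i x)) \<in> borel_measurable (restrict_space lborel (cimg M i))"
proof -
  assume i: "i \<in> idx M"
  have "wt i \<in> borel_measurable (restrict_space borel (cimg M i))"
    by (rule borel_measurable_continuous_on_restrict[OF smooth_on_continuous_on[OF wt_smooth[OF i]]])
  then have "(\<lambda>x. ennreal (wt i x)) \<in> borel_measurable (restrict_space borel (cimg M i))" by measurable
  then show ?thesis by (simp cong: measurable_cong_sets add: sets_restrict_space_cong[OF sets_lborel])
qed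

lemma lin_det_tr_cont:
  assumes ij: "i \<in> idx M" "j \<in> idx M" shows "continuous_on (ov i j) (\<lambda>x. lin_det (dtr i j x))"
proof -
  have "continuous_on (ov i j) (\<lambda>x. dtr i j x (bvec l) \<bullet> bvec k)" for k l
    by (intro continuous_on_inner smooth_on_continuous_on[OF dtr_smooth[OF ij]] continuous_on_const)
  then show ?thesis unfolding lin_det_def det_def
    by (simp only: vec_lambda_beta) (intro continuous_on_sum continuous_on_mult continuous_on_const continuous_on_prod)
qed

definition cmeas :: "'i => 'a measure" where
  "cmeas i = distr (density (restrict_space lborel (cimg M i)) (\<lambda>x. ennreal (wt i x))) bor (inv_chart i)"

lemma inv_chart_measurable':
  assumes "i \<in> idx M"
  shows "inv_chart i \<in> measurable (restrict_space lborel (cimg M i)) bor"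
  using inv_chart_measurable[OF assms] by (simp cong: measurable_cong_sets add: sets_restrict_space_cong[OF sets_lborel])

lemma emeasure_cmeas:
  assumes i: "i \<in> idx M" and B: "B \<in> sets borel" "B \<subseteq> cdom M i"
  shows "emeasure (cmeas i) B = (\<integral>\<^sup>+x. indicator (chart M i ` B) x * ennreal (wt i x) \<partial>lborel)"
proof -
  have Bs: "B \<in> sets bor"
    using B dom_sub[OF i] pts_closed by (auto simp: sets_restrict_space_iff)
  have S: "chart M i ` B \<in> sets borel"
    using inv_chart_vimage_borel[OF i B(1)] unfolding inv_chart_vimage[OF i B(2)] .
  have sub: "chart M i ` B \<subseteq> cimg M i" using B(2) by (auto simp: cimg_def)
  have "emeasure (cmeas i) B = emeasure (density (restrict_space lborel (cimg M i)) (\<lambda>x. ennreal (wt i x))) (inv_chart i -` B \<inter> cimg M i)"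
    unfolding cmeas_def using inv_chart_measurable'[OF i] Bs
    by (subst emeasure_distr) (auto simp: space_restrict_space)
  also have "\<dots> = (\<integral>\<^sup>+x. ennreal (wt i x) * indicator (chart M i ` B) x \<partial>restrict_space lborel (cimg M i))"
    unfolding inv_chart_vimage[OF i B(2)]
    using S sub cimg_borel[OF i] by (intro emeasure_density wt_measurable[OF i]) (auto simp: sets_restrict_space_iff)
  also have "\<dots> = (\<integral>\<^sup>+x. ennreal (wt i x) * indicator (chart M i ` B) x * indicator (cimg M i) x \<partial>lborel)"
    using cimg_borel[OF i] by (intro nn_integral_restrict_space) simp
  also have "\<dots> = (\<integral>\<^sup>+x. indicator (chart M i ` B) x * ennreal (wt i x) \<partial>lborel)"
    using sub by (intro nn_integral_cong) (auto simp: indicator_def)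
  finally show ?thesis .
qed

text \<open>The Jacobian of the transition is exactly the factor by which the density changes
  (\<open>wt_tr\<close>).\<close>

lemma emeasure_cmeas_overlap:
  assumes ij: "i \<in> idx M" "j \<in> idx M" and B: "B \<in> sets borel" "B \<subseteq> cdom M i" "B \<subseteq> cdom M j"
  shows "emeasure (cmeas i) B = emeasure (cmeas j) B"
proof -
  have sub: "chart M i ` B \<subseteq> ov i j" "chart M j ` B \<subseteq> ov j i" using B by (auto simp: overlap_def)
  have S: "chart M j ` B \<in> sets borel"
    using inv_chart_vimage_borel[OF ij(2) B(1)] unfolding inv_chart_vimage[OF ij(2) B(3)] .
  define h where "h y = indicator (chart M j ` B) y * ennreal (wt j y)" for y
  have hm: "h \<in> borel_measurable (restrict_space borel (ov j i))"
  proof -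
    have "continuous_on (ov j i) (wt j)" using continuous_on_subset[OF smooth_on_continuous_on[OF wt_smooth[OF ij(2)]] ov_sub] .
    from borel_measurable_continuous_on_restrict[OF this]
    have 1: "(\<lambda>x. ennreal (wt j x)) \<in> borel_measurable (restrict_space borel (ov j i))" by measurable
    have 2: "(indicator (chart M j ` B) :: 'e => ennreal) \<in> borel_measurable (restrict_space borel (ov j i))"
      using S by (intro measurable_restrict_space1) simp
    show ?thesis unfolding h_def[abs_def] by (rule borel_measurable_times_ennreal[OF 2 1])
  qed
  have "emeasure (cmeas j) B = (\<integral>\<^sup>+y. h y * indicator (ov j i) y \<partial>lborel)"
    unfolding emeasure_cmeas[OF ij(2) B(1,3)] h_def using sub(2) by (intro nn_integral_cong) (auto simp: indicator_def)
  also have "\<dots> = (\<integral>\<^sup>+x. (ennreal \<bar>lin_det (dtr i j x)\<bar> * h (tr i j x)) * indicator (ov i j) x \<partial>lborel)"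
    by (rule nn_integral_differentiable_image[OF ov_borel[OF ij] ov_borel[OF ij(2,1)] tr_homeo[OF ij] tr_deriv[OF ij] lin_det_tr_cont[OF ij] hm])
  also have "\<dots> = (\<integral>\<^sup>+x. indicator (chart M i ` B) x * ennreal (wt i x) \<partial>lborel)"
  proof (rule nn_integral_cong)
    fix x
    show "(ennreal \<bar>lin_det (dtr i j x)\<bar> * h (tr i j x)) * indicator (ov i j) x = indicator (chart M i ` B) x * ennreal (wt i x)"
    proof (cases "x \<in> ov i j")
      case True
      have "tr i j x \<in> chart M j ` B \<longleftrightarrow> x \<in> chart M i ` B"
      proof
        assume "tr i j x \<in> chart M j ` B"
        then obtain q where q: "q \<in> B" "tr i j x = chart M j q" by blast
        then have "x = tr j i (chart M j q)" using tr_tr[OF ij True] by simp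
        also have "\<dots> = chart M i q" using q B(3) by (intro tr_chart ij) auto
        finally show "x \<in> chart M i ` B" using q by blast
      next
        assume "x \<in> chart M i ` B"
        then show "tr i j x \<in> chart M j ` B" using B(2) tr_chart[OF ij(1)] by force
      qed
      then show ?thesis
        using True wt_tr[OF ij True] ennreal_mult[OF abs_ge_zero less_imp_le[OF wt_pos[OF ij(2) tr_cimg[OF ij True]]]]
        by (simp add: h_def indicator_def)
    next
      case False
      then show ?thesis using sub by (auto simp: indicator_def)
    qed
  qed
  finally show ?thesis using emeasure_cmeas[OF ij(1) B(1,2)] by simp
qed

definition measure_spec :: "'a measure => bool" where
  "measure_spec \<mu> \<longleftrightarrow> sets \<mu> = sets bor \<and>
        (\<forall>i\<in>idx M. \<forall>B\<in>sets borel. B \<subseteq> cdom M i \<longrightarrow>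
           emeasure \<mu> B =
             (\<integral>\<^sup>+x. indicator (chart M i ` B) x * ennreal (sqrt (gram_det (g i x))) \<partial>lborel))"

lemma sets_pts: "B \<in> sets bor \<longleftrightarrow> B \<in> sets borel \<and> B \<subseteq> pts M"
  using pts_closed by (auto simp: sets_restrict_space_iff)

text \<open>Chart measures are added over the disjoint pieces. Agreement on overlaps makes the
  result correct in every chart, not only in the one assigned to a piece.\<close>

lemma measure_spec_ex: "\<exists>\<mu>. measure_spec \<mu>"
proof -
  obtain n :: nat and c A where cA0: "\<forall>k<n. c k \<in> idx M" "\<forall>k<n. A k \<in> sets borel" "\<forall>k<n. A k \<subseteq> cdom M (c k)"
    and dis: "disjoint_family_on A {..<n}" and cover: "pts M = (\<Union>k<n. A k)" by (rule disjoint_chart_cover)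
  note cA = cA0[rule_format]
  define \<mu>0 where "\<mu>0 B = (\<Sum>k<n. emeasure (cmeas (c k)) (B \<inter> A k))" for B
  let ?S = "sets bor"
  have scm: "sets (cmeas i) = ?S" for i by (simp add: cmeas_def)
  have pos: "positive ?S \<mu>0" by (simp add: positive_def \<mu>0_def)
  have ca: "countably_additive ?S \<mu>0"
  proof (rule countably_additiveI)
    fix F :: "nat => 'a set" assume F: "range F \<subseteq> ?S" "disjoint_family F"
    have "(\<Sum>n. emeasure (cmeas (c k)) (F n \<inter> A k)) = emeasure (cmeas (c k)) (\<Union>n. F n \<inter> A k)" if k: "k < n" for k
    proof (rule suminf_emeasure)
      show "range (\<lambda>n. F n \<inter> A k) \<subseteq> sets (cmeas (c k))"
        using F(1) cA(2)[OF k] unfolding scm by (auto simp: sets_pts image_subset_iff)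
      show "disjoint_family (\<lambda>n. F n \<inter> A k)" using F(2) by (auto simp: disjoint_family_on_def)
    qed
    moreover have "(\<Union>n. F n \<inter> A k) = (\<Union>n. F n) \<inter> A k" for k by blast
    ultimately have "(\<Sum>k<n. \<Sum>i. emeasure (cmeas (c k)) (F i \<inter> A k)) = \<mu>0 (\<Union>i. F i)"
      unfolding \<mu>0_def by (intro sum.cong refl) simp
    moreover have "(\<Sum>i. \<mu>0 (F i)) = (\<Sum>k<n. \<Sum>i. emeasure (cmeas (c k)) (F i \<inter> A k))"
      unfolding \<mu>0_def by (rule suminf_sum) (rule summableI)
    ultimately show "(\<Sum>i. \<mu>0 (F i)) = \<mu>0 (\<Union>i. F i)" by simp
  qed
  define \<mu> where "\<mu> = measure_of (pts M) ?S \<mu>0"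
  have sp: "sets bor \<subseteq> Pow (pts M)" by (auto simp: sets_pts)
  have sa: "sigma_algebra (pts M) ?S" using sets.sigma_algebra_axioms[of "bor"] by (simp add: space_restrict_space)
  have s\<mu>: "sets \<mu> = ?S" unfolding \<mu>_def using sp sa by (simp add: sets_measure_of sigma_algebra.sigma_sets_eq)
  have e\<mu>: "emeasure \<mu> B = \<mu>0 B" if "B \<in> ?S" for B
    unfolding \<mu>_def by (rule emeasure_measure_of_sigma[OF sa pos ca that])
  have "measure_spec \<mu>"
    unfolding measure_spec_def
  proof (intro conjI s\<mu> ballI impI)
    fix i B assume i: "i \<in> idx M" and B: "B \<in> sets borel" "B \<subseteq> cdom M i"
    have Bp: "B \<subseteq> pts M" using B dom_sub[OF i] by blast
    have "emeasure \<mu> B = \<mu>0 B" using B Bp by (intro e\<mu>) (simp add: sets_pts)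
    also have "\<dots> = (\<Sum>k<n. emeasure (cmeas i) (B \<inter> A k))"
      unfolding \<mu>0_def using cA B i by (intro sum.cong refl emeasure_cmeas_overlap) auto
    also have "\<dots> = emeasure (cmeas i) B"
    proof (rule sum_emeasure_cover[symmetric])
      have "A k \<subseteq> pts M" if "k < n" for k using cover that by blast
      then show "A ` {..<n} \<subseteq> sets (cmeas i)" "B \<in> sets (cmeas i)"
        using cA(2) B Bp unfolding scm sets_pts image_subset_iff by auto
      show "B \<subseteq> (\<Union>k<n. A k)" using Bp cover by simp
    qed (use dis in auto)
    finally show "emeasure \<mu> B = (\<integral>\<^sup>+x. indicator (chart M i ` B) x * ennreal (sqrt (gram_det (g i x))) \<partial>lborel)"
      using emeasure_cmeas[OF i B] by simp
  qed
  then show ?thesis by blast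
qed

text \<open>The intersection of a Borel set with each piece lies in one chart domain, where the
  specification fixes its measure.\<close>

lemma measure_spec_unique:
  assumes "measure_spec \<mu>" "measure_spec \<mu>'" shows "\<mu> = \<mu>'"
proof (rule measure_eqI)
  obtain n :: nat and c A where cA0: "\<forall>k<n. c k \<in> idx M" "\<forall>k<n. A k \<in> sets borel" "\<forall>k<n. A k \<subseteq> cdom M (c k)"
    and dis: "disjoint_family_on A {..<n}" and cover: "pts M = (\<Union>k<n. A k)" by (rule disjoint_chart_cover)
  note cA = cA0[rule_format]
  have s: "sets \<mu> = sets bor" "sets \<mu>' = sets bor"
    using assms by (auto simp: measure_spec_def)
  then show "sets \<mu> = sets \<mu>'" by simp
  fix B assume "B \<in> sets \<mu>"
  then have B: "B \<in> sets borel" "B \<subseteq> pts M" by (auto simp: s sets_pts)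
  have "A k \<subseteq> pts M" if "k < n" for k using cover that by blast
  then have sub: "A ` {..<n} \<subseteq> sets bor"
    using cA(2) unfolding sets_pts image_subset_iff by auto
  have "emeasure \<nu> B = (\<Sum>k<n. emeasure \<nu> (B \<inter> A k))" if "sets \<nu> = sets bor" for \<nu>
  proof (rule sum_emeasure_cover)
    show "B \<in> sets \<nu>" "A ` {..<n} \<subseteq> sets \<nu>" using B sub unfolding that sets_pts by auto
    show "B \<subseteq> (\<Union>k<n. A k)" using B cover by simp
  qed (use dis in auto)
  moreover have "emeasure \<mu> (B \<inter> A k) = emeasure \<mu>' (B \<inter> A k)" if "k < n" for k
  proof -
    have k: "c k \<in> idx M" "B \<inter> A k \<in> sets borel" "B \<inter> A k \<subseteq> cdom M (c k)" using cA[OF that] B by auto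
    show ?thesis using assms k unfolding measure_spec_def by simp
  qed
  ultimately show "emeasure \<mu> B = emeasure \<mu>' B" using s by simp
qed

lemma riem_measure_spec: "measure_spec (riem_measure M g)"
proof -
  have "\<exists>!\<mu>. measure_spec \<mu>" using measure_spec_ex measure_spec_unique by blast
  then have "measure_spec (THE \<mu>. measure_spec \<mu>)" by (rule theI')
  then show ?thesis unfolding riem_measure_def measure_spec_def .
qed

abbreviation \<mu> :: "'a measure" where "\<mu> \<equiv> riem_measure M g"

lemma sets_riem: "sets \<mu> = sets bor"
  using riem_measure_spec by (simp add: measure_spec_def)

lemma space_riem: "space \<mu> = pts M"
  using sets_eq_imp_space_eq[OF sets_riem] by (simp add: space_restrict_space)

lemma riem_density_chart:
  assumes i: "i \<in> idx M"
  shows "density \<mu> (indicator (cdom M i)) = cmeas i"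
proof (rule measure_eqI)
  show s: "sets (density \<mu> (indicator (cdom M i))) = sets (cmeas i)"
    by (simp add: sets_riem cmeas_def)
  fix B assume "B \<in> sets (density \<mu> (indicator (cdom M i)))"
  then have B: "B \<in> sets borel" "B \<subseteq> pts M" by (auto simp: sets_riem sets_pts)
  have cs: "cdom M i \<in> sets \<mu>" "B \<in> sets \<mu>"
    using B cdom_borel[OF i] dom_sub[OF i] by (auto simp: sets_riem sets_pts)
  have BB: "B \<inter> cdom M i \<in> sets borel" "B \<inter> cdom M i \<subseteq> cdom M i" using B cdom_borel[OF i] by auto
  have "emeasure (density \<mu> (indicator (cdom M i))) B = (\<integral>\<^sup>+q. indicator (cdom M i) q * indicator B q \<partial>\<mu>)"
    using cs by (intro emeasure_density) auto
  also have "\<dots> = (\<integral>\<^sup>+q. indicator (B \<inter> cdom M i) q \<partial>\<mu>)"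
    by (intro nn_integral_cong) (auto simp: indicator_def)
  also have "\<dots> = emeasure \<mu> (B \<inter> cdom M i)"
    by (rule nn_integral_indicator[OF sets.Int[OF cs(2,1)]])
  also have "\<dots> = emeasure (cmeas i) (B \<inter> cdom M i)"
    using riem_measure_spec[unfolded measure_spec_def] i BB unfolding emeasure_cmeas[OF i BB] by simp
  also have "\<dots> = emeasure (cmeas i) B"
  proof -
    have "inv_chart i -` (B \<inter> cdom M i) \<inter> cimg M i = inv_chart i -` B \<inter> cimg M i"
      using inv_chart_dom by auto
    moreover have "emeasure (cmeas i) X = emeasure (density (restrict_space lborel (cimg M i)) (\<lambda>x. ennreal (wt i x))) (inv_chart i -` X \<inter> cimg M i)"
      if "X \<in> sets borel" "X \<subseteq> pts M" for X
      unfolding cmeas_def using inv_chart_measurable'[OF i] that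
      by (subst emeasure_distr) (auto simp: space_restrict_space sets_pts)
    ultimately show ?thesis using B cdom_borel[OF i] by (simp add: le_infI1)
  qed
  finally show "emeasure (density \<mu> (indicator (cdom M i))) B = emeasure (cmeas i) B" .
qed

text \<open>Functions vanishing outside one chart domain are integrated in coordinates with the
  weight \<open>wt i\<close>; partitions of unity reduce to this case.\<close>

lemma riem_integral_in_chart:
  fixes f :: "'a => real"
  assumes i: "i \<in> idx M" and f: "f \<in> borel_measurable bor"
    and z: "\<And>q. q \<in> pts M - cdom M i ==> f q = 0"
  shows "integrable \<mu> f \<longleftrightarrow> integrable lborel (\<lambda>x. indicator (cimg M i) x * (wt i x * f (inv_chart i x)))"
    and "(LINT q|\<mu>. f q) = (LINT x|lborel. indicator (cimg M i) x * (wt i x * f (inv_chart i x)))"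
proof -
  let ?L = "restrict_space lborel (cimg M i)"
  have fm: "f \<in> borel_measurable \<mu>" using f by (simp cong: measurable_cong_sets add: sets_riem)
  have cs: "cdom M i \<in> sets \<mu>" using cdom_borel[OF i] dom_sub[OF i] by (auto simp: sets_riem sets_pts)
  have d: "density \<mu> (\<lambda>q. ennreal (indicator (cdom M i) q)) = cmeas i"
    using riem_density_chart[OF i] by (simp add: ennreal_indicator)
  have eqf: "indicator (cdom M i) q *\<^sub>R f q = f q" if "q \<in> space \<mu>" for q
    using z[of q] that by (auto simp: space_riem indicator_def)
  have im: "(indicator (cdom M i) :: 'a => real) \<in> borel_measurable \<mu>" using cs by measurable
  have wm: "wt i \<in> borel_measurable ?L"
    using borel_measurable_continuous_on_restrict[OF smooth_on_continuous_on[OF wt_smooth[OF i]]]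
    by (simp cong: measurable_cong_sets add: sets_restrict_space_cong[OF sets_lborel])
  have nn: "AE x in ?L. 0 \<le> wt i x"
    using wt_pos[OF i] by (intro AE_I2) (auto simp: space_restrict_space less_imp_le)
  note ic = inv_chart_measurable'[OF i]
  have ic': "inv_chart i \<in> measurable (density ?L (\<lambda>x. ennreal (wt i x))) bor"
    using ic by (simp cong: measurable_cong_sets)
  have fim: "(\<lambda>x. f (inv_chart i x)) \<in> borel_measurable ?L" by (rule measurable_compose[OF ic f])
  have "integrable \<mu> f \<longleftrightarrow> integrable \<mu> (\<lambda>q. indicator (cdom M i) q *\<^sub>R f q)"
    by (rule Bochner_Integration.integrable_cong[OF refl eqf[symmetric]])
  also have "\<dots> \<longleftrightarrow> integrable (cmeas i) f"
    unfolding d[symmetric] by (rule integrable_density[OF fm im, symmetric]) simp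
  also have "\<dots> \<longleftrightarrow> integrable (density ?L (\<lambda>x. ennreal (wt i x))) (\<lambda>x. f (inv_chart i x))"
    unfolding cmeas_def by (rule integrable_distr_eq[OF ic' f])
  also have "\<dots> \<longleftrightarrow> integrable ?L (\<lambda>x. wt i x *\<^sub>R f (inv_chart i x))"
    by (rule integrable_density[OF fim wm nn])
  also have "\<dots> \<longleftrightarrow> integrable lborel (\<lambda>x. indicator (cimg M i) x *\<^sub>R (wt i x *\<^sub>R f (inv_chart i x)))"
    using cimg_borel[OF i] by (intro integrable_restrict_space) simp
  finally show "integrable \<mu> f \<longleftrightarrow> integrable lborel (\<lambda>x. indicator (cimg M i) x * (wt i x * f (inv_chart i x)))" by simp
  have "(LINT q|\<mu>. f q) = (LINT q|\<mu>. indicator (cdom M i) q *\<^sub>R f q)"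
    by (rule Bochner_Integration.integral_cong[OF refl eqf[symmetric]])
  also have "\<dots> = (LINT q|cmeas i. f q)"
    unfolding d[symmetric] by (rule integral_density[OF fm im, symmetric]) simp
  also have "\<dots> = (LINT x|density ?L (\<lambda>x. ennreal (wt i x)). f (inv_chart i x))"
    unfolding cmeas_def by (rule integral_distr[OF ic' f])
  also have "\<dots> = (LINT x|?L. wt i x *\<^sub>R f (inv_chart i x))"
    by (rule integral_density[OF fim wm nn])
  also have "\<dots> = (LINT x|lborel. indicator (cimg M i) x *\<^sub>R (wt i x *\<^sub>R f (inv_chart i x)))"
    using cimg_borel[OF i] by (intro integral_restrict_space) simp
  finally show "(LINT q|\<mu>. f q) = (LINT x|lborel. indicator (cimg M i) x * (wt i x * f (inv_chart i x)))" by simp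
qed

end

section \<open>Integrals of derivatives of compactly supported functions\<close>

lemma openin_diff_compact:
  fixes K :: "'a::t2_space set"
  assumes "compact K" shows "openin (top_of_set S) (S - K)"
proof -
  have "open (- K)" using compact_imp_closed[OF assms] by (rule open_Compl)
  then show ?thesis unfolding openin_open by blast
qed

text \<open>\<open>A\<close> and the complement of \<open>K\<close> are relatively open, cover
  \<open>S\<close>, and the two definitions agree on their intersection.\<close>

lemma zero_ext_continuous:
  fixes f :: "'a::t2_space => real"
  assumes A: "openin (top_of_set S) A" and K: "compact K" "K \<subseteq> A" and f: "continuous_on A f" "\<And>x. x \<in> A - K ==> f x = 0"
  shows "continuous_on S (\<lambda>x. if x \<in> A then f x else 0)"
proof -
  have S: "A \<union> (S - K) = S" using openin_subset[OF A] K(2) by auto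
  have "continuous_on (A \<union> (S - K)) (\<lambda>x. if x \<in> A then f x else 0)"
    by (rule continuous_on_cases_local_open) (use A f openin_diff_compact[OF K(1)] in \<open>auto simp: S\<close>)
  then show ?thesis unfolding S .
qed

lemma zero_ext_derivative:
  fixes f :: "'e::euclidean_space => real"
  assumes A: "openin (top_of_set S) A" "regular_set A" and K: "compact K" "K \<subseteq> A"
    and f: "smooth_on A f" "\<And>x. x \<in> A - K ==> f x = 0" and x: "x \<in> S"
  shows "((\<lambda>x. if x \<in> A then f x else 0) has_derivative (\<lambda>u. if x \<in> A then der A f x u else 0)) (at x within S)"
proof (cases "x \<in> A")
  case True
  have "((\<lambda>x. if x \<in> A then f x else 0) has_derivative der A f x) (at x within A)"
    by (rule has_derivative_transform[OF True _ smooth_on_has_derivative[OF A(2) f(1) True]]) simp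
  then show ?thesis using at_within_openin[OF A(1) True] True by simp
next
  case False
  then have xK: "x \<in> S - K" using K x by auto
  have "((\<lambda>x. if x \<in> A then f x else 0) has_derivative (\<lambda>u. 0)) (at x within S - K)"
    by (rule has_derivative_transform[OF xK _ has_derivative_const[of 0]]) (use f in auto)
  then show ?thesis using at_within_openin[OF openin_diff_compact[OF K(1)] xK] False by simp
qed

lemma der_zero_off:
  fixes f :: "'e::euclidean_space => real"
  assumes "regular_set A" "compact K" "\<And>x. x \<in> A - K ==> f x = 0" "x \<in> A - K"
  shows "der A f x u = 0"
proof -
  note o = openin_diff_compact[OF assms(2), of A]
  have "((\<lambda>y. 0) has_derivative (\<lambda>u. 0)) (at x within A - K)" by simp
  then have "(f has_derivative (\<lambda>u. 0)) (at x within A - K)"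
    by (rule has_derivative_transform[OF assms(4), rotated]) (use assms in auto)
  then have *: "(f has_derivative (\<lambda>u. 0)) (at x within A)" using at_within_openin[OF o assms(4)] by simp
  show ?thesis using der_eq[OF assms(1) _ *] assms(4) by simp
qed

lemma lborel_integral_translate:
  fixes \<phi> :: "'e::euclidean_space => real"
  assumes "\<phi> \<in> borel_measurable borel"
  shows "(LINT x|lborel. \<phi> (x + c)) = (LINT x|lborel. \<phi> x)"
    and "integrable lborel (\<lambda>x. \<phi> (x + c)) \<longleftrightarrow> integrable lborel \<phi>"
proof -
  have "(LINT x|lborel. \<phi> x) = (LINT x|distr lborel borel ((+) c). \<phi> x)" unfolding lborel_distr_plus ..
  also have "\<dots> = (LINT x|lborel. \<phi> (c + x))" using assms by (intro integral_distr) auto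
  finally show "(LINT x|lborel. \<phi> (x + c)) = (LINT x|lborel. \<phi> x)" by (simp add: add.commute)
  have "integrable lborel \<phi> \<longleftrightarrow> integrable (distr lborel borel ((+) c)) \<phi>" unfolding lborel_distr_plus ..
  also have "\<dots> \<longleftrightarrow> integrable lborel (\<lambda>x. \<phi> (c + x))" using assms by (intro integrable_distr_eq) auto
  finally show "integrable lborel (\<lambda>x. \<phi> (x + c)) \<longleftrightarrow> integrable lborel \<phi>" by (simp add: add.commute)
qed

lemma integrable_compact_support:
  fixes \<phi> :: "'e::euclidean_space => real"
  assumes "compact K" "continuous_on K \<phi>" "\<And>x. x \<notin> K ==> \<phi> x = 0"
  shows "integrable lborel \<phi>"
proof -
  have "integrable lborel (\<lambda>x. indicator K x *\<^sub>R \<phi> x)" by (rule borel_integrable_compact[OF assms(1,2)])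
  moreover have "(\<lambda>x. indicator K x *\<^sub>R \<phi> x) = \<phi>" by (rule ext) (use assms(3) in \<open>auto simp: indicator_def\<close>)
  ultimately show ?thesis by (simp only:)
qed

text \<open>By Fubini, since \<open>f (x + b) - f x\<close> has integral zero and equals the integral of the
  derivative along the segment from \<open>x\<close> to \<open>x + b\<close>.\<close>

lemma integral_derivative_zero:
  fixes f :: "'e::euclidean_space => real"
  assumes K: "compact K" and D: "\<And>x. (f has_derivative D x) (at x)" and cont: "continuous_on UNIV (\<lambda>x. D x b)"
    and z: "\<And>x. x \<notin> K ==> f x = 0"
  shows "(LINT x|lborel. D x b) = 0"
proof -
  define \<phi> where "\<phi> x = D x b" for x
  have fc: "continuous_on UNIV f" using D has_derivative_continuous_on[of UNIV f D] by simp
  have oK: "open (- K)" using compact_imp_closed[OF K] by (rule open_Compl)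
  have \<phi>z: "\<phi> x = 0" if "x \<notin> K" for x
  proof -
    have "((\<lambda>y. 0) has_derivative D x) (at x)"
      by (rule has_derivative_transform_within_open[OF D oK]) (use that z in auto)
    from has_derivative_unique[OF this has_derivative_const] show ?thesis by (simp add: \<phi>_def)
  qed
  have \<phi>c: "continuous_on S \<phi>" for S using continuous_on_subset[OF cont] unfolding \<phi>_def[abs_def] by blast
  have \<phi>m: "\<phi> \<in> borel_measurable borel" by (rule borel_measurable_continuous_onI[OF \<phi>c])
  have fm: "f \<in> borel_measurable borel" by (rule borel_measurable_continuous_onI[OF fc])
  have fi: "integrable lborel f" by (rule integrable_compact_support[OF K continuous_on_subset[OF fc] z]) auto
  define h where "h x t = indicator {0..1} t *\<^sub>R \<phi> (x + t *\<^sub>R b)" for x and t :: real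
  define C where "C = (\<lambda>(k, t). (k - t *\<^sub>R b, t)) ` (K \<times> {0..1::real})"
  have C: "compact C" unfolding C_def split_def
    by (intro compact_continuous_image compact_Times K continuous_intros) simp
  have "integrable lborel (case_prod h)"
  proof (rule integrable_compact_support[OF C])
    have eq: "case_prod h p = \<phi> (fst p + snd p *\<^sub>R b)" if "p \<in> C" for p
      using that by (auto simp: C_def h_def)
    have "continuous_on C (\<lambda>p. \<phi> (fst p + snd p *\<^sub>R b))"
      by (rule continuous_on_compose2[OF \<phi>c[of UNIV]]) (auto intro!: continuous_intros)
    then show "continuous_on C (case_prod h)" by (rule continuous_on_eq) (simp add: eq)
    fix p assume p: "p \<notin> C"
    obtain x t where xt: "p = (x, t)" by (cases p)
    have "\<phi> (x + t *\<^sub>R b) = 0" if "t \<in> {0..1}"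
    proof (rule \<phi>z, rule)
      assume "x + t *\<^sub>R b \<in> K"
      then have "p \<in> C" unfolding C_def xt using that by (intro image_eqI[of _ _ "(x + t *\<^sub>R b, t)"]) auto
      then show False using p by blast
    qed
    then show "case_prod h p = 0" by (auto simp: xt h_def indicator_def)
  qed
  then have "integrable (lborel \<Otimes>\<^sub>M lborel) (case_prod h)" unfolding lborel_prod .
  then have fub: "(LINT t|lborel. LINT x|lborel. h x t) = (LINT x|lborel. LINT t|lborel. h x t)"
    by (rule lborel_pair.Fubini_integral)
  have 1: "(LINT x|lborel. h x t) = indicator {0..1} t *\<^sub>R (LINT x|lborel. \<phi> x)" for t
    unfolding h_def using lborel_integral_translate(1)[OF \<phi>m, of "t *\<^sub>R b"] by (cases "t \<in> {0..1}") simp_all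
  have 2: "(LINT t|lborel. h x t) = f (x + b) - f x" for x
  proof -
    have "(LINT t|lborel. indicator {0..1} t *\<^sub>R \<phi> (x + t *\<^sub>R b)) = f (x + 1 *\<^sub>R b) - f (x + 0 *\<^sub>R b)"
    proof (rule integral_FTC_atLeastAtMost)
      fix t :: real
      have "((\<lambda>t. x + t *\<^sub>R b) has_derivative (\<lambda>r. r *\<^sub>R b)) (at t within {0..1})"
        by (auto intro!: derivative_eq_intros)
      from has_derivative_compose[OF this D]
      show "((\<lambda>t. f (x + t *\<^sub>R b)) has_vector_derivative \<phi> (x + t *\<^sub>R b)) (at t within {0..1})"
        using linear_cmul[OF has_derivative_linear[OF D]] by (simp add: has_vector_derivative_def \<phi>_def)
    next
      show "continuous_on {0..1} (\<lambda>t. \<phi> (x + t *\<^sub>R b))"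
        by (rule continuous_on_compose2[OF \<phi>c[of UNIV]]) (auto intro!: continuous_intros)
    qed simp
    then show ?thesis by (simp add: h_def)
  qed
  have "(LINT x|lborel. \<phi> x) = (LINT t|lborel. indicator {0..1::real} t *\<^sub>R (LINT x|lborel. \<phi> x))"
    by simp
  also have "\<dots> = (LINT x|lborel. f (x + b) - f x)" using fub unfolding 1 2 .
  also have "\<dots> = 0"
    using lborel_integral_translate[OF fm, of b] fi by simp
  finally show ?thesis by (simp add: \<phi>_def)
qed

lemma integrable_der:
  fixes f :: "'e::euclidean_space => real"
  assumes A: "regular_set A" and K: "compact K" "K \<subseteq> A" and f: "smooth_on A f" "\<And>x. x \<in> A - K ==> f x = 0"
  shows "integrable lborel (\<lambda>x. indicator A x * der A f x u)"
proof (rule integrable_compact_support[OF K(1)])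
  have "continuous_on K (\<lambda>x. der A f x u)"
    by (rule continuous_on_subset[OF smooth_on_continuous_on[OF smooth_on_frechet_derivative[OF A f(1)]] K(2)])
  then show "continuous_on K (\<lambda>x. indicator A x * der A f x u)"
    by (rule continuous_on_eq) (use K(2) in auto)
  show "indicator A x * der A f x u = 0" if "x \<notin> K" for x
  proof (cases "x \<in> A")
    case True
    have "der A f x u = 0" by (rule der_zero_off[OF A K(1) f(2)]) (use True that in auto)
    then show ?thesis by simp
  qed simp
qed

lemma integral_der_interior:
  fixes f :: "'e::euclidean_space => real"
  assumes A: "regular_set A" and K: "compact K" "K \<subseteq> interior A"
    and f: "smooth_on A f" "\<And>x. x \<in> A - K ==> f x = 0"
  shows "(LINT x|lborel. indicator A x * der A f x b) = 0"
proof -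
  let ?I = "interior A"
  have I: "openin (top_of_set UNIV) ?I" "regular_set ?I" by (auto intro: regular_set_open)
  have sm: "smooth_on ?I f" by (rule smooth_on_subset[OF f(1) interior_subset])
  have z: "f x = 0" if "x \<in> ?I - K" for x using f(2) that interior_subset by blast
  have "(LINT x|lborel. (if x \<in> ?I then der ?I f x b else 0)) = 0"
  proof (rule integral_derivative_zero[OF K(1), where D="\<lambda>x u. if x \<in> ?I then der ?I f x u else 0"])
    show "((\<lambda>x. if x \<in> ?I then f x else 0) has_derivative (\<lambda>u. if x \<in> ?I then der ?I f x u else 0)) (at x)" for x
      using zero_ext_derivative[OF I K sm z, of x] by simp
    show "continuous_on UNIV (\<lambda>x. if x \<in> ?I then der ?I f x b else 0)"
      by (rule zero_ext_continuous[OF I(1) K smooth_on_continuous_on[OF smooth_on_frechet_derivative[OF I(2) sm]]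
            der_zero_off[OF I(2) K(1) z]])
    show "(if x \<in> ?I then f x else 0) = 0" if "x \<notin> K" for x using z that by auto
  qed
  moreover have "(if x \<in> ?I then der ?I f x b else 0) = indicator A x * der A f x b" for x
  proof (cases "x \<in> ?I")
    case True
    have "at x within ?I = at x within A"
      using True interior_subset by (metis at_within_interior at_within_open open_interior)
    then show ?thesis using True interior_subset by (auto simp: indicator_def)
  next
    case False
    have "der A f x b = 0" if "x \<in> A" by (rule der_zero_off[OF A K(1) f(2)]) (use that False K(2) in auto)
    then show ?thesis using False by (simp add: indicator_def)
  qed
  ultimately show ?thesis by simp
qed

section \<open>The half space\<close>

lemma interior_half_space: "x \<in> interior half_space \<longleftrightarrow> 0 < fst (x :: real \<times> 'b::euclidean_space)"
proof
  assume "x \<in> interior half_space"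
  then obtain e where e: "e > 0" "cball x e \<subseteq> half_space" by (meson mem_interior_cball)
  have "x - (e, 0) \<in> cball x e" using e by (simp add: dist_norm norm_Pair)
  then have "x - (e, 0) \<in> half_space" using e(2) by blast
  then have "0 \<le> fst (x - (e, 0))" by (simp add: half_space_def)
  then show "0 < fst x" using e by simp
next
  assume "0 < fst x"
  moreover have "open (fst -` {0<..} :: (real \<times> 'b) set)" by (intro open_vimage open_greaterThan continuous_intros)
  ultimately show "x \<in> interior half_space"
    by (intro interiorI[of "fst -` {0<..}"]) (auto simp: half_space_def)
qed

lemma half_space_closure: "(half_space :: (real \<times> 'b::euclidean_space) set) \<subseteq> closure (interior half_space)"
proof
  fix x :: "real \<times> 'b" assume x: "x \<in> half_space"
  have "\<exists>y\<in>interior half_space. dist y x < e" if "e > 0" for e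
  proof (rule bexI[of _ "x + (e / 2, 0)"])
    show "x + (e / 2, 0) \<in> interior half_space"
      unfolding interior_half_space using x that by (simp add: half_space_def)
  qed (use that in \<open>simp add: dist_norm\<close>)
  then show "x \<in> closure (interior half_space)" unfolding closure_approachable by blast
qed

lemma half_space_closed: "closed (half_space :: (real \<times> 'b::euclidean_space) set)"
proof -
  have "closed (fst -` {0..} :: (real \<times> 'b) set)" by (intro closed_vimage closed_atLeast continuous_intros)
  then show ?thesis by (simp add: half_space_def vimage_def)
qed

lemma half_space_regular: "regular_set (half_space :: (real \<times> 'b::euclidean_space) set)"
  unfolding regular_set_def
proof (intro ballI allI impI)
  fix x i :: "real \<times> 'b" and e :: real assume "x \<in> half_space" "i \<in> Basis" "e > 0"
  then show "\<exists>d. 0 < \<bar>d\<bar> \<and> \<bar>d\<bar> < e \<and> x + d *\<^sub>R i \<in> half_space"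
    by (intro exI[of _ "e / 2"]) (auto simp: half_space_def Basis_prod_def)
qed

text \<open>Split \<open>u\<close> into a normal and a tangential part. On every slice parallel to
  the boundary the tangential derivative integrates to zero; along each normal ray the fundamental
  theorem leaves minus the boundary value.\<close>

lemma integral_der_half_space:
  fixes f :: "real \<times> 'b::euclidean_space => real"
  assumes A: "openin (top_of_set half_space) A" and K: "compact K" "K \<subseteq> A"
    and f: "smooth_on A f" "\<And>x. x \<in> A - K ==> f x = 0"
  shows "(LINT x|lborel. indicator A x * der A f x u) = - fst u * (LINT y|lborel. indicator {y. (0, y) \<in> A} y * f (0, y))"
proof -
  have AH: "A \<subseteq> half_space" using openin_subset[OF A] by simp
  note reg = regular_set_openin[OF half_space_regular A]
  define F where "F x = (if x \<in> A then f x else 0)" for x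
  define \<phi> where "\<phi> u x = (if x \<in> A then der A f x u else 0)" for u x
  have FD: "(F has_derivative (\<lambda>u. \<phi> u x)) (at x within half_space)" if "x \<in> half_space" for x
    unfolding F_def[abs_def] \<phi>_def using zero_ext_derivative[OF A reg K f that] by (simp cong: if_cong)
  have \<phi>z: "\<phi> u x = 0" if "x \<notin> K" for u x
    using der_zero_off[OF reg K(1) f(2)] that by (auto simp: \<phi>_def)
  have Fz: "F x = 0" if "x \<notin> K" for x using f(2) that by (auto simp: F_def)
  have \<phi>c: "continuous_on half_space (\<phi> u)" for u
    unfolding \<phi>_def[abs_def]
    by (rule zero_ext_continuous[OF A K smooth_on_continuous_on[OF smooth_on_frechet_derivative[OF reg f(1)]]
          der_zero_off[OF reg K(1) f(2)]])
  have ind: "indicator A x * der A f x u = \<phi> u x" for u x by (simp add: \<phi>_def)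
  have int: "integrable lborel (\<phi> u)" for u
    unfolding ind[symmetric] by (rule integrable_der[OF reg K f])
  have int2: "integrable (lborel \<Otimes>\<^sub>M lborel) (case_prod (\<lambda>t y. \<phi> u (t, y)))" for u :: "real \<times> 'b"
    unfolding lborel_prod using int[of u] by (simp add: split_def)
  have lin: "\<phi> u x = fst u * \<phi> (1, 0) x + \<phi> (0, snd u) x" for x
  proof (cases "x \<in> A")
    case True
    have "der A f x (fst u *\<^sub>R (1, 0) + (0, snd u)) = fst u * der A f x (1, 0) + der A f x (0, snd u)"
      by (simp only: linear_add[OF der_linear[OF reg f(1) True]] linear_cmul[OF der_linear[OF reg f(1) True]] real_scaleR_def)
    then show ?thesis using True by (simp add: \<phi>_def)
  qed (simp add: \<phi>_def)
  have tang: "(LINT x|lborel. \<phi> (0, v) x) = 0" for v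
  proof -
    have "(LINT x|lborel. \<phi> (0, v) x) = (LINT t|lborel. LINT y|lborel. \<phi> (0, v) (t, y))"
      using lborel_pair.integral_fst'[OF int2, of "(0, v)"] unfolding lborel_prod by (simp add: split_def)
    moreover have "(LINT y|lborel. \<phi> (0, v) (t, y)) = 0" for t :: real
    proof (cases "t \<ge> 0")
      case False
      then have "\<phi> (0, v) (t, y) = 0" for y using AH by (auto simp: \<phi>_def half_space_def)
      then show ?thesis by simp
    next
      case True
      then have H: "(t, y) \<in> half_space" for y :: 'b by (simp add: half_space_def)
      show ?thesis
      proof (rule integral_derivative_zero[of "snd ` K" "\<lambda>y. F (t, y)" "\<lambda>y w. \<phi> (0, w) (t, y)"])
        show "compact (snd ` K)" by (intro compact_continuous_image K continuous_intros)
        show "((\<lambda>y. F (t, y)) has_derivative (\<lambda>w. \<phi> (0, w) (t, y))) (at y)" for y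
        proof -
          have 1: "((\<lambda>y. (t, y)) has_derivative (\<lambda>w. (0, w))) (at y)" by (auto intro!: derivative_eq_intros)
          have 2: "(F has_derivative (\<lambda>u. \<phi> u (t, y))) (at (t, y) within range (\<lambda>y. (t, y)))"
            by (rule has_derivative_subset[OF FD[OF H]]) (use H in auto)
          show ?thesis using diff_chain_within[OF 1 2] by (simp add: o_def)
        qed
        show "continuous_on UNIV (\<lambda>y. \<phi> (0, v) (t, y))"
          by (rule continuous_on_compose2[OF \<phi>c]) (use H in \<open>auto intro!: continuous_intros\<close>)
        show "F (t, y) = 0" if "y \<notin> snd ` K" for y using that by (intro Fz) force
      qed
    qed
    ultimately show ?thesis by simp
  qed
  \<comment> \<open>A height above the support, so that the upper endpoint of the normal integration
    contributes nothing.\<close>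
  obtain T where T: "T > 0" "\<And>x. x \<in> K ==> fst x < T"
  proof -
    obtain B where B: "\<And>x. x \<in> K ==> norm x \<le> B" using compact_imp_bounded[OF K(1)] by (auto simp: bounded_iff)
    show ?thesis
    proof (rule that[of "\<bar>B\<bar> + 1"])
      fix x assume "x \<in> K"
      then show "fst x < \<bar>B\<bar> + 1" using B[of x] norm_fst_le[of "fst x" "snd x"] by (simp add: abs_le_iff)
    qed simp
  qed
  have norm: "(LINT x|lborel. \<phi> (1, 0) x) = - (LINT y|lborel. indicator {y. (0, y) \<in> A} y * f (0, y))"
  proof -
    have "(LINT x|lborel. \<phi> (1, 0) x) = (LINT t|lborel. LINT y|lborel. \<phi> (1, 0) (t, y))"
      using lborel_pair.integral_fst'[OF int2, of "(1, 0)"] unfolding lborel_prod by (simp add: split_def)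
    also have "\<dots> = (LINT y|lborel. LINT t|lborel. \<phi> (1, 0) (t, y))"
      by (rule lborel_pair.Fubini_integral[OF int2, symmetric])
    also have "\<dots> = (LINT y|lborel. - (indicator {y. (0, y) \<in> A} y * f (0, y)))"
    proof (rule Bochner_Integration.integral_cong[OF refl])
      fix y :: 'b
      have H: "(t, y) \<in> half_space" if "t \<ge> 0" for t using that by (simp add: half_space_def)
      have "\<phi> (1, 0) (t, y) = indicator {0..T} t *\<^sub>R \<phi> (1, 0) (t, y)" for t
      proof (cases "(t, y) \<in> K")
        case True
        then have "(t, y) \<in> half_space" using K(2) AH by blast
        then show ?thesis using T(2)[OF True] by (simp add: half_space_def)
      qed (simp add: \<phi>z)
      then have "(LINT t|lborel. \<phi> (1, 0) (t, y)) = (LINT t|lborel. indicator {0..T} t *\<^sub>R \<phi> (1, 0) (t, y))"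
        by (rule Bochner_Integration.integral_cong[OF refl])
      also have "\<dots> = F (T, y) - F (0, y)"
      proof (rule integral_FTC_atLeastAtMost)
        fix t assume t: "0 \<le> t" "t \<le> T"
        have 1: "((\<lambda>t. (t, y)) has_derivative (\<lambda>r. (r, 0))) (at t within {0..T})" by (auto intro!: derivative_eq_intros)
        have 2: "(F has_derivative (\<lambda>u. \<phi> u (t, y))) (at (t, y) within (\<lambda>t. (t, y)) ` {0..T})"
          by (rule has_derivative_subset[OF FD[OF H[OF t(1)]]]) (use H in auto)
        note li = has_derivative_linear[OF FD[OF H[OF t(1)]]]
        have hom: "\<phi> (r, 0) (t, y) = r *\<^sub>R \<phi> (1, 0) (t, y)" for r
        proof -
          have "\<phi> (r *\<^sub>R (1, 0)) (t, y) = r *\<^sub>R \<phi> (1, 0) (t, y)" by (rule linear_cmul[OF li])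
          moreover have "r *\<^sub>R ((1, 0) :: real \<times> 'b) = (r, 0)" by simp
          ultimately show ?thesis by (rule back_subst[of "\<lambda>z. \<phi> z (t, y) = _"])
        qed
        show "((\<lambda>t. F (t, y)) has_vector_derivative \<phi> (1, 0) (t, y)) (at t within {0..T})"
          unfolding has_vector_derivative_def
          by (rule has_derivative_eq_rhs[OF diff_chain_within[OF 1 2, unfolded o_def] ext]) (rule hom)
      next
        show "continuous_on {0..T} (\<lambda>t. \<phi> (1, 0) (t, y))"
          by (rule continuous_on_compose2[OF \<phi>c]) (use H in \<open>auto intro!: continuous_intros\<close>)
      qed (use T in simp)
      also have "F (T, y) = 0" using T(2)[of "(T, y)"] by (intro Fz) auto
      finally show "(LINT t|lborel. \<phi> (1, 0) (t, y)) = - (indicator {y. (0, y) \<in> A} y * f (0, y))"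
        by (simp add: F_def indicator_def)
    qed
    finally show ?thesis by simp
  qed
  have "(LINT x|lborel. \<phi> u x) = fst u * (LINT x|lborel. \<phi> (1, 0) x) + (LINT x|lborel. \<phi> (0, snd u) x)"
    unfolding lin using int by simp
  then show "(LINT x|lborel. indicator A x * der A f x u) = - fst u * (LINT y|lborel. indicator {y. (0, y) \<in> A} y * f (0, y))"
    unfolding ind tang norm by simp
qed

section \<open>Smooth functions and partitions of unity\<close>

text \<open>\<open>flat_fun 0\<close> is \<open>exp (-1/t)\<close> for positive \<open>t\<close> and
  zero otherwise, so for \<open>r > 0\<close> this is smooth and positive exactly on the open ball
  of radius \<open>r\<close>.\<close>

definition bump :: "'e::euclidean_space => real => 'e => real" where
  "bump x0 r x = flat_fun 0 (r\<^sup>2 - (x - x0) \<bullet> (x - x0))"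

lemma smooth_on_bump: "smooth_on A (bump x0 r)"
proof -
  have 1: "smooth_on A (\<lambda>x. r\<^sup>2 - (x - x0) \<bullet> (x - x0))"
    by (intro smooth_on_diff smooth_on_inner smooth_on_const smooth_on_linear bounded_linear_ident)
  have 2: "smooth_on UNIV (flat_fun 0)" by (rule smooth_on_open[OF open_UNIV]) (auto intro: Ck_on_flat_fun)
  show ?thesis unfolding bump_def[abs_def] by (rule smooth_on_compose[OF 1 2]) simp
qed

lemma bump_nonneg: "bump x0 r x \<ge> 0"
  by (simp add: bump_def flat_fun_def)

lemma bump_pos: "r > 0 ==> bump x0 r x > 0 \<longleftrightarrow> dist x0 x < r"
proof -
  assume r: "r > 0"
  have "bump x0 r x > 0 \<longleftrightarrow> (norm (x - x0))\<^sup>2 < r\<^sup>2"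
    by (simp add: bump_def flat_fun_def dot_square_norm)
  also have "\<dots> \<longleftrightarrow> norm (x - x0) < r"
    using power2_less_imp_less[of "norm (x - x0)" r] power_strict_mono[of "norm (x - x0)" r 2] r by auto
  finally show ?thesis by (simp add: dist_norm norm_minus_commute)
qed

context mfd
begin

lemma interior_cimg: "i \<in> idx M ==> interior (cimg M i) = cimg M i \<inter> interior R"
proof -
  assume "i \<in> idx M"
  then obtain T where T: "open T" "cimg M i = R \<inter> T" using cimg_open by (auto simp: openin_open)
  have "interior (cimg M i) = interior R \<inter> T" unfolding T(2) by (simp add: interior_open[OF T(1)])
  then show ?thesis using T(2) interior_subset[of R] by blast
qed

text \<open>Being interior does not depend on the chart: a transition is continuous and injective,
  so by invariance of domain it maps an open set to an open set, which then lies in the interior of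
  \<open>R\<close>.\<close>

lemma interior_pts_iff:
  assumes i: "i \<in> idx M" and q: "q \<in> cdom M i"
  shows "q \<in> interior_pts M \<longleftrightarrow> chart M i q \<in> interior R"
proof
  assume "chart M i q \<in> interior R"
  then have "chart M i q \<in> interior (cimg M i)" using interior_cimg[OF i] chart_cimg[OF q] by blast
  then show "q \<in> interior_pts M" unfolding interior_pts_def using i q by blast
next
  assume "q \<in> interior_pts M"
  then obtain j where j: "j \<in> idx M" "q \<in> cdom M j" "chart M j q \<in> interior (cimg M j)"
    by (auto simp: interior_pts_def)
  obtain T where T: "open T" "ov j i = cimg M j \<inter> T" using ov_open[OF j(1) i] by (auto simp: openin_open)
  define W where "W = interior (cimg M j) \<inter> T"
  have W: "open W" "W \<subseteq> ov j i" unfolding W_def T(2) using T(1) interior_subset by auto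
  have xov: "chart M j q \<in> ov j i" using q j(2) by (auto simp: overlap_def)
  then have xW: "chart M j q \<in> W" using j(3) T(2) by (auto simp: W_def)
  have "continuous_on W (tr j i)" by (rule continuous_on_subset[OF smooth_on_continuous_on[OF tr_smooth[OF j(1) i]] W(2)])
  moreover have "inj_on (tr j i) W"
    by (rule inj_on_inverseI[of _ "tr i j"]) (use tr_tr[OF j(1) i] W(2) in auto)
  ultimately have "open (tr j i ` W)" using W(1) by (intro invariance_of_domain)
  moreover have "tr j i ` W \<subseteq> R"
    using tr_cimg[OF j(1) i] W(2) openin_subset[OF cimg_open[OF i]] by fastforce
  ultimately have "tr j i ` W \<subseteq> interior R" by (intro interior_maximal)
  then show "chart M i q \<in> interior R" using xW tr_chart[OF j(1,2), of i] by (metis image_eqI subsetD)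
qed

lemma off_compact_open:
  assumes i: "i \<in> idx M" and C: "compact C"
  shows "openin (top_of_set (cimg M i)) {x \<in> cimg M i. inv_chart i x \<notin> C}"
proof -
  have "open (- C)" using compact_imp_closed[OF C] by (rule open_Compl)
  then have "openin (top_of_set (cimg M i)) (cimg M i \<inter> inv_chart i -` (- C))"
    by (rule continuous_openin_preimage_gen[OF inv_chart_cont[OF i]])
  moreover have "cimg M i \<inter> inv_chart i -` (- C) = {x \<in> cimg M i. inv_chart i x \<notin> C}" by auto
  ultimately show ?thesis by simp
qed

definition smooth_fun :: "('a => real) => bool" where
  "smooth_fun u \<longleftrightarrow> (\<forall>i\<in>idx M. smooth_on (cimg M i) (\<lambda>x. u (inv_chart i x)))"

lemma continuous_on_pts:
  fixes f :: "'a => 'z::topological_space"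
  assumes "\<And>i. i \<in> idx M ==> continuous_on (cdom M i) f" shows "continuous_on (pts M) f"
  unfolding continuous_on_eq_continuous_within
proof
  fix q assume "q \<in> pts M"
  then obtain i where i: "i \<in> idx M" "q \<in> cdom M i" using pts_cover by blast
  then have "continuous (at q within cdom M i) f" using assms by (simp add: continuous_on_eq_continuous_within)
  then show "continuous (at q within pts M) f" unfolding at_within_openin[OF dom_open[OF i(1)] i(2)] .
qed

lemma continuous_on_cdom:
  assumes i: "i \<in> idx M" and f: "continuous_on (cimg M i) (\<lambda>x. f (inv_chart i x))"
  shows "continuous_on (cdom M i) f"
proof -
  have "continuous_on (cdom M i) (\<lambda>q. f (inv_chart i (chart M i q)))"
    by (rule continuous_on_compose2[OF f chart_cont[OF i]]) (auto simp: chart_cimg)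
  then show ?thesis by (rule continuous_on_eq) (simp add: inv_chart_chart[OF i])
qed

lemma smooth_fun_continuous: "smooth_fun u ==> continuous_on (pts M) u"
  unfolding smooth_fun_def by (intro continuous_on_pts continuous_on_cdom smooth_on_continuous_on) auto

lemma compact_inv_chart: "i \<in> idx M ==> compact K ==> K \<subseteq> cimg M i ==> compact (inv_chart i ` K)"
  by (rule compact_continuous_image[OF continuous_on_subset[OF inv_chart_cont]])

lemma compact_chart: "i \<in> idx M ==> compact C ==> C \<subseteq> cdom M i ==> compact (chart M i ` C)"
  by (rule compact_continuous_image[OF continuous_on_subset[OF chart_cont]])

text \<open>A bump is pulled back through one chart and extended by zero. Near points of the chart
  domain it is a composition with a transition; near other points it vanishes, as the complement of
  the compact set \<open>C\<close> is open.\<close>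

lemma chart_bump:
  assumes i: "i \<in> idx M" and r: "r > 0" and sub: "cball x0 r \<inter> R \<subseteq> cimg M i"
  defines "C \<equiv> inv_chart i ` (cball x0 r \<inter> R)"
  obtains u where "smooth_fun u" "\<And>q. u q \<ge> 0" "\<And>q. q \<in> cdom M i ==> u q = bump x0 r (chart M i q)"
    "compact C" "C \<subseteq> cdom M i" "\<And>q. q \<notin> C ==> u q = 0"
proof -
  define u where "u q = (if q \<in> cdom M i then bump x0 r (chart M i q) else 0)" for q
  have C: "compact C" unfolding C_def
    by (rule compact_inv_chart[OF i compact_Int_closed[OF compact_cball R(1)] sub])
  have Csub: "C \<subseteq> cdom M i" unfolding C_def using sub inv_chart_dom by blast
  have z: "u q = 0" if q: "q \<notin> C" for q
  proof (cases "q \<in> cdom M i")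
    case True
    have "chart M i q \<notin> cball x0 r"
    proof
      assume "chart M i q \<in> cball x0 r"
      then have "chart M i q \<in> cball x0 r \<inter> R" using chart_cimg[OF True] openin_subset[OF cimg_open[OF i]] by auto
      then have "q \<in> C" unfolding C_def using inv_chart_chart[OF i True] by (metis image_eqI)
      then show False using q by blast
    qed
    then have "\<not> bump x0 r (chart M i q) > 0" unfolding bump_pos[OF r] by simp
    then show ?thesis using bump_nonneg[of x0 r "chart M i q"] True by (simp add: u_def)
  qed (simp add: u_def)
  have "smooth_fun u"
    unfolding smooth_fun_def
  proof (intro ballI smooth_on_local)
    fix j x assume j: "j \<in> idx M" and x: "x \<in> cimg M j"
    show "\<exists>U. open U \<and> x \<in> U \<and> smooth_on (cimg M j \<inter> U) (\<lambda>x. u (inv_chart j x))"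
    proof (cases "inv_chart j x \<in> cdom M i")
      case True
      obtain T where T: "open T" "ov j i = cimg M j \<inter> T" using ov_open[OF j i] by (auto simp: openin_open)
      have "smooth_on (ov j i) (\<lambda>x. bump x0 r (tr j i x))"
        by (rule smooth_on_compose[OF tr_smooth[OF j i] smooth_on_bump[of UNIV]]) simp
      then have "smooth_on (ov j i) (\<lambda>x. u (inv_chart j x))"
        by (rule smooth_on_cong) (simp add: u_def ov_iff[OF j] transition_def)
      then show ?thesis using T True x ov_iff[OF j, of x i] by (intro exI[of _ T]) auto
    next
      case False
      obtain T where T: "open T" "{x \<in> cimg M j. inv_chart j x \<notin> C} = cimg M j \<inter> T"
        using off_compact_open[OF j C] by (auto simp: openin_open)
      have "smooth_on (cimg M j \<inter> T) (\<lambda>x. u (inv_chart j x))"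
        by (rule smooth_on_cong[OF smooth_on_const[of _ 0]]) (use T(2) z in blast)
      moreover have "x \<in> T" using False Csub x T(2) by blast
      ultimately show ?thesis using T(1) by blast
    qed
  qed
  then show ?thesis
    by (rule that[OF _ _ _ C Csub z]) (auto simp: u_def bump_nonneg)
qed

lemma small_cball:
  assumes i: "i \<in> idx M" and x: "x \<in> cimg M i"
  obtains r where "r > 0" "cball x r \<inter> R \<subseteq> cimg M i"
proof -
  obtain T where T: "open T" "cimg M i = R \<inter> T" using cimg_open[OF i] by (auto simp: openin_open)
  then obtain r where "r > 0" "cball x r \<subseteq> T" using x open_contains_cball_eq[OF T(1)] by blast
  then show ?thesis using that[of r] T(2) by blast
qed

text \<open>Finitely many bumps whose positivity sets cover the compact manifold, divided by their
  sum.\<close>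

lemma partition_of_unity:
  obtains Q :: "'a set" and c \<rho> C where "finite Q"
    "\<forall>q\<in>Q. c q \<in> idx M \<and> smooth_fun (\<rho> q) \<and> compact (C q) \<and> C q \<subseteq> cdom M (c q) \<and> (\<forall>p. p \<notin> C q \<longrightarrow> \<rho> q p = 0)"
    "\<forall>p\<in>pts M. (\<Sum>q\<in>Q. \<rho> q p) = 1"
proof -
  let ?P = "\<lambda>q i u C. i \<in> idx M \<and> smooth_fun u \<and> (\<forall>p. u p \<ge> 0) \<and> u q > 0 \<and> compact C \<and> C \<subseteq> cdom M i \<and> (\<forall>p. p \<notin> C \<longrightarrow> u p = 0)"
  have "\<exists>i u C. ?P q i u C" if q: "q \<in> pts M" for q
  proof -
    obtain i where i: "i \<in> idx M" "q \<in> cdom M i" using q pts_cover by blast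
    obtain r where r: "r > 0" "cball (chart M i q) r \<inter> R \<subseteq> cimg M i" by (rule small_cball[OF i(1) chart_cimg[OF i(2)]])
    obtain u where u: "smooth_fun u" "\<And>q. u q \<ge> 0" "\<And>p. p \<in> cdom M i ==> u p = bump (chart M i q) r (chart M i p)"
      "compact (inv_chart i ` (cball (chart M i q) r \<inter> R))" "inv_chart i ` (cball (chart M i q) r \<inter> R) \<subseteq> cdom M i"
      "\<And>p. p \<notin> inv_chart i ` (cball (chart M i q) r \<inter> R) ==> u p = 0"
      using chart_bump[OF i(1) r] by metis
    have "u q > 0" unfolding u(3)[OF i(2)] bump_pos[OF r(1)] using r(1) by simp
    then show ?thesis using i u by blast
  qed
  then obtain c u C where cuC: "\<And>q. q \<in> pts M ==> ?P q (c q) (u q) (C q)" by metis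
  define V where "V q = {p \<in> pts M. u q p > 0}" for q
  have "openin (top_of_set (pts M)) (V q)" if "q \<in> pts M" for q
  proof -
    have "continuous_on (pts M) (u q)" using cuC[OF that] smooth_fun_continuous by blast
    then have "openin (top_of_set (pts M)) (pts M \<inter> u q -` {0<..})"
      by (rule continuous_openin_preimage_gen) simp
    moreover have "pts M \<inter> u q -` {0<..} = V q" by (auto simp: V_def)
    ultimately show ?thesis by simp
  qed
  moreover have "pts M \<subseteq> \<Union>(V ` pts M)" using cuC by (auto simp: V_def)
  ultimately have "\<exists>D\<subseteq>V ` pts M. finite D \<and> pts M \<subseteq> \<Union>D"
    using compact_pts[unfolded compact_eq_openin_cover, rule_format, of "V ` pts M"] by blast
  then obtain D where D: "D \<subseteq> V ` pts M" "finite D" "pts M \<subseteq> \<Union>D" by blast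
  then obtain Q where Q: "Q \<subseteq> pts M" "finite Q" "D = V ` Q" using finite_subset_image by metis
  define s where "s p = (\<Sum>q\<in>Q. u q p)" for p
  have spos: "s p > 0" if "p \<in> pts M" for p
  proof -
    have "p \<in> \<Union>(V ` Q)" using that D(3) Q(3) by blast
    then obtain q where q: "q \<in> Q" "u q p > 0" by (auto simp: V_def)
    show ?thesis unfolding s_def using Q cuC q by (intro sum_pos2[of Q q]) auto
  qed
  define \<rho> where "\<rho> q p = u q p * s p powr (- 1)" for q p
  have ss: "smooth_fun s" unfolding smooth_fun_def s_def
    using cuC Q by (intro ballI smooth_on_sum) (auto simp: smooth_fun_def)
  have "smooth_fun (\<rho> q)" if "q \<in> Q" for q
    unfolding smooth_fun_def \<rho>_def
  proof (intro ballI smooth_on_mult smooth_on_powr)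
    fix i assume i: "i \<in> idx M"
    show "smooth_on (cimg M i) (\<lambda>x. u q (inv_chart i x))" "smooth_on (cimg M i) (\<lambda>x. s (inv_chart i x))"
      using cuC[of q] that Q(1) ss i unfolding smooth_fun_def by blast+
    show "s (inv_chart i x) > 0" if "x \<in> cimg M i" for x
      using inv_chart_dom[OF that] dom_sub[OF i] by (intro spos) blast
  qed
  moreover have "(\<Sum>q\<in>Q. \<rho> q p) = 1" if "p \<in> pts M" for p
    unfolding \<rho>_def sum_distrib_right[symmetric] s_def[symmetric] using spos[OF that] by (simp add: powr_minus)
  moreover have "\<rho> q p = 0" if "q \<in> Q" "p \<notin> C q" for q p
    using cuC[of q] that Q(1) by (auto simp: \<rho>_def)
  ultimately show ?thesis using that[of Q c \<rho> C] Q cuC by blast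
qed

section \<open>Scalar functions given by local expressions\<close>

definition glue :: "('i => 'e => real) => 'a => real" where
  "glue f q = (let i = (SOME i. i \<in> idx M \<and> q \<in> cdom M i) in f i (chart M i q))"

text \<open>Agreement on overlaps makes the choice of a chart in \<open>riem_integral\<close>
  immaterial; continuity gives integrability, the manifold being compact.\<close>

definition scal :: "('i => 'e => real) => bool" where
  "scal f \<longleftrightarrow> (\<forall>i\<in>idx M. continuous_on (cimg M i) (f i)) \<and> (\<forall>i\<in>idx M. \<forall>j\<in>idx M. \<forall>x\<in>ov i j. f i x = f j (tr i j x))"

lemma glue_some:
  assumes "q \<in> pts M"
  obtains i where "i \<in> idx M" "q \<in> cdom M i" "\<forall>f. glue f q = f i (chart M i q)"
proof -
  have "\<exists>i. i \<in> idx M \<and> q \<in> cdom M i" using assms pts_cover by blast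
  then have "(SOME i. i \<in> idx M \<and> q \<in> cdom M i) \<in> idx M \<and> q \<in> cdom M (SOME i. i \<in> idx M \<and> q \<in> cdom M i)" by (rule someI_ex)
  then show ?thesis using that[of "SOME i. i \<in> idx M \<and> q \<in> cdom M i"] by (simp add: glue_def Let_def)
qed

lemma glue_eq:
  assumes f: "scal f" and i: "i \<in> idx M" and q: "q \<in> cdom M i"
  shows "glue f q = f i (chart M i q)"
proof -
  have "q \<in> pts M" using dom_sub[OF i] q by blast
  then obtain j where j: "j \<in> idx M" "q \<in> cdom M j" "\<forall>f. glue f q = f j (chart M j q)" by (rule glue_some)
  have x: "chart M j q \<in> ov j i" using j q by (auto simp: overlap_def)
  then have "f j (chart M j q) = f i (tr j i (chart M j q))" using f i j(1) by (simp add: scal_def)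
  then show ?thesis using j(3) tr_chart[OF j(1,2)] by simp
qed

lemma glue_inv_chart: "scal f ==> i \<in> idx M ==> x \<in> cimg M i ==> glue f (inv_chart i x) = f i x"
  using glue_eq[of f i "inv_chart i x"] inv_chart_dom chart_inv_chart by simp

lemma scal_cont: "scal f ==> i \<in> idx M ==> continuous_on (cimg M i) (f i)"
  by (simp add: scal_def)

lemma glue_continuous: "scal f ==> continuous_on (pts M) (glue f)"
proof (intro continuous_on_pts continuous_on_cdom)
  fix i assume f: "scal f" and i: "i \<in> idx M"
  show "continuous_on (cimg M i) (\<lambda>x. glue f (inv_chart i x))"
    by (rule continuous_on_eq[OF scal_cont[OF f i]]) (simp add: glue_inv_chart[OF f i])
qed

lemma scal_add: "scal f ==> scal f' ==> scal (\<lambda>i x. f i x + f' i x)"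
  unfolding scal_def by (auto intro: continuous_on_add)

lemma scal_cmul: "scal f ==> scal (\<lambda>i x. c * f i x)"
  unfolding scal_def by (auto intro: continuous_on_mult continuous_on_const)

lemma tensor_scale:
  assumes u: "smooth_fun u" and T: "tensor_field M p T"
  shows "tensor_field M p (\<lambda>i x vs. u (inv_chart i x) * T i x vs)"
proof (rule tensor_fieldI)
  show "tfield (cimg M i) p (\<lambda>x vs. u (inv_chart i x) * T i x vs)" if i: "i \<in> idx M" for i
    using tensor_tfield[OF T i] u i unfolding tfield_def smooth_fun_def
    by (auto intro: multilin_cmul smooth_on_mult)
  show "u (inv_chart i x) * T i x vs = u (inv_chart j (tr i j x)) * T j (tr i j x) (map (dtr i j x) vs)"
    if "i \<in> idx M" "j \<in> idx M" "x \<in> ov i j" "length vs = p" for i j x vs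
    using tensor_tr[OF T that] inv_chart_tr[OF that(1,2,3)] by simp
qed

lemma tensor_0_scal: "tensor_field M 0 T ==> scal (\<lambda>i x. T i x [])"
  using tensor_tr[of 0 T _ _ _ "[]"] tfield_smooth[OF tensor_tfield, of 0 T _ "[]"]
  unfolding scal_def by (auto intro: smooth_on_continuous_on)

end

lemma tsum_map: "tsum E p (\<lambda>vs. f (map D vs)) = tsum (\<lambda>k. D (E k)) p f"
  for D :: "'v::euclidean_space => 'v"
  proof (induction p arbitrary: f)
  case (Suc p)
  show ?case using Suc.IH[of "\<lambda>vs. f (D (E _) # vs)"] by simp
qed simp

section \<open>Integrals of continuous functions\<close>

context rmfd
begin

abbreviation rint :: "('i => 'e => real) => real" where "rint \<equiv> riem_integral M g"
abbreviation ip :: "nat => ('i, 'e) tensor => ('i, 'e) tensor => 'i => 'e => real" where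
  "ip p \<alpha> \<beta> \<equiv> (\<lambda>i x. form_inner (g i x) p (\<alpha> i x) (\<beta> i x))"
abbreviation F :: "'i => 'e => nat => 'e" where "F i x \<equiv> gs_frame (g i x)"

lemma onb_F: "i \<in> idx M ==> x \<in> cimg M i ==> onb (g i x) (F i x)"
  by (rule onb_gs_frame[OF g_metric])

lemma onb_tr:
  assumes ij: "i \<in> idx M" "j \<in> idx M" and x: "x \<in> ov i j" and E: "onb (g i x) E"
  shows "onb (g j (tr i j x)) (\<lambda>k. dtr i j x (E k))"
  using E tensor_tr[OF g_tensor ij x, of "[E _, E _]"] by (simp add: onb_def)

lemma riem_integral_glue: "rint f = (LINT q|\<mu>. glue f q)"
  by (simp add: riem_integral_def glue_def)

lemma integrable_chart_compact:
  assumes i: "i \<in> idx M" and f: "continuous_on (pts M) (f :: 'a => real)" and C: "compact C" "C \<subseteq> cdom M i" "\<And>q. q \<in> pts M - C ==> f q = 0"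
  shows "integrable \<mu> f"
proof -
  have z: "f q = 0" if "q \<in> pts M - cdom M i" for q using C that by blast
  let ?h = "\<lambda>x. indicator (cimg M i) x * (wt i x * f (inv_chart i x))"
  have K: "chart M i ` C \<subseteq> cimg M i" using C(2) by (auto simp: cimg_def)
  have "integrable lborel ?h"
  proof (rule integrable_compact_support[OF compact_chart[OF i C(1,2)]])
    have "continuous_on (cimg M i) (\<lambda>x. f (inv_chart i x))"
      by (rule continuous_on_compose2[OF f inv_chart_cont[OF i]]) (use inv_chart_dom dom_sub[OF i] in blast)
    then have "continuous_on (cimg M i) (\<lambda>x. wt i x * f (inv_chart i x))"
      by (intro continuous_on_mult smooth_on_continuous_on[OF wt_smooth[OF i]])
    then have "continuous_on (chart M i ` C) (\<lambda>x. wt i x * f (inv_chart i x))" using K by (rule continuous_on_subset)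
    then show "continuous_on (chart M i ` C) ?h" by (rule continuous_on_eq) (use K in auto)
    fix x assume x: "x \<notin> chart M i ` C"
    have "f (inv_chart i x) = 0" if xc: "x \<in> cimg M i"
    proof (rule C(3))
      have "inv_chart i x \<notin> C" using x chart_inv_chart[OF xc] by (metis image_eqI)
      then show "inv_chart i x \<in> pts M - C" using inv_chart_dom[OF xc] dom_sub[OF i] by blast
    qed
    then show "?h x = 0" by (simp add: indicator_def)
  qed
  then show ?thesis using riem_integral_in_chart(1)[OF i borel_measurable_continuous_on_restrict[OF f] z] by blast
qed

lemma integrable_continuous:
  assumes f: "continuous_on (pts M) (f :: 'a => real)" shows "integrable \<mu> f"
proof -
  obtain Q :: "'a set" and c \<rho> C where Q: "finite Q"
    "\<forall>q\<in>Q. c q \<in> idx M \<and> smooth_fun (\<rho> q) \<and> compact (C q) \<and> C q \<subseteq> cdom M (c q) \<and> (\<forall>p. p \<notin> C q \<longrightarrow> \<rho> q p = 0)"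
    "\<forall>p\<in>pts M. (\<Sum>q\<in>Q. \<rho> q p) = 1" by (rule partition_of_unity)
  have "integrable \<mu> (\<lambda>p. \<Sum>q\<in>Q. \<rho> q p * f p)"
  proof (rule Bochner_Integration.integrable_sum)
    fix q assume q: "q \<in> Q"
    have q': "c q \<in> idx M" "smooth_fun (\<rho> q)" "compact (C q)" "C q \<subseteq> cdom M (c q)" "\<And>p. p \<notin> C q ==> \<rho> q p = 0"
      using Q(2) q by auto
    show "integrable \<mu> (\<lambda>p. \<rho> q p * f p)"
      by (rule integrable_chart_compact[OF q'(1) _ q'(3,4)])
        (use q'(5) in \<open>auto intro: continuous_on_mult f smooth_fun_continuous[OF q'(2)]\<close>)
  qed
  moreover have "(\<Sum>q\<in>Q. \<rho> q p * f p) = f p" if "p \<in> space \<mu>" for p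
    using Q(3) that unfolding space_riem sum_distrib_right[symmetric] by simp
  ultimately show ?thesis using Bochner_Integration.integrable_cong[OF refl, of \<mu> "\<lambda>p. \<Sum>q\<in>Q. \<rho> q p * f p" f] by blast
qed

lemma scal_integrable: "scal f ==> integrable \<mu> (glue f)"
  by (rule integrable_continuous[OF glue_continuous])

lemma riem_integral_cong:
  assumes "\<And>i x. i \<in> idx M ==> x \<in> cimg M i ==> f i x = f' i x"
  shows "rint f = rint f'"
  unfolding riem_integral_glue
proof (rule Bochner_Integration.integral_cong[OF refl])
  fix q assume "q \<in> space \<mu>"
  then obtain i where "i \<in> idx M" "q \<in> cdom M i" "\<forall>f. glue f q = f i (chart M i q)"
    using glue_some unfolding space_riem by metis
  then show "glue f q = glue f' q" using assms chart_cimg by simp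
qed

lemma riem_integral_add:
  "scal f ==> scal f' ==> rint (\<lambda>i x. f i x + f' i x) = rint f + rint f'"
  unfolding riem_integral_glue
  by (subst Bochner_Integration.integral_add[OF scal_integrable scal_integrable, symmetric]) (simp_all add: glue_def[abs_def] Let_def)

lemma riem_integral_cmul: "rint (\<lambda>i x. c * f i x) = c * rint f"
  unfolding riem_integral_def by (simp add: Let_def)

lemma riem_integral_sum:
  assumes "finite Q" "\<And>q. q \<in> Q ==> scal (f q)"
  shows "rint (\<lambda>i x. \<Sum>q\<in>Q. f q i x) = (\<Sum>q\<in>Q. rint (f q))"
proof -
  have "glue (\<lambda>i x. \<Sum>q\<in>Q. f q i x) = (\<lambda>p. \<Sum>q\<in>Q. glue (f q) p)" by (simp add: fun_eq_iff glue_def Let_def)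
  then show ?thesis unfolding riem_integral_glue
    by (simp add: Bochner_Integration.integral_sum[OF scal_integrable[OF assms(2)]])
qed

text \<open>A nonnegative integrand with integral zero vanishes almost everywhere in coordinates,
  and by continuity a nonzero value would persist on an open set, which is not negligible. This is
  why the point is taken in the interior of the chart image.\<close>

lemma riem_integral_zero_imp:
  assumes f: "scal f" and nn: "\<And>i x. i \<in> idx M ==> x \<in> cimg M i ==> f i x \<ge> 0" and z: "rint f = 0"
    and i: "i \<in> idx M" and x: "x \<in> interior (cimg M i)" and off: "\<And>q. q \<in> pts M - cdom M i ==> glue f q = 0"
  shows "f i x = 0"
proof (rule ccontr)
  assume nz: "f i x \<noteq> 0"
  let ?\<phi> = "\<lambda>y. indicator (cimg M i) y * (wt i y * glue f (inv_chart i y))"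
  note in_chart = riem_integral_in_chart[OF i borel_measurable_continuous_on_restrict[OF glue_continuous[OF f]] off]
  have \<phi>: "?\<phi> y = indicator (cimg M i) y * (wt i y * f i y)" for y
    using glue_inv_chart[OF f i, of y] by (cases "y \<in> cimg M i") auto
  have "?\<phi> y \<ge> 0" for y
    unfolding \<phi> using nn[OF i, of y] wt_pos[OF i, of y] by (cases "y \<in> cimg M i") (auto intro: mult_nonneg_nonneg less_imp_le)
  moreover have "integrable lborel ?\<phi>" using in_chart(1) scal_integrable[OF f] by blast
  moreover have "(LINT y|lborel. ?\<phi> y) = 0" using in_chart(2) z by (simp add: riem_integral_glue)
  ultimately have ae: "AE y in lborel. ?\<phi> y = 0" using integral_nonneg_eq_0_iff_AE[of lborel ?\<phi>] by blast
  define V where "V = interior (cimg M i) \<inter> f i -` (- {0})"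
  have V: "open V" unfolding V_def
    by (rule continuous_open_preimage[OF continuous_on_subset[OF scal_cont[OF f i] interior_subset] open_interior]) auto
  have "AE y in lborel. y \<notin> V"
    using ae
  proof (rule eventually_mono)
    fix y assume "?\<phi> y = 0"
    then show "y \<notin> V"
      using wt_pos[OF i, of y] interior_subset[of "cimg M i"] unfolding \<phi> V_def by (auto simp: indicator_def)
  qed
  then have "emeasure lborel V = 0" using AE_iff_measurable[of V lborel "\<lambda>y. y \<notin> V"] V by simp
  then have "V \<in> null_sets lborel" using V by auto
  then have "negligible V" by (simp add: negligible_iff_null_sets null_sets_completionI)
  moreover have "x \<in> V" using x nz by (simp add: V_def)
  ultimately show False using open_not_negligible[OF V] by blast
qed

end

section \<open>The divergence theorem and formal adjoints\<close>

context mfd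
begin

definition supp_in :: "'a set => nat => ('i, 'e) tensor => bool" where
  "supp_in K p T \<longleftrightarrow> (\<forall>i\<in>idx M. \<forall>x\<in>cimg M i. inv_chart i x \<notin> K \<longrightarrow> (\<forall>vs. length vs = p \<longrightarrow> T i x vs = 0))"

lemma supp_inD: "supp_in K p T ==> i \<in> idx M ==> x \<in> cimg M i ==> inv_chart i x \<notin> K ==> length vs = p ==> T i x vs = 0"
  by (simp add: supp_in_def)

lemma supp_in_pts: "supp_in (pts M) p T"
  using inv_chart_dom dom_sub by (auto simp: supp_in_def)

lemma test_form_iff:
  "test_form M p \<phi> \<longleftrightarrow> diff_form M p \<phi> \<and> (\<exists>K. compact K \<and> K \<subseteq> interior_pts M \<and> supp_in K p \<phi>)"
proof -
  have "(\<forall>i\<in>idx M. \<forall>q\<in>cdom M i - K. \<forall>vs. length vs = p \<longrightarrow> \<phi> i (chart M i q) vs = 0) \<longleftrightarrow> supp_in K p \<phi>" for K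
  proof -
    have "(\<forall>q\<in>cdom M i - K. \<forall>vs. length vs = p \<longrightarrow> \<phi> i (chart M i q) vs = 0) \<longleftrightarrow>
       (\<forall>x\<in>cimg M i. inv_chart i x \<notin> K \<longrightarrow> (\<forall>vs. length vs = p \<longrightarrow> \<phi> i x vs = 0))" if i: "i \<in> idx M" for i
      by (simp add: cimg_def inv_chart_chart[OF i]) blast
    then show ?thesis by (simp add: supp_in_def)
  qed
  then show ?thesis unfolding test_form_def by presburger
qed

lemma tfield_sum:
  assumes "\<And>q. q \<in> Q ==> tfield A p (T q)" shows "tfield A p (\<lambda>x vs. \<Sum>q\<in>Q. T q x vs)"
  using assms unfolding tfield_def by (auto intro!: multilin_sum smooth_on_sum)

lemma tensor_cmul:
  assumes T: "tensor_field M p T" shows "tensor_field M p (\<lambda>i x vs. c * T i x vs)"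
proof (rule tensor_fieldI)
  show "tfield (cimg M i) p (\<lambda>x vs. c * T i x vs)" if i: "i \<in> idx M" for i
    using tensor_tfield[OF T i] unfolding tfield_def by (auto intro: multilin_cmul smooth_on_mult smooth_on_const)
  show "c * T i x vs = c * T j (tr i j x) (map (dtr i j x) vs)"
    if "i \<in> idx M" "j \<in> idx M" "x \<in> ov i j" "length vs = p" for i j x vs
    using tensor_tr[OF T that] by simp
qed

lemma tensor_add:
  assumes T: "tensor_field M p T" "tensor_field M p T'" shows "tensor_field M p (\<lambda>i x vs. T i x vs + T' i x vs)"
proof (rule tensor_fieldI)
  show "tfield (cimg M i) p (\<lambda>x vs. T i x vs + T' i x vs)" if i: "i \<in> idx M" for i
    using tensor_tfield[OF T(1) i] tensor_tfield[OF T(2) i] unfolding tfield_def by (auto intro: multilin_add smooth_on_add)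
  show "T i x vs + T' i x vs = T j (tr i j x) (map (dtr i j x) vs) + T' j (tr i j x) (map (dtr i j x) vs)"
    if "i \<in> idx M" "j \<in> idx M" "x \<in> ov i j" "length vs = p" for i j x vs
    using tensor_tr[OF T(1) that] tensor_tr[OF T(2) that] by simp
qed

lemma diff_form_add:
  assumes "diff_form M p \<eta>" "diff_form M p \<eta>'" shows "diff_form M p (\<lambda>i x vs. \<eta> i x vs + \<eta>' i x vs)"
  using assms unfolding diff_form_def by (auto intro: tensor_add alternating_add)

lemma diff_form_cmul:
  assumes "diff_form M p \<eta>" shows "diff_form M p (\<lambda>i x vs. c * \<eta> i x vs)"
  using assms unfolding diff_form_def by (auto intro: tensor_cmul alternating_cmul)

lemma diff_form_scale:
  assumes "smooth_fun u" "diff_form M p \<eta>" shows "diff_form M p (\<lambda>i x vs. u (inv_chart i x) * \<eta> i x vs)"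
  using assms unfolding diff_form_def by (auto intro: tensor_scale alternating_cmul)

end

context rmfd
begin

lemma contract_smooth:
  assumes "tensor_field M p \<alpha>" "tensor_field M p \<beta>" "i \<in> idx M"
  shows "smooth_on (cimg M i) (\<lambda>x. contract (F i x) p (\<alpha> i x) (\<beta> i x))"
proof (cases "cimg M i = {}")
  case True
  then show ?thesis by (simp add: smooth_on_def)
next
  case False
  then obtain x where "x \<in> cimg M i" by blast
  from chart_metric.der_contract[OF chart_metric[OF assms(3)] this tensor_tfield[OF assms(1,3)] tensor_tfield[OF assms(2,3)]]
  show ?thesis by (rule conjunct1)
qed

lemma contract_tr:
  assumes \<alpha>: "tensor_field M p \<alpha>" and \<beta>: "tensor_field M p \<beta>" and ij: "i \<in> idx M" "j \<in> idx M" and x: "x \<in> ov i j"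
  shows "contract (F i x) p (\<alpha> i x) (\<beta> i x) = contract (F j (tr i j x)) p (\<alpha> j (tr i j x)) (\<beta> j (tr i j x))"
proof -
  let ?D = "dtr i j x" and ?y = "tr i j x"
  have xi: "x \<in> cimg M i" and y: "?y \<in> cimg M j" using x ov_sub tr_cimg[OF ij x] by auto
  have "contract (F i x) p (\<alpha> i x) (\<beta> i x) = tsum (F i x) p (\<lambda>vs. \<alpha> j ?y (map ?D vs) * \<beta> j ?y (map ?D vs))"
    by (rule tsum_cong) (simp add: tensor_tr[OF \<alpha> ij x] tensor_tr[OF \<beta> ij x])
  also have "\<dots> = contract (\<lambda>k. ?D (F i x k)) p (\<alpha> j ?y) (\<beta> j ?y)"
    by (rule tsum_map)
  also have "\<dots> = contract (F j ?y) p (\<alpha> j ?y) (\<beta> j ?y)"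
    by (rule contract_frame[OF g_metric[OF ij(2) y] onb_tr[OF ij x onb_F[OF ij(1) xi]] onb_F[OF ij(2) y]
        tfield_multilin[OF tensor_tfield[OF \<alpha> ij(2)] y] tfield_multilin[OF tensor_tfield[OF \<beta> ij(2)] y]])
  finally show ?thesis .
qed

lemma scal_contract:
  assumes "tensor_field M p \<alpha>" "tensor_field M p \<beta>"
  shows "scal (\<lambda>i x. contract (F i x) p (\<alpha> i x) (\<beta> i x))"
  unfolding scal_def
  using smooth_on_continuous_on[OF contract_smooth[OF assms]] contract_tr[OF assms] by blast

lemma scal_cong:
  assumes f: "scal f" and eq: "\<And>i x. i \<in> idx M ==> x \<in> cimg M i ==> f' i x = f i x"
  shows "scal f'"
  unfolding scal_def
proof (intro conjI ballI)
  show "continuous_on (cimg M i) (f' i)" if "i \<in> idx M" for i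
    by (rule continuous_on_eq[OF scal_cont[OF f that]]) (rule eq[OF that, symmetric])
  show "f' i x = f' j (tr i j x)" if ij: "i \<in> idx M" "j \<in> idx M" and x: "x \<in> ov i j" for i j x
    using f ij x eq[OF ij(1), of x] eq[OF ij(2) tr_cimg[OF ij x]] ov_sub by (auto simp: scal_def)
qed

lemma form_inner_F:
  assumes "diff_form M p \<alpha>" "diff_form M p \<beta>" "i \<in> idx M" "x \<in> cimg M i"
  shows "form_inner (g i x) p (\<alpha> i x) (\<beta> i x) = contract (F i x) p (\<alpha> i x) (\<beta> i x) / fact p"
  by (rule form_inner_contract[OF g_metric[OF assms(3,4)] onb_F[OF assms(3,4)] diff_form_alt[OF assms(1,3,4)] diff_form_alt[OF assms(2,3,4)]])

lemma scal_form_inner: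
  assumes "diff_form M p \<alpha>" "diff_form M p \<beta>"
  shows "scal (ip p \<alpha> \<beta>)"
  by (rule scal_cong[OF scal_cmul[OF scal_contract[OF diff_form_tensor[OF assms(1)] diff_form_tensor[OF assms(2)]], of "1 / fact p"]])
    (simp add: form_inner_F[OF assms])

text \<open>The metric trace over the first two slots; applied to \<nabla>T it is the divergence of
  T.\<close>

definition tr12 :: "('i, 'e) tensor => ('i, 'e) tensor" where
  "tr12 T i x vs = (\<Sum>k<DIM('e). T i x (F i x k # F i x k # vs))"

lemma tr12_tensor:
  assumes T: "tensor_field M (Suc (Suc p)) T" shows "tensor_field M p (tr12 T)"
proof (rule tensor_fieldI)
  show "tfield (cimg M i) p (tr12 T i)" if i: "i \<in> idx M" for i
  proof -
    have "tfield (cimg M i) p (\<lambda>x vs. T i x (F i x k # F i x k # vs))" if k: "k < DIM('e)" for k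
    proof -
      note s = chart_metric.smooth_frame[OF chart_metric[OF i] k]
      show ?thesis by (rule tfield_Cons_field[OF tfield_Cons_field[OF tensor_tfield[OF T i] s] s])
    qed
    then have "tfield (cimg M i) p (\<lambda>x vs. \<Sum>k<DIM('e). T i x (F i x k # F i x k # vs))"
      by (intro tfield_sum) auto
    then show ?thesis unfolding tr12_def[abs_def] .
  qed
  fix i j x and vs :: "'e list" assume ij: "i \<in> idx M" "j \<in> idx M" and x: "x \<in> ov i j" and vs: "length vs = p"
  let ?D = "dtr i j x" and ?y = "tr i j x"
  have xi: "x \<in> cimg M i" and y: "?y \<in> cimg M j" using x ov_sub tr_cimg[OF ij x] by auto
  note m = tfield_multilin[OF tensor_tfield[OF T ij(2)] y]
  have "tr12 T i x vs = (\<Sum>k<DIM('e). T j ?y (?D (F i x k) # ?D (F i x k) # map ?D vs))"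
    unfolding tr12_def by (intro sum.cong refl) (simp add: tensor_tr[OF T ij x] vs)
  also have "\<dots> = (\<Sum>k<DIM('e). T j ?y (F j ?y k # F j ?y k # map ?D vs))"
  proof (rule onb_trace[where B = "\<lambda>u v. T j ?y (u # v # map ?D vs)", OF g_metric[OF ij(2) y] onb_tr[OF ij x onb_F[OF ij(1) xi]] onb_F[OF ij(2) y]])
    show "linear (\<lambda>u. T j ?y (u # v # map ?D vs))" for v by (rule multilin_head[OF m]) (simp add: vs)
    show "linear (\<lambda>v. T j ?y (u # v # map ?D vs))" for u by (rule multilin_head[OF multilin_Cons[OF m]]) (simp add: vs)
  qed
  finally show "tr12 T i x vs = tr12 T j ?y (map ?D vs)" by (simp add: tr12_def)
qed

text \<open>Derivatives are local, and the complement of a compact set is open in every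
  chart.\<close>

lemma nabla_zero_off:
  assumes T: "supp_in K p T" and K: "compact K" shows "supp_in K (Suc p) (nabla M g T)"
  unfolding supp_in_def
proof (intro ballI impI allI)
  fix i x and ws :: "'e list" assume i: "i \<in> idx M" and x: "x \<in> cimg M i" "inv_chart i x \<notin> K" and ws: "length ws = Suc p"
  obtain u vs where w: "ws = u # vs" "length vs = p" using ws by (cases ws) auto
  let ?U = "{x \<in> cimg M i. inv_chart i x \<notin> K}"
  note o = off_compact_open[OF i K]
  have xU: "x \<in> ?U" using x by simp
  have "der (cimg M i) (\<lambda>y. T i y vs) x u = der ?U (\<lambda>y. T i y vs) x u"
    unfolding frechet_derivative_openin[OF o xU] ..
  also have "\<dots> = der ?U (\<lambda>y. 0) x u" by (rule der_cong[OF xU]) (simp add: supp_inD[OF T i] w)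
  also have "\<dots> = 0" by (rule der_const[OF regular_set_openin[OF cimg_regular[OF i] o] xU])
  finally have 1: "der (cimg M i) (\<lambda>y. T i y vs) x u = 0" .
  have "form_ext (chr (cimg M i) (g i) x u) (T i x) vs = 0"
    by (rule form_ext_zero) (simp add: supp_inD[OF T i x] w)
  then show "nabla M g T i x ws = 0" using 1 by (simp add: nabla_nab nab_def pder_def w)
qed

lemma nabla_cong:
  assumes i: "i \<in> idx M" and x: "x \<in> cimg M i" and eq: "\<And>y vs. y \<in> cimg M i ==> length vs = p ==> T i y vs = T' i y vs"
    and ws: "length ws = Suc p"
  shows "nabla M g T i x ws = nabla M g T' i x ws"
proof -
  obtain u vs where w: "ws = u # vs" "length vs = p" using ws by (cases ws) auto
  have "der (cimg M i) (\<lambda>y. T i y vs) x u = der (cimg M i) (\<lambda>y. T' i y vs) x u"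
    by (rule der_cong[OF x]) (rule eq[OF _ w(2)])
  moreover have "form_ext (chr (cimg M i) (g i) x u) (T i x) vs = form_ext (chr (cimg M i) (g i) x u) (T' i x) vs"
    by (rule form_ext_cong) (use eq[OF x] w in auto)
  ultimately show ?thesis by (simp add: nabla_nab nab_def pder_def w)
qed

lemma nabla_sum:
  assumes i: "i \<in> idx M" and x: "x \<in> cimg M i" and T: "\<And>q. q \<in> Q ==> tensor_field M p (T q)" and ws: "length ws = Suc p"
  shows "nabla M g (\<lambda>i x vs. \<Sum>q\<in>Q. T q i x vs) i x ws = (\<Sum>q\<in>Q. nabla M g (T q) i x ws)"
proof -
  obtain u vs where w: "ws = u # vs" "length vs = p" using ws by (cases ws) auto
  have "der (cimg M i) (\<lambda>y. \<Sum>q\<in>Q. T q i y vs) x u = (\<Sum>q\<in>Q. der (cimg M i) (\<lambda>y. T q i y vs) x u)"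
    by (rule der_sum[OF cimg_regular[OF i] tfield_smooth[OF tensor_tfield[OF T i] w(2)] x])
  moreover have "form_ext S (\<lambda>vs. \<Sum>q\<in>Q. T q i x vs) vs = (\<Sum>q\<in>Q. form_ext S (T q i x) vs)" for S
    using form_ext_sum[of S "\<lambda>q. 1" "\<lambda>q. T q i x" Q vs] by simp
  ultimately show ?thesis by (simp add: nabla_nab nab_def pder_def w sum_subtractf)
qed

definition dvg :: "('i, 'e) tensor => 'i => 'e => real" where
  "dvg \<theta> i x = tr12 (nabla M g \<theta>) i x []"

definition sharp :: "('i, 'e) tensor => 'i => 'e => 'e" where
  "sharp \<theta> i x = (\<Sum>k<DIM('e). \<theta> i x [F i x k] *\<^sub>R F i x k)"

lemma scal_dvg: "tensor_field M 1 \<theta> ==> scal (dvg \<theta>)"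
  using tensor_0_scal[OF tr12_tensor[OF nabla_tensor[of 1 \<theta>, simplified]]] by (simp add: dvg_def[abs_def] numeral_2_eq_2)

lemma sharp_smooth:
  assumes \<theta>: "tensor_field M 1 \<theta>" and i: "i \<in> idx M" shows "smooth_on (cimg M i) (sharp \<theta> i)"
proof (cases "cimg M i = {}")
  case True
  then show ?thesis by (simp add: smooth_on_def)
next
  case False
  then obtain x where "x \<in> cimg M i" by blast
  from chart_metric.divergence_local(1)[OF chart_metric[OF i] tensor_tfield[OF \<theta> i] this]
  show ?thesis unfolding sharp_def[abs_def] .
qed

text \<open>For a one-form supported in one chart \<open>divergence_local\<close> cancels the
  density and leaves coordinate derivatives; the flat integral lemmas then apply, with or without a
  boundary.\<close>

lemma integral_dvg_chart:
  assumes \<theta>: "tensor_field M 1 \<theta>" and i: "i \<in> idx M" and C: "compact C" "C \<subseteq> cdom M i" and supp: "supp_in C 1 \<theta>"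
  shows "rint (dvg \<theta>) =
    (\<Sum>b\<in>Basis. LINT x|lborel. indicator (cimg M i) x * der (cimg M i) (\<lambda>y. wt i y * (sharp \<theta> i y \<bullet> b)) x b)"
    and "b \<in> Basis ==> smooth_on (cimg M i) (\<lambda>y. wt i y * (sharp \<theta> i y \<bullet> b))"
    and "x \<in> cimg M i - chart M i ` C ==> sharp \<theta> i x = 0"
proof -
  note sd = scal_dvg[OF \<theta>]
  show smooth: "smooth_on (cimg M i) (\<lambda>y. wt i y * (sharp \<theta> i y \<bullet> b))" if "b \<in> Basis" for b
    by (intro smooth_on_mult wt_smooth[OF i] smooth_on_inner sharp_smooth[OF \<theta> i] smooth_on_const)
  show zero: "sharp \<theta> i x = 0" if x: "x \<in> cimg M i - chart M i ` C" for x
  proof -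
    have "inv_chart i x \<notin> C" using x chart_inv_chart[of x i] by (metis DiffE image_eqI)
    then show ?thesis unfolding sharp_def using supp_inD[OF supp i, of x] x by simp
  qed
  have K: "compact (chart M i ` C)" "chart M i ` C \<subseteq> cimg M i" using compact_chart[OF i C] C(2) by (auto simp: cimg_def)
  have int: "integrable lborel (\<lambda>x. indicator (cimg M i) x * der (cimg M i) (\<lambda>y. wt i y * (sharp \<theta> i y \<bullet> b)) x b)" if "b \<in> Basis" for b
    by (rule integrable_der[OF cimg_regular[OF i] K smooth[OF that]]) (simp add: zero)
  have z: "glue (dvg \<theta>) q = 0" if q: "q \<in> pts M - cdom M i" for q
  proof -
    obtain j where j: "j \<in> idx M" "q \<in> cdom M j" "\<forall>f. glue f q = f j (chart M j q)" using q by (auto elim: glue_some)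
    have nz: "inv_chart j (chart M j q) \<notin> C" using q C(2) inv_chart_chart[OF j(1,2)] by auto
    show ?thesis using j(3) supp_inD[OF nabla_zero_off[OF supp C(1)] j(1) chart_cimg[OF j(2)] nz]
      by (simp add: dvg_def tr12_def)
  qed
  have "rint (dvg \<theta>) = (LINT x|lborel. indicator (cimg M i) x * (wt i x * glue (dvg \<theta>) (inv_chart i x)))"
    unfolding riem_integral_glue
    by (rule riem_integral_in_chart(2)[OF i borel_measurable_continuous_on_restrict[OF glue_continuous[OF sd]] z])
  also have "\<dots> = (LINT x|lborel. (\<Sum>b\<in>Basis. indicator (cimg M i) x * der (cimg M i) (\<lambda>y. wt i y * (sharp \<theta> i y \<bullet> b)) x b))"
  proof (rule Bochner_Integration.integral_cong[OF refl])
    fix x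
    show "indicator (cimg M i) x * (wt i x * glue (dvg \<theta>) (inv_chart i x)) =
      (\<Sum>b\<in>Basis. indicator (cimg M i) x * der (cimg M i) (\<lambda>y. wt i y * (sharp \<theta> i y \<bullet> b)) x b)"
    proof (cases "x \<in> cimg M i")
      case True
      have "(\<Sum>b\<in>Basis. der (cimg M i) (\<lambda>y. wt i y * (sharp \<theta> i y \<bullet> b)) x b) = wt i x * dvg \<theta> i x"
        using chart_metric.divergence_local(2)[OF chart_metric[OF i] tensor_tfield[OF \<theta> i] True]
        unfolding wt_dens[OF i, symmetric] by (simp only: sharp_def dvg_def tr12_def nabla_nab)
      then show ?thesis using True by (simp add: glue_inv_chart[OF sd i True])
    qed simp
  qed
  also have "\<dots> = (\<Sum>b\<in>Basis. LINT x|lborel. indicator (cimg M i) x * der (cimg M i) (\<lambda>y. wt i y * (sharp \<theta> i y \<bullet> b)) x b)"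
    by (rule Bochner_Integration.integral_sum[OF int])
  finally show "rint (dvg \<theta>) =
    (\<Sum>b\<in>Basis. LINT x|lborel. indicator (cimg M i) x * der (cimg M i) (\<lambda>y. wt i y * (sharp \<theta> i y \<bullet> b)) x b)" .
qed

text \<open>The pieces are supported in \<open>K\<close> as well as in a chart, so that forms
  supported in the interior and arbitrary forms share this reduction.\<close>

lemma dvg_partition:
  assumes \<theta>: "tensor_field M 1 \<theta>" and K: "compact K" "supp_in K 1 \<theta>"
  obtains Q :: "'a set" and c C \<theta>' where "finite Q"
    "\<forall>q\<in>Q. c q \<in> idx M \<and> tensor_field M 1 (\<theta>' q) \<and> compact (C q) \<and> C q \<subseteq> cdom M (c q) \<and> C q \<subseteq> K \<and> supp_in (C q) 1 (\<theta>' q)"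
    "rint (dvg \<theta>) = (\<Sum>q\<in>Q. rint (dvg (\<theta>' q)))"
    "\<forall>i\<in>idx M. \<forall>x\<in>cimg M i. \<forall>v. \<theta> i x v = (\<Sum>q\<in>Q. \<theta>' q i x v)"
proof -
  obtain Q :: "'a set" and c \<rho> C where Q: "finite Q"
    "\<forall>q\<in>Q. c q \<in> idx M \<and> smooth_fun (\<rho> q) \<and> compact (C q) \<and> C q \<subseteq> cdom M (c q) \<and> (\<forall>p. p \<notin> C q \<longrightarrow> \<rho> q p = 0)"
    "\<forall>p\<in>pts M. (\<Sum>q\<in>Q. \<rho> q p) = 1" by (rule partition_of_unity)
  define \<theta>' where "\<theta>' q i x vs = \<rho> q (inv_chart i x) * \<theta> i x vs" for q i x vs
  have t: "tensor_field M 1 (\<theta>' q)" if "q \<in> Q" for q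
    unfolding \<theta>'_def using Q(2) that by (intro tensor_scale \<theta>) auto
  have supp: "supp_in (C q \<inter> K) 1 (\<theta>' q)" if q: "q \<in> Q" for q
    unfolding supp_in_def
  proof (intro ballI impI allI)
    fix i x and vs :: "'e list" assume a: "i \<in> idx M" "x \<in> cimg M i" "inv_chart i x \<notin> C q \<inter> K" "length vs = 1"
    show "\<theta>' q i x vs = 0"
      using a Q(2) q supp_inD[OF K(2) a(1,2) _ a(4)] by (cases "inv_chart i x \<in> K") (auto simp: \<theta>'_def)
  qed
  have sum: "\<theta> i x v = (\<Sum>q\<in>Q. \<theta>' q i x v)" if "i \<in> idx M" "x \<in> cimg M i" for i x v
    using Q(3) inv_chart_dom[OF that(2)] dom_sub[OF that(1)] unfolding \<theta>'_def sum_distrib_right[symmetric] by auto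
  have "rint (dvg \<theta>) = rint (\<lambda>i x. \<Sum>q\<in>Q. dvg (\<theta>' q) i x)"
  proof (rule riem_integral_cong)
    fix i x assume i: "i \<in> idx M" and x: "x \<in> cimg M i"
    have "nabla M g \<theta> i x [u, v] = (\<Sum>q\<in>Q. nabla M g (\<theta>' q) i x [u, v])" for u v
    proof -
      have "nabla M g \<theta> i x [u, v] = nabla M g (\<lambda>i x v. \<Sum>q\<in>Q. \<theta>' q i x v) i x [u, v]"
        by (rule nabla_cong[OF i x, of 1]) (simp_all add: sum[OF i])
      also have "\<dots> = (\<Sum>q\<in>Q. nabla M g (\<theta>' q) i x [u, v])" by (rule nabla_sum[OF i x t]) simp_all
      finally show ?thesis .
    qed
    then show "dvg \<theta> i x = (\<Sum>q\<in>Q. dvg (\<theta>' q) i x)"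
      by (simp add: dvg_def tr12_def sum.swap[of _ Q])
  qed
  also have "\<dots> = (\<Sum>q\<in>Q. rint (dvg (\<theta>' q)))"
    by (rule riem_integral_sum[OF Q(1) scal_dvg[OF t]])
  finally show ?thesis
    using that[of Q c \<theta>' "\<lambda>q. C q \<inter> K"] Q(1,2) t supp sum compact_Int_closed[OF _ compact_imp_closed[OF K(1)]] by blast
qed

lemma integral_dvg_interior:
  assumes \<theta>: "tensor_field M 1 \<theta>" and K: "compact K" "K \<subseteq> interior_pts M" "supp_in K 1 \<theta>"
  shows "rint (dvg \<theta>) = 0"
proof -
  obtain Q :: "'a set" and c C \<theta>' where Q: "finite Q"
    "\<forall>q\<in>Q. c q \<in> idx M \<and> tensor_field M 1 (\<theta>' q) \<and> compact (C q) \<and> C q \<subseteq> cdom M (c q) \<and> C q \<subseteq> K \<and> supp_in (C q) 1 (\<theta>' q)"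
    "rint (dvg \<theta>) = (\<Sum>q\<in>Q. rint (dvg (\<theta>' q)))"
    "\<forall>i\<in>idx M. \<forall>x\<in>cimg M i. \<forall>v. \<theta> i x v = (\<Sum>q\<in>Q. \<theta>' q i x v)"
    by (rule dvg_partition[OF \<theta> K(1,3)])
  have "rint (dvg (\<theta>' q)) = 0" if "q \<in> Q" for q
  proof -
    have q: "c q \<in> idx M" "tensor_field M 1 (\<theta>' q)" "compact (C q)" "C q \<subseteq> cdom M (c q)" "C q \<subseteq> K" "supp_in (C q) 1 (\<theta>' q)"
      using Q(2) that by auto
    note L = integral_dvg_chart[OF q(2,1,3,4,6)]
    have Ki: "chart M (c q) ` C q \<subseteq> interior (cimg M (c q))"
    proof
      fix x assume "x \<in> chart M (c q) ` C q"
      then obtain p where p: "p \<in> C q" "x = chart M (c q) p" by blast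
      then have "p \<in> cdom M (c q)" "p \<in> interior_pts M" using q(4,5) K(2) by auto
      then show "x \<in> interior (cimg M (c q))"
        using interior_pts_iff[OF q(1), of p] interior_cimg[OF q(1)] chart_cimg[of p] p(2) by auto
    qed
    have "(LINT x|lborel. indicator (cimg M (c q)) x * der (cimg M (c q)) (\<lambda>y. wt (c q) y * (sharp (\<theta>' q) (c q) y \<bullet> b)) x b) = 0"
      if "b \<in> Basis" for b
      by (rule integral_der_interior[OF cimg_regular[OF q(1)] compact_chart[OF q(1,3,4)] Ki L(2)[OF that]]) (simp add: L(3))
    then show ?thesis unfolding L(1) by simp
  qed
  then show ?thesis using Q(3) by simp
qed

section \<open>Green's formulas and identification of the formal adjoints\<close>

definition ndiv :: "('i, 'e) tensor => ('i, 'e) tensor" where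
  "ndiv T i x vs = - tr12 (nabla M g T) i x vs"

lemma ndiv_tensor: "tensor_field M (Suc p) T ==> tensor_field M p (ndiv T)"
  using tensor_cmul[OF tr12_tensor[OF nabla_tensor[of "Suc p" T]], of "-1"] by (simp add: ndiv_def[abs_def])

text \<open>Form-valued one-forms, the arguments on which \<open>ndiv\<close> is the formal adjoint
  of \<nabla>. Forms of positive degree are a special case, and there \<open>ndiv\<close> is also
  the codifferential.\<close>

definition form1_field :: "nat => ('i, 'e) tensor => bool" where
  "form1_field p T \<longleftrightarrow> tensor_field M (Suc p) T \<and> (\<forall>i\<in>idx M. \<forall>x\<in>cimg M i. \<forall>v. alternating p (\<lambda>vs. T i x (v # vs)))"

lemma form1_tensor: "form1_field p T ==> tensor_field M (Suc p) T"
  by (simp add: form1_field_def)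

lemma form1_alt: "form1_field p T ==> i \<in> idx M ==> x \<in> cimg M i ==> alternating p (\<lambda>vs. T i x (v # vs))"
  by (simp add: form1_field_def)

lemma form1_nabla: "diff_form M p \<phi> ==> form1_field p (nabla M g \<phi>)"
  by (simp add: form1_field_def alternating_nabla nabla_tensor[OF diff_form_tensor])

lemma form1_form: "diff_form M (Suc p) \<omega> ==> form1_field p \<omega>"
  by (simp add: form1_field_def diff_form_tensor alternating_Cons[OF diff_form_alt])

lemma ndiv_form:
  assumes T1: "form1_field p T" shows "diff_form M p (ndiv T)"
  unfolding diff_form_def
proof (intro conjI ballI)
  note T = form1_tensor[OF T1] and alt = form1_alt[OF T1]
  show "tensor_field M p (ndiv T)" by (rule ndiv_tensor[OF T])
  fix i x assume i: "i \<in> idx M" and x: "x \<in> cimg M i"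
  let ?\<Gamma> = "chr (cimg M i) (g i) x"
  have "alternating p (\<lambda>vs. nabla M g T i x (u # v # vs))" for u v
  proof -
    have "alternating p (\<lambda>vs. nab (cimg M i) (g i) (\<lambda>y vs. T i y (v # vs)) x (u # vs))"
      by (rule chart_metric.alternating_nab[OF chart_metric[OF i] tfield_Cons[OF tensor_tfield[OF T i]] _ x]) (rule alt[OF i])
    from alternating_add[OF this alternating_cmul[OF alt[OF i x, of "?\<Gamma> u v"], of "-1"]]
    show ?thesis by (simp add: nabla_nab nab_def pder_def form_ext_Cons algebra_simps)
  qed
  then have "alternating p (\<lambda>vs. - 1 * (\<Sum>k<DIM('e). nabla M g T i x (F i x k # F i x k # vs)))"
    by (intro alternating_cmul alternating_sum)
  then show "alternating p (ndiv T i x)" by (simp add: ndiv_def[abs_def] tr12_def)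
qed

lemma ndiv_diff_form:
  assumes "diff_form M (Suc p) \<omega>" shows "diff_form M p (ndiv \<omega>)"
  by (rule ndiv_form[OF form1_form[OF assms]])

text \<open>Its divergence is the defect in Green's formula; on the unit normal it is, up to
  \<open>fact p\<close>, the boundary integrand.\<close>

definition flux :: "nat => ('i, 'e) tensor => ('i, 'e) tensor => ('i, 'e) tensor" where
  "flux p \<alpha> T i x ws = contract (F i x) p (\<alpha> i x) (\<lambda>vs. T i x (hd ws # vs))"

lemma flux_tensor:
  assumes \<alpha>: "tensor_field M p \<alpha>" and T: "tensor_field M (Suc p) T" shows "tensor_field M 1 (flux p \<alpha> T)"
proof (rule tensor_fieldI)
  show "tfield (cimg M i) 1 (flux p \<alpha> T i)" if i: "i \<in> idx M" for i
    unfolding flux_def[abs_def] by (rule chart_metric.green_local(1)[OF chart_metric[OF i] tensor_tfield[OF \<alpha> i] tensor_tfield[OF T i]])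
  fix i j x and ws :: "'e list" assume ij: "i \<in> idx M" "j \<in> idx M" and x: "x \<in> ov i j" and ws: "length ws = 1"
  then obtain v where w: "ws = [v]" by (cases ws) auto
  let ?D = "dtr i j x" and ?y = "tr i j x"
  have xi: "x \<in> cimg M i" and y: "?y \<in> cimg M j" using x ov_sub tr_cimg[OF ij x] by auto
  have "contract (F i x) p (\<alpha> i x) (\<lambda>vs. T i x (v # vs)) = tsum (F i x) p (\<lambda>vs. \<alpha> j ?y (map ?D vs) * T j ?y (?D v # map ?D vs))"
    by (rule tsum_cong) (simp add: tensor_tr[OF \<alpha> ij x] tensor_tr[OF T ij x])
  also have "\<dots> = contract (\<lambda>k. ?D (F i x k)) p (\<alpha> j ?y) (\<lambda>vs. T j ?y (?D v # vs))"
    by (rule tsum_map)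
  also have "\<dots> = contract (F j ?y) p (\<alpha> j ?y) (\<lambda>vs. T j ?y (?D v # vs))"
    by (rule contract_frame[OF g_metric[OF ij(2) y] onb_tr[OF ij x onb_F[OF ij(1) xi]] onb_F[OF ij(2) y]
        tfield_multilin[OF tensor_tfield[OF \<alpha> ij(2)] y] multilin_Cons[OF tfield_multilin[OF tensor_tfield[OF T ij(2)] y]]])
  finally show "flux p \<alpha> T i x ws = flux p \<alpha> T j ?y (map ?D ws)" by (simp add: flux_def w)
qed

lemma dvg_flux:
  assumes \<alpha>: "tensor_field M p \<alpha>" and T: "tensor_field M (Suc p) T" and i: "i \<in> idx M" and x: "x \<in> cimg M i"
  shows "dvg (flux p \<alpha> T) i x =
    contract (F i x) (Suc p) (nabla M g \<alpha> i x) (T i x) - contract (F i x) p (\<alpha> i x) (ndiv T i x)"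
proof -
  have "nabla M g (flux p \<alpha> T) i x [u, v] = contract (F i x) p (\<lambda>vs. nabla M g \<alpha> i x (u # vs)) (\<lambda>vs. T i x (v # vs)) +
      contract (F i x) p (\<alpha> i x) (\<lambda>vs. nabla M g T i x (u # v # vs))" for u v
    unfolding nabla_nab flux_def[abs_def]
    by (rule chart_metric.green_local(2)[OF chart_metric[OF i] tensor_tfield[OF \<alpha> i] tensor_tfield[OF T i] x])
  then have "dvg (flux p \<alpha> T) i x = contract (F i x) (Suc p) (nabla M g \<alpha> i x) (T i x) +
      (\<Sum>k<DIM('e). contract (F i x) p (\<alpha> i x) (\<lambda>vs. nabla M g T i x (F i x k # F i x k # vs)))"
    by (simp add: dvg_def tr12_def sum.distrib)
  also have "(\<Sum>k<DIM('e). contract (F i x) p (\<alpha> i x) (\<lambda>vs. nabla M g T i x (F i x k # F i x k # vs))) =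
      contract (F i x) p (\<alpha> i x) (tr12 (nabla M g T) i x)"
    by (simp add: tr12_def sum_distrib_left tsum_sum)
  also have "\<dots> = - contract (F i x) p (\<alpha> i x) (ndiv T i x)"
    using tsum_cmul[of "F i x" p "-1" "\<lambda>vs. \<alpha> i x vs * tr12 (nabla M g T) i x vs"] by (simp add: ndiv_def)
  finally show ?thesis by simp
qed

text \<open>Green's formula for d before integration. The factor \<open>p + 1\<close> from
  \<open>contract_alt\<close> turns the normalisation \<open>fact (Suc p)\<close> into
  \<open>fact p\<close>.\<close>

lemma ext_d_dvg:
  assumes \<phi>: "diff_form M p \<phi>" and \<omega>: "diff_form M (Suc p) \<omega>" and i: "i \<in> idx M" and x: "x \<in> cimg M i"
  shows "form_inner (g i x) (Suc p) (ext_d M \<phi> i x) (\<omega> i x) =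
    form_inner (g i x) p (\<phi> i x) (ndiv \<omega> i x) + 1 / fact p * dvg (flux p \<phi> \<omega>) i x"
proof -
  have "form_inner (g i x) (Suc p) (ext_d M \<phi> i x) (\<omega> i x) = contract (F i x) (Suc p) (ext_d M \<phi> i x) (\<omega> i x) / fact (Suc p)"
    by (rule form_inner_F[OF ext_d_form[OF \<phi>] \<omega> i x])
  also have "contract (F i x) (Suc p) (ext_d M \<phi> i x) (\<omega> i x) = contract (F i x) (Suc p) (alt (nabla M g \<phi> i x)) (\<omega> i x)"
    by (rule tsum_cong) (simp only: ext_d_nabla[OF \<phi> i x])
  also have "\<dots> = real (Suc p) * contract (F i x) (Suc p) (nabla M g \<phi> i x) (\<omega> i x)"
    by (rule contract_alt[OF diff_form_alt[OF \<omega> i x]])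
  also have "real (Suc p) * contract (F i x) (Suc p) (nabla M g \<phi> i x) (\<omega> i x) / fact (Suc p) =
      contract (F i x) (Suc p) (nabla M g \<phi> i x) (\<omega> i x) / fact p"
    unfolding fact_Suc of_nat_mult by (rule mult_divide_mult_cancel_left) simp
  finally show ?thesis
    unfolding dvg_flux[OF diff_form_tensor[OF \<phi>] diff_form_tensor[OF \<omega>] i x] form_inner_F[OF \<phi> ndiv_diff_form[OF \<omega>] i x]
    by (simp add: diff_divide_distrib)
qed

lemma form1_inner_F:
  assumes T: "form1_field p T" "form1_field p T'" and i: "i \<in> idx M" and x: "x \<in> cimg M i"
  shows "form1_inner (g i x) p (T i x) (T' i x) = contract (F i x) (Suc p) (T i x) (T' i x) / fact p"
  by (rule form1_inner_contract[OF g_metric[OF i x] onb_F[OF i x] tfield_multilin[OF tensor_tfield[OF form1_tensor[OF T(1)] i] x]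
    tfield_multilin[OF tensor_tfield[OF form1_tensor[OF T(2)] i] x] form1_alt[OF T(1) i x] form1_alt[OF T(2) i x]])

lemma nabla_dvg:
  assumes \<phi>: "diff_form M p \<phi>" and T: "form1_field p T"
    and i: "i \<in> idx M" and x: "x \<in> cimg M i"
  shows "form1_inner (g i x) p (nabla M g \<phi> i x) (T i x) =
    form_inner (g i x) p (\<phi> i x) (ndiv T i x) + 1 / fact p * dvg (flux p \<phi> T) i x"
  unfolding form1_inner_F[OF form1_nabla[OF \<phi>] T i x]
    dvg_flux[OF diff_form_tensor[OF \<phi>] form1_tensor[OF T] i x] form_inner_F[OF \<phi> ndiv_form[OF T] i x]
  by (simp add: diff_divide_distrib)

lemma flux_supp:
  assumes "supp_in K p \<phi>" shows "supp_in K 1 (flux p \<phi> T)"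
  unfolding supp_in_def flux_def
proof (intro ballI impI allI)
  fix i x and vs :: "'e list" assume "i \<in> idx M" "x \<in> cimg M i" "inv_chart i x \<notin> K"
  from supp_inD[OF assms this]
  have "contract (F i x) p (\<phi> i x) (\<lambda>us. T i x (hd vs # us)) = tsum (F i x) p (\<lambda>us. 0)" by (intro tsum_cong) simp
  then show "contract (F i x) p (\<phi> i x) (\<lambda>us. T i x (hd vs # us)) = 0" by (simp only: tsum_0)
qed

lemma integral_add_dvg:
  assumes "scal f" "tensor_field M 1 \<theta>" "\<And>i x. i \<in> idx M ==> x \<in> cimg M i ==> f' i x = f i x + c * dvg \<theta> i x"
  shows "rint f' = rint f + c * rint (dvg \<theta>)"
  unfolding riem_integral_cmul[symmetric] riem_integral_add[OF assms(1) scal_cmul[OF scal_dvg[OF assms(2)]], symmetric]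
  by (rule riem_integral_cong[OF assms(3)])

lemma integral_ext_d:
  assumes \<phi>: "diff_form M p \<phi>" and \<omega>: "diff_form M (Suc p) \<omega>"
  shows "rint (ip (Suc p) (ext_d M \<phi>) \<omega>) = rint (ip p \<phi> (ndiv \<omega>)) + 1 / fact p * rint (dvg (flux p \<phi> \<omega>))"
  by (rule integral_add_dvg[OF scal_form_inner[OF \<phi> ndiv_diff_form[OF \<omega>]] flux_tensor[OF diff_form_tensor[OF \<phi>] diff_form_tensor[OF \<omega>]]
    ext_d_dvg[OF \<phi> \<omega>]])

lemma integral_nabla:
  assumes \<phi>: "diff_form M p \<phi>" and T: "form1_field p T"
  shows "rint (\<lambda>i x. form1_inner (g i x) p (nabla M g \<phi> i x) (T i x)) =
    rint (ip p \<phi> (ndiv T)) + 1 / fact p * rint (dvg (flux p \<phi> T))"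
  by (rule integral_add_dvg[OF scal_form_inner[OF \<phi> ndiv_form[OF T]] flux_tensor[OF diff_form_tensor[OF \<phi>] form1_tensor[OF T]]
    nabla_dvg[OF \<phi> T]])

text \<open>Test with a bump times the difference \<delta> of the two forms: the integrand is a
  nonnegative multiple of the squared norm of \<delta>, so \<delta> vanishes where the bump is
  positive. Only interior points admit such a bump; the others are reached by continuity.\<close>

lemma forms_eqI_test:
  assumes \<eta>: "diff_form M p \<eta>" and \<eta>': "diff_form M p \<eta>'"
    and test: "\<And>\<phi>. test_form M p \<phi> ==> rint (ip p \<phi> \<eta>) =
      rint (ip p \<phi> \<eta>')"
    and i: "i \<in> idx M" and x: "x \<in> cimg M i" and vs: "length vs = p"
  shows "\<eta> i x vs = \<eta>' i x vs"
proof -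
  define \<delta> where "\<delta> i x vs = \<eta> i x vs + (- 1) * \<eta>' i x vs" for i x vs
  have \<delta>: "diff_form M p \<delta>" unfolding \<delta>_def[abs_def] by (rule diff_form_add[OF \<eta> diff_form_cmul[OF \<eta>']])
  define f where "f i x = form_inner (g i x) p (\<delta> i x) (\<delta> i x)" for i x
  have f: "scal f" unfolding f_def[abs_def] by (rule scal_form_inner[OF \<delta> \<delta>])
  have interior: "f i y = 0" if y: "y \<in> interior (cimg M i)" for y
  proof -
    obtain r where r: "r > 0" "cball y r \<subseteq> interior (cimg M i)" using y open_contains_cball[of "interior (cimg M i)"] by auto
    have sub: "cball y r \<inter> R \<subseteq> cimg M i" using r(2) interior_subset by blast
    define C where "C = inv_chart i ` (cball y r \<inter> R)"
    obtain u where u: "smooth_fun u" "\<And>q. u q \<ge> 0" "\<And>q. q \<in> cdom M i ==> u q = bump y r (chart M i q)"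
      "compact C" "C \<subseteq> cdom M i" "\<And>q. q \<notin> C ==> u q = 0"
      using chart_bump[OF i r(1) sub] unfolding C_def by metis
    define \<phi> where "\<phi> i x vs = u (inv_chart i x) * \<delta> i x vs" for i x vs
    have \<phi>: "diff_form M p \<phi>" unfolding \<phi>_def[abs_def] by (rule diff_form_scale[OF u(1) \<delta>])
    have yi: "y \<in> cimg M i" using y interior_subset by blast
    have "C \<subseteq> interior_pts M"
    proof
      fix q assume "q \<in> C"
      then obtain z where z: "z \<in> cball y r" "q = inv_chart i z" unfolding C_def by blast
      then have "z \<in> interior (cimg M i)" using r(2) by blast
      moreover then have "z \<in> cimg M i" using interior_subset by blast
      ultimately show "q \<in> interior_pts M"
        unfolding interior_pts_def z(2) using i inv_chart_dom[of z i] chart_inv_chart[of z i] by auto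
    qed
    moreover have "supp_in C p \<phi>" unfolding supp_in_def \<phi>_def by (simp add: u(6))
    ultimately have tf: "test_form M p \<phi>" unfolding test_form_iff using \<phi> u(4) by blast
    have s: "scal (ip p \<phi> \<delta>)" by (rule scal_form_inner[OF \<phi> \<delta>])
    have eq: "form_inner (g i x) p (\<phi> i x) (\<delta> i x) = u (inv_chart i x) * f i x" for i x
      unfolding \<phi>_def f_def by (rule form_inner_cmul)
    have split: "form_inner (g i x) p (\<phi> i x) (\<delta> i x) =
       form_inner (g i x) p (\<phi> i x) (\<eta> i x) + (- 1) * form_inner (g i x) p (\<phi> i x) (\<eta>' i x)" for i x
      unfolding form_inner_sym[of _ _ "\<phi> i x"] \<delta>_def form_inner_add form_inner_cmul ..
    have "rint (ip p \<phi> \<delta>) = 0"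
      unfolding split riem_integral_add[OF scal_form_inner[OF \<phi> \<eta>] scal_cmul[OF scal_form_inner[OF \<phi> \<eta>']]] riem_integral_cmul test[OF tf] by simp
    then have "form_inner (g i y) p (\<phi> i y) (\<delta> i y) = 0"
    proof (rule riem_integral_zero_imp[OF s _ _ i y, rotated])
      show "form_inner (g i x) p (\<phi> i x) (\<delta> i x) \<ge> 0" for i x by (simp add: eq f_def u(2) form_inner_self_nonneg)
      fix q assume q: "q \<in> pts M - cdom M i"
      then obtain j where "j \<in> idx M" "q \<in> cdom M j" "\<forall>f. glue f q = f j (chart M j q)" by (auto elim: glue_some)
      then show "glue (ip p \<phi> \<delta>) q = 0"
        using u(5,6) q by (auto simp: eq inv_chart_chart)
    qed
    then have "u (inv_chart i y) * f i y = 0" unfolding eq .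
    moreover have "u (inv_chart i y) > 0"
      using u(3)[OF inv_chart_dom[OF yi]] chart_inv_chart[OF yi] bump_pos[OF r(1), of y y] r(1) by simp
    ultimately show ?thesis by simp
  qed
  \<comment> \<open>A nonzero value would persist on a set open in \<open>R\<close>, which meets the
    dense set \<open>interior R\<close>.\<close>
  have "f i x = 0"
  proof (rule ccontr)
    assume nz: "f i x \<noteq> 0"
    have "openin (top_of_set (cimg M i)) (cimg M i \<inter> f i -` (- {0}))"
      by (rule continuous_openin_preimage_gen[OF scal_cont[OF f i]]) auto
    then have "openin (top_of_set R) (cimg M i \<inter> f i -` (- {0}))" by (rule openin_trans[OF _ cimg_open[OF i]])
    then obtain T where T: "open T" "cimg M i \<inter> f i -` (- {0}) = R \<inter> T" by (auto simp: openin_open)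
    then have "x \<in> R \<inter> T" using x nz by blast
    then obtain y where y: "y \<in> interior R" "y \<in> T" using R(3) T(1) open_Int_closure_eq_empty[OF T(1), of "interior R"] by blast
    then have "y \<in> R \<inter> T" using interior_subset by blast
    then have "y \<in> cimg M i" "f i y \<noteq> 0" unfolding T(2)[symmetric] by auto
    then show False using interior[of y] y(1) interior_cimg[OF i] by blast
  qed
  then have "\<delta> i x vs = 0" unfolding f_def
    by (rule form_inner_self_zero[OF g_metric[OF i x] diff_form_alt[OF \<delta> i x] _ vs])
  then show ?thesis by (simp add: \<delta>_def)
qed

text \<open>The \<open>SOME\<close> in \<open>codiff\<close> and \<open>nabla_adj\<close> may return
  any solution; two solutions agree on chart images, so an explicit adjoint describes the chosen one
  there.\<close>

lemma some_adjoint: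
  fixes L :: "('i, 'e) tensor => real"
  assumes \<eta>: "diff_form M p \<eta>" and adj: "\<forall>\<phi>. test_form M p \<phi> \<longrightarrow> L \<phi> = rint (ip p \<phi> \<eta>)"
  defines "\<eta>' \<equiv> SOME \<eta>. diff_form M p \<eta> \<and> (\<forall>\<phi>. test_form M p \<phi> \<longrightarrow> L \<phi> = rint (ip p \<phi> \<eta>))"
  shows "diff_form M p \<eta>'" and "i \<in> idx M ==> x \<in> cimg M i ==> length vs = p ==> \<eta>' i x vs = \<eta> i x vs"
proof -
  let ?P = "\<lambda>\<eta>. diff_form M p \<eta> \<and> (\<forall>\<phi>. test_form M p \<phi> \<longrightarrow> L \<phi> = rint (ip p \<phi> \<eta>))"
  have "?P \<eta>" using \<eta> adj by blast
  then have P: "?P \<eta>'" unfolding \<eta>'_def by (rule someI[of ?P])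
  then show \<eta>': "diff_form M p \<eta>'" by blast
  show "\<eta>' i x vs = \<eta> i x vs" if i: "i \<in> idx M" "x \<in> cimg M i" "length vs = p"
  proof (rule forms_eqI_test[OF \<eta>' \<eta> _ i])
    fix \<phi> assume "test_form M p \<phi>"
    then show "rint (ip p \<phi> \<eta>') = rint (ip p \<phi> \<eta>)" using P adj by simp
  qed
qed

lemma integral_dvg_flux_test:
  assumes "test_form M p \<phi>" "tensor_field M (Suc p) T" shows "rint (dvg (flux p \<phi> T)) = 0"
proof -
  obtain K where K: "diff_form M p \<phi>" "compact K" "K \<subseteq> interior_pts M" "supp_in K p \<phi>"
    using test_form_iff[THEN iffD1, OF assms(1)] by blast
  show ?thesis by (rule integral_dvg_interior[OF flux_tensor[OF diff_form_tensor[OF K(1)] assms(2)] K(2,3) flux_supp[OF K(4)]])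
qed

lemma test_form_form: "test_form M p \<phi> ==> diff_form M p \<phi>"
  by (simp add: test_form_def)

lemma codiff_ndiv:
  assumes \<omega>: "diff_form M (Suc p) \<omega>"
  shows "diff_form M p (codiff M g (Suc p) \<omega>)"
    and "i \<in> idx M ==> x \<in> cimg M i ==> length vs = p ==> codiff M g (Suc p) \<omega> i x vs = ndiv \<omega> i x vs"
proof -
  have adj: "rint (ip (Suc p) (ext_d M \<phi>) \<omega>) = rint (ip p \<phi> (ndiv \<omega>))" if tf: "test_form M p \<phi>" for \<phi>
    unfolding integral_ext_d[OF test_form_form[OF tf] \<omega>] integral_dvg_flux_test[OF tf diff_form_tensor[OF \<omega>]] by simp
  then have "\<forall>\<phi>. test_form M p \<phi> \<longrightarrow> rint (ip (Suc p) (ext_d M \<phi>) \<omega>) = rint (ip p \<phi> (ndiv \<omega>))" by blast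
  note * = some_adjoint[OF ndiv_diff_form[OF \<omega>] this, folded codiff_def[of M g "Suc p" \<omega>, unfolded diff_Suc_1]]
  show "diff_form M p (codiff M g (Suc p) \<omega>)"
    "i \<in> idx M ==> x \<in> cimg M i ==> length vs = p ==> codiff M g (Suc p) \<omega> i x vs = ndiv \<omega> i x vs"
    by (rule *)+
qed

lemma nabla_adj_ndiv:
  assumes T: "form1_field p T" and i: "i \<in> idx M" "x \<in> cimg M i" "length vs = p"
  shows "nabla_adj M g p T i x vs = ndiv T i x vs"
proof -
  have adj: "rint (\<lambda>i x. form1_inner (g i x) p (nabla M g \<phi> i x) (T i x)) = rint (ip p \<phi> (ndiv T))" if tf: "test_form M p \<phi>" for \<phi>
    unfolding integral_nabla[OF test_form_form[OF tf] T] integral_dvg_flux_test[OF tf form1_tensor[OF T]] by simp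
  show ?thesis unfolding nabla_adj_def by (rule some_adjoint(2)[OF ndiv_form[OF T] _ i]) (use adj in blast)
qed

text \<open>Without boundary the whole manifold is a compact subset of its interior, so the
  divergence theorem applies to arbitrary forms. The application is to \<Sigma>.\<close>

lemma integral_ext_d_closed:
  assumes closed: "interior_pts M = pts M" and \<phi>: "diff_form M p \<phi>" and \<omega>: "diff_form M (Suc p) \<omega>"
  shows "rint (ip (Suc p) (ext_d M \<phi>) \<omega>) =
    rint (ip p \<phi> (codiff M g (Suc p) \<omega>))"
proof -
  have "rint (dvg (flux p \<phi> \<omega>)) = 0"
    by (rule integral_dvg_interior[OF flux_tensor[OF diff_form_tensor[OF \<phi>] diff_form_tensor[OF \<omega>]] compact_pts _ supp_in_pts])
      (simp add: closed)
  then have "rint (ip (Suc p) (ext_d M \<phi>) \<omega>) =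
    rint (ip p \<phi> (ndiv \<omega>))"
    unfolding integral_ext_d[OF \<phi> \<omega>] by simp
  also have "\<dots> = rint (ip p \<phi> (codiff M g (Suc p) \<omega>))"
    by (rule riem_integral_cong, rule form_inner_cong[OF g_metric]) (simp_all add: codiff_ndiv(2)[OF \<omega>])
  finally show ?thesis .
qed

end

section \<open>The unit normal of a hypersurface\<close>

abbreviation pb :: "((real \<times> 'b::euclidean_space) list => real) => 'b list => real" where
  "pb \<alpha> \<equiv> (\<lambda>vs. \<alpha> (map (Pair 0) vs))"

lemma linear_Pair0: "linear (Pair (0 :: real) :: 'b::euclidean_space => real \<times> 'b)"
  by (rule linearI) auto

lemma pullback_pb: "pullback \<omega> i y = pb (\<omega> i (0, y))"
  by (simp add: pullback_def fun_eq_iff)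

lemma metric_pb: "metric_at h ==> metric_at (pb h)"
  unfolding metric_at_def using multilin_map[OF _ linear_Pair0, of 2 h] by (auto simp: zero_prod_def)

text \<open>The last Gram-Schmidt vector for a tangential frame followed by \<open>(1, 0)\<close>.
  This explicit form makes smooth dependence on the metric and positivity of the first coordinate
  accessible.\<close>

definition normal_of :: "((real \<times> 'b::euclidean_space) list => real) => real \<times> 'b" where
  "normal_of h = normalize_perp h (1, 0) (\<lambda>k. (0, gs_frame (pb h) k)) DIM('b)"

lemma normal_of:
  fixes h :: "(real \<times> 'b::euclidean_space) list => real"
  assumes h: "metric_at h"
  shows "h [normal_of h, normal_of h] = 1" and "h [normal_of h, (0, u)] = 0" and "fst (normal_of h) > 0"
proof -
  let ?E = "\<lambda>k. (0 :: real, gs_frame (pb h) k :: 'b)"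
  have onb: "onb (pb h) (gs_frame (pb h))" by (rule onb_gs_frame[OF metric_pb[OF h]])
  then have E: "h [?E i, ?E j] = (if i = j then 1 else 0)" if "i < DIM('b)" "j < DIM('b)" for i j
    using that by (simp add: onb_def)
  have sub: "span (?E ` {..<DIM('b)}) \<subseteq> {x. fst x = 0}"
    by (rule span_minimal) (auto simp: subspace_def)
  then have b: "(1, 0) \<notin> span (?E ` {..<DIM('b)})" by auto
  note np = normalize_perp[OF h E b, folded normal_of_def]
  show "h [normal_of h, normal_of h] = 1" by (rule np(1))
  obtain c z where "c > 0" "z \<in> span (?E ` {..<DIM('b)})" "normal_of h = c *\<^sub>R ((1, 0) - z)" using np(3) by blast
  then show "fst (normal_of h) > 0" using sub by auto
  have lin: "linear (\<lambda>u. h [normal_of h, (0, u)])"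
    using linear_compose[OF linear_Pair0 metric_at_linear2[OF h]] by (simp add: o_def)
  have "h [normal_of h, (0, u)] = (\<Sum>k<DIM('b). pb h [u, gs_frame (pb h) k] * h [normal_of h, ?E k])"
    by (rule onb_expand_real[OF metric_pb[OF h] onb lin])
  then show "h [normal_of h, (0, u)] = 0" using np(2) by simp
qed

text \<open>Subtracting the multiple of the normal that removes the first coordinate leaves a
  tangential vector; pairing with the normal identifies the multiple.\<close>

lemma normal_decomp:
  assumes h: "metric_at h"
  shows "fst v = h [v, normal_of h] * fst (normal_of h)"
    and "v = h [v, normal_of h] *\<^sub>R normal_of h + (0, snd (v - h [v, normal_of h] *\<^sub>R normal_of h))"
proof -
  let ?N = "normal_of h"
  define w where "w = v - (fst v / fst ?N) *\<^sub>R ?N"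
  have "fst w = 0" using normal_of(3)[OF h] by (simp add: w_def)
  then have w0: "w = (0, snd w)" by (simp add: prod_eq_iff)
  have "h [w, ?N] = 0" by (subst w0, subst metric_at_sym[OF h]) (rule normal_of(2)[OF h])
  moreover have "h [w, ?N] = h [v, ?N] - (fst v / fst ?N) * h [?N, ?N]"
    using linear_diff[OF metric_at_linear1[OF h, of ?N], of v] linear_cmul[OF metric_at_linear1[OF h, of ?N]] by (simp add: w_def)
  ultimately have c: "h [v, ?N] = fst v / fst ?N" using normal_of(1)[OF h] by simp
  then show "fst v = h [v, ?N] * fst ?N" using normal_of(3)[OF h] by simp
  show "v = h [v, ?N] *\<^sub>R ?N + (0, snd (v - h [v, ?N] *\<^sub>R ?N))"
    unfolding c w0[unfolded w_def, symmetric] by simp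
qed

lemma normal_unique:
  assumes h: "metric_at h" and N: "h [N, N] = 1" "\<And>u. h [N, (0, u)] = 0" "fst N > 0"
  shows "N = normal_of h"
proof -
  let ?N = "normal_of h"
  define c where "c = h [N, ?N]"
  define w where "w = snd (N - c *\<^sub>R ?N)"
  have eq: "N = c *\<^sub>R ?N + (0, w)" unfolding c_def w_def by (rule normal_decomp(2)[OF h])
  have "h [N, (0, w)] = c * h [?N, (0, w)] + h [(0, w), (0, w)]"
    using linear_add[OF metric_at_linear1[OF h, of "(0, w)"], of "c *\<^sub>R ?N" "(0, w)"] linear_cmul[OF metric_at_linear1[OF h, of "(0, w)"], of c ?N] eq by simp
  then have "h [(0, w), (0, w)] = 0" using N(2) normal_of(2)[OF h] by simp
  then have "(0 :: real, w) = 0" using h unfolding metric_at_def by (metis less_irrefl)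
  then have eq': "N = c *\<^sub>R ?N" using eq by simp
  have "h [N, N] = c * h [?N, N]" using linear_cmul[OF metric_at_linear1[OF h, of N], of c ?N] eq' by simp
  then have "c * c = 1" using N(1) metric_at_sym[OF h, of ?N N] by (simp add: c_def)
  moreover have "c > 0" using N(3) normal_of(3)[OF h] arg_cong[OF eq', of fst] by (simp add: zero_less_mult_iff)
  ultimately have "c = 1" by (metis abs_1 abs_of_pos abs_mult_self_eq abs_square_eq_1 power2_eq_square)
  then show ?thesis using eq' by simp
qed

lemma inner_normal_eq: "metric_at (g i (0, y)) ==> inner_normal g i y = normal_of (g i (0, y))"
  unfolding inner_normal_def
  by (rule the_equality) (auto simp: normal_of intro: normal_unique)

definition nframe :: "real \<times> 'b => (nat => 'b) => nat => real \<times> 'b" where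
  "nframe N f k = (case k of 0 => N | Suc l => (0, f l))"

lemma nframe_simps [simp]: "nframe N f 0 = N" "nframe N f (Suc l) = (0, f l)"
  by (simp_all add: nframe_def)

lemma DIM_half: "DIM(real \<times> 'b::euclidean_space) = Suc DIM('b)" by simp

lemma onb_nframe:
  fixes h :: "(real \<times> 'b::euclidean_space) list => real"
  assumes h: "metric_at h" and f: "onb (pb h) f"
  shows "onb h (nframe (normal_of h) f)"
  unfolding onb_def DIM_half
proof (intro allI impI)
  fix i j assume "i < Suc DIM('b)" "j < Suc DIM('b)"
  then show "h [nframe (normal_of h) f i, nframe (normal_of h) f j] = (if i = j then 1 else 0)"
    using f normal_of[OF h] metric_at_sym[OF h, of "(0, _)" "normal_of h"] by (cases i; cases j) (auto simp: onb_def)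
qed

lemma tsum_nframe:
  "tsum (nframe N f) (Suc p) F = tsum (nframe N f) p (\<lambda>vs. F (N # vs)) + (\<Sum>k<DIM('b). tsum (nframe N f) p (\<lambda>vs. F ((0, f k) # vs)))"
  for N :: "real \<times> 'b::euclidean_space"
  by (simp only: tsum.simps DIM_half sum.lessThan_Suc_shift nframe_simps)

lemma alternating_swap_head:
  assumes \<omega>: "alternating (Suc p) \<omega>" and us: "length us = p" "j < p"
  shows "\<omega> (a # us[j := b]) = - \<omega> (b # us[j := a])"
proof -
  note m = alternating_multilin[OF \<omega>]
  have u: "us[j := x] = take j us @ x # drop (Suc j) us" for x using us by (simp add: upd_conv_take_nth_drop)
  have l2: "linear (\<lambda>y. \<omega> (x # us[j := y]))" for x
    unfolding u by (rule multilin_mid[OF multilin_Cons[OF m]]) (use us in simp)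
  have l1: "linear (\<lambda>x. \<omega> (x # us[j := y]))" for y by (rule multilin_head[OF m]) (use us in simp)
  have z: "\<omega> (x # us[j := x]) = 0" for x
    by (rule alternating_not_distinct[OF \<omega>]) (use us in \<open>auto simp: set_update_memI\<close>)
  have "0 = \<omega> ((a + b) # us[j := a + b])" using z by simp
  also have "\<dots> = \<omega> (a # us[j := b]) + \<omega> (b # us[j := a])"
    using linear_add[OF l1[of "a + b"], of a b] linear_add[OF l2[of a], of a b] linear_add[OF l2[of b], of a b] z by simp
  finally show ?thesis by simp
qed

text \<open>In an alternating form the normal occupies at most one of the \<open>p + 1\<close>
  slots, and each slot contributes the same, since the sign enters through both factors.\<close>

lemma contract_nframe:
  fixes f :: "nat => 'b::euclidean_space"
  shows "alternating (Suc p) \<alpha> ==> alternating (Suc p) \<beta> ==>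
    contract (nframe N f) (Suc p) \<alpha> \<beta> =
    contract f (Suc p) (pb \<alpha>) (pb \<beta>) + real (Suc p) * contract f p (pb (\<lambda>vs. \<alpha> (N # vs))) (pb (\<lambda>vs. \<beta> (N # vs)))"
proof (induction p arbitrary: \<alpha> \<beta>)
  case 0
  show ?case unfolding tsum_nframe by simp
next
  case (Suc p)
  note a = alternating_Cons[OF Suc.prems(1)] and b = alternating_Cons[OF Suc.prems(2)]
  have NN: "\<alpha> (N # N # vs) = 0" if "length vs = p" for vs
    by (rule alternating_not_distinct[OF Suc.prems(1)]) (simp_all add: that)
  have swap: "\<omega> (v # N # vs) = - \<omega> (N # v # vs)" if "alternating (Suc (Suc p)) \<omega>" "length vs = p" for \<omega> :: "(real \<times> 'b) list => real" and v vs
    using alternating_swap_head[OF that(1), of "N # vs" 0 v N] that(2) by simp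
  have "contract (nframe N f) (Suc (Suc p)) \<alpha> \<beta> = contract (nframe N f) (Suc p) (\<lambda>vs. \<alpha> (N # vs)) (\<lambda>vs. \<beta> (N # vs)) +
    (\<Sum>k<DIM('b). contract (nframe N f) (Suc p) (\<lambda>vs. \<alpha> ((0, f k) # vs)) (\<lambda>vs. \<beta> ((0, f k) # vs)))"
    by (rule tsum_nframe)
  also have "contract (nframe N f) (Suc p) (\<lambda>vs. \<alpha> (N # vs)) (\<lambda>vs. \<beta> (N # vs)) =
     contract f (Suc p) (pb (\<lambda>vs. \<alpha> (N # vs))) (pb (\<lambda>vs. \<beta> (N # vs))) +
     real (Suc p) * tsum f p (\<lambda>vs. \<alpha> (N # N # map (Pair 0) vs) * \<beta> (N # N # map (Pair 0) vs))"
    by (rule Suc.IH[OF a b])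
  also have "tsum f p (\<lambda>vs. \<alpha> (N # N # map (Pair 0) vs) * \<beta> (N # N # map (Pair 0) vs)) = tsum f p (\<lambda>vs. 0)"
    by (rule tsum_cong) (simp add: NN)
  also have "(\<Sum>k<DIM('b). contract (nframe N f) (Suc p) (\<lambda>vs. \<alpha> ((0, f k) # vs)) (\<lambda>vs. \<beta> ((0, f k) # vs))) =
    (\<Sum>k<DIM('b). contract f (Suc p) (pb (\<lambda>vs. \<alpha> ((0, f k) # vs))) (pb (\<lambda>vs. \<beta> ((0, f k) # vs))) +
       real (Suc p) * tsum f p (\<lambda>vs. \<alpha> (N # (0, f k) # map (Pair 0) vs) * \<beta> (N # (0, f k) # map (Pair 0) vs)))"
  proof (rule sum.cong[OF refl])
    fix k
    have "contract (nframe N f) (Suc p) (\<lambda>vs. \<alpha> ((0, f k) # vs)) (\<lambda>vs. \<beta> ((0, f k) # vs)) =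
      contract f (Suc p) (pb (\<lambda>vs. \<alpha> ((0, f k) # vs))) (pb (\<lambda>vs. \<beta> ((0, f k) # vs))) +
      real (Suc p) * tsum f p (\<lambda>vs. \<alpha> ((0, f k) # N # map (Pair 0) vs) * \<beta> ((0, f k) # N # map (Pair 0) vs))"
      by (rule Suc.IH[OF a b])
    also have "tsum f p (\<lambda>vs. \<alpha> ((0, f k) # N # map (Pair 0) vs) * \<beta> ((0, f k) # N # map (Pair 0) vs)) =
      tsum f p (\<lambda>vs. \<alpha> (N # (0, f k) # map (Pair 0) vs) * \<beta> (N # (0, f k) # map (Pair 0) vs))"
      by (rule tsum_cong) (simp add: swap[OF Suc.prems(1)] swap[OF Suc.prems(2)])
    finally show "contract (nframe N f) (Suc p) (\<lambda>vs. \<alpha> ((0, f k) # vs)) (\<lambda>vs. \<beta> ((0, f k) # vs)) =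
      contract f (Suc p) (pb (\<lambda>vs. \<alpha> ((0, f k) # vs))) (pb (\<lambda>vs. \<beta> ((0, f k) # vs))) +
      real (Suc p) * tsum f p (\<lambda>vs. \<alpha> (N # (0, f k) # map (Pair 0) vs) * \<beta> (N # (0, f k) # map (Pair 0) vs))" .
  qed
  finally show ?case
    unfolding tsum_0 sum.distrib sum_distrib_left[symmetric] by (simp add: algebra_simps)
qed

lemma alternating_pb: "alternating p \<alpha> ==> alternating p (pb \<alpha>)"
  by (rule alternating_map[OF _ linear_Pair0])

text \<open>The factor \<open>p + 1\<close> of \<open>contract_nframe\<close> is the ratio of the
  two factorial normalisations.\<close>

lemma form_inner_split:
  assumes h: "metric_at h" and ab: "alternating (Suc p) \<alpha>" "alternating (Suc p) \<beta>"
  shows "form_inner h (Suc p) \<alpha> \<beta> = form_inner (pb h) (Suc p) (pb \<alpha>) (pb \<beta>) +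
    form_inner (pb h) p (pb (\<lambda>vs. \<alpha> (normal_of h # vs))) (pb (\<lambda>vs. \<beta> (normal_of h # vs)))"
proof -
  let ?f = "gs_frame (pb h)" and ?N = "normal_of h"
  note hb = metric_pb[OF h] note f = onb_gs_frame[OF hb]
  have "form_inner h (Suc p) \<alpha> \<beta> = contract (nframe ?N ?f) (Suc p) \<alpha> \<beta> / fact (Suc p)"
    by (rule form_inner_contract[OF h onb_nframe[OF h f] ab])
  also have "\<dots> = contract ?f (Suc p) (pb \<alpha>) (pb \<beta>) / fact (Suc p) +
     real (Suc p) * contract ?f p (pb (\<lambda>vs. \<alpha> (?N # vs))) (pb (\<lambda>vs. \<beta> (?N # vs))) / fact (Suc p)"
    unfolding contract_nframe[OF ab] add_divide_distrib ..
  also have "contract ?f (Suc p) (pb \<alpha>) (pb \<beta>) / fact (Suc p) = form_inner (pb h) (Suc p) (pb \<alpha>) (pb \<beta>)"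
    by (rule form_inner_contract[OF hb f alternating_pb[OF ab(1)] alternating_pb[OF ab(2)], symmetric])
  also have "real (Suc p) * contract ?f p (pb (\<lambda>vs. \<alpha> (?N # vs))) (pb (\<lambda>vs. \<beta> (?N # vs))) / fact (Suc p) =
    contract ?f p (pb (\<lambda>vs. \<alpha> (?N # vs))) (pb (\<lambda>vs. \<beta> (?N # vs))) / fact p"
    unfolding fact_Suc of_nat_mult by (rule mult_divide_mult_cancel_left) simp
  also have "\<dots> = form_inner (pb h) p (pb (\<lambda>vs. \<alpha> (?N # vs))) (pb (\<lambda>vs. \<beta> (?N # vs)))"
    by (rule form_inner_contract[OF hb f alternating_pb[OF alternating_Cons[OF ab(1)]] alternating_pb[OF alternating_Cons[OF ab(2)]], symmetric])
  finally show ?thesis .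
qed

lemma form_inner_0: "metric_at h ==> form_inner h 0 \<alpha> \<beta> = \<alpha> [] * \<beta> []"
proof -
  assume h: "metric_at h"
  have e: "{I. I \<subseteq> {..<DIM('a)} \<and> card I = 0} = {{}}" using finite_subset[OF _ finite_lessThan] by auto
  show ?thesis unfolding form_inner_def e by simp
qed

lemma orthonormal_frame_Cons_normal:
  fixes h :: "(real \<times> 'b::euclidean_space) list => real"
  assumes h: "metric_at h" and fs: "orthonormal_frame (pb h) fs"
  shows "orthonormal_frame h (normal_of h # map (Pair 0) fs)"
proof -
  have "length fs = DIM('b)" using fs by (simp add: orthonormal_frame_def)
  then have "map (nframe (normal_of h) ((!) fs)) [0..<Suc DIM('b)] = normal_of h # map (Pair 0) fs"
    by (intro nth_equalityI) (auto simp: nth_Cons nframe_def simp del: upt_Suc split: nat.split)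
  then show ?thesis using frame_onb[OF onb_nframe[OF h onb_frame[OF fs]]] unfolding DIM_half by simp
qed

text \<open>Lists of frame vectors without repetition are rearrangements of \<open>es\<close>, and
  rearranging does not change the square of the difference.\<close>

lemma top_form_unique:
  fixes h :: "'e::euclidean_space list => real"
  assumes h: "metric_at h" and es: "orthonormal_frame h es" and ab: "alternating DIM('e) \<alpha>" "alternating DIM('e) \<beta>"
    and eq: "\<alpha> es = \<beta> es" and vs: "length vs = DIM('e)"
  shows "\<alpha> vs = \<beta> vs"
proof -
  define \<delta> where "\<delta> vs = \<alpha> vs + (- 1) * \<beta> vs" for vs
  have \<delta>: "alternating DIM('e) \<delta>" unfolding \<delta>_def[abs_def] by (rule alternating_add[OF ab(1) alternating_cmul[OF ab(2)]])
  note d = orthonormal_frame_distinct[OF es]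
  have z: "\<delta> ws = 0" if ws: "length ws = DIM('e)" "set ws \<subseteq> (!) es ` {..<DIM('e)}" for ws
  proof (cases "distinct ws")
    case True
    have "set ws = set es"
    proof (rule card_subset_eq)
      show "set ws \<subseteq> set es" using ws(2) d(2) by auto
      show "card (set ws) = card (set es)" using distinct_card[OF True] distinct_card[OF d(1)] d(2) ws(1) by simp
    qed simp
    then have "mset ws = mset es" using True d(1) by (simp add: set_eq_iff_mset_eq_distinct)
    then have "\<delta> ws * \<delta> ws = \<delta> es * \<delta> es" by (rule alternating_product_permute[OF \<delta> \<delta> _ ws(1)])
    then show ?thesis using eq by (simp add: \<delta>_def)
  qed (rule alternating_not_distinct[OF \<delta> ws(1)])
  have "\<delta> vs = (\<lambda>vs. 0 * \<delta> vs) vs"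
    by (rule multilin_eq_on_frame[OF h onb_frame[OF es] alternating_multilin[OF \<delta>] multilin_cmul[OF alternating_multilin[OF \<delta>]] _ vs]) (simp add: z)
  then show ?thesis by (simp add: \<delta>_def)
qed

lemma metric_inner: "metric_at (\<lambda>vs :: 'e::euclidean_space list. vs ! 0 \<bullet> vs ! 1)"
  unfolding metric_at_def
proof (intro conjI allI impI)
  let ?h = "\<lambda>vs :: 'e list. vs ! 0 \<bullet> vs ! 1"
  show "multilin 2 ?h" unfolding numeral_2_eq_2
  proof (rule multilin_SucI)
    fix v :: 'e
    show "multilin (Suc 0) (\<lambda>vs. (v # vs) ! 0 \<bullet> (v # vs) ! 1)"
      by (rule multilin_SucI) (auto intro: multilin_0 linearI simp: inner_add_right)
    show "linear (\<lambda>v. (v # vs) ! 0 \<bullet> (v # vs) ! 1)" for vs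
      by (auto intro: linearI simp: inner_add_left)
  qed
qed (auto simp: inner_commute)

lemma vol_std_euclidean:
  fixes es :: "'e::euclidean_space list"
  assumes "orthonormal_frame (\<lambda>vs. vs ! 0 \<bullet> vs ! 1) es" shows "(vol_std es)\<^sup>2 = 1"
proof -
  let ?h = "\<lambda>vs :: 'e list. vs ! 0 \<bullet> vs ! 1"
  have "gram_matrix ?h = mat 1" by (simp add: gram_matrix_def mat_def bvec_inner vec_eq_iff)
  then have "gram_det ?h = 1" by (simp add: gram_det_matrix)
  then show ?thesis using gram_det_vol_std[OF metric_inner assms] by simp
qed

text \<open>Relates the densities of the manifold and its boundary, as needed to compare the
  coordinate flux through the boundary with the metric one. Both Gram determinants are read off from
  coordinate volumes of a frame adapted to the normal.\<close>

lemma gram_det_normal: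
  fixes h :: "(real \<times> 'b::euclidean_space) list => real"
  assumes h: "metric_at h"
  shows "sqrt (gram_det h) * fst (normal_of h) = sqrt (gram_det (pb h))"
proof -
  let ?N = "normal_of h" and ?ip = "\<lambda>vs :: 'b list. vs ! 0 \<bullet> vs ! 1" and ?ip' = "\<lambda>vs :: (real \<times> 'b) list. vs ! 0 \<bullet> vs ! 1"
  define \<sigma> where "\<sigma> vs = vol_std ((1 :: real, 0 :: 'b) # map (Pair 0) vs)" for vs
  have volS: "alternating (Suc DIM('b)) (vol_std :: (real \<times> 'b) list => real)" using alternating_vol_std[where 'e = "real \<times> 'b"] by simp
  have \<sigma>: "alternating DIM('b) \<sigma>" unfolding \<sigma>_def[abs_def] by (rule alternating_pb[OF alternating_Cons[OF volS]])
  let ?bs = "frame ?ip" and ?fs = "frame (pb h)"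
  have bs: "orthonormal_frame ?ip ?bs" by (rule frame_orthonormal[OF metric_inner])
  have fs: "orthonormal_frame (pb h) ?fs" by (rule frame_orthonormal[OF metric_pb[OF h]])
  have lf: "length ?fs = DIM('b)" using fs by (simp add: orthonormal_frame_def)
  have bs': "orthonormal_frame ?ip' ((1, 0) # map (Pair 0) ?bs)"
    using bs unfolding orthonormal_frame_def DIM_half
    by (auto simp: nth_Cons inner_prod_def split: nat.splits)
  have v1: "(vol_std ?bs)\<^sup>2 = 1" by (rule vol_std_euclidean[OF bs])
  have s1: "(\<sigma> ?bs)\<^sup>2 = 1" unfolding \<sigma>_def by (rule vol_std_euclidean[OF bs'])
  \<comment> \<open>Two top degree forms on the boundary that agree on \<open>?bs\<close>, hence
    also on \<open>?fs\<close>. The coefficients square to one, so \<open>\<sigma>\<close> is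
    \<open>vol_std\<close> up to sign.\<close>
  have c: "(\<lambda>vs. \<sigma> ?bs * vol_std vs) ?fs = (\<lambda>vs. vol_std ?bs * \<sigma> vs) ?fs"
    by (rule top_form_unique[OF metric_inner bs alternating_cmul[OF alternating_vol_std] alternating_cmul[OF \<sigma>] _ lf]) simp
  have sq: "(\<sigma> ?fs)\<^sup>2 = (vol_std ?fs)\<^sup>2"
    using arg_cong[OF c, of "\<lambda>x. x\<^sup>2"] v1 s1 by (simp add: power_mult_distrib)
  note m = alternating_multilin[OF volS]
  have lin: "linear (\<lambda>v. vol_std (v # map (Pair (0 :: real)) ?fs))" by (rule multilin_head[OF m]) (simp add: lf)
  \<comment> \<open>With the tangential part of the normal in the first slot there is one vector too
    many in the boundary directions.\<close>
  have "vol_std (map (Pair (0 :: real)) (snd ?N # ?fs)) = 0"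
    by (rule alternating_above_dim[OF alternating_pb[OF volS]]) (simp_all add: lf)
  moreover have N: "?N = fst ?N *\<^sub>R (1, 0) + (0, snd ?N)" by (simp add: prod_eq_iff)
  ultimately have "vol_std (?N # map (Pair 0) ?fs) = fst ?N * \<sigma> ?fs"
    using linear_add[OF lin, of "fst ?N *\<^sub>R (1, 0)" "(0, snd ?N)"] linear_cmul[OF lin, of "fst ?N" "(1, 0)"]
    by (simp add: \<sigma>_def)
  then have G: "gram_det h * (fst ?N * \<sigma> ?fs)\<^sup>2 = 1"
    using gram_det_vol_std[OF h orthonormal_frame_Cons_normal[OF h fs]] by simp
  have H: "gram_det (pb h) * (vol_std ?fs)\<^sup>2 = 1" by (rule gram_det_vol_std[OF metric_pb[OF h] fs])
  then have nz: "(vol_std ?fs)\<^sup>2 \<noteq> 0" by auto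
  have "(gram_det h * (fst ?N)\<^sup>2) * (vol_std ?fs)\<^sup>2 = gram_det (pb h) * (vol_std ?fs)\<^sup>2"
    using G H unfolding power_mult_distrib sq by (simp add: mult.assoc)
  then have "gram_det h * (fst ?N)\<^sup>2 = gram_det (pb h)" using nz by simp
  then have "sqrt (gram_det (pb h)) = sqrt (gram_det h) * sqrt ((fst ?N)\<^sup>2)" unfolding real_sqrt_mult[symmetric] by simp
  then show ?thesis using normal_of(3)[OF h] by simp
qed

section \<open>The second fundamental form\<close>

text \<open>The invariance of \<open>A\<close> under projection to the boundary allows fields along the boundary
  to be extended, constantly in the first coordinate, to fields on \<open>A\<close>.\<close>

locale half_chart =
  fixes A :: "(real \<times> 'b::euclidean_space) set" and G :: "real \<times> 'b => (real \<times> 'b) list => real"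
  assumes op: "openin (top_of_set half_space) A" and slab: "\<And>x. x \<in> A ==> (0, snd x) \<in> A"
    and tG: "tfield A 2 G" and met: "\<And>x. x \<in> A ==> metric_at (G x)"

lemma open_boundary_slice:
  assumes "openin (top_of_set half_space) A" shows "open {y. (0, y) \<in> A}"
proof -
  obtain T where T: "open T" "A = half_space \<inter> T" using assms by (auto simp: openin_open)
  have "open ((\<lambda>y. (0, y)) -` T)" by (rule open_vimage[OF T(1)]) (intro continuous_intros)
  moreover have "(\<lambda>y. (0, y)) -` T = {y. (0, y) \<in> A}" using T(2) by (auto simp: half_space_def)
  ultimately show ?thesis by simp
qed

lemma smooth_Pair0: "smooth_on S (Pair (0 :: real))"
  by (rule smooth_on_linear) (rule bounded_linear_Pair[OF bounded_linear_zero bounded_linear_ident])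

lemma smooth_on_slice:
  "smooth_on A f ==> smooth_on {y. (0, y) \<in> A} (\<lambda>y. f (0 :: real, y :: 'b::euclidean_space))"
  by (rule smooth_on_compose[OF smooth_Pair0]) auto

lemma der_slice:
  fixes f :: "real \<times> 'b::euclidean_space => 'f::real_normed_vector"
  assumes A: "openin (top_of_set half_space) A" and f: "smooth_on A f" and y: "(0, y) \<in> A"
  shows "der {y. (0, y) \<in> A} (\<lambda>y. f (0, y)) y u = der A f (0, y) (0, u)"
proof (rule der_eq[OF regular_set_open[OF open_boundary_slice[OF A]]])
  let ?B = "{y. (0, y) \<in> A}"
  show "y \<in> ?B" using y by simp
  have 1: "(Pair 0 has_derivative Pair 0) (at y within ?B)"
    by (rule bounded_linear_imp_has_derivative) (rule bounded_linear_Pair[OF bounded_linear_zero bounded_linear_ident])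
  have 2: "(f has_derivative der A f (0, y)) (at (0, y) within Pair 0 ` ?B)"
    by (rule has_derivative_subset[OF smooth_on_has_derivative[OF regular_set_openin[OF half_space_regular A] f y]]) auto
  show "((\<lambda>y. f (0, y)) has_derivative (\<lambda>u. der A f (0, y) (0, u))) (at y within ?B)"
    using diff_chain_within[OF 1 2] by (simp only: o_def)
qed

lemma tfield_slice:
  assumes T: "tfield A p T" shows "tfield {y. (0, y) \<in> A} p (\<lambda>y. pb (T (0, y)))"
  unfolding tfield_def
proof (intro conjI ballI allI impI)
  show "multilin p (pb (T (0, y)))" if "y \<in> {y. (0, y) \<in> A}" for y
    using multilin_map[OF tfield_multilin[OF T] linear_Pair0] that by simp
  show "smooth_on {y. (0, y) \<in> A} (\<lambda>y. T (0, y) (map (Pair 0) vs))" if "length vs = p" for vs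
    by (rule smooth_on_slice[OF tfield_smooth[OF T]]) (simp add: that)
qed

sublocale half_chart \<subseteq> chart_metric A G
  by unfold_locales (auto intro: regular_set_openin[OF half_space_regular op] tG met)

sublocale half_chart \<subseteq> bd: chart_metric "{y. (0, y) \<in> A}" "\<lambda>y. pb (G (0, y))"
  by unfold_locales (auto intro: regular_set_open open_boundary_slice[OF op] tfield_slice[OF tG] metric_pb met)

context half_chart
begin

abbreviation "B \<equiv> {y. (0, y) \<in> A}"
abbreviation "H \<equiv> \<lambda>y. pb (G (0, y))"

lemma smooth_extend: "smooth_on B f ==> smooth_on A (\<lambda>x. f (snd x))"
  by (rule smooth_on_compose[OF smooth_on_linear[OF bounded_linear_snd]]) (auto intro: slab)

abbreviation nrm :: "'b => real \<times> 'b" where "nrm y \<equiv> normal_of (G (0, y))"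

text \<open>Off the boundary the vectors \<open>(0, bd.E (snd x) k)\<close> need not be orthonormal
  for \<open>G x\<close>, so this need not be a unit normal there. What matters is that it is smooth
  and restricts to \<open>nrm\<close> on the boundary.\<close>

definition nrm_ext :: "real \<times> 'b => real \<times> 'b" where
  "nrm_ext x = normalize_perp (G x) (1, 0) (\<lambda>k. (0, bd.E (snd x) k)) DIM('b)"

lemma nrm_ext: "nrm_ext (0, y) = nrm y"
  by (simp add: nrm_ext_def normal_of_def)

lemma smooth_nrm_ext: "smooth_on A nrm_ext"
proof -
  define w where "w x = (1 :: real, 0 :: 'b) - (\<Sum>l<DIM('b). G x [(1, 0), (0, bd.E (snd x) l)] *\<^sub>R (0, bd.E (snd x) l))" for x
  have n: "nrm_ext x = (G x [w x, w x] powr (- 1 / 2)) *\<^sub>R w x" for x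
    by (simp add: nrm_ext_def normalize_perp_def w_def Let_def)
  have e: "smooth_on A (\<lambda>x. (0 :: real, bd.E (snd x) l))" if "l < DIM('b)" for l
    by (rule smooth_on_compose[OF smooth_extend[OF bd.smooth_frame[OF that]] smooth_Pair0]) (rule subset_UNIV)
  have sw: "smooth_on A w"
    unfolding w_def by (intro smooth_on_diff smooth_on_const smooth_on_sum smooth_on_scaleR smooth_G e) auto
  have "fst (w x) = 1" for x by (simp add: w_def fst_sum)
  then have "w x \<noteq> 0" for x by (metis fst_zero zero_neq_one)
  then have pos: "G x [w x, w x] > 0" if "x \<in> A" for x
    using met[OF that] unfolding metric_at_def by blast
  show ?thesis unfolding n[abs_def] by (intro smooth_on_scaleR smooth_on_powr smooth_G sw pos)
qed

lemma smooth_nrm: "smooth_on B nrm"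
  using smooth_on_slice[OF smooth_nrm_ext] by (simp add: nrm_ext)

definition dnrm :: "'b => 'b => real \<times> 'b" where
  "dnrm y u = der B nrm y u + \<Gamma> (0, y) (0, u) (nrm y)"

definition shp :: "'b => 'b => 'b" where "shp y u = - snd (dnrm y u)"

text \<open>The second fundamental form, read off from the normal component of the connection on
  coordinate-constant tangential fields.\<close>

definition sff :: "'b => 'b => 'b => real" where
  "sff y u w = G (0, y) [nrm y, \<Gamma> (0, y) (0, u) (0, w)]"

lemma dnrm_ext: "y \<in> B ==> dnrm y u = der A nrm_ext (0, y) (0, u) + \<Gamma> (0, y) (0, u) (nrm y)"
  using der_slice[OF op smooth_nrm_ext, of y u] by (simp add: dnrm_def nrm_ext)

text \<open>The fields are extended off the boundary, but a derivative along the boundary only sees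
  that the inner product is constant there.\<close>

lemma der_along:
  assumes V: "smooth_on A V" and W: "smooth_on A W" and y: "y \<in> B"
    and const: "\<And>z. z \<in> B ==> G (0, z) [V (0, z), W (0, z)] = c"
  shows "G (0, y) [der A V (0, y) (0, u) + \<Gamma> (0, y) (0, u) (V (0, y)), W (0, y)] +
    G (0, y) [V (0, y), der A W (0, y) (0, u) + \<Gamma> (0, y) (0, u) (W (0, y))] = 0"
proof -
  have yA: "(0, y) \<in> A" using y by simp
  have "der A (\<lambda>x. G x [V x, W x]) (0, y) (0, u) = der B (\<lambda>y. G (0, y) [V (0, y), W (0, y)]) y u"
    by (rule der_slice[OF op smooth_G[OF V W] yA, symmetric])
  also have "\<dots> = der B (\<lambda>y. c) y u" by (rule der_cong[OF y const])
  also have "\<dots> = 0" by (rule der_const[OF bd.reg y])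
  finally show ?thesis unfolding der_metric[OF V W yA] .
qed

text \<open>Constant length of the normal leaves its derivative without normal component, and hence
  without first coordinate.\<close>

lemma dnrm_tangent:
  assumes y: "y \<in> B" shows "dnrm y u = (0, - shp y u)"
proof -
  have m: "metric_at (G (0, y))" using met y by simp
  have "G (0, z) [nrm_ext (0, z), nrm_ext (0, z)] = 1" if "z \<in> B" for z
    unfolding nrm_ext by (rule normal_of(1)[OF met]) (use that in simp)
  from der_along[OF smooth_nrm_ext smooth_nrm_ext y this, of u]
  have "G (0, y) [dnrm y u, nrm y] + G (0, y) [nrm y, dnrm y u] = 0"
    unfolding dnrm_ext[OF y] nrm_ext .
  then have "G (0, y) [dnrm y u, nrm y] = 0" using metric_at_sym[OF m, of "nrm y" "dnrm y u"] by simp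
  then have "fst (dnrm y u) = 0" using normal_decomp(1)[OF m, of "dnrm y u"] by simp
  then show ?thesis by (simp add: shp_def prod_eq_iff)
qed

text \<open>The Weingarten equation: differentiate the orthogonality of the normal and a constant
  tangential field.\<close>

lemma shp_sff:
  assumes y: "y \<in> B" shows "G (0, y) [(0, shp y u), (0, w)] = sff y u w"
proof -
  have m: "metric_at (G (0, y))" using met y by simp
  have c: "G (0, z) [nrm_ext (0, z), (0, w)] = 0" if "z \<in> B" for z
    unfolding nrm_ext by (rule normal_of(2)[OF met]) (use that in simp)
  have yA: "(0, y) \<in> A" using y by simp
  from der_along[OF smooth_nrm_ext smooth_on_const y c, of u]
  have *: "G (0, y) [dnrm y u, (0, w)] + sff y u w = 0"
    unfolding dnrm_ext[OF y] nrm_ext sff_def der_const[OF reg yA] by simp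
  have "dnrm y u = - (0, shp y u)" unfolding dnrm_tangent[OF y] by simp
  then have "G (0, y) [dnrm y u, (0, w)] = - G (0, y) [(0, shp y u), (0, w)]"
    using linear_neg[OF metric_at_linear1[OF m, of "(0, w)"], of "(0, shp y u)"] by simp
  then show ?thesis using * by simp
qed

lemma sff_sym: "y \<in> B ==> sff y u w = sff y w u"
  using \<Gamma>_sym[of "(0, y)" "(0, u)" "(0, w)"] by (simp add: sff_def)

lemma shp_sym: "y \<in> B ==> H y [shp y u, w] = H y [u, shp y w]"
  using shp_sff[of y u w] shp_sff[of y w u] sff_sym[of y u w] metric_at_sym[OF met, of "(0, y)" "(0, u)" "(0, shp y w)"] by simp

lemma linear_shp: "y \<in> B ==> linear (shp y)"
proof -
  assume y: "y \<in> B"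
  then have yA: "(0, y) \<in> A" by simp
  have 1: "linear (der B nrm y)" by (rule der_linear[OF bd.reg smooth_nrm y])
  have 2: "linear (\<lambda>u. \<Gamma> (0, y) (0, u) (nrm y))"
    using linear_compose[OF linear_Pair0 \<Gamma>_linear(2)[OF yA]] by (simp add: o_def)
  have "linear (\<lambda>u. dnrm y u)" unfolding dnrm_def by (rule linear_compose_add[OF 1 2])
  then have "linear (\<lambda>u. - snd (dnrm y u))"
    by (intro linear_compose_neg) (use linear_compose[OF _ linear_snd] in \<open>auto simp: o_def\<close>)
  then show ?thesis unfolding shp_def[abs_def] .
qed

text \<open>The tangential part of the ambient connection is symmetric and compatible with the
  induced metric, so by uniqueness it is the connection of the boundary.\<close>

lemma gauss_formula:
  assumes y: "y \<in> B"
  shows "\<Gamma> (0, y) (0, u) (0, w) = sff y u w *\<^sub>R nrm y + (0, bd.\<Gamma> y u w)"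
proof -
  have yA: "(0, y) \<in> A" using y by simp
  note m = met[OF yA]
  define \<Delta> where "\<Delta> u w = snd (\<Gamma> (0, y) (0, u) (0, w) - sff y u w *\<^sub>R nrm y)" for u w
  have dec: "\<Gamma> (0, y) (0, u) (0, w) = sff y u w *\<^sub>R nrm y + (0, \<Delta> u w)" for u w
    using normal_decomp(2)[OF m, of "\<Gamma> (0, y) (0, u) (0, w)"]
    unfolding \<Delta>_def sff_def metric_at_sym[OF m, of "nrm y"] .
  have tang: "G (0, y) [\<Gamma> (0, y) (0, u) (0, v), (0, w)] = G (0, y) [(0, \<Delta> u v), (0, w)]" for u v w
    unfolding dec
    using linear_add[OF metric_at_linear1[OF m, of "(0, w)"], of "sff y u v *\<^sub>R nrm y" "(0, \<Delta> u v)"]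
      linear_cmul[OF metric_at_linear1[OF m, of "(0, w)"], of "sff y u v" "nrm y"] normal_of(2)[OF m, of w] by simp
  have "\<Delta> = bd.\<Gamma> y"
  proof (rule bd.\<Gamma>_unique[OF y])
    show "\<Delta> u v = \<Delta> v u" for u v
      unfolding \<Delta>_def sff_sym[OF y, of u v] \<Gamma>_sym[OF yA, of "(0, u)"] ..
    fix u v w
    have "der B (\<lambda>y. H y [v, w]) y u = der A (\<lambda>x. G x [(0, v), (0, w)]) (0, y) (0, u)"
      using der_slice[OF op tfield_smooth[OF tG, of "[(0, v), (0, w)]"] yA, of u] by simp
    also have "\<dots> = G (0, y) [\<Gamma> (0, y) (0, u) (0, v), (0, w)] + G (0, y) [(0, v), \<Gamma> (0, y) (0, u) (0, w)]"
      by (rule \<Gamma>_metric[OF yA])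
    also have "\<dots> = G (0, y) [(0, \<Delta> u v), (0, w)] + G (0, y) [(0, v), (0, \<Delta> u w)]"
      unfolding metric_at_sym[OF m, of "(0, v)"] tang ..
    finally show "der B (\<lambda>y. H y [v, w]) y u = H y [\<Delta> u v, w] + H y [v, \<Delta> u w]" by simp
  qed
  then show ?thesis using dec by simp
qed

text \<open>The Gauss formula in each slot: its normal part is the only correction to the intrinsic
  derivative.\<close>

lemma nab_slice:
  assumes \<beta>: "tfield A p \<beta>" and y: "y \<in> B" and vs: "length vs = p"
  shows "nab A G \<beta> (0, y) ((0, u) # map (Pair 0) vs) =
    nab B H (\<lambda>y. pb (\<beta> (0, y))) y (u # vs) -
    (\<Sum>j<p. sff y u (vs ! j) * \<beta> (0, y) ((map (Pair 0) vs)[j := nrm y]))"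
proof -
  have yA: "(0, y) \<in> A" using y by simp
  have d: "der A (\<lambda>x. \<beta> x (map (Pair 0) vs)) (0, y) (0, u) = der B (\<lambda>y. \<beta> (0, y) (map (Pair 0) vs)) y u"
    by (rule der_slice[OF op tfield_smooth[OF \<beta>] yA, symmetric]) (simp add: vs)
  have "\<beta> (0, y) ((map (Pair 0) vs)[j := \<Gamma> (0, y) (0, u) (map (Pair 0) vs ! j)]) =
     sff y u (vs ! j) * \<beta> (0, y) ((map (Pair 0) vs)[j := nrm y]) + \<beta> (0, y) (map (Pair 0) (vs[j := bd.\<Gamma> y u (vs ! j)]))"
    if j: "j < p" for j
  proof -
    have lin: "linear (\<lambda>z. \<beta> (0, y) ((map (Pair 0) vs)[j := z]))"
      using tfield_multilin[OF \<beta> yA] j vs by (simp add: multilin_def)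
    have nth: "map (Pair (0 :: real)) vs ! j = (0, vs ! j)" using j vs by simp
    show ?thesis
      unfolding nth gauss_formula[OF y] map_update
      using linear_add[OF lin, of "sff y u (vs ! j) *\<^sub>R nrm y" "(0, bd.\<Gamma> y u (vs ! j))"]
        linear_cmul[OF lin, of "sff y u (vs ! j)" "nrm y"] by simp
  qed
  then have "form_ext (\<Gamma> (0, y) (0, u)) (\<beta> (0, y)) (map (Pair 0) vs) =
     (\<Sum>j<p. sff y u (vs ! j) * \<beta> (0, y) ((map (Pair 0) vs)[j := nrm y])) + form_ext (bd.\<Gamma> y u) (pb (\<beta> (0, y))) vs"
    by (simp add: form_ext_def vs sum.distrib)
  then show ?thesis using d by (simp add: nab_def pder_def)
qed

context
  fixes p \<omega>
  assumes \<omega>: "tfield A (Suc p) \<omega>" and alternating_field: "\<forall>x\<in>A. alternating (Suc p) (\<omega> x)"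
begin

lemmas alt = bspec[OF alternating_field]

text \<open>Weingarten in the first slot of \<omega>. The Gauss corrections in the other slots
  insert the normal a second time and vanish.\<close>

lemma nab_normal_slot:
  assumes y: "y \<in> B" and vs: "length vs = p"
  shows "nab A G \<omega> (0, y) ((0, u) # nrm y # map (Pair 0) vs) =
    nab B H (\<lambda>y. pb (\<lambda>vs. \<omega> (0, y) (nrm y # vs))) y (u # vs) +
    \<omega> (0, y) ((0, shp y u) # map (Pair 0) vs)"
proof -
  have yA: "(0, y) \<in> A" using y by simp
  have i: "tfield A p (\<lambda>x vs. \<omega> x (nrm_ext x # vs))" by (rule tfield_Cons_field[OF \<omega> smooth_nrm_ext])
  have "nab A G (\<lambda>x vs. \<omega> x (nrm_ext x # vs)) (0, y) ((0, u) # map (Pair 0) vs) =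
    nab A G \<omega> (0, y) ((0, u) # nrm y # map (Pair 0) vs) + \<omega> (0, y) (dnrm y u # map (Pair 0) vs)"
    using nab_Cons_field[OF \<omega> smooth_nrm_ext yA, of "map (Pair 0) vs" "(0, u)"] vs unfolding nrm_ext dnrm_ext[OF y] by simp
  moreover have "\<omega> (0, y) (nrm y # (map (Pair 0) vs)[j := nrm y]) = 0" if "j < p" for j
    by (rule alternating_not_distinct[OF alt[OF yA]]) (use vs that in \<open>auto simp: set_update_memI\<close>)
  then have "nab A G (\<lambda>x vs. \<omega> x (nrm_ext x # vs)) (0, y) ((0, u) # map (Pair 0) vs) =
    nab B H (\<lambda>y. pb (\<lambda>vs. \<omega> (0, y) (nrm y # vs))) y (u # vs)"
    unfolding nab_slice[OF i y vs] nrm_ext by simp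
  moreover have "\<omega> (0, y) (dnrm y u # map (Pair 0) vs) = - \<omega> (0, y) ((0, shp y u) # map (Pair 0) vs)"
  proof -
    have lin: "linear (\<lambda>z. \<omega> (0, y) (z # map (Pair 0) vs))"
      by (rule multilin_head[OF tfield_multilin[OF \<omega> yA]]) (simp add: vs)
    have "dnrm y u = - (0, shp y u)" unfolding dnrm_tangent[OF y] by simp
    then show ?thesis using linear_neg[OF lin, of "(0, shp y u)"] by simp
  qed
  ultimately show ?thesis by simp
qed

text \<open>In the recursion for \<open>alt\<close> one term differentiates in the normal direction;
  the others differentiate tangentially with the normal in the first slot of \<omega>, where
  \<open>nab_normal_slot\<close> applies. Their shape operator terms add up to
  \<open>form_ext\<close>.\<close>

lemma normal_ext_d:
  assumes y: "y \<in> B" and us: "length us = Suc p"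
  shows "alt (nab A G \<omega> (0, y)) (nrm y # map (Pair 0) us) =
    nab A G \<omega> (0, y) (nrm y # map (Pair 0) us) -
    alt (nab B H (\<lambda>y. pb (\<lambda>vs. \<omega> (0, y) (nrm y # vs))) y) us -
    form_ext (shp y) (pb (\<omega> (0, y))) us"
proof -
  have yA: "(0, y) \<in> A" using y by simp
  let ?\<gamma> = "\<lambda>y. pb (\<lambda>vs. \<omega> (0, y) (nrm y # vs))"
  have "alt (\<lambda>ws. nab A G \<omega> (0, y) (hd ws # nrm y # tl ws)) (map (Pair 0) us) =
    alt (\<lambda>ws. nab A G \<omega> (0, y) (hd (map (Pair 0) ws) # nrm y # tl (map (Pair 0) ws))) us"
    by (rule alt_map)
  also have "\<dots> = alt (\<lambda>ws. nab B H ?\<gamma> y ws - - pb (\<omega> (0, y)) (shp y (hd ws) # tl ws)) us"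
    by (rule alt_cong) (use us in \<open>simp add: nab_normal_slot[OF y]\<close>)
  also have "\<dots> = alt (nab B H ?\<gamma> y) us - alt (\<lambda>ws. - pb (\<omega> (0, y)) (shp y (hd ws) # tl ws)) us"
    by (rule alt_diff)
  also have "alt (\<lambda>ws. - pb (\<omega> (0, y)) (shp y (hd ws) # tl ws)) us = - form_ext (shp y) (pb (\<omega> (0, y))) us"
    unfolding form_ext_alt[OF alternating_pb[OF alt[OF yA]] us] alt_def by (simp add: sum_negf)
  finally show ?thesis unfolding alt_Cons by simp
qed

text \<open>The trace is taken in a frame adapted to the normal. The Gauss corrections in the slot
  of the traced vector add up to the trace of the shape operator, those in the other slots to its
  derivation extension, the sign coming from exchanging the normal with the traced vector.\<close>

lemma tangential_codiff:
  assumes y: "y \<in> B" and us: "length us = p" and F: "onb (G (0, y)) F"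
  shows "(\<Sum>k<DIM(real \<times> 'b). nab A G \<omega> (0, y) (F k # F k # map (Pair 0) us)) =
    nab A G \<omega> (0, y) (nrm y # nrm y # map (Pair 0) us) +
    (\<Sum>k<DIM('b). nab B H (\<lambda>y. pb (\<omega> (0, y))) y (bd.E y k # bd.E y k # us)) -
    trace_wrt (H y) (shp y) * pb (\<lambda>vs. \<omega> (0, y) (nrm y # vs)) us +
    form_ext (shp y) (pb (\<lambda>vs. \<omega> (0, y) (nrm y # vs))) us"
proof -
  have yA: "(0, y) \<in> A" using y by simp
  note m = met[OF yA] and mb = metric_pb[OF met[OF yA]] and f = bd.onbE[OF y]
  note mn = tfield_multilin[OF tfield_nab[OF \<omega>] yA] and mo = tfield_multilin[OF \<omega> yA]
  let ?f = "bd.E y" and ?J = "map (Pair (0 :: real)) us"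
  have "(\<Sum>k<DIM(real \<times> 'b). nab A G \<omega> (0, y) (F k # F k # ?J)) =
     (\<Sum>k<DIM(real \<times> 'b). nab A G \<omega> (0, y) (nframe (nrm y) ?f k # nframe (nrm y) ?f k # ?J))"
  proof (rule onb_trace[where B = "\<lambda>u v. nab A G \<omega> (0, y) (u # v # ?J)", OF m F onb_nframe[OF m f]])
    show "linear (\<lambda>u. nab A G \<omega> (0, y) (u # v # ?J))" for v by (rule multilin_head[OF mn]) (simp add: us)
    show "linear (\<lambda>v. nab A G \<omega> (0, y) (u # v # ?J))" for u by (rule multilin_head[OF multilin_Cons[OF mn]]) (simp add: us)
  qed
  also have "\<dots> = nab A G \<omega> (0, y) (nrm y # nrm y # ?J) +
      (\<Sum>k<DIM('b). nab A G \<omega> (0, y) ((0, ?f k) # map (Pair 0) (?f k # us)))"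
    unfolding DIM_half sum.lessThan_Suc_shift by simp
  also have "(\<Sum>k<DIM('b). nab A G \<omega> (0, y) ((0, ?f k) # map (Pair 0) (?f k # us))) =
     (\<Sum>k<DIM('b). nab B H (\<lambda>y. pb (\<omega> (0, y))) y (?f k # ?f k # us)
       - (sff y (?f k) (?f k) * \<omega> (0, y) (nrm y # ?J)
       + (\<Sum>j<p. sff y (?f k) (us ! j) * \<omega> (0, y) ((0, ?f k) # ?J[j := nrm y]))))"
  proof (rule sum.cong[OF refl])
    fix k
    have "nab A G \<omega> (0, y) ((0, ?f k) # map (Pair 0) (?f k # us)) =
      nab B H (\<lambda>y. pb (\<omega> (0, y))) y (?f k # ?f k # us) -
      (\<Sum>j<Suc p. sff y (?f k) ((?f k # us) ! j) * \<omega> (0, y) ((map (Pair 0) (?f k # us))[j := nrm y]))"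
      by (rule nab_slice[OF \<omega> y]) (simp add: us)
    then show "nab A G \<omega> (0, y) ((0, ?f k) # map (Pair 0) (?f k # us)) =
      nab B H (\<lambda>y. pb (\<omega> (0, y))) y (?f k # ?f k # us)
       - (sff y (?f k) (?f k) * \<omega> (0, y) (nrm y # ?J)
       + (\<Sum>j<p. sff y (?f k) (us ! j) * \<omega> (0, y) ((0, ?f k) # ?J[j := nrm y])))"
      unfolding sum.lessThan_Suc_shift by simp
  qed
  also have "\<dots> = (\<Sum>k<DIM('b). nab B H (\<lambda>y. pb (\<omega> (0, y))) y (?f k # ?f k # us)) -
      ((\<Sum>k<DIM('b). sff y (?f k) (?f k)) * \<omega> (0, y) (nrm y # ?J) +
       (\<Sum>j<p. \<Sum>k<DIM('b). sff y (?f k) (us ! j) * \<omega> (0, y) ((0, ?f k) # ?J[j := nrm y])))"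
    by (simp add: sum_subtractf sum.distrib sum_distrib_right sum.swap[of _ "{..<p}"])
  also have "(\<Sum>k<DIM('b). sff y (?f k) (?f k)) = trace_wrt (H y) (shp y)"
    unfolding trace_wrt_def by (simp add: shp_sff[OF y])
  also have "(\<Sum>j<p. \<Sum>k<DIM('b). sff y (?f k) (us ! j) * \<omega> (0, y) ((0, ?f k) # ?J[j := nrm y])) =
      (\<Sum>j<p. - \<omega> (0, y) (nrm y # map (Pair 0) (us[j := shp y (us ! j)])))"
  proof (rule sum.cong[OF refl])
    fix j assume j: "j \<in> {..<p}"
    have lin: "linear (\<lambda>u. \<omega> (0, y) ((0, u) # ?J[j := nrm y]))"
      using linear_compose[OF linear_Pair0 multilin_head[OF mo, of "?J[j := nrm y]"]] us by (simp add: o_def)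
    have "\<omega> (0, y) ((0, shp y (us ! j)) # ?J[j := nrm y]) =
        (\<Sum>k<DIM('b). H y [shp y (us ! j), ?f k] * \<omega> (0, y) ((0, ?f k) # ?J[j := nrm y]))"
      by (rule onb_expand_real[OF mb f lin])
    then have "(\<Sum>k<DIM('b). sff y (?f k) (us ! j) * \<omega> (0, y) ((0, ?f k) # ?J[j := nrm y])) =
        \<omega> (0, y) ((0, shp y (us ! j)) # ?J[j := nrm y])"
      by (simp add: shp_sff[OF y] sff_sym[OF y, of "us ! j"])
    also have "\<dots> = - \<omega> (0, y) (nrm y # ?J[j := (0, shp y (us ! j))])"
      by (rule alternating_swap_head[OF alt[OF yA]]) (use us j in auto)
    finally show "(\<Sum>k<DIM('b). sff y (?f k) (us ! j) * \<omega> (0, y) ((0, ?f k) # ?J[j := nrm y])) =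
        - \<omega> (0, y) (nrm y # map (Pair 0) (us[j := shp y (us ! j)]))" by (simp add: map_update)
  qed
  also have "\<dots> = - form_ext (shp y) (pb (\<lambda>vs. \<omega> (0, y) (nrm y # vs))) us"
    by (simp add: form_ext_def us sum_negf)
  finally show ?thesis by simp
qed

end

end

section \<open>The boundary manifold\<close>

locale bmfd = rmfd half_space M g
  for M :: "('i, 'a::t2_space, real \<times> 'b::euclidean_space) atlas" and g
begin

lemma cimg_fst: "i \<in> idx M ==> x \<in> cimg M i ==> fst x \<ge> 0"
  using openin_subset[OF cimg_open] by (auto simp: half_space_def)

lemma boundary_pt: "i \<in> idx M ==> q \<in> cdom M i ==> q \<in> interior_pts M \<longleftrightarrow> fst (chart M i q) \<noteq> 0"
  using interior_pts_iff[of i q] interior_half_space[of "chart M i q"] cimg_fst[of i "chart M i q"] chart_cimg[of q i] by auto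

lemma bdry_simps [simp]: "idx (bdry M) = idx M" "pts (bdry M) = pts M - interior_pts M"
  "cdom (bdry M) i = cdom M i - interior_pts M" "chart (bdry M) i q = snd (chart M i q)"
  by (simp_all add: bdry_def)

lemma bdry_chart: "i \<in> idx M ==> q \<in> cdom M i - interior_pts M ==> chart M i q = (0, snd (chart M i q))"
  using boundary_pt[of i q] by (auto simp: prod_eq_iff)

lemma bdry_inv_chart_dom: "i \<in> idx M ==> (0, y) \<in> cimg M i ==> inv_chart i (0, y) \<in> cdom M i - interior_pts M"
  using boundary_pt[of i "inv_chart i (0, y)"] inv_chart_dom[of "(0, y)" i] chart_inv_chart[of "(0, y)" i] by auto

lemma cimg_bdry:
  assumes i: "i \<in> idx M" shows "cimg (bdry M) i = {y. (0, y) \<in> cimg M i}"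
proof (intro equalityI subsetI)
  fix y assume "y \<in> cimg (bdry M) i"
  then obtain q where q: "q \<in> cdom M i - interior_pts M" "y = snd (chart M i q)" by (auto simp: cimg_def)
  then show "y \<in> {y. (0, y) \<in> cimg M i}" using chart_cimg[of q i] bdry_chart[OF i q(1)] by auto
next
  fix y assume "y \<in> {y. (0, y) \<in> cimg M i}"
  then have y: "(0, y) \<in> cimg M i" by simp
  show "y \<in> cimg (bdry M) i" unfolding cimg_def
    by (rule image_eqI[of _ _ "inv_chart i (0, y)"]) (use bdry_inv_chart_dom[OF i y] chart_inv_chart[OF y] in auto)
qed

lemma bdry_inj: "i \<in> idx M ==> inj_on (chart (bdry M) i) (cdom (bdry M) i)"
proof (rule inj_onI)
  fix q q' assume i: "i \<in> idx M" and q: "q \<in> cdom (bdry M) i" "q' \<in> cdom (bdry M) i" "chart (bdry M) i q = chart (bdry M) i q'"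
  then have "chart M i q = chart M i q'" using bdry_chart[OF i, of q] bdry_chart[OF i, of q'] by simp
  then show "q = q'" using inj_onD[OF chart_inj[OF i]] q by auto
qed

lemma bdry_inv_chart:
  assumes i: "i \<in> idx M" and y: "(0, y) \<in> cimg M i"
  shows "inv_into (cdom (bdry M) i) (chart (bdry M) i) y = inv_chart i (0, y)"
  by (rule inv_into_f_eq[OF bdry_inj[OF i]]) (use bdry_inv_chart_dom[OF i y] chart_inv_chart[OF y] in auto)

lemma overlap_bdry:
  assumes i: "i \<in> idx M" shows "overlap (bdry M) i j = {y. (0, y) \<in> ov i j}"
proof (intro equalityI subsetI)
  fix y assume "y \<in> overlap (bdry M) i j"
  then obtain q where q: "q \<in> cdom M i - interior_pts M" "q \<in> cdom M j" "y = snd (chart M i q)" by (auto simp: overlap_def)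
  then show "y \<in> {y. (0, y) \<in> ov i j}" using bdry_chart[OF i q(1)] by (auto simp: overlap_def)
next
  fix y assume "y \<in> {y. (0, y) \<in> ov i j}"
  then have y: "(0, y) \<in> cimg M i" "inv_chart i (0, y) \<in> cdom M j" using ov_iff[OF i] by auto
  show "y \<in> overlap (bdry M) i j" unfolding overlap_def
    by (rule image_eqI[of _ _ "inv_chart i (0, y)"]) (use bdry_inv_chart_dom[OF i y(1)] y chart_inv_chart[OF y(1)] in auto)
qed

text \<open>Boundary points are characterised independently of charts, so transitions preserve the
  face where the first coordinate vanishes.\<close>

lemma tr_bdry:
  assumes ij: "i \<in> idx M" "j \<in> idx M" and y: "(0, y) \<in> ov i j"
  shows "tr i j (0, y) = (0, transition (bdry M) i j y)"
proof -
  have yi: "(0, y) \<in> cimg M i" "inv_chart i (0, y) \<in> cdom M j" using y ov_iff[OF ij(1)] by auto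
  then have "inv_chart i (0, y) \<in> cdom M j - interior_pts M" using bdry_inv_chart_dom[OF ij(1)] by auto
  from bdry_chart[OF ij(2) this] show ?thesis
    unfolding transition_def bdry_inv_chart[OF ij(1) yi(1)] by simp
qed

lemma ov_open_half: "i \<in> idx M ==> j \<in> idx M ==> openin (top_of_set half_space) (ov i j)"
  by (rule openin_trans[OF ov_open cimg_open])

lemma smooth_atlas_bdry: "smooth_atlas UNIV (bdry M)"
  unfolding smooth_atlas_def
proof (intro conjI ballI)
  show "pts (bdry M) = (\<Union>i\<in>idx (bdry M). cdom (bdry M) i)" using pts_cover by auto
next
  fix i assume "i \<in> idx (bdry M)"
  then have i: "i \<in> idx M" by simp
  obtain T where "open T" "cdom M i = pts M \<inter> T" using dom_open[OF i] by (auto simp: openin_open)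
  then show "openin (top_of_set (pts (bdry M))) (cdom (bdry M) i)"
    unfolding openin_open by (intro exI[of _ T]) auto
  show "openin (top_of_set UNIV) (cimg (bdry M) i)"
    using open_boundary_slice[OF cimg_open[OF i]] by (simp add: cimg_bdry[OF i])
  have "homeomorphism (cdom (bdry M) i) (cimg (bdry M) i) (chart (bdry M) i) (\<lambda>y. inv_chart i (0, y))"
  proof (rule homeomorphismI)
    have "continuous_on (cdom (bdry M) i) (\<lambda>q. snd (chart M i q))"
      by (intro continuous_on_snd continuous_on_subset[OF chart_cont[OF i]]) auto
    then show "continuous_on (cdom (bdry M) i) (chart (bdry M) i)" by (simp add: bdry_def)
    show "continuous_on (cimg (bdry M) i) (\<lambda>y. inv_chart i (0, y))"
      by (rule continuous_on_compose2[OF inv_chart_cont[OF i]]) (auto intro!: continuous_intros simp: cimg_bdry[OF i])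
    show "chart (bdry M) i ` cdom (bdry M) i \<subseteq> cimg (bdry M) i" by (simp add: cimg_def)
    show "(\<lambda>y. inv_chart i (0, y)) ` cimg (bdry M) i \<subseteq> cdom (bdry M) i"
      using bdry_inv_chart_dom[OF i] by (auto simp: cimg_bdry[OF i])
    show "inv_chart i (0, chart (bdry M) i q) = q" if "q \<in> cdom (bdry M) i" for q
      using that bdry_chart[OF i, of q] inv_chart_chart[OF i, of q] by simp
    show "chart (bdry M) i (inv_chart i (0, y)) = y" if "y \<in> cimg (bdry M) i" for y
      using that chart_inv_chart[of "(0, y)" i] by (simp add: cimg_bdry[OF i])
  qed
  then show "\<exists>\<psi>. homeomorphism (cdom (bdry M) i) (cimg (bdry M) i) (chart (bdry M) i) \<psi>" by blast
next
  fix i j assume "i \<in> idx (bdry M)" "j \<in> idx (bdry M)"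
  then have ij: "i \<in> idx M" "j \<in> idx M" by auto
  have "smooth_on {y. (0, y) \<in> ov i j} (\<lambda>y. snd (tr i j (0, y)))"
    by (rule smooth_on_compose[OF smooth_on_slice[OF tr_smooth[OF ij]] smooth_on_linear[OF bounded_linear_snd]]) (rule subset_UNIV)
  then show "smooth_on (overlap (bdry M) i j) (transition (bdry M) i j)"
    unfolding overlap_bdry[OF ij(1)] by (rule smooth_on_cong) (simp add: tr_bdry[OF ij])
qed

text \<open>The interior is relatively open, being the union of the chart preimages of the open half
  space.\<close>

lemma compact_bdry: "compact (pts (bdry M))"
proof -
  have "openin (top_of_set (pts M)) (\<Union>i\<in>idx M. cdom M i \<inter> chart M i -` interior half_space)"
  proof (rule openin_Union, clarify)
    fix i assume i: "i \<in> idx M"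
    have "openin (top_of_set (cdom M i)) (cdom M i \<inter> chart M i -` interior half_space)"
      by (rule continuous_openin_preimage_gen[OF chart_cont[OF i] open_interior])
    then show "openin (top_of_set (pts M)) (cdom M i \<inter> chart M i -` interior half_space)"
      by (rule openin_trans[OF _ dom_open[OF i]])
  qed
  then obtain T where T: "open T" "(\<Union>i\<in>idx M. cdom M i \<inter> chart M i -` interior half_space) = pts M \<inter> T"
    by (auto simp: openin_open)
  have "pts M \<inter> interior_pts M = (\<Union>i\<in>idx M. cdom M i \<inter> chart M i -` interior half_space)"
    using interior_pts_iff pts_cover by auto
  then have "pts (bdry M) = pts M - T" using T(2) by auto
  then show ?thesis using compact_diff[OF compact_pts T(1)] by simp
qed

lemma mfd_bdry: "mfd UNIV (bdry M)"
  by unfold_locales (use smooth_atlas_bdry compact_bdry in \<open>auto intro: regular_set_open\<close>)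

lemma dtr_bdry:
  assumes ij: "i \<in> idx M" "j \<in> idx M" and y: "(0, y) \<in> ov i j"
  shows "dtr i j (0, y) (0, v) = (0, der (overlap (bdry M) i j) (transition (bdry M) i j) y v)"
proof -
  interpret b: mfd UNIV "bdry M" by (rule mfd_bdry)
  let ?O = "{y. (0, y) \<in> ov i j}"
  have ij': "i \<in> idx (bdry M)" "j \<in> idx (bdry M)" using ij by auto
  have yO: "y \<in> ?O" using y by simp
  note reg = regular_set_open[OF open_boundary_slice[OF ov_open_half[OF ij]]]
  have "dtr i j (0, y) (0, v) = der ?O (\<lambda>y. tr i j (0, y)) y v"
    by (rule der_slice[OF ov_open_half[OF ij] tr_smooth[OF ij] y, symmetric])
  also have "\<dots> = der ?O (\<lambda>y. (0 :: real, transition (bdry M) i j y)) y v"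
    by (rule der_cong[OF yO]) (simp add: tr_bdry[OF ij])
  also have "\<dots> = (0, der ?O (transition (bdry M) i j) y v)"
    by (rule der_eq[OF reg yO], rule has_derivative_Pair[OF has_derivative_const])
      (use b.tr_deriv[OF ij', of y] yO in \<open>simp add: overlap_bdry[OF ij(1)]\<close>)
  finally show ?thesis unfolding overlap_bdry[OF ij(1)] .
qed

lemma pullback_tensor:
  assumes T: "tensor_field M p T" shows "tensor_field (bdry M) p (pullback T)"
proof (rule mfd.tensor_fieldI[OF mfd_bdry])
  show "tfield (cimg (bdry M) i) p (pullback T i)" if "i \<in> idx (bdry M)" for i
    using tfield_slice[OF tensor_tfield[OF T]] that by (simp add: cimg_bdry pullback_pb[abs_def])
  fix i j y and vs :: "'b list" assume ij: "i \<in> idx (bdry M)" "j \<in> idx (bdry M)" and y: "y \<in> overlap (bdry M) i j" and vs: "length vs = p"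
  then have ij': "i \<in> idx M" "j \<in> idx M" and y': "(0, y) \<in> ov i j" by (auto simp: overlap_bdry)
  show "pullback T i y vs = pullback T j (transition (bdry M) i j y)
      (map (der (overlap (bdry M) i j) (transition (bdry M) i j) y) vs)"
    using tensor_tr[OF T ij' y', of "map (Pair 0) vs"] vs
    by (simp add: pullback_def tr_bdry[OF ij' y'] dtr_bdry[OF ij' y'] o_def)
qed

lemma pullback_form:
  assumes "diff_form M p \<omega>" shows "diff_form (bdry M) p (pullback \<omega>)"
  using assms pullback_tensor[of p \<omega>] unfolding diff_form_def
  by (auto simp: cimg_bdry pullback_pb intro: alternating_pb)

lemma rmfd_bdry: "rmfd UNIV (bdry M) (pullback g)"
proof (intro rmfd.intro mfd_bdry rmfd_axioms.intro)
  have "metric_at (pullback g i y)" if "i \<in> idx M" "y \<in> cimg (bdry M) i" for i y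
    using metric_pb[OF g_metric[OF that(1), of "(0, y)"]] that by (simp add: cimg_bdry pullback_pb)
  then show "riemannian_metric (bdry M) (pullback g)"
    unfolding riemannian_metric_def using pullback_tensor[OF g_tensor] by (auto simp: metric_at_def)
qed

end

sublocale bmfd \<subseteq> bd: rmfd UNIV "bdry M" "pullback g"
  by (rule rmfd_bdry)

section \<open>The unit normal and normal components on the boundary manifold\<close>

lemma one_sided_derivative_nonneg:
  fixes f :: "'e::real_normed_vector => real"
  assumes D: "(f has_derivative D) (at x within S)" and f: "f x = 0" "\<And>z. z \<in> S ==> f z \<ge> 0"
    and e: "e > 0" "\<And>t. 0 \<le> t ==> t < e ==> x + t *\<^sub>R v \<in> S"
  shows "D v \<ge> 0"
proof (rule ccontr)
  assume neg: "\<not> D v \<ge> 0"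
  have 1: "((\<lambda>t. x + t *\<^sub>R v) has_derivative (\<lambda>t. t *\<^sub>R v)) (at 0 within {0..<e})" by (auto intro!: derivative_eq_intros)
  have "(f has_derivative D) (at (x + 0 *\<^sub>R v) within (\<lambda>t. x + t *\<^sub>R v) ` {0..<e})"
    unfolding scaleR_zero_left add_0_right
    by (rule has_derivative_subset[OF D]) (use e(2) in auto)
  from diff_chain_within[OF 1 this]
  have "((\<lambda>t. f (x + t *\<^sub>R v)) has_derivative (\<lambda>t. D (t *\<^sub>R v))) (at 0 within {0..<e})" by (simp only: o_def)
  moreover have "D (t *\<^sub>R v) = D v * t" for t using linear_cmul[OF has_derivative_linear[OF D], of t v] by simp
  ultimately have "((\<lambda>t. f (x + t *\<^sub>R v)) has_real_derivative D v) (at 0 within {0..<e})"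
    by (simp add: has_field_derivative_def)
  from has_real_derivative_neg_dec_right[OF this] neg
  obtain d where d: "d > 0" "\<And>h. 0 < h ==> 0 + h \<in> {0..<e} ==> h < d ==> f (x + (0 + h) *\<^sub>R v) < f (x + 0 *\<^sub>R v)" by auto
  define h where "h = min (d / 2) (e / 2)"
  have "0 < h" "h < d" "h < e" using d(1) e(1) by (auto simp: h_def min_def)
  then show False using d(2)[of h] f(1) f(2)[OF e(2), of h] by simp
qed

context bmfd
begin

abbreviation N :: "'i => 'b => real \<times> 'b" where "N i y \<equiv> normal_of (g i (0, y))"

lemma metric_bdry: "i \<in> idx M ==> y \<in> cimg (bdry M) i ==> metric_at (g i (0, y))"
  by (rule g_metric) (simp_all add: cimg_bdry)

text \<open>A transition preserves metric and boundary, so it maps the normal to a unit vector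
  orthogonal to the boundary. Its first coordinate is nonnegative by the one-sided derivative, as
  transitions stay in the half space, and nonzero because a tangential image would be orthogonal to
  itself.\<close>

lemma normal_tr:
  assumes ij: "i \<in> idx M" "j \<in> idx M" and y: "(0, y) \<in> ov i j"
  shows "dtr i j (0, y) (N i y) = N j (transition (bdry M) i j y)"
proof -
  let ?D = "dtr i j (0, y)" and ?z = "transition (bdry M) i j y"
  have yi: "(0, y) \<in> cimg M i" using y ov_sub by auto
  have z: "(0, ?z) \<in> cimg M j" "(0, ?z) \<in> ov j i" using tr_cimg[OF ij y] tr_ov[OF ij y] by (simp_all add: tr_bdry[OF ij y])
  note m = g_metric[OF ij(1) yi] and m' = g_metric[OF ij(2) z(1)]
  have inv: "g j (0, ?z) [?D u, ?D v] = g i (0, y) [u, v]" for u v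
    using tensor_tr[OF g_tensor ij y, of "[u, v]"] by (simp add: tr_bdry[OF ij y])
  have 1: "g j (0, ?z) [?D (N i y), ?D (N i y)] = 1" unfolding inv by (rule normal_of(1)[OF m])
  have 2: "g j (0, ?z) [?D (N i y), (0, u)] = 0" for u
  proof -
    have "?D (dtr j i (0, ?z) (0, u)) = (0, u)"
      using dtr_inverse[OF ij(2,1) z(2), of "(0, u)"] tr_tr[OF ij y] by (simp add: tr_bdry[OF ij y])
    then have "g j (0, ?z) [?D (N i y), (0, u)] = g i (0, y) [N i y, dtr j i (0, ?z) (0, u)]"
      using inv[of "N i y" "dtr j i (0, ?z) (0, u)"] by simp
    then show ?thesis unfolding dtr_bdry[OF ij(2,1) z(2)] normal_of(2)[OF m] .
  qed
  have "fst (?D (N i y)) \<ge> 0"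
  proof -
    obtain T where T: "open T" "ov i j = half_space \<inter> T" using ov_open_half[OF ij] by (auto simp: openin_open)
    have "open ((\<lambda>t. (0, y) + t *\<^sub>R N i y) -` T)" by (intro open_vimage[OF T(1)] continuous_intros)
    moreover have "0 \<in> (\<lambda>t. (0, y) + t *\<^sub>R N i y) -` T" using y T(2) by simp
    ultimately obtain e where e: "e > 0" "ball 0 e \<subseteq> (\<lambda>t. (0, y) + t *\<^sub>R N i y) -` T" using open_contains_ball by blast
    have D: "((\<lambda>x. fst (tr i j x)) has_derivative (\<lambda>u. fst (?D u))) (at (0, y) within ov i j)"
      by (rule has_derivative_fst[OF tr_deriv[OF ij y]])
    show ?thesis
    proof (rule one_sided_derivative_nonneg[OF D _ _ e(1)])
      show "fst (tr i j (0, y)) = 0" by (simp add: tr_bdry[OF ij y])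
      show "fst (tr i j x) \<ge> 0" if "x \<in> ov i j" for x by (rule cimg_fst[OF ij(2) tr_cimg[OF ij that]])
      show "(0, y) + t *\<^sub>R N i y \<in> ov i j" if t: "0 \<le> t" "t < e" for t
      proof -
        have "t \<in> ball 0 e" using t by simp
        then have "(0, y) + t *\<^sub>R N i y \<in> T" using e(2) by blast
        moreover have "(0, y) + t *\<^sub>R N i y \<in> half_space" using t normal_of(3)[OF m] by (simp add: half_space_def)
        ultimately show ?thesis using T(2) by blast
      qed
    qed
  qed
  moreover have "fst (?D (N i y)) \<noteq> 0"
  proof
    assume "fst (?D (N i y)) = 0"
    then have "?D (N i y) = (0, snd (?D (N i y)))" by (simp add: prod_eq_iff)
    then show False using 1 2[of "snd (?D (N i y))"] by simp
  qed
  ultimately have "fst (?D (N i y)) > 0" by simp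
  then show ?thesis by (rule normal_unique[OF m' 1 2])
qed

text \<open>The part of a chart image lying over its boundary slice, as \<open>half_chart\<close>
  demands. It is relatively open and contains the slice, so derivatives at boundary points are
  unchanged.\<close>

definition slab :: "'i => (real \<times> 'b) set" where
  "slab i = {x \<in> cimg M i. (0, snd x) \<in> cimg M i}"

lemma slab_slice: "i \<in> idx M ==> {y. (0, y) \<in> slab i} = cimg (bdry M) i"
  by (auto simp: slab_def cimg_bdry)

lemma slab_open:
  assumes i: "i \<in> idx M" shows "openin (top_of_set (cimg M i)) (slab i)"
proof -
  obtain T where T: "open T" "cimg M i = half_space \<inter> T" using cimg_open[OF i] by (auto simp: openin_open)
  have "open ((\<lambda>x. (0, snd x)) -` T)" by (intro open_vimage[OF T(1)] continuous_intros)
  moreover have "slab i = cimg M i \<inter> (\<lambda>x. (0, snd x)) -` T" using T(2) by (auto simp: slab_def half_space_def)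
  ultimately show ?thesis unfolding openin_open by blast
qed

lemma half_chart: "i \<in> idx M ==> half_chart (slab i) (g i)"
proof
  assume i: "i \<in> idx M"
  show "openin (top_of_set half_space) (slab i)" by (rule openin_trans[OF slab_open[OF i] cimg_open[OF i]])
  show "tfield (slab i) 2 (g i)" by (rule tfield_subset[OF tensor_tfield[OF g_tensor i]]) (auto simp: slab_def)
  show "(0, snd x) \<in> slab i" "metric_at (g i x)" if "x \<in> slab i" for x
    using that g_metric[OF i] by (auto simp: slab_def)
qed

lemma slab_tfield: "tensor_field M p T ==> i \<in> idx M ==> tfield (slab i) p (T i)"
  by (rule tfield_subset[OF tensor_tfield]) (auto simp: slab_def)

lemma nabla_slab:
  assumes i: "i \<in> idx M" and y: "y \<in> cimg (bdry M) i"
  shows "nabla M g T i (0, y) = nab (slab i) (g i) (T i) (0, y)"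
    and "christoffel M g i (0, y) = chr (slab i) (g i) (0, y)"
proof -
  have "(0, y) \<in> slab i" using y i by (simp add: slab_def cimg_bdry)
  note eq = frechet_derivative_openin[OF slab_open[OF i] this]
  show "christoffel M g i (0, y) = chr (slab i) (g i) (0, y)" unfolding christoffel_chr chr_def eq ..
  show "nabla M g T i (0, y) = nab (slab i) (g i) (T i) (0, y)"
    unfolding nabla_nab nab_def[abs_def] pder_def[abs_def] chr_def eq ..
qed

lemma nabla_bdry: "i \<in> idx M ==> nabla (bdry M) (pullback g) T i = nab {y. (0, y) \<in> slab i} (\<lambda>y. pb (g i (0, y))) (T i)"
  by (simp add: nabla_nab slab_slice pullback_pb[abs_def])

lemma int_normal_eq: "i \<in> idx M ==> y \<in> cimg (bdry M) i ==> int_normal g T i y = pb (\<lambda>vs. T i (0, y) (N i y # vs))"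
  by (simp add: int_normal_def fun_eq_iff inner_normal_eq[where g = g, OF metric_bdry])

text \<open>Smoothness comes from the extension \<open>nrm_ext\<close> of the normal, the
  transformation law from \<open>normal_tr\<close>.\<close>

lemma int_normal_tensor:
  assumes T: "tensor_field M (Suc p) T" shows "tensor_field (bdry M) p (int_normal g T)"
proof (rule bd.tensor_fieldI)
  fix i assume "i \<in> idx (bdry M)"
  then have i: "i \<in> idx M" by simp
  interpret h: half_chart "slab i" "g i" by (rule half_chart[OF i])
  have "tfield (cimg (bdry M) i) p (\<lambda>y. pb (\<lambda>vs. T i (0, y) (N i y # vs)))"
    using tfield_slice[OF tfield_Cons_field[OF slab_tfield[OF T i] h.smooth_nrm_ext]]
    unfolding slab_slice[OF i] h.nrm_ext .
  then show "tfield (cimg (bdry M) i) p (int_normal g T i)"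
    unfolding tfield_def by (auto simp: int_normal_eq[OF i] intro: smooth_on_cong)
next
  fix i j y and vs :: "'b list" assume ij: "i \<in> idx (bdry M)" "j \<in> idx (bdry M)" and y: "y \<in> overlap (bdry M) i j" and vs: "length vs = p"
  then have ij': "i \<in> idx M" "j \<in> idx M" and y': "(0, y) \<in> ov i j" by (auto simp: overlap_bdry)
  have yi: "y \<in> cimg (bdry M) i" using y bd.ov_sub by auto
  show "int_normal g T i y vs = int_normal g T j (transition (bdry M) i j y)
      (map (der (overlap (bdry M) i j) (transition (bdry M) i j) y) vs)"
    using tensor_tr[OF T ij' y', of "N i y # map (Pair 0) vs"] vs
    by (simp add: int_normal_eq[OF ij'(1) yi] int_normal_eq[OF ij'(2) bd.tr_cimg[OF ij y]] normal_tr[OF ij' y']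
        tr_bdry[OF ij' y'] dtr_bdry[OF ij' y'] o_def)
qed

lemma int_normal_form:
  assumes "diff_form M (Suc p) \<omega>" shows "diff_form (bdry M) p (int_normal g \<omega>)"
  using assms int_normal_tensor[of p \<omega>] unfolding diff_form_def
  by (auto simp: int_normal_eq cimg_bdry intro!: alternating_pb alternating_Cons)

lemma scal_normal: "tensor_field M 1 \<theta> ==> bd.scal (\<lambda>i y. int_normal g \<theta> i y [])"
  by (rule bd.tensor_0_scal[OF int_normal_tensor]) simp

lemma sum_Basis_fst: "(\<Sum>b\<in>Basis. fst (b :: real \<times> 'b) * f b) = (f (1, 0) :: real)"
proof -
  have "(\<Sum>b\<in>Basis. fst (b :: real \<times> 'b) * f b) = (\<Sum>b\<in>{(1, 0)}. fst (b :: real \<times> 'b) * f b)"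
    by (rule sum.mono_neutral_right) (auto simp: Basis_prod_def)
  then show ?thesis by simp
qed

text \<open>In a frame adapted to the normal only the normal has a nonzero first coordinate;
  \<open>gram_det_normal\<close> converts the weights.\<close>

lemma wt_sharp_fst:
  assumes \<theta>: "tensor_field M 1 \<theta>" and i: "i \<in> idx M" and y: "y \<in> cimg (bdry M) i"
  shows "wt i (0, y) * fst (sharp \<theta> i (0, y)) = bd.wt i y * int_normal g \<theta> i y []"
proof -
  have yc: "(0, y) \<in> cimg M i" using y i by (simp add: cimg_bdry)
  note m = g_metric[OF i yc]
  let ?f = "gs_frame (pb (g i (0, y)))" and ?E = "F i (0, y)"
  have lin: "linear (\<lambda>u. \<theta> i (0, y) [u])"
    by (rule multilin_head[of 0]) (use tfield_multilin[OF tensor_tfield[OF \<theta> i] yc] in auto)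
  have "fst (sharp \<theta> i (0, y)) = (\<Sum>k<DIM(real \<times> 'b). \<theta> i (0, y) [?E k] * fst (?E k))"
    by (simp add: sharp_def fst_sum)
  also have "\<dots> = (\<Sum>k<DIM(real \<times> 'b). \<theta> i (0, y) [nframe (N i y) ?f k] * fst (nframe (N i y) ?f k))"
  proof (rule onb_trace[where B = "\<lambda>u v. \<theta> i (0, y) [u] * fst v", OF m onb_F[OF i yc] onb_nframe[OF m onb_gs_frame[OF metric_pb[OF m]]]])
    show "linear (\<lambda>u. \<theta> i (0, y) [u] * fst v)" for v :: "real \<times> 'b" using linear_cmul_fun[OF lin, of "fst v"] by (simp add: mult.commute)
    show "linear (\<lambda>v :: real \<times> 'b. \<theta> i (0, y) [u] * fst v)" for u by (rule linear_cmul_fun[OF linear_fst])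
  qed
  also have "\<dots> = \<theta> i (0, y) [N i y] * fst (N i y)"
    unfolding DIM_half sum.lessThan_Suc_shift by simp
  finally show ?thesis using gram_det_normal[OF m] by (simp add: int_normal_eq[OF i y] pullback_pb mult_ac)
qed

text \<open>The sign is that of the lower endpoint in the normal integration, since the unit normal
  points inwards. In each chart the coordinate flux is converted by
  \<open>wt_sharp_fst\<close>.\<close>

lemma integral_dvg_boundary:
  assumes \<theta>: "tensor_field M 1 \<theta>"
  shows "rint (dvg \<theta>) = - bd.rint (\<lambda>i y. int_normal g \<theta> i y [])"
proof -
  obtain Q :: "'a set" and c C \<theta>' where Q: "finite Q"
    "\<forall>q\<in>Q. c q \<in> idx M \<and> tensor_field M 1 (\<theta>' q) \<and> compact (C q) \<and> C q \<subseteq> cdom M (c q) \<and> C q \<subseteq> pts M \<and> supp_in (C q) 1 (\<theta>' q)"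
    "rint (dvg \<theta>) = (\<Sum>q\<in>Q. rint (dvg (\<theta>' q)))"
    "\<forall>i\<in>idx M. \<forall>x\<in>cimg M i. \<forall>v. \<theta> i x v = (\<Sum>q\<in>Q. \<theta>' q i x v)"
    by (rule dvg_partition[OF \<theta> compact_pts supp_in_pts])
  have one: "rint (dvg (\<theta>' q)) = - bd.rint (\<lambda>i y. int_normal g (\<theta>' q) i y [])" if "q \<in> Q" for q
  proof -
    have q: "c q \<in> idx M" "tensor_field M 1 (\<theta>' q)" "compact (C q)" "C q \<subseteq> cdom M (c q)" "supp_in (C q) 1 (\<theta>' q)"
      using Q(2) that by auto
    then have cq: "c q \<in> idx (bdry M)" by simp
    let ?i = "c q" and ?n = "\<lambda>i y. int_normal g (\<theta>' q) i y []"
    note L = integral_dvg_chart[OF q(2,1,3,4,5)] and sn = scal_normal[OF q(2)]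
    have Kc: "chart M ?i ` C q \<subseteq> cimg M ?i" using q(4) by (auto simp: cimg_def)
    have "rint (dvg (\<theta>' q)) =
      (\<Sum>b\<in>Basis. - fst b * (LINT y|lborel. indicator {y. (0, y) \<in> cimg M ?i} y * (wt ?i (0, y) * (sharp (\<theta>' q) ?i (0, y) \<bullet> b))))"
      unfolding L(1)
      by (rule sum.cong[OF refl], rule integral_der_half_space[OF cimg_open[OF q(1)] compact_chart[OF q(1,3,4)] Kc L(2)])
        (simp_all add: L(3))
    also have "\<dots> = - (\<Sum>b\<in>Basis. fst b * (LINT y|lborel. indicator {y. (0, y) \<in> cimg M ?i} y * (wt ?i (0, y) * (sharp (\<theta>' q) ?i (0, y) \<bullet> b))))"
      by (simp add: sum_negf)
    also have "\<dots> = - (LINT y|lborel. indicator (cimg (bdry M) ?i) y * (wt ?i (0, y) * fst (sharp (\<theta>' q) ?i (0, y))))"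
      unfolding sum_Basis_fst cimg_bdry[OF q(1)] by (simp add: inner_prod_def)
    also have "(LINT y|lborel. indicator (cimg (bdry M) ?i) y * (wt ?i (0, y) * fst (sharp (\<theta>' q) ?i (0, y)))) =
      (LINT y|lborel. indicator (cimg (bdry M) ?i) y * (bd.wt ?i y * bd.glue ?n (bd.inv_chart ?i y)))"
    proof (rule Bochner_Integration.integral_cong[OF refl])
      show "indicator (cimg (bdry M) ?i) y * (wt ?i (0, y) * fst (sharp (\<theta>' q) ?i (0, y))) =
        indicator (cimg (bdry M) ?i) y * (bd.wt ?i y * bd.glue ?n (bd.inv_chart ?i y))" for y
      proof (cases "y \<in> cimg (bdry M) ?i")
        case True
        show ?thesis unfolding wt_sharp_fst[OF q(2,1) True] bd.glue_inv_chart[OF sn cq True] ..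
      qed simp
    qed
    also have "\<dots> = bd.rint ?n"
      unfolding bd.riem_integral_glue
    proof (rule bd.riem_integral_in_chart(2)[OF cq borel_measurable_continuous_on_restrict[OF bd.glue_continuous[OF sn]], symmetric])
      \<comment> \<open>Outside the boundary part of the chart the piece vanishes, also when read in
        another chart, because its support lies in the chart domain.\<close>
      fix z assume z: "z \<in> pts (bdry M) - cdom (bdry M) ?i"
      then obtain j where j: "j \<in> idx (bdry M)" "z \<in> cdom (bdry M) j" "\<forall>f. bd.glue f z = f j (chart (bdry M) j z)"
        by (elim DiffE bd.glue_some)
      then have j': "j \<in> idx M" "z \<in> cdom M j - interior_pts M" by auto
      have y: "snd (chart M j z) \<in> cimg (bdry M) j" using bd.chart_cimg[OF j(2)] by simp
      have "inv_chart j (0, snd (chart M j z)) = z" using bdry_chart[OF j'] inv_chart_chart[OF j'(1)] j'(2) by simp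
      then have "inv_chart j (0, snd (chart M j z)) \<notin> C q" using z q(4) by auto
      then have "\<theta>' q j (0, snd (chart M j z)) [N j (snd (chart M j z))] = 0"
        using y by (intro supp_inD[OF q(5) j'(1)]) (simp_all add: cimg_bdry[OF j'(1)])
      then show "bd.glue ?n z = 0" using j(3) int_normal_eq[OF j'(1) y] by simp
    qed
    finally show ?thesis .
  qed
  have "rint (dvg \<theta>) = - (\<Sum>q\<in>Q. bd.rint (\<lambda>i y. int_normal g (\<theta>' q) i y []))"
    unfolding Q(3) by (simp add: one sum_negf)
  also have "(\<Sum>q\<in>Q. bd.rint (\<lambda>i y. int_normal g (\<theta>' q) i y [])) =
    bd.rint (\<lambda>i y. \<Sum>q\<in>Q. int_normal g (\<theta>' q) i y [])"
    by (rule bd.riem_integral_sum[OF Q(1) scal_normal, symmetric]) (use Q(2) in blast)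
  also have "\<dots> = bd.rint (\<lambda>i y. int_normal g \<theta> i y [])"
    by (rule bd.riem_integral_cong) (use Q(4) in \<open>simp add: int_normal_def cimg_bdry\<close>)
  finally show ?thesis .
qed

end

section \<open>The boundary term\<close>

text \<open>With respect to the volume form \<open>\<nu>'\<close>, the normal contraction of \<nu>,
  the restriction \<beta> is the star of \<gamma> on the boundary: after splitting off the normal,
  the tangential summand evaluates \<nu> on \<open>DIM('b) + 1\<close> boundary vectors and drops
  out.\<close>

lemma bdry_terms_pointwise:
  fixes h :: "(real \<times> 'b::euclidean_space) list => real"
  assumes h: "metric_at h" and S: "linear S" "\<And>u v. pb h [S u, v] = pb h [u, S v]"
    and \<nu>: "alternating DIM(real \<times> 'b) \<nu>" "\<And>es. orthonormal_frame h es ==> \<bar>\<nu> es\<bar> = 1"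
    and \<omega>: "alternating (Suc p) \<omega>"
    and \<beta>: "\<And>us. \<beta> us = form_inner h (Suc p) \<omega> (\<lambda>vs. \<nu> (vs @ map (Pair 0) us))"
  defines "\<gamma> \<equiv> pb (\<lambda>vs. \<omega> (normal_of h # vs))"
  shows "form_inner (pb h) (DIM('b) + 1 - Suc p) (form_ext S \<beta>) \<beta> =
    trace_wrt (pb h) S * form_inner (pb h) p \<gamma> \<gamma> - form_inner (pb h) p (form_ext S \<gamma>) \<gamma>"
proof -
  note hb = metric_pb[OF h]
  have \<gamma>: "alternating p \<gamma>" unfolding \<gamma>_def by (rule alternating_pb[OF alternating_Cons[OF \<omega>]])
  show ?thesis
  proof (cases "p \<le> DIM('b)")
    case True
    define q where "q = DIM('b) - p"
    have pq: "p + q = DIM('b)" using True by (simp add: q_def)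
    define \<nu>' where "\<nu>' = pb (\<lambda>vs. \<nu> (normal_of h # vs))"
    have \<nu>1: "alternating (Suc DIM('b)) \<nu>" using \<nu>(1) by simp
    have \<nu>': "alternating DIM('b) \<nu>'" unfolding \<nu>'_def by (rule alternating_pb[OF alternating_Cons[OF \<nu>1]])
    have \<nu>'1: "\<bar>\<nu>' es\<bar> = 1" if "orthonormal_frame (pb h) es" for es
      unfolding \<nu>'_def by (rule \<nu>(2)[OF orthonormal_frame_Cons_normal[OF h that]])
    have \<beta>': "\<beta> us = star_wrt (pb h) \<nu>' p \<gamma> us" if us: "length us = q" for us
    proof -
      have a: "alternating (Suc p) (\<lambda>vs. \<nu> (vs @ map (Pair 0) us))"
        by (rule alternating_append2[of _ q]) (use \<nu>1 pq us in simp_all)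
      have "\<beta> us = form_inner (pb h) (Suc p) (pb \<omega>) (\<lambda>vs. \<nu> (map (Pair 0) vs @ map (Pair 0) us)) + form_inner (pb h) p \<gamma> (\<lambda>vs. \<nu>' (vs @ us))"
        unfolding \<beta> form_inner_split[OF h \<omega> a] \<gamma>_def \<nu>'_def by simp
      also have "form_inner (pb h) (Suc p) (pb \<omega>) (\<lambda>vs. \<nu> (map (Pair 0) vs @ map (Pair 0) us)) =
        form_inner (pb h) (Suc p) (pb \<omega>) (\<lambda>vs. 0)"
      proof (rule form_inner_cong[OF hb refl])
        fix vs :: "'b list" assume vs: "length vs = Suc p"
        have "pb \<nu> (vs @ us) = 0" by (rule alternating_above_dim[OF alternating_pb[OF \<nu>1]]) (use vs us pq in auto)
        then show "\<nu> (map (Pair 0) vs @ map (Pair 0) us) = 0" by simp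
      qed
      finally show ?thesis by (simp add: star_wrt_def form_inner_def)
    qed
    have "form_inner (pb h) q (form_ext S \<beta>) \<beta> =
      form_inner (pb h) q (form_ext S (star_wrt (pb h) \<nu>' p \<gamma>)) (star_wrt (pb h) \<nu>' p \<gamma>)"
      by (rule form_inner_cong[OF hb form_ext_cong \<beta>']) (simp_all add: \<beta>')
    also have "\<dots> = trace_wrt (pb h) S * form_inner (pb h) p \<gamma> \<gamma> - form_inner (pb h) p (form_ext S \<gamma>) \<gamma>"
      by (rule form_ext_star_inner[OF hb S \<nu>' \<nu>'1 pq \<gamma>])
    finally show ?thesis by (simp add: q_def)
  next
    \<comment> \<open>For \<open>p > DIM('b)\<close> the form \<gamma> vanishes, and the truncated
      degree on the left is 0, where \<open>form_ext\<close> is zero.\<close>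
    case False
    then have z: "\<gamma> vs = 0" if "length vs = p" for vs using alternating_above_dim[OF \<gamma> _ that] by simp
    have "form_inner (pb h) p \<alpha> \<gamma> = form_inner (pb h) p \<alpha> (\<lambda>vs. 0)" for \<alpha>
      by (rule form_inner_cong[OF hb refl z])
    then have "form_inner (pb h) p \<alpha> \<gamma> = 0" for \<alpha> by (simp add: form_inner_def)
    then show ?thesis using False by (simp add: form_inner_0[OF hb] form_ext_Nil)
  qed
qed

lemma (in bmfd) shape_op_shp:
  assumes i: "i \<in> idx M" and y: "y \<in> cimg (bdry M) i"
  shows "shape_op M g i y = half_chart.shp (slab i) (g i) y"
proof
  fix u
  interpret h: half_chart "slab i" "g i" by (rule half_chart[OF i])
  have "der (cimg (bdry M) i) (inner_normal g i) y u = der (cimg (bdry M) i) (N i) y u"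
    by (rule der_cong[OF y]) (rule inner_normal_eq[where g = g, OF metric_bdry[OF i]])
  then show "shape_op M g i y u = h.shp y u"
    unfolding shape_op_def dirderiv_def h.shp_def h.dnrm_def slab_slice[OF i] nabla_slab(2)[OF i y]
      inner_normal_eq[where g = g, OF metric_bdry[OF i y]] by simp
qed

text \<open>The boundary integrands of three integrations by parts: of d\<delta>\<omega> against
  \<omega>, of \<nabla>\<omega> against itself, and of d\<omega> against itself. The last has the
  opposite sign.\<close>

definition (in bmfd) bdry_flux :: "nat => ('i, real \<times> 'b) tensor => 'i => 'b => real" where
  "bdry_flux p \<omega> i y = 1 / fact p * int_normal g (flux p (ndiv \<omega>) \<omega>) i y [] +
      1 / fact (Suc p) * int_normal g (flux (Suc p) \<omega> (nabla M g \<omega>)) i y [] +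
      - (1 / fact (Suc p)) * int_normal g (flux (Suc p) \<omega> (ext_d M \<omega>)) i y []"

context bmfd
begin

context
  fixes i y
  assumes i: "i \<in> idx M" and y: "y \<in> cimg (bdry M) i"
begin

lemma y0: "(0, y) \<in> cimg M i"
  using i y by (simp add: cimg_bdry)

lemma shape_linear: "linear (shape_op M g i y)"
  and shape_sym: "pb (g i (0, y)) [shape_op M g i y u, v] = pb (g i (0, y)) [u, shape_op M g i y v]"
proof -
  interpret h: half_chart "slab i" "g i" by (rule half_chart[OF i])
  have yb: "y \<in> h.B" using y by (simp add: slab_slice[OF i])
  show "linear (shape_op M g i y)"
    "pb (g i (0, y)) [shape_op M g i y u, v] = pb (g i (0, y)) [u, shape_op M g i y v]"
    unfolding shape_op_shp[OF i y] by (rule h.linear_shp[OF yb], rule h.shp_sym[OF yb])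
qed

lemma mean_curvature_trace:
  "real DIM('b) * mean_curvature M g i y = trace_wrt (pb (g i (0, y))) (shape_op M g i y)"
  unfolding trace_wrt_Basis[OF metric_pb[OF g_metric[OF i y0]] shape_linear] by (simp add: mean_curvature_def)

lemma bdry_term_eq:
  assumes \<omega>: "diff_form M (Suc p) \<omega>" and \<nu>: "local_volume_form M g \<nu>"
  shows "bdry_term M g \<nu> (Suc p) \<omega> i y = bdry_term' M g (Suc p) \<omega> i y"
proof -
  let ?h = "g i (0, y)" and ?\<beta> = "pullback (hodge_star g \<nu> (Suc p) \<omega>) i y"
  have \<nu>': "alternating DIM(real \<times> 'b) (\<nu> i (0, y))" "\<And>es. orthonormal_frame ?h es ==> \<bar>\<nu> i (0, y) es\<bar> = 1"
    using \<nu> i y0 by (simp_all add: local_volume_form_def)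
  have \<beta>: "?\<beta> us = form_inner ?h (Suc p) (\<omega> i (0, y)) (\<lambda>vs. \<nu> i (0, y) (vs @ map (Pair 0) us))" for us
    by (simp add: pullback_def hodge_star_def form_inner_def)
  have "form_inner (pb ?h) (DIM('b) + 1 - Suc p) (form_ext (shape_op M g i y) ?\<beta>) ?\<beta> =
    trace_wrt (pb ?h) (shape_op M g i y) * form_inner (pb ?h) p (int_normal g \<omega> i y) (int_normal g \<omega> i y) -
    form_inner (pb ?h) p (form_ext (shape_op M g i y) (int_normal g \<omega> i y)) (int_normal g \<omega> i y)"
    unfolding int_normal_eq[OF i y]
    by (rule bdry_terms_pointwise[OF g_metric[OF i y0] shape_linear shape_sym \<nu>' diff_form_alt[OF \<omega> i y0] \<beta>])
  then show ?thesis
    unfolding bdry_term_def bdry_term'_def Let_def pullback_pb[of g] mean_curvature_trace by simp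
qed

lemma normal_ext_d_form:
  assumes \<omega>: "diff_form M (Suc p) \<omega>" and us: "length us = Suc p"
  shows "ext_d M \<omega> i (0, y) (N i y # map (Pair 0) us) = nabla M g \<omega> i (0, y) (N i y # map (Pair 0) us) -
    ext_d (bdry M) (int_normal g \<omega>) i y us - form_ext (shape_op M g i y) (pullback \<omega> i y) us"
proof -
  interpret h: half_chart "slab i" "g i" by (rule half_chart[OF i])
  have yb: "y \<in> h.B" using y by (simp add: slab_slice[OF i])
  have ib: "i \<in> idx (bdry M)" using i by simp
  have alt: "\<forall>x\<in>slab i. alternating (Suc p) (\<omega> i x)"
    using diff_form_alt[OF \<omega> i] by (simp add: slab_def)
  have "nab h.B h.H (\<lambda>y. pb (\<lambda>vs. \<omega> i (0, y) (N i y # vs))) y ws =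
      nabla (bdry M) (pullback g) (int_normal g \<omega>) i y ws" if ws: "length ws = Suc p" for ws
    using bd.nabla_cong[OF ib y, of p "\<lambda>j y. pb (\<lambda>vs. \<omega> j (0, y) (N j y # vs))" "int_normal g \<omega>" ws] ws
    by (simp add: int_normal_eq[OF i] nabla_bdry[OF i])
  then have "alt (nab h.B h.H (\<lambda>y. pb (\<lambda>vs. \<omega> i (0, y) (N i y # vs))) y) us =
      alt (nabla (bdry M) (pullback g) (int_normal g \<omega>) i y) us"
    by (intro alt_cong) (simp add: us)
  also have "\<dots> = ext_d (bdry M) (int_normal g \<omega>) i y us"
    by (rule bd.ext_d_nabla[OF int_normal_form[OF \<omega>] ib y us, symmetric])
  finally have d: "alt (nab h.B h.H (\<lambda>y. pb (\<lambda>vs. \<omega> i (0, y) (N i y # vs))) y) us =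
      ext_d (bdry M) (int_normal g \<omega>) i y us" .
  have "ext_d M \<omega> i (0, y) (N i y # map (Pair 0) us) = alt (nab (slab i) (g i) (\<omega> i) (0, y)) (N i y # map (Pair 0) us)"
    using ext_d_nabla[OF \<omega> i y0, of "N i y # map (Pair 0) us"] us by (simp add: nabla_slab(1)[OF i y])
  then show ?thesis
    unfolding h.normal_ext_d[OF slab_tfield[OF diff_form_tensor[OF \<omega>] i] alt yb us] d nabla_slab(1)[OF i y] shape_op_shp[OF i y] pullback_pb .
qed

lemma tangential_ndiv:
  assumes \<omega>: "diff_form M (Suc p) \<omega>" and us: "length us = p"
  shows "ndiv \<omega> i (0, y) (map (Pair 0) us) = - nabla M g \<omega> i (0, y) (N i y # N i y # map (Pair 0) us) +
    bd.ndiv (pullback \<omega>) i y us + trace_wrt (pb (g i (0, y))) (shape_op M g i y) * int_normal g \<omega> i y us -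
    form_ext (shape_op M g i y) (int_normal g \<omega> i y) us"
proof -
  interpret h: half_chart "slab i" "g i" by (rule half_chart[OF i])
  have yb: "y \<in> h.B" using y by (simp add: slab_slice[OF i])
  have alt: "\<forall>x\<in>slab i. alternating (Suc p) (\<omega> i x)"
    using diff_form_alt[OF \<omega> i] by (simp add: slab_def)
  show ?thesis
    using h.tangential_codiff[OF slab_tfield[OF diff_form_tensor[OF \<omega>] i] alt yb us onb_F[OF i y0]]
    unfolding ndiv_def tr12_def bd.ndiv_def bd.tr12_def nabla_bdry[OF i] nabla_slab(1)[OF i y] shape_op_shp[OF i y]
      int_normal_eq[OF i y]
    unfolding pullback_pb[abs_def] by (simp del: DIM_prod sum.lessThan_Suc)
qed

lemma normal_flux:
  assumes \<alpha>: "diff_form M p \<alpha>" and T: "form1_field p T"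
  shows "1 / fact p * int_normal g (flux p \<alpha> T) i y [] =
    form_inner (g i (0, y)) p (\<alpha> i (0, y)) (\<lambda>vs. T i (0, y) (N i y # vs))"
  unfolding form_inner_contract[OF g_metric[OF i y0] onb_F[OF i y0] diff_form_alt[OF \<alpha> i y0] form1_alt[OF T i y0]]
  by (simp add: int_normal_eq[OF i y] flux_def)

text \<open>Each inner product is split at the normal into \<open>T1\<close>, \<open>T2\<close> and
  \<open>T3\<close>. The derivatives in the normal direction cancel: \<open>?n1\<close> between
  \<open>T2\<close> and \<open>T3\<close>, \<open>?n2\<close> between \<open>T1\<close> and
  \<open>T3\<close>. All that remains is tangential.\<close>

lemma boundary_identity:
  assumes \<omega>: "diff_form M (Suc p) \<omega>"
  shows "bdry_flux p \<omega> i y =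
    form_inner (pullback g i y) (Suc p) (ext_d (bdry M) (int_normal g \<omega>) i y) (pullback \<omega> i y) +
    form_inner (pullback g i y) p (int_normal g \<omega> i y) (bd.ndiv (pullback \<omega>) i y) + bdry_term' M g (Suc p) \<omega> i y"
proof -
  let ?h = "g i (0, y)" and ?\<alpha> = "pullback \<omega> i y" and ?\<gamma> = "int_normal g \<omega> i y" and ?S = "shape_op M g i y"
    and ?N = "N i y" and ?\<omega> = "\<omega> i (0, y)" and ?n = "nabla M g \<omega> i (0, y)" and ?d = "ext_d (bdry M) (int_normal g \<omega>) i y"
    and ?\<delta> = "bd.ndiv (pullback \<omega>) i y"
  let ?n1 = "pb (\<lambda>vs. ?n (?N # vs))" and ?n2 = "pb (\<lambda>vs. ?n (?N # ?N # vs))" and ?t = "trace_wrt (pb ?h) ?S"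
  note h = g_metric[OF i y0] and hb = metric_pb[OF g_metric[OF i y0]]
  have NN: "\<alpha> (?N # ?N # vs) = 0" if "alternating q \<alpha>" "length (?N # ?N # vs) = q" for \<alpha> :: "(real \<times> 'b) list => real" and q vs
    by (rule alternating_not_distinct[OF that]) simp
  have zero: "form_inner (pb ?h) q \<alpha> \<beta> = 0" if "\<And>vs. length vs = q ==> \<beta> vs = 0" for q \<alpha> \<beta>
  proof -
    have "form_inner (pb ?h) q \<alpha> \<beta> = form_inner (pb ?h) q \<alpha> (\<lambda>vs. 0)" by (rule form_inner_cong[OF hb refl that])
    then show ?thesis by (simp add: form_inner_def)
  qed
  have "form_inner ?h p (ndiv \<omega> i (0, y)) (\<lambda>vs. ?\<omega> (?N # vs)) = form_inner (pb ?h) p (pb (ndiv \<omega> i (0, y))) ?\<gamma>"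
  \<comment> \<open>In positive degree the normal part drops out, since the normal would occur twice
    in \<omega>; in degree 0 there is nothing to split.\<close>
  proof (cases p)
    case 0
    then show ?thesis by (simp add: form_inner_0[OF h] form_inner_0[OF hb] int_normal_eq[OF i y])
  next
    case (Suc q)
    have a: "alternating (Suc q) (ndiv \<omega> i (0, y))" "alternating (Suc q) (\<lambda>vs. ?\<omega> (?N # vs))"
      using diff_form_alt[OF ndiv_diff_form[OF \<omega>] i y0] alternating_Cons[OF diff_form_alt[OF \<omega> i y0]] Suc by simp_all
    show ?thesis
      unfolding Suc form_inner_split[OF h a] int_normal_eq[OF i y]
      using zero[OF NN[OF diff_form_alt[OF \<omega> i y0]], of q] Suc by simp
  qed
  also have "\<dots> = form_inner (pb ?h) p (\<lambda>us. - 1 * ?n2 us + ?\<delta> us + ?t * ?\<gamma> us - form_ext ?S ?\<gamma> us) ?\<gamma>"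
    by (rule form_inner_cong[OF hb _ refl]) (simp add: tangential_ndiv[OF \<omega>])
  finally have T1: "form_inner ?h p (ndiv \<omega> i (0, y)) (\<lambda>vs. ?\<omega> (?N # vs)) =
      - form_inner (pb ?h) p ?n2 ?\<gamma> + form_inner (pb ?h) p ?\<delta> ?\<gamma> + ?t * form_inner (pb ?h) p ?\<gamma> ?\<gamma> - form_inner (pb ?h) p (form_ext ?S ?\<gamma>) ?\<gamma>"
    unfolding form_inner_diff form_inner_add form_inner_cmul by simp
  have "form_inner ?h (Suc p) ?\<omega> (\<lambda>vs. ?n (?N # vs)) = form_inner (pb ?h) (Suc p) ?\<alpha> ?n1 + form_inner (pb ?h) p ?\<gamma> ?n2"
    unfolding form_inner_split[OF h diff_form_alt[OF \<omega> i y0] alternating_nabla[OF \<omega> i y0]] pullback_pb int_normal_eq[OF i y] ..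
  then have T3: "form_inner ?h (Suc p) ?\<omega> (\<lambda>vs. ?n (?N # vs)) = form_inner (pb ?h) (Suc p) ?n1 ?\<alpha> + form_inner (pb ?h) p ?n2 ?\<gamma>"
    unfolding form_inner_sym[of _ _ ?n1] form_inner_sym[of _ _ ?n2] .
  note da = diff_form_alt[OF ext_d_form[OF \<omega>] i y0]
  have "form_inner ?h (Suc p) ?\<omega> (\<lambda>vs. ext_d M \<omega> i (0, y) (?N # vs)) =
    form_inner (pb ?h) (Suc p) ?\<alpha> (pb (\<lambda>vs. ext_d M \<omega> i (0, y) (?N # vs)))"
    unfolding form_inner_split[OF h diff_form_alt[OF \<omega> i y0] alternating_Cons[OF da]] pullback_pb
    using zero[OF NN[OF da], of p] by simp
  also have "\<dots> = form_inner (pb ?h) (Suc p) (\<lambda>us. ?n1 us - ?d us - form_ext ?S ?\<alpha> us) ?\<alpha>"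
    unfolding form_inner_sym[of _ _ ?\<alpha>]
    by (rule form_inner_cong[OF hb _ refl]) (rule normal_ext_d_form[OF \<omega>])
  finally have T2: "form_inner ?h (Suc p) ?\<omega> (\<lambda>vs. ext_d M \<omega> i (0, y) (?N # vs)) =
     form_inner (pb ?h) (Suc p) ?n1 ?\<alpha> - form_inner (pb ?h) (Suc p) ?d ?\<alpha> - form_inner (pb ?h) (Suc p) (form_ext ?S ?\<alpha>) ?\<alpha>"
    unfolding form_inner_diff .
  have B: "bdry_term' M g (Suc p) \<omega> i y = form_inner (pb ?h) (Suc p) (form_ext ?S ?\<alpha>) ?\<alpha> +
     ?t * form_inner (pb ?h) p ?\<gamma> ?\<gamma> - form_inner (pb ?h) p (form_ext ?S ?\<gamma>) ?\<gamma>"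
    unfolding bdry_term'_def Let_def pullback_pb[of g] mean_curvature_trace by simp
  show ?thesis
    unfolding bdry_flux_def mult_minus_left normal_flux[OF ndiv_diff_form[OF \<omega>] form1_form[OF \<omega>]] normal_flux[OF \<omega> form1_nabla[OF \<omega>]]
      normal_flux[OF \<omega> form1_form[OF ext_d_form[OF \<omega>]]] T1 T2 T3 B pullback_pb[of g] form_inner_sym[of _ _ ?\<gamma> ?\<delta>] by simp
qed

end

section \<open>The integrated Bochner formula and the boundary integral\<close>

lemma scal_form1_inner:
  assumes "form1_field p T" "form1_field p T'" shows "scal (\<lambda>i x. form1_inner (g i x) p (T i x) (T' i x))"
  by (rule scal_cong[OF scal_cmul[OF scal_contract[OF form1_tensor[OF assms(1)] form1_tensor[OF assms(2)]], of "1 / fact p"]])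
    (simp add: form1_inner_F[OF assms])

text \<open>\<open>curvature_term\<close> speaks of the chosen adjoints. They are replaced by the
  explicit contractions, also under d, because both agree on the whole chart image.\<close>

lemma bochner_pointwise:
  assumes W: "curvature_term M g (Suc p) W" and \<omega>: "diff_form M (Suc p) \<omega>" and i: "i \<in> idx M" and x: "x \<in> cimg M i"
  shows "form_inner (g i x) (Suc p) (ext_d M (ndiv \<omega>) i x) (\<omega> i x) + form_inner (g i x) (Suc p) (\<omega> i x) (ndiv (ext_d M \<omega>) i x) =
    form_inner (g i x) (Suc p) (\<omega> i x) (ndiv (nabla M g \<omega>) i x) + form_inner (g i x) (Suc p) (W i x (\<omega> i x)) (\<omega> i x)"
proof -
  have eq: "ext_d M (ndiv \<omega>) i x vs + ndiv (ext_d M \<omega>) i x vs = ndiv (nabla M g \<omega>) i x vs + W i x (\<omega> i x) vs"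
    if vs: "length vs = Suc p" for vs
  proof -
    have "ext_d M (codiff M g (Suc p) \<omega>) i x vs = ext_d M (ndiv \<omega>) i x vs"
      unfolding ext_d_def dirderiv_def
      by (intro sum.cong refl arg_cong2[of _ _ _ _ "(*)"] der_cong[OF x] codiff_ndiv(2)[OF \<omega> i]) (use vs in auto)
    moreover have "codiff M g (Suc (Suc p)) (ext_d M \<omega>) i x vs = ndiv (ext_d M \<omega>) i x vs"
      by (rule codiff_ndiv(2)[OF ext_d_form[OF \<omega>] i x vs])
    moreover have "nabla_adj M g (Suc p) (nabla M g \<omega>) i x vs = ndiv (nabla M g \<omega>) i x vs"
      by (rule nabla_adj_ndiv[OF form1_nabla[OF \<omega>] i x vs])
    moreover have "hodge_laplacian M g (Suc p) \<omega> i x vs = nabla_adj M g (Suc p) (nabla M g \<omega>) i x vs + W i x (\<omega> i x) vs"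
      using W \<omega> i x vs by (simp add: curvature_term_def)
    ultimately show ?thesis by (simp add: hodge_laplacian_def)
  qed
  show ?thesis
    unfolding form_inner_sym[of _ _ "\<omega> i x"] form_inner_add[symmetric]
    by (rule form_inner_cong[OF g_metric[OF i x] eq refl])
qed

text \<open>A linear combination of the Bochner formula with three integrations by parts, in which
  the second order terms cancel.\<close>

lemma bochner_integral:
  assumes W: "curvature_term M g (Suc p) W" and \<omega>: "diff_form M (Suc p) \<omega>"
  shows "rint (\<lambda>i x. form_inner (g i x) (Suc (Suc p)) (ext_d M \<omega> i x) (ext_d M \<omega> i x) +
      form_inner (g i x) p (codiff M g (Suc p) \<omega> i x) (codiff M g (Suc p) \<omega> i x)) =
    rint (\<lambda>i x. form1_inner (g i x) (Suc p) (nabla M g \<omega> i x) (nabla M g \<omega> i x) +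
      form_inner (g i x) (Suc p) (W i x (\<omega> i x)) (\<omega> i x)) +
    (bd.rint (bdry_flux p \<omega>))"
proof -
  let ?I = "rint" and ?J = "bd.rint"
  let ?f = "\<lambda>p \<alpha> \<beta> i x. form_inner (g i x) p (\<alpha> i x) (\<beta> i x)" and ?W = "\<lambda>i x. W i x (\<omega> i x)" and ?n = "nabla M g \<omega>"
  note d = ext_d_form[OF \<omega>] and \<delta> = ndiv_diff_form[OF \<omega>] and n1 = form1_nabla[OF \<omega>]
  note dd = ext_d_form[OF \<delta>] and \<delta>d = ndiv_diff_form[OF d] and \<delta>n = ndiv_form[OF n1]
  have Wf: "diff_form M (Suc p) ?W" using W \<omega> by (simp add: curvature_term_def)
  note t1 = flux_tensor[OF diff_form_tensor[OF \<delta>] diff_form_tensor[OF \<omega>]]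
    and t2 = flux_tensor[OF diff_form_tensor[OF \<omega>] diff_form_tensor[OF d]]
    and t3 = flux_tensor[OF diff_form_tensor[OF \<omega>] form1_tensor[OF n1]]
  have "?I (\<lambda>i x. ?f (Suc (Suc p)) (ext_d M \<omega>) (ext_d M \<omega>) i x + ?f p (codiff M g (Suc p) \<omega>) (codiff M g (Suc p) \<omega>) i x) =
    ?I (?f (Suc (Suc p)) (ext_d M \<omega>) (ext_d M \<omega>)) + ?I (?f p (codiff M g (Suc p) \<omega>) (codiff M g (Suc p) \<omega>))"
    by (rule riem_integral_add[OF scal_form_inner[OF d d] scal_form_inner[OF codiff_ndiv(1)[OF \<omega>] codiff_ndiv(1)[OF \<omega>]]])
  also have "?I (?f p (codiff M g (Suc p) \<omega>) (codiff M g (Suc p) \<omega>)) = ?I (?f p (ndiv \<omega>) (ndiv \<omega>))"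
    by (rule riem_integral_cong, rule form_inner_cong[OF g_metric]) (simp_all add: codiff_ndiv(2)[OF \<omega>])
  finally have L: "?I (\<lambda>i x. ?f (Suc (Suc p)) (ext_d M \<omega>) (ext_d M \<omega>) i x + ?f p (codiff M g (Suc p) \<omega>) (codiff M g (Suc p) \<omega>) i x) =
    ?I (?f (Suc (Suc p)) (ext_d M \<omega>) (ext_d M \<omega>)) + ?I (?f p (ndiv \<omega>) (ndiv \<omega>))" .
  have R: "?I (\<lambda>i x. form1_inner (g i x) (Suc p) (?n i x) (?n i x) + ?f (Suc p) ?W \<omega> i x) =
    ?I (\<lambda>i x. form1_inner (g i x) (Suc p) (?n i x) (?n i x)) + ?I (?f (Suc p) ?W \<omega>)"
    by (rule riem_integral_add[OF scal_form1_inner[OF n1 n1] scal_form_inner[OF Wf \<omega>]])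
  have B: "?I (?f (Suc p) (ext_d M (ndiv \<omega>)) \<omega>) + ?I (?f (Suc p) \<omega> (ndiv (ext_d M \<omega>))) =
    ?I (?f (Suc p) \<omega> (ndiv ?n)) + ?I (?f (Suc p) ?W \<omega>)"
    unfolding riem_integral_add[OF scal_form_inner[OF dd \<omega>] scal_form_inner[OF \<omega> \<delta>d], symmetric]
      riem_integral_add[OF scal_form_inner[OF \<omega> \<delta>n] scal_form_inner[OF Wf \<omega>], symmetric]
    by (rule riem_integral_cong) (rule bochner_pointwise[OF W \<omega>])
  note s = bd.scal_cmul[OF scal_normal]
  have S: "?J (bdry_flux p \<omega>) =
    1 / fact p * ?J (\<lambda>i y. int_normal g (flux p (ndiv \<omega>) \<omega>) i y []) +
    1 / fact (Suc p) * ?J (\<lambda>i y. int_normal g (flux (Suc p) \<omega> ?n) i y []) +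
    - (1 / fact (Suc p)) * ?J (\<lambda>i y. int_normal g (flux (Suc p) \<omega> (ext_d M \<omega>)) i y [])"
    unfolding bdry_flux_def[abs_def] bd.riem_integral_add[OF bd.scal_add[OF s[OF t1] s[OF t3]] s[OF t2]] bd.riem_integral_add[OF s[OF t1] s[OF t3]] bd.riem_integral_cmul ..
  show ?thesis
    unfolding L R S
    using B integral_ext_d[OF \<delta> \<omega>] integral_ext_d[OF \<omega> d] integral_nabla[OF \<omega> n1]
    unfolding integral_dvg_boundary[OF t1] integral_dvg_boundary[OF t2] integral_dvg_boundary[OF t3] by linarith
qed

lemma interior_pts_bdry: "interior_pts (bdry M) = pts (bdry M)"
  using bd.interior_pts_iff bd.pts_cover by (auto simp: interior_pts_def)

text \<open>On the closed manifold \<Sigma> the exterior derivative of the normal component is moved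
  to the codifferential of the tangential one. The two derivative terms become equal, hence the
  factor 2.\<close>

lemma boundary_integral:
  assumes \<omega>: "diff_form M (Suc p) \<omega>"
  shows "bd.rint (bdry_flux p \<omega>) =
    2 * bd.rint (\<lambda>i y. form_inner (pullback g i y) p
        (int_normal g \<omega> i y) (codiff (bdry M) (pullback g) (Suc p) (pullback \<omega>) i y)) +
    bd.rint (bdry_term' M g (Suc p) \<omega>)"
proof -
  let ?J = "bd.rint" and ?f = "\<lambda>p \<alpha> \<beta> i y. form_inner (pullback g i y) p (\<alpha> i y) (\<beta> i y)"
    and ?\<gamma> = "int_normal g \<omega>" and ?\<alpha> = "pullback \<omega>"
  note \<gamma> = int_normal_form[OF \<omega>] and \<alpha> = pullback_form[OF \<omega>] and d = ext_d_form[OF \<omega>] and \<delta> = ndiv_diff_form[OF \<omega>]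
  note sA = bd.scal_form_inner[OF bd.ext_d_form[OF \<gamma>] \<alpha>] and sD = bd.scal_form_inner[OF \<gamma> bd.ndiv_diff_form[OF \<alpha>]]
  note s = bd.scal_cmul[OF scal_normal]
  have sB: "bd.scal (bdry_flux p \<omega>)" unfolding bdry_flux_def[abs_def]
    by (intro bd.scal_add s flux_tensor diff_form_tensor \<delta> \<omega> d form1_tensor form1_nabla)
  have eq: "bdry_flux p \<omega> i y = ?f (Suc p) (ext_d (bdry M) ?\<gamma>) ?\<alpha> i y + ?f p ?\<gamma> (bd.ndiv ?\<alpha>) i y + bdry_term' M g (Suc p) \<omega> i y"
    if "i \<in> idx (bdry M)" "y \<in> cimg (bdry M) i" for i y
    using boundary_identity[OF _ that(2) \<omega>] that(1) by simp
  \<comment> \<open>Continuity and chart independence of the boundary term are inherited from the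
    other terms of \<open>eq\<close> instead of being checked directly.\<close>
  have sb: "bd.scal (bdry_term' M g (Suc p) \<omega>)"
    by (rule bd.scal_cong[OF bd.scal_add[OF bd.scal_add[OF sB bd.scal_cmul[OF sA, of "-1"]] bd.scal_cmul[OF sD, of "-1"]]])
      (use eq in force)
  have "?J (bdry_flux p \<omega>) = ?J (\<lambda>i y. ?f (Suc p) (ext_d (bdry M) ?\<gamma>) ?\<alpha> i y + ?f p ?\<gamma> (bd.ndiv ?\<alpha>) i y + bdry_term' M g (Suc p) \<omega> i y)"
    by (rule bd.riem_integral_cong[OF eq])
  also have "\<dots> = ?J (?f (Suc p) (ext_d (bdry M) ?\<gamma>) ?\<alpha>) + ?J (?f p ?\<gamma> (bd.ndiv ?\<alpha>)) + ?J (bdry_term' M g (Suc p) \<omega>)"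
    unfolding bd.riem_integral_add[OF bd.scal_add[OF sA sD] sb] bd.riem_integral_add[OF sA sD] ..
  also have "?J (?f p ?\<gamma> (bd.ndiv ?\<alpha>)) = ?J (?f p ?\<gamma> (codiff (bdry M) (pullback g) (Suc p) ?\<alpha>))"
    by (rule bd.riem_integral_cong, rule form_inner_cong[OF bd.g_metric]) (simp_all add: bd.codiff_ndiv(2)[OF \<alpha>])
  also have "?J (?f (Suc p) (ext_d (bdry M) ?\<gamma>) ?\<alpha>) = ?J (?f p ?\<gamma> (codiff (bdry M) (pullback g) (Suc p) ?\<alpha>))"
    by (rule bd.integral_ext_d_closed[OF interior_pts_bdry \<gamma> \<alpha>])
  finally show ?thesis by simp
qed

end

theorem theorem3:
  fixes \<Omega> :: "('i, 'a::t2_space, real \<times> 'b::euclidean_space) atlas"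
    and g \<omega> \<nu> :: "('i, real \<times> 'b) tensor"
    and W :: "'i \<Rightarrow> real \<times> 'b \<Rightarrow> ((real \<times> 'b) list \<Rightarrow> real) \<Rightarrow> ((real \<times> 'b) list \<Rightarrow> real)"
    and p :: nat
  assumes "smooth_atlas half_space \<Omega>" and "compact (pts \<Omega>)" and "riemannian_metric \<Omega> g"
    and "curvature_term \<Omega> g p W" and "local_volume_form \<Omega> g \<nu>"
    and "diff_form \<Omega> p \<omega>" and "p \<ge> 1"
  shows
    "riem_integral \<Omega> g (\<lambda>i x.
         form_inner (g i x) (p + 1) (ext_d \<Omega> \<omega> i x) (ext_d \<Omega> \<omega> i x)
         + form_inner (g i x) (p - 1) (codiff \<Omega> g p \<omega> i x) (codiff \<Omega> g p \<omega> i x))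
     = riem_integral \<Omega> g (\<lambda>i x.
         form1_inner (g i x) p (nabla \<Omega> g \<omega> i x) (nabla \<Omega> g \<omega> i x)
         + form_inner (g i x) p (W i x (\<omega> i x)) (\<omega> i x))
       + 2 * riem_integral (bdry \<Omega>) (pullback g) (\<lambda>i y.
           form_inner (pullback g i y) (p - 1)
             (int_normal g \<omega> i y) (codiff (bdry \<Omega>) (pullback g) p (pullback \<omega>) i y))
       + riem_integral (bdry \<Omega>) (pullback g) (bdry_term \<Omega> g \<nu> p \<omega>)
     \<and> (\<forall>i\<in>idx \<Omega>. \<forall>y\<in>cimg (bdry \<Omega>) i. bdry_term \<Omega> g \<nu> p \<omega> i y = bdry_term' \<Omega> g p \<omega> i y)"
  proof -
  \<comment> \<open>Positive degree is written as a successor, so that \<open>p - 1\<close> and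
    \<open>p + 1\<close> take the form used in the lemmas.\<close>
  obtain q where p: "p = Suc q" using assms(7) by (cases p) auto
  interpret bmfd \<Omega> g
    by unfold_locales (use assms(1-3) half_space_closed half_space_regular half_space_closure in auto)
  have \<omega>: "diff_form \<Omega> (Suc q) \<omega>" and W: "curvature_term \<Omega> g (Suc q) W" using assms(4,6) by (simp_all add: p)
  have eq: "bdry_term \<Omega> g \<nu> (Suc q) \<omega> i y = bdry_term' \<Omega> g (Suc q) \<omega> i y" if "i \<in> idx \<Omega>" "y \<in> cimg (bdry \<Omega>) i" for i y
    by (rule bdry_term_eq[OF that \<omega> assms(5)])
  have "riem_integral (bdry \<Omega>) (pullback g) (bdry_term \<Omega> g \<nu> (Suc q) \<omega>) =
      riem_integral (bdry \<Omega>) (pullback g) (bdry_term' \<Omega> g (Suc q) \<omega>)"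
    by (rule bd.riem_integral_cong) (simp add: eq)
  then show ?thesis
    using bochner_integral[OF W \<omega>] boundary_integral[OF \<omega>] eq by (simp add: p)
qed

end
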